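(* Let $(G,H,\widetilde L,\rho)$ be a measure cut and project scheme, let $f:H\to\mathbb C$ be continuous and admissible, and let $\nu_f$ be the translation bounded measure on $G$ given by $\nu_f(\varphi)=\int_{G\times H}\varphi(t)f(h)\,d\rho(t,h)$ for $\varphi\in C_c(G)$. Then the following hold. (a) $\nu_f$ is strongly almost periodic. In particular, $\Omega(\nu_f)$ has a unique structure of a topological abelian group such that $G\to\Omega(\nu_f)$, $t\mapsto\alpha_t\nu_f$, is a continuous group homomorphism. (b) $(\Omega(\nu_f),\alpha)$ is a factor of $(\mathbb T,\beta)$ with factor map $\mu:\mathbb T\to\Omega(\nu_f)$ given by $\mu([s,k])(\varphi)=\int_{G\times H} f(h+k)\,\varphi(s+t)\,d\rho(t,h)$ for $\varphi\in C_c(G)$. In fact, $\mu$ is a group homomorphism (for the group structure in (a)). (c) $(\Omega(\nu_f),\alpha)$ is minimal, uniquely ergodic and has pure point spectrum with continuous eigenfunctions. The set of eigenvalues is contained in $\{\lambda\circ\iota:\lambda\in\widehat{\mathbb T}\}\subset\widehat G$.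
   Context: All locally compact spaces are Hausdorff. For a $\sigma$-compact locally compact space $X$, $C_c(X)$ is the space of compactly supported continuous complex functions, and $\mathcal M(X)$ the set of complex regular Borel (Radon) measures, identified with the dual $C_c(X)^*$ and carrying the vague topology (pointwise convergence on $C_c(X)$); $|\mu|$ is the total variation of $\mu$. Cut and project scheme $(G,H,\widetilde L)$: $G,H$ are $\sigma$-compact locally compact abelian groups, $\widetilde L\subset G\times H$ is a lattice (discrete cocompact subgroup), the projection $\pi:G\times H\to G$ is injective on $\widetilde L$, and the image $L^\star$ of $\widetilde L$ under the projection to $H$ is dense in $H$. A measure cut and project scheme $(G,H,\widetilde L,\rho)$ is such a scheme with an $\widetilde L$-invariant measure $\rho\in\mathcal M(G\times H)$. A function $f:H\to\mathbb C$ is admissible if it is measurable, locally bounded, and for all $\varepsilon>0$, $\varphi\in C_c(G)$ there is a compact $Q\subset H$ with $\int_{G\times H}|\varphi(t+s)f(h+k)|(1-1_Q(h+k))\,d|\rho|(t,h)\le\varepsilon$ for every $(s,k)\in G\times H$. $\mathbb T:=(G\times H)/\widetilde L$ is a compact abelian group, $[t,k]$ is the class of $(t,k)$, $\iota:G\to\mathbb T$, $\iota(t)=[t,0]$, and $G$ acts on $\mathbb T$ by $\beta_t([s,k])=\iota(t)+[s,k]=[s+t,k]$. A measure $\nu\in\mathcal M(G)$ is translation bounded if there are $C>0$ and a nonempty open relatively compact $V\subset G$ with $|\nu|(t+V)\le C$ for all $t\in G$. The group $G$ acts on translation bounded measures by $(\alpha_t\nu)(\varphi)=\int\varphi(s+t)\,d\nu(s)$.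 The hull $\Omega(\nu)$ is the vague closure of $\{\alpha_t\nu:t\in G\}$; it is compact and $\alpha$-invariant, so $(\Omega(\nu),\alpha)$ is a topological dynamical system over $G$. With $\nu*\varphi(s)=\int\varphi(s-u)\,d\nu(u)$, $\nu$ is strongly almost periodic if $\nu*\varphi$ is Bohr almost periodic for all $\varphi\in C_c(G)$. $(\Theta,\beta)$ is a factor of $(\Omega,\alpha)$ with factor map $\Phi$ if $\Phi:\Omega\to\Theta$ is a continuous surjection with $\Phi(\alpha_t\omega)=\beta_t\Phi(\omega)$ for all $t,\omega$. A system is minimal if all orbits are dense; it is uniquely ergodic if there is exactly one invariant probability measure $m$. For such $m$ put $(T_tg)(\omega)=g(\alpha_{-t}\omega)$ on $L^2(\Omega,m)$; $g$ is an eigenfunction with eigenvalue $\hat s\in\widehat G$ if $T_tg=(\hat s,t)g$ for all $t$, and it is continuous if it has a continuous representative $g$ with $g(\alpha_{-t}\omega)=(\hat s,t)g(\omega)$ for all $\omega,t$. Pure point spectrum means that eigenfunctions are total in $L^2(\Omega,m)$; "with continuous eigenfunctions" means that all eigenfunctions are continuous. *)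

theory Defs
  imports "HOL-Analysis.Analysis" "HOL-Algebra.Coset"
begin

section \<open>Complex Radon measures\<close>

definition sigma_compact :: "'a::topological_space set \<Rightarrow> bool"
  where "sigma_compact S \<longleftrightarrow> (\<exists>K::nat \<Rightarrow> 'a set. (\<forall>n. compact (K n)) \<and> (\<Union>n. K n) = S)"

definition supp :: "('a::topological_space \<Rightarrow> complex) \<Rightarrow> 'a set"
  where "supp \<phi> = closure {x. \<phi> x \<noteq> 0}"

definition Cc :: "('a::topological_space \<Rightarrow> complex) set"
  where "Cc = {\<phi>. continuous_on UNIV \<phi> \<and> compact (supp \<phi>)}"

type_synonym 'a functional = "('a \<Rightarrow> complex) \<Rightarrow> complex"

text \<open>
  A complex Radon measure on a \<open>\<sigma>\<close>-compact locally compact Hausdorff space is a linear functional on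
  \<^const>\<open>Cc\<close> that is bounded on the functions supported in any given compact set.  Such a measure
  need not be bounded, hence need not have a value on every Borel set.  Functionals are total
  functions in HOL; extensionality makes equality of measures mean equality on \<^const>\<open>Cc\<close>.
\<close>

definition radon_measures :: "'a::topological_space functional set"
  where "radon_measures = {\<mu> \<in> extensional Cc.
    (\<forall>\<phi>\<in>Cc. \<forall>\<psi>\<in>Cc. \<mu> (\<lambda>x. \<phi> x + \<psi> x) = \<mu> \<phi> + \<mu> \<psi>) \<and>
    (\<forall>c. \<forall>\<phi>\<in>Cc. \<mu> (\<lambda>x. c * \<phi> x) = c * \<mu> \<phi>) \<and>
    (\<forall>K. compact K \<longrightarrow>
      (\<exists>C. \<forall>\<phi>\<in>Cc. supp \<phi> \<subseteq> K \<longrightarrow> cmod (\<mu> \<phi>) \<le> C * (SUP x. cmod (\<phi> x))))}"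

definition vague_topology :: "'a::topological_space functional topology"
  where "vague_topology = subtopology (product_topology (\<lambda>_. euclidean) Cc) radon_measures"

text \<open>
  The total variation, as a Borel measure: on open sets it is the supremum of \<open>\<bar>\<mu>(\<psi>)\<bar>\<close> over test
  functions bounded by 1 and supported in the set, and it is outer regular (the Riesz construction).
\<close>

definition variation_open :: "'a::topological_space functional \<Rightarrow> 'a set \<Rightarrow> ennreal"
  where "variation_open \<mu> U =
    (SUP \<psi>\<in>{\<psi> \<in> Cc. supp \<psi> \<subseteq> U \<and> (\<forall>x. cmod (\<psi> x) \<le> 1)}. ennreal (cmod (\<mu> \<psi>)))"

definition total_variation :: "'a::topological_space functional \<Rightarrow> 'a measure"
  where "total_variation \<mu> =
    measure_of UNIV (sets borel) (\<lambda>A. INF U\<in>{U. open U \<and> A \<subseteq> U}. variation_open \<mu> U)"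

text \<open>
  The integral \<open>\<integral>g d\<mu>\<close> for \<open>\<bar>\<mu>\<bar>\<close>-integrable \<open>g\<close>: the continuous extension of \<open>\<mu>\<close> from \<^const>\<open>Cc\<close>,
  which is dense in \<open>L\<^sup>1(\<bar>\<mu>\<bar>)\<close>.
\<close>

definition radon_integral :: "'a::topological_space functional \<Rightarrow> ('a \<Rightarrow> complex) \<Rightarrow> complex"
  where "radon_integral \<mu> g = (THE z. \<exists>\<phi>::nat \<Rightarrow> 'a \<Rightarrow> complex. (\<forall>n. \<phi> n \<in> Cc) \<and>
    (\<lambda>n. \<integral>\<^sup>+x. ennreal (cmod (g x - \<phi> n x)) \<partial>total_variation \<mu>) \<longlonglongrightarrow> 0 \<and>
    (\<lambda>n. \<mu> (\<phi> n)) \<longlonglongrightarrow> z)"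

definition translation_bounded :: "'g::topological_ab_group_add functional \<Rightarrow> bool"
  where "translation_bounded \<nu> \<longleftrightarrow>
    (\<exists>C>0. \<exists>V. open V \<and> V \<noteq> {} \<and> compact (closure V) \<and>
      (\<forall>t. emeasure (total_variation \<nu>) ((\<lambda>v. t + v) ` V) \<le> ennreal C))"

section \<open>Topological groups and characters\<close>

definition additive_group :: "'a::ab_group_add monoid"
  where "additive_group = \<lparr>carrier = UNIV, mult = (+), one = 0\<rparr>"

definition topological_abelian_group :: "('a, 'b) monoid_scheme \<Rightarrow> 'a topology \<Rightarrow> bool"
  where "topological_abelian_group A T \<longleftrightarrow> comm_group A \<and> topspace T = carrier A \<and>
    continuous_map (prod_topology T T) T (\<lambda>(x, y). x \<otimes>\<^bsub>A\<^esub> y) \<and>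
    continuous_map T T (\<lambda>x. inv\<^bsub>A\<^esub> x)"

text \<open>
  The elements of the dual group.  Only the values on the carrier matter, so two members may
  represent the same character if the carrier is not the whole type.
\<close>

definition characters :: "('a, 'b) monoid_scheme \<Rightarrow> 'a topology \<Rightarrow> ('a \<Rightarrow> complex) set"
  where "characters A T = {\<xi>. continuous_map T euclidean \<xi> \<and>
    (\<forall>x\<in>carrier A. cmod (\<xi> x) = 1) \<and>
    (\<forall>x\<in>carrier A. \<forall>y\<in>carrier A. \<xi> (x \<otimes>\<^bsub>A\<^esub> y) = \<xi> x * \<xi> y)}"

abbreviation dual :: "('g::topological_ab_group_add \<Rightarrow> complex) set"
  where "dual \<equiv> characters additive_group euclidean"

section \<open>Cut and project schemes\<close>

definition quotient_topology :: "'a::{topological_space, ab_group_add} set \<Rightarrow> 'a set topology"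
  where "quotient_topology L = topology (\<lambda>U. U \<subseteq> carrier (additive_group Mod L) \<and>
    open {x. L #>\<^bsub>additive_group\<^esub> x \<in> U})"

lemma openin_quotient_topology:
  "openin (quotient_topology L) U \<longleftrightarrow>
    U \<subseteq> carrier (additive_group Mod L) \<and> open {x. L #>\<^bsub>additive_group\<^esub> x \<in> U}"
proof -
  have "istopology (\<lambda>U. U \<subseteq> carrier (additive_group Mod L) \<and>
    open {x. L #>\<^bsub>additive_group\<^esub> x \<in> U})"
    unfolding istopology_def
  proof (intro conjI allI impI)
    fix \<K>
    assume K: "\<forall>K\<in>\<K>. K \<subseteq> carrier (additive_group Mod L) \<and>
      open {x. L #>\<^bsub>additive_group\<^esub> x \<in> K}"
    have "{x. L #>\<^bsub>additive_group\<^esub> x \<in> \<Union>\<K>} = (\<Union>K\<in>\<K>. {x. L #>\<^bsub>additive_group\<^esub> x \<in> K})"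
      by auto
    then show "open {x. L #>\<^bsub>additive_group\<^esub> x \<in> \<Union>\<K>}"
      using K by auto
    show "\<Union>\<K> \<subseteq> carrier (additive_group Mod L)"
      using K by auto
  qed (auto simp: Collect_conj_eq)
  then show ?thesis
    by (simp add: quotient_topology_def)
qed

lemma topspace_quotient_topology [simp]:
  "topspace (quotient_topology L) = carrier (additive_group Mod L)"
proof -
  have "{x. L #>\<^bsub>additive_group\<^esub> x \<in> carrier (additive_group Mod L)} = UNIV"
    by (auto simp: carrier_FactGroup additive_group_def)
  then have "openin (quotient_topology L) (carrier (additive_group Mod L))"
    by (simp add: openin_quotient_topology)
  then show ?thesis
    by (metis openin_quotient_topology openin_subset openin_topspace subset_antisym)
qed

definition cut_and_project_scheme ::
    "('g::{topological_ab_group_add, t2_space} \<times> 'h::{topological_ab_group_add, t2_space}) set \<Rightarrow> bool"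
  where "cut_and_project_scheme L \<longleftrightarrow>
    locally_compact_space (euclidean :: 'g topology) \<and> sigma_compact (UNIV :: 'g set) \<and>
    locally_compact_space (euclidean :: 'h topology) \<and> sigma_compact (UNIV :: 'h set) \<and>
    subgroup L additive_group \<and> discrete L \<and> compact_space (quotient_topology L) \<and>
    inj_on fst L \<and> closure (snd ` L) = UNIV"

definition measure_cut_and_project_scheme ::
    "('g::{topological_ab_group_add, t2_space} \<times> 'h::{topological_ab_group_add, t2_space}) set \<Rightarrow>
      ('g \<times> 'h) functional \<Rightarrow> bool"
  where "measure_cut_and_project_scheme L \<rho> \<longleftrightarrow> cut_and_project_scheme L \<and>
    \<rho> \<in> radon_measures \<and> (\<forall>l\<in>L. \<forall>\<phi>\<in>Cc. \<rho> (\<lambda>x. \<phi> (x + l)) = \<rho> \<phi>)"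

definition admissible ::
    "('g::topological_ab_group_add \<times> 'h::topological_ab_group_add) functional \<Rightarrow> ('h \<Rightarrow> complex) \<Rightarrow> bool"
  where "admissible \<rho> f \<longleftrightarrow> f \<in> borel_measurable borel \<and>
    (\<forall>x. \<exists>U. open U \<and> x \<in> U \<and> bounded (f ` U)) \<and>
    (\<forall>\<epsilon>>0. \<forall>\<phi>\<in>Cc. \<exists>Q. compact Q \<and> (\<forall>s k.
      (\<integral>\<^sup>+(t, h). ennreal (cmod (\<phi> (t + s) * f (h + k)) * (1 - indicator Q (h + k)))
        \<partial>total_variation \<rho>) \<le> ennreal \<epsilon>))"

definition weighted_comb ::
    "('g::topological_ab_group_add \<times> 'h::topological_ab_group_add) functional \<Rightarrow> ('h \<Rightarrow> complex) \<Rightarrow>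
      'g functional"
  where "weighted_comb \<rho> f = (\<lambda>\<phi>\<in>Cc. radon_integral \<rho> (\<lambda>(t, h). \<phi> t * f h))"

abbreviation torus :: "('g::topological_ab_group_add \<times> 'h::topological_ab_group_add) set \<Rightarrow> ('g \<times> 'h) set monoid"
  where "torus L \<equiv> additive_group Mod L"

definition torus_class ::
    "('g::topological_ab_group_add \<times> 'h::topological_ab_group_add) set \<Rightarrow> 'g \<Rightarrow> 'h \<Rightarrow> ('g \<times> 'h) set"
  where "torus_class L s k = L #>\<^bsub>additive_group\<^esub> (s, k)"

definition torus_embed ::
    "('g::topological_ab_group_add \<times> 'h::topological_ab_group_add) set \<Rightarrow> 'g \<Rightarrow> ('g \<times> 'h) set"
  where "torus_embed L t = torus_class L t 0"

definition torus_action ::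
    "('g::topological_ab_group_add \<times> 'h::topological_ab_group_add) set \<Rightarrow>
      'g \<Rightarrow> ('g \<times> 'h) set \<Rightarrow> ('g \<times> 'h) set"
  where "torus_action L t x = torus_embed L t \<otimes>\<^bsub>torus L\<^esub> x"

section \<open>Hulls and almost periodicity\<close>

definition translate :: "'g::topological_ab_group_add \<Rightarrow> 'g functional \<Rightarrow> 'g functional"
  where "translate t \<nu> = (\<lambda>\<phi>\<in>Cc. \<nu> (\<lambda>s. \<phi> (s + t)))"

definition measure_hull :: "'g::topological_ab_group_add functional \<Rightarrow> 'g functional set"
  where "measure_hull \<nu> = vague_topology closure_of (range (\<lambda>t. translate t \<nu>))"

definition hull_topology :: "'g::topological_ab_group_add functional \<Rightarrow> 'g functional topology"
  where "hull_topology \<nu> = subtopology vague_topology (measure_hull \<nu>)"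

definition convolution :: "'g::topological_ab_group_add functional \<Rightarrow> ('g \<Rightarrow> complex) \<Rightarrow> 'g \<Rightarrow> complex"
  where "convolution \<nu> \<phi> s = \<nu> (\<lambda>u. \<phi> (s - u))"

definition relatively_dense :: "'g::topological_ab_group_add set \<Rightarrow> bool"
  where "relatively_dense P \<longleftrightarrow> (\<exists>K. compact K \<and> (\<forall>x. \<exists>p\<in>P. \<exists>k\<in>K. x = p + k))"

definition bohr_almost_periodic :: "('g::topological_ab_group_add \<Rightarrow> complex) \<Rightarrow> bool"
  where "bohr_almost_periodic F \<longleftrightarrow> continuous_on UNIV F \<and>
    (\<forall>\<epsilon>>0. relatively_dense {t. \<forall>s. cmod (F (s + t) - F s) \<le> \<epsilon>})"

definition strongly_almost_periodic :: "'g::topological_ab_group_add functional \<Rightarrow> bool"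
  where "strongly_almost_periodic \<nu> \<longleftrightarrow> (\<forall>\<phi>\<in>Cc. bohr_almost_periodic (convolution \<nu> \<phi>))"

definition hull_group_structure ::
    "'g::topological_ab_group_add functional \<Rightarrow> 'g functional monoid \<Rightarrow> bool"
  where "hull_group_structure \<nu> A \<longleftrightarrow>
    topological_abelian_group A (hull_topology \<nu>) \<and>
    continuous_map euclidean (hull_topology \<nu>) (\<lambda>t. translate t \<nu>) \<and>
    (\<lambda>t. translate t \<nu>) \<in> hom additive_group A"

section \<open>Topological dynamical systems\<close>

text \<open>A system over \<open>G\<close> is given by the topology of the phase space and the action on its points.\<close>

definition factor_map ::
    "'x topology \<Rightarrow> ('g \<Rightarrow> 'x \<Rightarrow> 'x) \<Rightarrow> 'y topology \<Rightarrow> ('g \<Rightarrow> 'y \<Rightarrow> 'y) \<Rightarrow> ('x \<Rightarrow> 'y) \<Rightarrow> bool"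
  where "factor_map X a Y b \<Phi> \<longleftrightarrow>
    continuous_map X Y \<Phi> \<and> \<Phi> ` topspace X = topspace Y \<and>
    (\<forall>t. \<forall>x\<in>topspace X. \<Phi> (a t x) = b t (\<Phi> x))"

definition minimal_system :: "'x topology \<Rightarrow> ('g \<Rightarrow> 'x \<Rightarrow> 'x) \<Rightarrow> bool"
  where "minimal_system X a \<longleftrightarrow>
    (\<forall>x\<in>topspace X. X closure_of (range (\<lambda>t. a t x)) = topspace X)"

definition borel_of :: "'x topology \<Rightarrow> 'x measure"
  where "borel_of X = sigma (topspace X) {U. openin X U}"

text \<open>Measures are Radon, so regularity is part of the notion of an invariant probability measure.\<close>

definition regular_measure :: "'x topology \<Rightarrow> 'x measure \<Rightarrow> bool"
  where "regular_measure X m \<longleftrightarrow> (\<forall>A\<in>sets m.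
    emeasure m A = (INF U\<in>{U. openin X U \<and> A \<subseteq> U}. emeasure m U) \<and>
    emeasure m A = (SUP K\<in>{K. K \<in> sets m \<and> compactin X K \<and> K \<subseteq> A}. emeasure m K))"

definition invariant_probability ::
    "'x topology \<Rightarrow> ('g \<Rightarrow> 'x \<Rightarrow> 'x) \<Rightarrow> 'x measure \<Rightarrow> bool"
  where "invariant_probability X a m \<longleftrightarrow>
    sets m = sets (borel_of X) \<and> emeasure m (space m) = 1 \<and> regular_measure X m \<and>
    (\<forall>t. a t \<in> measurable m m \<and> distr m m (a t) = m)"

definition uniquely_ergodic :: "'x topology \<Rightarrow> ('g \<Rightarrow> 'x \<Rightarrow> 'x) \<Rightarrow> bool"
  where "uniquely_ergodic X a \<longleftrightarrow> (\<exists>!m. invariant_probability X a m)"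

definition L2 :: "'x measure \<Rightarrow> ('x \<Rightarrow> complex) set"
  where "L2 m = {g \<in> borel_measurable m. integrable m (\<lambda>x. (cmod (g x))\<^sup>2)}"

definition eigenfunction ::
    "('g::topological_ab_group_add \<Rightarrow> 'x \<Rightarrow> 'x) \<Rightarrow> 'x measure \<Rightarrow> ('g \<Rightarrow> complex) \<Rightarrow> ('x \<Rightarrow> complex) \<Rightarrow> bool"
  where "eigenfunction a m \<xi> g \<longleftrightarrow> \<xi> \<in> dual \<and> g \<in> L2 m \<and> \<not> (AE x in m. g x = 0) \<and>
    (\<forall>t. AE x in m. g (a (- t) x) = \<xi> t * g x)"

definition eigenvalues ::
    "('g::topological_ab_group_add \<Rightarrow> 'x \<Rightarrow> 'x) \<Rightarrow> 'x measure \<Rightarrow> ('g \<Rightarrow> complex) set"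
  where "eigenvalues a m = {\<xi>. \<exists>g. eigenfunction a m \<xi> g}"

definition continuous_eigenfunction ::
    "'x topology \<Rightarrow> ('g::topological_ab_group_add \<Rightarrow> 'x \<Rightarrow> 'x) \<Rightarrow> 'x measure \<Rightarrow>
      ('g \<Rightarrow> complex) \<Rightarrow> ('x \<Rightarrow> complex) \<Rightarrow> bool"
  where "continuous_eigenfunction X a m \<xi> g \<longleftrightarrow> eigenfunction a m \<xi> g \<and>
    (\<exists>g'. continuous_map X euclidean g' \<and> (AE x in m. g x = g' x) \<and>
      (\<forall>t. \<forall>x\<in>topspace X. g' (a (- t) x) = \<xi> t * g' x))"

definition pure_point_spectrum ::
    "('g::topological_ab_group_add \<Rightarrow> 'x \<Rightarrow> 'x) \<Rightarrow> 'x measure \<Rightarrow> bool"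
  where "pure_point_spectrum a m \<longleftrightarrow> (\<forall>g\<in>L2 m. \<forall>\<epsilon>>0. \<exists>E c. finite E \<and>
    (\<forall>e\<in>E. \<exists>\<xi>. eigenfunction a m \<xi> e) \<and>
    (\<integral>\<^sup>+x. ennreal ((cmod (g x - (\<Sum>e\<in>E. c e * e x)))\<^sup>2) \<partial>m) < ennreal \<epsilon>)"

definition all_eigenfunctions_continuous ::
    "'x topology \<Rightarrow> ('g::topological_ab_group_add \<Rightarrow> 'x \<Rightarrow> 'x) \<Rightarrow> 'x measure \<Rightarrow> bool"
  where "all_eigenfunctions_continuous X a m \<longleftrightarrow>
    (\<forall>\<xi> g. eigenfunction a m \<xi> g \<longrightarrow> continuous_eigenfunction X a m \<xi> g)"

end

theory Submission
  imports Defs "HOL-Complex_Analysis.Great_Picard" "HOL-Probability.Probability_Measure"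
begin

text \<open>
  For a test function \<open>\<phi>\<close> the map \<open>(s, k) \<mapsto> \<integral> f (h + k) * \<phi> (s + t) d\<rho>(t, h)\<close> is continuous and
  \<open>L\<close>-periodic: admissibility allows one to cut \<open>f\<close> off to compact support with an error that is small
  uniformly in \<open>(s, k)\<close>, and then \<open>L\<close>-invariance of \<open>\<rho>\<close> and cocompactness of \<open>L\<close> apply. So these
  measures form a continuous image of the torus. Density of the projection of \<open>L\<close> to \<open>H\<close> means that
  the points \<open>(t, 0) + l\<close> are dense in \<open>G \<times> H\<close>; hence the image is the hull, and identities between
  continuous expressions need only be checked on the orbit of \<open>\<nu>\<close>. This yields the group structure,
  its uniqueness, and minimality. Almost periodicity and equicontinuity of the action come from
  uniform continuity of periodic functions together with a finite set \<open>T\<close> in \<open>G\<close> such that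
  \<open>(T \<times> {0}) + L\<close> is a net in \<open>G \<times> H\<close>.

  On an equicontinuous minimal system, continuous functions restrict to almost periodic functions on
  orbits. Their mean is the integral against every invariant measure, and the Riesz representation of
  the mean gives one. A nonzero almost periodic function \<open>u\<close> has a nonzero Fourier coefficient: a
  positive definite eigenfunction of convolution with the autocorrelation of \<open>u\<close> that is extremal
  among the normalised ones is a character. Characters occurring in orbit functions extend to
  continuous eigenfunctions, and these are therefore total. On the torus an eigenfunction divided by
  its value at \<open>0\<close> becomes a character.
\<close>

section \<open>The total variation of a Radon functional\<close>

text \<open>This shapes the proof in three ways. Regularity of invariant measures is used in
  earnest, because continuous functions determine only the regular Borel measures on such a space.
  Compactness of the action is expressed by finite colourings, through which countably many points
  control a whole function, so that sequences suffice in every compactness argument. And harmonic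
  analysis takes place on \<open>G\<close> as an abstract group, with the mean in the role of the
  Haar integral of a compact group; topology returns only when a character is extended to the hull,
  where continuity of the orbit maps makes it continuous on \<open>G\<close>. The Riesz construction
  is needed twice, for \<open>\<rho>\<close> on \<open>G \<times> H\<close> and for the mean on the
  hull, hence its development for topologies given as values. For \<open>\<rho>\<close> it yields
  \<open>norm_le_integral\<close>, the estimate by which the definite description in
  \<open>radon_integral\<close> can be evaluated at all.\<close>

definition support_in :: "'a topology \<Rightarrow> ('a \<Rightarrow> complex) \<Rightarrow> 'a set"
  where "support_in X \<phi> = X closure_of {x \<in> topspace X. \<phi> x \<noteq> 0}"

definition Cc_on :: "'a topology \<Rightarrow> ('a \<Rightarrow> complex) set"
  where "Cc_on X = {\<phi>. continuous_map X euclidean \<phi> \<and> compactin X (support_in X \<phi>)}"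

definition unit_tests :: "'a topology \<Rightarrow> 'a set \<Rightarrow> ('a \<Rightarrow> complex) set"
  where "unit_tests X U = {\<psi> \<in> Cc_on X. support_in X \<psi> \<subseteq> U \<and> (\<forall>x\<in>topspace X. cmod (\<psi> x) \<le> 1)}"

definition open_variation :: "'a topology \<Rightarrow> (('a \<Rightarrow> complex) \<Rightarrow> complex) \<Rightarrow> 'a set \<Rightarrow> ennreal"
  where "open_variation X \<mu> U = (SUP \<psi>\<in>unit_tests X U. ennreal (cmod (\<mu> \<psi>)))"

definition outer_variation :: "'a topology \<Rightarrow> (('a \<Rightarrow> complex) \<Rightarrow> complex) \<Rightarrow> 'a set \<Rightarrow> ennreal"
  where "outer_variation X \<mu> A = (INF U\<in>{U. openin X U \<and> A \<subseteq> U}. open_variation X \<mu> U)"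

text \<open>The same Riesz construction as \<open>total_variation\<close>, relative to a topology
  that is a value: it is applied to the euclidean topology and, with the mean as functional, to a
  compact phase space.\<close>

definition variation_measure :: "'a topology \<Rightarrow> (('a \<Rightarrow> complex) \<Rightarrow> complex) \<Rightarrow> 'a measure"
  where "variation_measure X \<mu> =
    measure_of (topspace X) (sigma_sets (topspace X) {U. openin X U}) (outer_variation X \<mu>)"

section \<open>Functions of compact support and cut-off functions\<close>

lemma continuous_map_compose_UNIV:
  assumes "continuous_map X euclidean \<phi>" "continuous_on UNIV g"
  shows "continuous_map X euclidean (\<lambda>x. g (\<phi> x))"
  using continuous_map_compose[OF assms(1), of euclidean g] assms(2) by (simp add: o_def)

lemma continuous_map_compose2_UNIV:
  assumes "continuous_map X euclidean \<phi>" "continuous_map X euclidean \<psi>" "continuous_on UNIV (\<lambda>p. g (fst p) (snd p))"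
  shows "continuous_map X euclidean (\<lambda>x. g (\<phi> x) (\<psi> x))"
proof -
  have "continuous_map X (prod_topology euclidean euclidean) (\<lambda>x. (\<phi> x, \<psi> x))"
    unfolding continuous_map_pairwise using assms by (simp add: o_def)
  then have "continuous_map X euclidean (\<lambda>x. (\<phi> x, \<psi> x))"
    by simp
  from continuous_map_compose_UNIV[OF this assms(3)] show ?thesis by simp
qed

text \<open>The phase by which a complex value is rotated onto the nonnegative axis, so that values
  of a functional on several test functions can be made to add up without cancellation.\<close>

lemma cnj_sgn_mult: "cnj (sgn z) * z = of_real (cmod z)"
proof (cases "z = 0")
  case False
  have "cnj z * z = of_real (cmod z) * of_real (cmod z)"
    unfolding mult.commute[of "cnj z"] by (metis complex_norm_square of_real_power power2_eq_square)
  then show ?thesis using False by (simp add: sgn_eq)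
qed simp

lemma support_in_subset: "support_in X \<phi> \<subseteq> topspace X"
  by (simp add: support_in_def closure_of_subset_topspace)

lemma zero_outside_support: "x \<in> topspace X \<Longrightarrow> x \<notin> support_in X \<phi> \<Longrightarrow> \<phi> x = 0"
  using closure_of_subset[of "{x \<in> topspace X. \<phi> x \<noteq> 0}" X] by (auto simp: support_in_def)

lemma Cc_onI:
  assumes "Hausdorff_space X" "continuous_map X euclidean \<phi>" "compactin X K"
    "\<And>x. x \<in> topspace X \<Longrightarrow> x \<notin> K \<Longrightarrow> \<phi> x = 0"
  shows "\<phi> \<in> Cc_on X" "support_in X \<phi> \<subseteq> K"
proof -
  have "closedin X K" using assms compactin_imp_closedin by blast
  then show *: "support_in X \<phi> \<subseteq> K"
    unfolding support_in_def using assms(4) by (intro closure_of_minimal) auto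
  have "closedin X (support_in X \<phi>)" by (simp add: support_in_def)
  then show "\<phi> \<in> Cc_on X"
    using assms(2) closed_compactin[OF assms(3) *] by (simp add: Cc_on_def)
qed

lemma Cc_on_dominated:
  assumes "Hausdorff_space X" "\<phi> \<in> Cc_on X" "continuous_map X euclidean \<psi>"
    "\<And>x. x \<in> topspace X \<Longrightarrow> \<phi> x = 0 \<Longrightarrow> \<psi> x = 0"
  shows "\<psi> \<in> Cc_on X" "support_in X \<psi> \<subseteq> support_in X \<phi>"
  using Cc_onI[OF assms(1,3), of "support_in X \<phi>"] assms(2,4) zero_outside_support[of _ X \<phi>]
  by (auto simp: Cc_on_def)

lemma Cc_on_cmult:
  assumes "Hausdorff_space X" "\<phi> \<in> Cc_on X"
  shows "(\<lambda>x. c * \<phi> x) \<in> Cc_on X" "support_in X (\<lambda>x. c * \<phi> x) \<subseteq> support_in X \<phi>"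
proof -
  have c: "continuous_map X euclidean (\<lambda>x. c * \<phi> x)"
    using assms(2) by (intro continuous_map_compose_UNIV[where g = "\<lambda>z. c * z"] continuous_intros) (auto simp: Cc_on_def)
  show "(\<lambda>x. c * \<phi> x) \<in> Cc_on X" "support_in X (\<lambda>x. c * \<phi> x) \<subseteq> support_in X \<phi>"
    by (rule Cc_on_dominated[OF assms c]; simp)+
qed

lemma Cc_on_add:
  assumes "Hausdorff_space X" "\<phi> \<in> Cc_on X" "\<psi> \<in> Cc_on X"
  shows "(\<lambda>x. \<phi> x + \<psi> x) \<in> Cc_on X" "support_in X (\<lambda>x. \<phi> x + \<psi> x) \<subseteq> support_in X \<phi> \<union> support_in X \<psi>"
proof -
  have c: "continuous_map X euclidean (\<lambda>x. \<phi> x + \<psi> x)"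
    using assms by (intro continuous_map_compose2_UNIV[where g = "(+)"] continuous_intros) (auto simp: Cc_on_def)
  have K: "compactin X (support_in X \<phi> \<union> support_in X \<psi>)"
    using assms by (auto simp: Cc_on_def intro: compactin_Un)
  have z: "\<phi> x + \<psi> x = 0" if "x \<in> topspace X" "x \<notin> support_in X \<phi> \<union> support_in X \<psi>" for x
    using that zero_outside_support[of x X \<phi>] zero_outside_support[of x X \<psi>] by auto
  show "(\<lambda>x. \<phi> x + \<psi> x) \<in> Cc_on X" "support_in X (\<lambda>x. \<phi> x + \<psi> x) \<subseteq> support_in X \<phi> \<union> support_in X \<psi>"
    using Cc_onI[OF assms(1) c K z] by simp_all
qed

lemma Cc_on_zero: "(\<lambda>x. 0) \<in> Cc_on X" "support_in X (\<lambda>x. 0) = {}"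
  by (simp_all add: Cc_on_def support_in_def)

lemma Cc_on_bounded:
  assumes "\<phi> \<in> Cc_on X"
  obtains B where "B > 0" "\<And>x. x \<in> topspace X \<Longrightarrow> cmod (\<phi> x) \<le> B"
proof -
  have "compactin euclidean (\<phi> ` support_in X \<phi>)"
    using assms image_compactin[of X "support_in X \<phi>" euclidean \<phi>] by (simp add: Cc_on_def)
  then have "bounded (\<phi> ` support_in X \<phi>)"
    by (simp add: compact_imp_bounded)
  then obtain B where B: "B > 0" "\<And>x. x \<in> support_in X \<phi> \<Longrightarrow> cmod (\<phi> x) \<le> B"
    by (auto simp: bounded_pos)
  have "cmod (\<phi> x) \<le> B" if "x \<in> topspace X" for x
    using B zero_outside_support[OF that, of \<phi>] by (cases "x \<in> support_in X \<phi>") auto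
  then show ?thesis using that B(1) by blast
qed

text \<open>Every point of \<open>K\<close> has a compact neighbourhood inside \<open>U\<close>;
  finitely many of their interiors cover \<open>K\<close>.\<close>

lemma compact_open_sandwich:
  assumes "locally_compact_space X" "Hausdorff_space X" "compactin X K" "openin X U" "K \<subseteq> U"
  obtains V C where "openin X V" "compactin X C" "K \<subseteq> V" "V \<subseteq> C" "C \<subseteq> U"
proof -
  have nb: "neighbourhood_base_of (compactin X) X"
    using assms locally_compact_space_neighbourhood_base by blast
  have "\<exists>V C. openin X V \<and> compactin X C \<and> x \<in> V \<and> V \<subseteq> C \<and> C \<subseteq> U" if "x \<in> K" for x
    using nb assms(4,5) that unfolding neighbourhood_base_of by blast
  then obtain V C where VC: "\<And>x. x \<in> K \<Longrightarrow> openin X (V x)" "\<And>x. x \<in> K \<Longrightarrow> compactin X (C x)"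
    "\<And>x. x \<in> K \<Longrightarrow> x \<in> V x \<and> V x \<subseteq> C x \<and> C x \<subseteq> U"
    by metis
  have op: "\<And>W. W \<in> V ` K \<Longrightarrow> openin X W" and cov: "K \<subseteq> \<Union> (V ` K)"
    using VC by auto
  obtain F where F: "finite F" "F \<subseteq> V ` K" "K \<subseteq> \<Union> F"
    using compactinD[OF assms(3) op cov] by auto
  obtain T where T: "T \<subseteq> K" "finite T" "F = V ` T"
    using finite_subset_image[OF F(1,2)] by auto
  show ?thesis
  proof
    show "openin X (\<Union>x\<in>T. V x)" using VC T by blast
    show "compactin X (\<Union>x\<in>T. C x)" using VC T by (intro compactin_Union) auto
    show "K \<subseteq> (\<Union>x\<in>T. V x)" using F T by simp
    show "(\<Union>x\<in>T. V x) \<subseteq> (\<Union>x\<in>T. C x)" "(\<Union>x\<in>T. C x) \<subseteq> U" using VC T by blast+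
  qed
qed

text \<open>The separation is from the complement of an open set \<open>V\<close> squeezed between
  \<open>K\<close> and a compact subset \<open>C\<close> of \<open>U\<close>, not from the
  complement of \<open>U\<close>. So the function vanishes off \<open>C\<close>, and its closed
  support stays inside \<open>U\<close>.\<close>

lemma Urysohn_compact_support:
  assumes "locally_compact_space X" "Hausdorff_space X" "compactin X K" "openin X U" "K \<subseteq> U"
  obtains h :: "'a \<Rightarrow> real" and C where "continuous_map X euclideanreal h" "compactin X C" "C \<subseteq> U"
    "\<And>x. x \<in> topspace X \<Longrightarrow> 0 \<le> h x \<and> h x \<le> 1" "\<And>x. x \<in> K \<Longrightarrow> h x = 1"
    "\<And>x. x \<in> topspace X \<Longrightarrow> x \<notin> C \<Longrightarrow> h x = 0"
proof -
  obtain V C where VC: "openin X V" "compactin X C" "K \<subseteq> V" "V \<subseteq> C" "C \<subseteq> U"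
    using compact_open_sandwich[OF assms] .
  have cr: "completely_regular_space X"
    using assms(1,2) locally_compact_Hausdorff_imp_regular_space
      locally_compact_regular_imp_completely_regular_space by blast
  have "closedin X (topspace X - V)" "disjnt K (topspace X - V)"
    using VC by (auto simp: disjnt_def)
  then obtain h where h: "continuous_map X (top_of_set {0..1::real}) h"
    "h ` (topspace X - V) \<subseteq> {0}" "h ` K \<subseteq> {1}"
    using Urysohn_completely_regular_compact_closed[OF _ cr assms(3), of 0 1] by (metis zero_le_one)
  show ?thesis
  proof (rule that[of h C])
    show "continuous_map X euclideanreal h" using h(1) continuous_map_into_fulltopology by blast
    show "0 \<le> h x \<and> h x \<le> 1" if "x \<in> topspace X" for x
      using h(1) that by (auto simp: continuous_map_in_subtopology Pi_iff)
    show "h x = 1" if "x \<in> K" for x using h(3) that by auto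
    show "h x = 0" if "x \<in> topspace X" "x \<notin> C" for x using h(2) VC(4) that by auto
  qed (rule VC)+
qed

text \<open>Boundedness quantifies over all upper bounds \<open>B\<close> instead of naming a
  supremum, which would first have to be shown to be meaningful on the given space.\<close>

locale radon_functional =
  fixes X :: "'a topology" and \<mu> :: "('a \<Rightarrow> complex) \<Rightarrow> complex"
  assumes lc: "locally_compact_space X" and haus: "Hausdorff_space X"
    and add: "\<And>\<phi> \<psi>. \<phi> \<in> Cc_on X \<Longrightarrow> \<psi> \<in> Cc_on X \<Longrightarrow> \<mu> (\<lambda>x. \<phi> x + \<psi> x) = \<mu> \<phi> + \<mu> \<psi>"
    and scale: "\<And>\<phi> c. \<phi> \<in> Cc_on X \<Longrightarrow> \<mu> (\<lambda>x. c * \<phi> x) = c * \<mu> \<phi>"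
    and bounded: "\<And>K. compactin X K \<Longrightarrow> \<exists>C. \<forall>\<phi>\<in>Cc_on X. support_in X \<phi> \<subseteq> K \<longrightarrow>
      (\<forall>B. (\<forall>x\<in>topspace X. cmod (\<phi> x) \<le> B) \<longrightarrow> cmod (\<mu> \<phi>) \<le> C * B)"
begin

section \<open>The variation of open sets\<close>

lemma sum:
  "finite I \<Longrightarrow> (\<And>i. i \<in> I \<Longrightarrow> \<phi> i \<in> Cc_on X) \<Longrightarrow>
    (\<lambda>x. \<Sum>i\<in>I. \<phi> i x) \<in> Cc_on X \<and> \<mu> (\<lambda>x. \<Sum>i\<in>I. \<phi> i x) = (\<Sum>i\<in>I. \<mu> (\<phi> i))"
proof (induction I rule: finite_induct)
  case empty
  show ?case using scale[OF Cc_on_zero(1), of 0] by (simp add: Cc_on_zero)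
next
  case (insert i I)
  then show ?case using Cc_on_add(1)[OF haus, of "\<phi> i" "\<lambda>x. \<Sum>i\<in>I. \<phi> i x"] add by simp
qed

text \<open>Test functions are total on the type, and a functional might react to values outside the
  space. It does not: such a function has empty support, and the bound applies with \<open>B\<close>
  equal to 0. This allows replacing a function by a sum that agrees with it on the space
  only.\<close>

lemma zero_on_space:
  assumes "\<phi> \<in> Cc_on X" "\<And>x. x \<in> topspace X \<Longrightarrow> \<phi> x = 0"
  shows "\<mu> \<phi> = 0"
proof -
  have "support_in X \<phi> = {}"
    using assms(2) by (simp add: support_in_def cong: conj_cong)
  then show ?thesis
    using bounded[of "{}"] assms by (force dest: bspec[of _ _ \<phi>] spec[of _ 0])
qed

lemma unit_tests_zero: "(\<lambda>x. 0) \<in> unit_tests X U"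
  by (simp add: unit_tests_def Cc_on_zero)

lemma test_le_variation: "\<psi> \<in> unit_tests X U \<Longrightarrow> ennreal (cmod (\<mu> \<psi>)) \<le> open_variation X \<mu> U"
  unfolding open_variation_def by (rule SUP_upper)

lemma scaled_test_le_variation:
  assumes "\<phi> \<in> Cc_on X" "support_in X \<phi> \<subseteq> U" "\<And>x. x \<in> topspace X \<Longrightarrow> cmod (\<phi> x) \<le> c" "c > 0"
  shows "ennreal (cmod (\<mu> \<phi>)) \<le> ennreal c * open_variation X \<mu> U"
proof -
  have "(\<lambda>x. of_real (1 / c) * \<phi> x) \<in> unit_tests X U"
    using Cc_on_cmult[OF haus assms(1), of "of_real (1 / c)"] assms(2-4)
    by (auto simp: unit_tests_def norm_mult norm_divide divide_le_eq)
  then have "ennreal (cmod (\<mu> (\<lambda>x. of_real (1 / c) * \<phi> x))) \<le> open_variation X \<mu> U"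
    by (rule test_le_variation)
  moreover have "cmod (\<mu> (\<lambda>x. of_real (1 / c) * \<phi> x)) = cmod (\<mu> \<phi>) / c"
    unfolding scale[OF assms(1)] using assms(4) by (simp add: norm_mult norm_divide)
  ultimately have "ennreal c * ennreal (cmod (\<mu> \<phi>) / c) \<le> ennreal c * open_variation X \<mu> U"
    by (intro mult_left_mono) simp_all
  then show ?thesis using assms(4) by (simp flip: ennreal_mult)
qed

lemma open_variation_mono: "U \<subseteq> V \<Longrightarrow> open_variation X \<mu> U \<le> open_variation X \<mu> V"
  unfolding open_variation_def by (intro SUP_subset_mono) (auto simp: unit_tests_def)

lemma open_variation_empty: "open_variation X \<mu> {} = 0"
proof -
  have "\<mu> \<psi> = 0" if "\<psi> \<in> unit_tests X {}" for \<psi>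
  proof (rule zero_on_space)
    show "\<psi> \<in> Cc_on X" using that by (simp add: unit_tests_def)
    show "\<psi> x = 0" if "x \<in> topspace X" for x
      using \<open>\<psi> \<in> unit_tests X {}\<close> zero_outside_support[OF that, of \<psi>] by (auto simp: unit_tests_def)
  qed
  then show ?thesis unfolding open_variation_def
    by (auto simp: le_zero_eq[symmetric] simp del: le_zero_eq intro!: SUP_least)
qed

lemma open_variation_finite:
  assumes "compactin X K" "U \<subseteq> K"
  shows "open_variation X \<mu> U < \<infinity>"
proof -
  obtain C where C: "\<And>\<phi> B. \<phi> \<in> Cc_on X \<Longrightarrow> support_in X \<phi> \<subseteq> K \<Longrightarrow>
      (\<And>x. x \<in> topspace X \<Longrightarrow> cmod (\<phi> x) \<le> B) \<Longrightarrow> cmod (\<mu> \<phi>) \<le> C * B"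
    using bounded[OF assms(1)] by blast
  have "open_variation X \<mu> U \<le> ennreal (C * 1)"
    unfolding open_variation_def using assms(2)
    by (intro SUP_least ennreal_leI C) (auto simp: unit_tests_def)
  then show ?thesis using ennreal_less_top le_less_trans by (metis infinity_ennreal_def)
qed

text \<open>The cut-off function has to equal 1 on a neighbourhood of the part of the support outside the
  second set, since supports are closed.\<close>

lemma open_variation_Un:
  assumes "openin X U" "openin X V"
  shows "open_variation X \<mu> (U \<union> V) \<le> open_variation X \<mu> U + open_variation X \<mu> V"
  unfolding open_variation_def[of X \<mu> "U \<union> V"]
proof (rule SUP_least)
  fix \<psi> assume \<psi>: "\<psi> \<in> unit_tests X (U \<union> V)"
  define K where "K = support_in X \<psi>"
  have K: "compactin X K" "K \<subseteq> U \<union> V" "\<psi> \<in> Cc_on X" "continuous_map X euclidean \<psi>"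
    "\<And>x. x \<in> topspace X \<Longrightarrow> cmod (\<psi> x) \<le> 1"
    using \<psi> by (auto simp: unit_tests_def K_def Cc_on_def)
  have KV: "compactin X (K - V)"
    using K(1) assms(2) compactin_imp_closedin[OF haus K(1)]
    by (intro closed_compactin[OF K(1)] closedin_diff) auto
  obtain W C where W: "openin X W" "compactin X C" "K - V \<subseteq> W" "W \<subseteq> C" "C \<subseteq> U"
    using compact_open_sandwich[OF lc haus KV assms(1)] K(2) by blast
  obtain h D where h: "continuous_map X euclideanreal h" "compactin X D" "D \<subseteq> U"
    "\<And>x. x \<in> topspace X \<Longrightarrow> 0 \<le> h x \<and> h x \<le> 1" "\<And>x. x \<in> C \<Longrightarrow> h x = 1"
    "\<And>x. x \<in> topspace X \<Longrightarrow> x \<notin> D \<Longrightarrow> h x = 0"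
    using Urysohn_compact_support[OF lc haus W(2) assms(1) W(5)] by metis
  define \<psi>1 where "\<psi>1 x = of_real (h x) * \<psi> x" for x
  define \<psi>2 where "\<psi>2 x = of_real (1 - h x) * \<psi> x" for x
  have cont: "continuous_map X euclidean \<psi>1" "continuous_map X euclidean \<psi>2"
    unfolding \<psi>1_def \<psi>2_def
    by (intro continuous_map_compose2_UNIV[OF h(1) K(4), where g = "\<lambda>a z. of_real a * z"]
        continuous_map_compose2_UNIV[OF h(1) K(4), where g = "\<lambda>a z. of_real (1 - a) * z"] continuous_intros)+
  have 1: "\<psi>1 \<in> Cc_on X" "support_in X \<psi>1 \<subseteq> D"
    using Cc_onI[OF haus cont(1) h(2)] h(6) by (auto simp: \<psi>1_def)
  have KW: "compactin X (K - W)"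
    using K(1) W(1) compactin_imp_closedin[OF haus K(1)]
    by (intro closed_compactin[OF K(1)] closedin_diff) auto
  have z2: "\<psi>2 x = 0" if "x \<in> topspace X" "x \<notin> K - W" for x
    using that zero_outside_support[of x X \<psi>] h(5)[of x] W(4) by (auto simp: \<psi>2_def K_def)
  have 2: "\<psi>2 \<in> Cc_on X" "support_in X \<psi>2 \<subseteq> K - W"
    using Cc_onI[OF haus cont(2) KW z2] by auto
  have le1: "cmod (of_real a * \<psi> x) \<le> 1" if "x \<in> topspace X" "0 \<le> a" "a \<le> 1" for a x
    using K(5)[OF that(1)] that by (simp add: norm_mult mult_le_one)
  have "cmod (\<psi>1 x) \<le> 1" "cmod (\<psi>2 x) \<le> 1" if "x \<in> topspace X" for x
    unfolding \<psi>1_def \<psi>2_def using h(4)[OF that] by (intro le1 that; simp)+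
  then have "\<psi>1 \<in> unit_tests X U" "\<psi>2 \<in> unit_tests X V"
    using 1 2 h(3,4) W(3) K(2) by (auto simp: unit_tests_def)
  then have le: "ennreal (cmod (\<mu> \<psi>1)) + ennreal (cmod (\<mu> \<psi>2)) \<le> open_variation X \<mu> U + open_variation X \<mu> V"
    by (intro add_mono test_le_variation)
  have "\<psi> = (\<lambda>x. \<psi>1 x + \<psi>2 x)" by (auto simp: \<psi>1_def \<psi>2_def algebra_simps)
  then have "\<mu> \<psi> = \<mu> \<psi>1 + \<mu> \<psi>2" using add[OF 1(1) 2(1)] by simp
  then have "ennreal (cmod (\<mu> \<psi>)) \<le> ennreal (cmod (\<mu> \<psi>1)) + ennreal (cmod (\<mu> \<psi>2))"
    by (simp add: norm_triangle_ineq flip: ennreal_plus)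
  then show "ennreal (cmod (\<mu> \<psi>)) \<le> open_variation X \<mu> U + open_variation X \<mu> V"
    using le by (rule order_trans)
qed

lemma open_variation_UN_finite:
  fixes U :: "nat \<Rightarrow> 'a set"
  assumes "\<And>i. openin X (U i)"
  shows "open_variation X \<mu> (\<Union>i<n. U i) \<le> (\<Sum>i<n. open_variation X \<mu> (U i))"
proof (induction n)
  case (Suc n)
  have "open_variation X \<mu> (\<Union>i<Suc n. U i) = open_variation X \<mu> ((\<Union>i<n. U i) \<union> U n)"
    by (simp add: lessThan_Suc Un_commute)
  also have "\<dots> \<le> open_variation X \<mu> (\<Union>i<n. U i) + open_variation X \<mu> (U n)"
    using assms by (intro open_variation_Un openin_Union) auto
  also have "\<dots> \<le> (\<Sum>i<n. open_variation X \<mu> (U i)) + open_variation X \<mu> (U n)"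
    using Suc by (intro add_mono) auto
  finally show ?case by simp
qed (simp add: open_variation_empty)

text \<open>The support of a test function is compact, so finitely many of the open sets already
  contain it.\<close>

lemma open_variation_UN:
  fixes U :: "nat \<Rightarrow> 'a set"
  assumes U: "\<And>i. openin X (U i)"
  shows "open_variation X \<mu> (\<Union>i. U i) \<le> (\<Sum>i. open_variation X \<mu> (U i))"
  unfolding open_variation_def[of X \<mu> "\<Union>i. U i"]
proof (rule SUP_least)
  fix \<psi> assume \<psi>: "\<psi> \<in> unit_tests X (\<Union>i. U i)"
  then have K: "compactin X (support_in X \<psi>)" "support_in X \<psi> \<subseteq> (\<Union>i. U i)"
    by (auto simp: unit_tests_def Cc_on_def)
  have "\<exists>F. finite F \<and> F \<subseteq> range U \<and> support_in X \<psi> \<subseteq> \<Union>F"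
    by (rule compactinD[OF K(1) _ K(2)]) (use U in auto)
  then obtain F where F: "finite F" "F \<subseteq> range U" "support_in X \<psi> \<subseteq> \<Union>F" by auto
  obtain T where T: "finite T" "F = U ` T" using finite_subset_image[OF F(1,2)] by auto
  obtain n where n: "T \<subseteq> {..<n}" using T(1) finite_nat_iff_bounded by blast
  have "support_in X \<psi> \<subseteq> (\<Union>i<n. U i)" using F(3) T(2) n by blast
  then have "\<psi> \<in> unit_tests X (\<Union>i<n. U i)" using \<psi> by (simp add: unit_tests_def)
  then have "ennreal (cmod (\<mu> \<psi>)) \<le> open_variation X \<mu> (\<Union>i<n. U i)" by (rule test_le_variation)
  also have "\<dots> \<le> (\<Sum>i<n. open_variation X \<mu> (U i))" by (rule open_variation_UN_finite[OF U])
  also have "\<dots> \<le> (\<Sum>i. open_variation X \<mu> (U i))" by (rule sum_le_suminf) auto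
  finally show "ennreal (cmod (\<mu> \<psi>)) \<le> (\<Sum>i. open_variation X \<mu> (U i))" .
qed

section \<open>Caratheodory extension of the variation\<close>

lemma outer_variation_open: "openin X U \<Longrightarrow> outer_variation X \<mu> U = open_variation X \<mu> U"
  unfolding outer_variation_def
  by (rule antisym) (auto intro: INF_lower INF_greatest open_variation_mono)

lemma outer_variation_mono: "A \<subseteq> B \<Longrightarrow> outer_variation X \<mu> A \<le> outer_variation X \<mu> B"
  unfolding outer_variation_def by (intro INF_superset_mono) auto

lemma outer_measure_space_variation:
  "outer_measure_space (Pow (topspace X)) (outer_variation X \<mu>)"
  unfolding outer_measure_space_def
proof (intro conjI)
  show "positive (Pow (topspace X)) (outer_variation X \<mu>)"
    unfolding positive_def by (simp add: outer_variation_open open_variation_empty)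
  show "increasing (Pow (topspace X)) (outer_variation X \<mu>)"
    by (auto simp: increasing_def outer_variation_mono)
  show "countably_subadditive (Pow (topspace X)) (outer_variation X \<mu>)"
    unfolding countably_subadditive_def
  proof (intro allI impI)
    fix A :: "nat \<Rightarrow> 'a set"
    assume A: "range A \<subseteq> Pow (topspace X)"
    show "outer_variation X \<mu> (\<Union>i. A i) \<le> (\<Sum>i. outer_variation X \<mu> (A i))"
    proof (rule ennreal_le_epsilon)
      fix e :: real assume fin: "(\<Sum>i. outer_variation X \<mu> (A i)) < Orderings.top" and "0 < e"
      have "\<exists>U. openin X U \<and> A i \<subseteq> U \<and> open_variation X \<mu> U \<le> outer_variation X \<mu> (A i) + ennreal (e * (1/2) ^ Suc i)" for i
      proof -
        have "outer_variation X \<mu> (A i) \<noteq> \<infinity>"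
          using ennreal_suminf_lessD[OF fin, of i] by auto
        then show ?thesis
          using INF_approx_ennreal[of "e * (1/2) ^ Suc i" "outer_variation X \<mu> (A i)"] \<open>0 < e\<close>
          unfolding outer_variation_def by (fastforce intro: less_imp_le)
      qed
      then obtain U where U: "\<And>i. openin X (U i)" "\<And>i. A i \<subseteq> U i"
        "\<And>i. open_variation X \<mu> (U i) \<le> outer_variation X \<mu> (A i) + ennreal (e * (1/2) ^ Suc i)"
        by metis
      have "outer_variation X \<mu> (\<Union>i. A i) \<le> outer_variation X \<mu> (\<Union>i. U i)"
        using U(2) by (intro outer_variation_mono) blast
      also have "\<dots> = open_variation X \<mu> (\<Union>i. U i)"
        using U(1) by (intro outer_variation_open) auto
      also have "\<dots> \<le> (\<Sum>i. open_variation X \<mu> (U i))" by (rule open_variation_UN[OF U(1)])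
      also have "\<dots> \<le> (\<Sum>i. outer_variation X \<mu> (A i) + ennreal (e * (1/2) ^ Suc i))"
        by (intro suminf_le U(3)) auto
      also have "\<dots> = (\<Sum>i. outer_variation X \<mu> (A i)) + (\<Sum>i. ennreal e * ennreal ((1/2) ^ Suc i))"
        using \<open>0 < e\<close> by (subst suminf_add[symmetric])
          (auto simp del: ennreal_suminf_cmult simp add: ennreal_mult[symmetric])
      also have "\<dots> = (\<Sum>i. outer_variation X \<mu> (A i)) + ennreal e"
        unfolding ennreal_suminf_cmult
        by (subst suminf_ennreal_eq[OF zero_le_power power_half_series]) auto
      finally show "outer_variation X \<mu> (\<Union>i. A i) \<le> (\<Sum>i. outer_variation X \<mu> (A i)) + ennreal e" .
    qed
  qed
qed

text \<open>Let \<open>\<eta>\<close> be a test function on the remaining set. After multiplication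
  by phases both values are nonnegative, and since the supports are disjoint the sum is still
  bounded by 1, hence a test function for \<open>W\<close>. This superadditivity is the hard half of
  the measurability of open sets.\<close>

lemma open_variation_split:
  assumes "openin X U" "openin X W" and \<psi>: "\<psi> \<in> unit_tests X (W \<inter> U)"
  shows "ennreal (cmod (\<mu> \<psi>)) + open_variation X \<mu> (W - support_in X \<psi>) \<le> open_variation X \<mu> W"
proof -
  have "ennreal (cmod (\<mu> \<psi>)) + ennreal (cmod (\<mu> \<eta>)) \<le> open_variation X \<mu> W"
    if \<eta>: "\<eta> \<in> unit_tests X (W - support_in X \<psi>)" for \<eta>
  proof -
    define a where "a = cnj (sgn (\<mu> \<psi>))"
    define b where "b = cnj (sgn (\<mu> \<eta>))"
    have ab: "a * \<mu> \<psi> = of_real (cmod (\<mu> \<psi>))" "b * \<mu> \<eta> = of_real (cmod (\<mu> \<eta>))"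
      by (simp_all add: a_def b_def cnj_sgn_mult)
    have nab: "cmod a \<le> 1" "cmod b \<le> 1" by (simp_all add: a_def b_def norm_sgn)
    have mem: "\<psi> \<in> Cc_on X" "\<eta> \<in> Cc_on X" using \<psi> \<eta> by (auto simp: unit_tests_def)
    have mem': "(\<lambda>x. a * \<psi> x) \<in> Cc_on X" "(\<lambda>x. b * \<eta> x) \<in> Cc_on X"
      by (intro Cc_on_cmult haus mem)+
    have "(\<lambda>x. a * \<psi> x + b * \<eta> x) \<in> unit_tests X W"
      unfolding unit_tests_def
    proof (intro CollectI conjI ballI)
      show "(\<lambda>x. a * \<psi> x + b * \<eta> x) \<in> Cc_on X" by (intro Cc_on_add haus mem')
      have "support_in X (\<lambda>x. a * \<psi> x + b * \<eta> x) \<subseteq> support_in X \<psi> \<union> support_in X \<eta>"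
        using Cc_on_add(2)[OF haus mem'] Cc_on_cmult(2)[OF haus mem(1), of a] Cc_on_cmult(2)[OF haus mem(2), of b]
        by blast
      then show "support_in X (\<lambda>x. a * \<psi> x + b * \<eta> x) \<subseteq> W"
        using \<psi> \<eta> by (auto simp: unit_tests_def)
      fix x assume x: "x \<in> topspace X"
      have "cmod (a * \<psi> x) \<le> 1" "cmod (b * \<eta> x) \<le> 1"
        using \<psi> \<eta> x nab by (auto simp: unit_tests_def norm_mult intro!: mult_le_one)
      moreover have "\<psi> x = 0 \<or> \<eta> x = 0"
        using zero_outside_support[OF x, of \<psi>] zero_outside_support[OF x, of \<eta>] \<eta>
        by (auto simp: unit_tests_def)
      ultimately show "cmod (a * \<psi> x + b * \<eta> x) \<le> 1" by auto
    qed
    then have "ennreal (cmod (\<mu> (\<lambda>x. a * \<psi> x + b * \<eta> x))) \<le> open_variation X \<mu> W"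
      by (rule test_le_variation)
    also have "\<mu> (\<lambda>x. a * \<psi> x + b * \<eta> x) = of_real (cmod (\<mu> \<psi>) + cmod (\<mu> \<eta>))"
      by (simp add: add mem mem' scale ab)
    finally show ?thesis by (simp del: of_real_add flip: ennreal_plus)
  qed
  moreover have "unit_tests X (W - support_in X \<psi>) \<noteq> {}" using unit_tests_zero by blast
  ultimately show ?thesis
    unfolding open_variation_def[of X \<mu> "W - support_in X \<psi>"]
    by (subst ennreal_SUP_add_right) (auto intro!: SUP_least)
qed

text \<open>Take an open \<open>W\<close> containing \<open>A\<close> and a test function \<psi> in
  \<open>W \<inter> U\<close>. Its support lies in \<open>U\<close>, so \<open>A - U\<close> remains
  inside the open set \<open>W - support_in X \<psi>\<close>, and
  \<open>open_variation_split\<close> applies. The supremum over \<psi> recovers the variation of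
  \<open>W \<inter> U\<close>.\<close>

lemma openin_lambda_system:
  assumes U: "openin X U"
  shows "U \<in> lambda_system (topspace X) (Pow (topspace X)) (outer_variation X \<mu>)"
proof -
  interpret algebra "topspace X" "Pow (topspace X)" by (rule algebra_Pow)
  have "outer_variation X \<mu> (A \<inter> U) + outer_variation X \<mu> (A - U) = outer_variation X \<mu> A"
    if A: "A \<subseteq> topspace X" for A
  proof (rule antisym)
    show "outer_variation X \<mu> (A \<inter> U) + outer_variation X \<mu> (A - U) \<le> outer_variation X \<mu> A"
      unfolding outer_variation_def[of X \<mu> A]
    proof (rule INF_greatest)
      fix W assume "W \<in> {W. openin X W \<and> A \<subseteq> W}"
      then have W: "openin X W" "A \<subseteq> W" by auto
      have "ennreal (cmod (\<mu> \<psi>)) + outer_variation X \<mu> (A - U) \<le> open_variation X \<mu> W"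
        if \<psi>: "\<psi> \<in> unit_tests X (W \<inter> U)" for \<psi>
      proof -
        have "closedin X (support_in X \<psi>)" by (simp add: support_in_def)
        then have op: "openin X (W - support_in X \<psi>)" using W(1) by blast
        have "outer_variation X \<mu> (A - U) \<le> outer_variation X \<mu> (W - support_in X \<psi>)"
          using \<psi> W by (intro outer_variation_mono) (auto simp: unit_tests_def)
        then show ?thesis
          using open_variation_split[OF U W(1) \<psi>] outer_variation_open[OF op]
          by (metis add_left_mono order_trans)
      qed
      moreover have "unit_tests X (W \<inter> U) \<noteq> {}" using unit_tests_zero by blast
      ultimately have "open_variation X \<mu> (W \<inter> U) + outer_variation X \<mu> (A - U) \<le> open_variation X \<mu> W"
        unfolding open_variation_def[of X \<mu> "W \<inter> U"]
        by (subst ennreal_SUP_add_left[symmetric]) (auto intro!: SUP_least)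
      moreover have "outer_variation X \<mu> (A \<inter> U) \<le> outer_variation X \<mu> (W \<inter> U)"
        using W by (intro outer_variation_mono) auto
      moreover have "outer_variation X \<mu> (W \<inter> U) = open_variation X \<mu> (W \<inter> U)"
        using W U by (intro outer_variation_open) auto
      ultimately show "outer_variation X \<mu> (A \<inter> U) + outer_variation X \<mu> (A - U) \<le> open_variation X \<mu> W"
        by (metis add_right_mono order_trans)
    qed
    have "subadditive (Pow (topspace X)) (outer_variation X \<mu>)"
      using outer_measure_space_variation unfolding outer_measure_space_def
      by (intro countably_subadditive_subadditive) auto
    then have "outer_variation X \<mu> ((A \<inter> U) \<union> (A - U)) \<le> outer_variation X \<mu> (A \<inter> U) + outer_variation X \<mu> (A - U)"
      by (rule subadditiveD) (use A in auto)
    then show "outer_variation X \<mu> A \<le> outer_variation X \<mu> (A \<inter> U) + outer_variation X \<mu> (A - U)"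
      by (simp add: Int_Diff_Un)
  qed
  then show ?thesis
    using openin_subset[OF U] by (auto simp: lambda_system_eq)
qed

lemma measure_space_variation:
  "measure_space (topspace X) (sigma_sets (topspace X) {U. openin X U}) (outer_variation X \<mu>)"
proof -
  interpret sigma_algebra "topspace X" "Pow (topspace X)" by (rule sigma_algebra_Pow)
  have ms: "measure_space (topspace X) (lambda_system (topspace X) (Pow (topspace X)) (outer_variation X \<mu>)) (outer_variation X \<mu>)"
    by (rule caratheodory_lemma[OF outer_measure_space_variation])
  then interpret L: sigma_algebra "topspace X" "lambda_system (topspace X) (Pow (topspace X)) (outer_variation X \<mu>)"
    by (simp add: measure_space_def)
  have "sigma_sets (topspace X) {U. openin X U} \<subseteq> lambda_system (topspace X) (Pow (topspace X)) (outer_variation X \<mu>)"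
    by (rule L.sigma_sets_subset) (use openin_lambda_system in auto)
  then show ?thesis
    by (rule measure_down[OF ms sigma_algebra_sigma_sets, rotated]) (auto dest: openin_subset)
qed

lemma sets_variation_measure: "sets (variation_measure X \<mu>) = sigma_sets (topspace X) {U. openin X U}"
  and space_variation_measure: "space (variation_measure X \<mu>) = topspace X"
proof -
  have "{U. openin X U} \<subseteq> Pow (topspace X)" by (auto dest: openin_subset)
  from sigma_sets_into_sp[OF this] have *: "sigma_sets (topspace X) {U. openin X U} \<subseteq> Pow (topspace X)" by auto
  show "space (variation_measure X \<mu>) = topspace X"
    unfolding variation_measure_def using * by (rule space_measure_of)
  have "sets (variation_measure X \<mu>) = sigma_sets (topspace X) (sigma_sets (topspace X) {U. openin X U})"
    unfolding variation_measure_def using * by (rule sets_measure_of)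
  then show "sets (variation_measure X \<mu>) = sigma_sets (topspace X) {U. openin X U}"
    using \<open>{U. openin X U} \<subseteq> Pow (topspace X)\<close> by (simp add: sigma_sets_sigma_sets_eq)
qed

lemma emeasure_variation_measure:
  assumes "A \<in> sigma_sets (topspace X) {U. openin X U}"
  shows "emeasure (variation_measure X \<mu>) A = outer_variation X \<mu> A"
  using measure_space_variation assms unfolding variation_measure_def measure_space_def
  by (intro emeasure_measure_of_sigma) auto

lemma emeasure_variation_open:
  assumes "openin X U"
  shows "emeasure (variation_measure X \<mu>) U = open_variation X \<mu> U"
  using assms by (simp add: emeasure_variation_measure outer_variation_open sigma_sets.Basic)

lemma continuous_measurable_variation:
  assumes "continuous_map X euclidean (g :: 'a \<Rightarrow> 'b::topological_space)"
  shows "g \<in> borel_measurable (variation_measure X \<mu>)"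
proof (rule borel_measurableI)
  fix S :: "'b set" assume "open S"
  then have "openin X {x \<in> topspace X. g x \<in> S}"
    using assms by (auto simp: continuous_map_def)
  moreover have "g -` S \<inter> space (variation_measure X \<mu>) = {x \<in> topspace X. g x \<in> S}"
    by (auto simp: space_variation_measure)
  ultimately show "g -` S \<inter> space (variation_measure X \<mu>) \<in> sets (variation_measure X \<mu>)"
    by (simp add: sets_variation_measure sigma_sets.Basic)
qed

text \<open>Cut \<open>\<phi>\<close> radially into layers of thickness \<open>\<epsilon>\<close>. The layer between heights \<open>j * \<epsilon>\<close> and
  \<open>(j + 1) * \<epsilon>\<close> is at most \<open>\<epsilon>\<close> and supported in the open set where \<open>\<phi>\<close> exceeds
  \<open>(j - 1) * \<epsilon>\<close>.\<close>

lemma norm_le_integral_aux: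
  assumes \<phi>: "\<phi> \<in> Cc_on X" and U: "openin X U" "support_in X \<phi> \<subseteq> U" and \<epsilon>: "\<epsilon> > 0"
  shows "ennreal (cmod (\<mu> \<phi>)) \<le>
    (\<integral>\<^sup>+x. ennreal (cmod (\<phi> x)) \<partial>variation_measure X \<mu>) + 2 * ennreal \<epsilon> * open_variation X \<mu> U"
proof -
  let ?M = "variation_measure X \<mu>"
  have cont: "continuous_map X euclidean \<phi>" using \<phi> by (simp add: Cc_on_def)
  obtain B where B: "B > 0" "\<And>x. x \<in> topspace X \<Longrightarrow> cmod (\<phi> x) \<le> B" using Cc_on_bounded[OF \<phi>] by blast
  obtain N :: nat where "B / \<epsilon> < real N"
    using reals_Archimedean2 by blast
  then have N: "B \<le> real N * \<epsilon>"
    using \<epsilon> by (simp add: divide_less_eq)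
  \<comment> \<open>\<open>T a\<close> is the radial retraction onto the closed disc of radius
    \<open>a\<close>.\<close>
  define T where "T a z = (if a = 0 then 0 else z * of_real (a / max a (cmod z)))" for a and z :: complex
  have T_small: "T a z = z" if "0 \<le> a" "cmod z \<le> a" for a z
    using that by (auto simp: T_def max_def)
  have T_large: "T a z = of_real a * sgn z" if "0 \<le> a" "a \<le> cmod z" for a z
    using that by (auto simp: T_def max_def sgn_eq)
  have T_cont: "continuous_on UNIV (T a)" if "a > 0" for a
  proof -
    have "max a (cmod z) > 0" for z :: complex using that by (simp add: less_max_iff_disj)
    then have "max a (cmod z) \<noteq> 0" for z :: complex by (metis less_irrefl)
    then have "continuous_on UNIV (\<lambda>z. z * of_real (a / max a (cmod z)) :: complex)"
      by (intro continuous_intros) auto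
    then show ?thesis using that by (simp add: T_def[abs_def])
  qed
  define layer where "layer j x = T (real (Suc j) * \<epsilon>) (\<phi> x) - T (real j * \<epsilon>) (\<phi> x)" for j x
  define E where "E j = {x \<in> topspace X. cmod (\<phi> x) > real j * \<epsilon>}" for j :: nat
  have E_open: "openin X (E j)" for j
  proof -
    have "continuous_map X euclideanreal (\<lambda>x. cmod (\<phi> x))"
      by (intro continuous_map_compose_UNIV[OF cont, where g = cmod] continuous_intros)
    then have "openin X {x \<in> topspace X. cmod (\<phi> x) \<in> {real j * \<epsilon><..}}"
      by (rule openin_continuous_map_preimage) simp
    then show ?thesis by (simp add: E_def)
  qed
  have layer_cont: "continuous_map X euclidean (layer j)" for j
  proof (cases j)
    case 0
    then show ?thesis unfolding layer_def using \<epsilon>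
      by (auto simp: T_def[of 0] intro!: continuous_map_compose_UNIV[OF cont] T_cont)
  next
    case (Suc i)
    then have "continuous_map X euclidean (\<lambda>x. T (real (Suc j) * \<epsilon>) (\<phi> x) - T (real j * \<epsilon>) (\<phi> x))"
      using \<epsilon> by (intro continuous_map_compose_UNIV[OF cont, of "\<lambda>z. T (real (Suc j) * \<epsilon>) z - T (real j * \<epsilon>) z"]
          continuous_on_diff T_cont) auto
    then show ?thesis by (simp add: layer_def[abs_def])
  qed
  have layer_zero: "layer j x = 0" if "cmod (\<phi> x) \<le> real j * \<epsilon>" for j x
    using that \<epsilon> T_small[of "real j * \<epsilon>" "\<phi> x"] T_small[of "real (Suc j) * \<epsilon>" "\<phi> x"]
    by (auto simp: layer_def algebra_simps)
  have layer_le: "cmod (layer j x) \<le> \<epsilon>" for j x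
  proof (cases "cmod (\<phi> x) \<le> real j * \<epsilon>")
    case True
    then show ?thesis using layer_zero \<epsilon> by simp
  next
    case False
    then have low: "T (real j * \<epsilon>) (\<phi> x) = of_real (real j * \<epsilon>) * sgn (\<phi> x)"
      using \<epsilon> by (intro T_large) auto
    have nz: "\<phi> x \<noteq> 0" using False \<epsilon> by auto
    obtain c where c: "T (real (Suc j) * \<epsilon>) (\<phi> x) = of_real c * sgn (\<phi> x)" "real j * \<epsilon> \<le> c" "c \<le> real (Suc j) * \<epsilon>"
    proof (cases "cmod (\<phi> x) \<le> real (Suc j) * \<epsilon>")
      case True
      have "T (real (Suc j) * \<epsilon>) (\<phi> x) = \<phi> x" by (rule T_small) (use True \<epsilon> in auto)
      also have "\<dots> = of_real (cmod (\<phi> x)) * sgn (\<phi> x)" using nz by (simp add: sgn_eq)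
      finally show ?thesis using that[of "cmod (\<phi> x)"] True False by auto
    next
      case large: False
      have "T (real (Suc j) * \<epsilon>) (\<phi> x) = of_real (real (Suc j) * \<epsilon>) * sgn (\<phi> x)"
        by (rule T_large) (use large \<epsilon> in auto)
      then show ?thesis using that[of "real (Suc j) * \<epsilon>"] \<epsilon> by (simp add: algebra_simps)
    qed
    have "layer j x = of_real (c - real j * \<epsilon>) * sgn (\<phi> x)"
      unfolding layer_def c(1) low by (simp only: of_real_diff left_diff_distrib)
    then have "cmod (layer j x) = c - real j * \<epsilon>"
      using c(2) nz by (simp add: norm_mult norm_sgn del: of_real_diff)
    then show ?thesis using c(3) by (simp add: algebra_simps)
  qed
  have layer_Cc: "layer j \<in> Cc_on X" "support_in X (layer j) \<subseteq> U" for j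
  proof -
    have z: "layer j x = 0" if "x \<in> topspace X" "\<phi> x = 0" for x
      using layer_zero[of x j] that \<epsilon> by simp
    show "layer j \<in> Cc_on X" "support_in X (layer j) \<subseteq> U"
      using Cc_on_dominated[OF haus \<phi> layer_cont z] U(2) by auto
  qed
  have supp_E: "support_in X (layer (Suc j)) \<subseteq> E j" for j
  proof -
    have cl: "closedin X {x \<in> topspace X. cmod (\<phi> x) \<in> {real (Suc j) * \<epsilon>..}}"
      by (rule closedin_continuous_map_preimage[OF continuous_map_compose_UNIV[OF cont, where g = cmod]])
        (auto intro: continuous_intros)
    have "support_in X (layer (Suc j)) \<subseteq> {x \<in> topspace X. cmod (\<phi> x) \<in> {real (Suc j) * \<epsilon>..}}"
      unfolding support_in_def using layer_zero[of _ "Suc j"] by (intro closure_of_minimal[OF _ cl]) force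
    also have "\<dots> \<subseteq> E j"
      using \<epsilon> by (auto simp: E_def algebra_simps)
    finally show ?thesis .
  qed
  have "\<phi> x = (\<Sum>j<N. layer j x)" if "x \<in> topspace X" for x
  proof -
    have "(\<Sum>j<n. layer j x) = T (real n * \<epsilon>) (\<phi> x)" for n
      unfolding layer_def by (induction n) (auto simp: T_def)
    moreover have "T (real N * \<epsilon>) (\<phi> x) = \<phi> x"
      using B(2)[OF that] N \<epsilon> by (intro T_small) auto
    ultimately show ?thesis by simp
  qed
  moreover have sumCc: "(\<lambda>x. \<Sum>j<N. layer j x) \<in> Cc_on X" "\<mu> (\<lambda>x. \<Sum>j<N. layer j x) = (\<Sum>j<N. \<mu> (layer j))"
    using sum[of "{..<N}" layer] layer_Cc by auto
  moreover have neg: "(\<lambda>x. (- 1) * (\<Sum>j<N. layer j x)) \<in> Cc_on X"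
    by (rule Cc_on_cmult(1)[OF haus sumCc(1)])
  ultimately have "\<mu> (\<lambda>x. \<phi> x + (- 1) * (\<Sum>j<N. layer j x)) = 0"
    by (intro zero_on_space Cc_on_add haus \<phi>) auto
  moreover have "\<mu> (\<lambda>x. \<phi> x + (- 1) * (\<Sum>j<N. layer j x)) = \<mu> \<phi> + (- 1) * \<mu> (\<lambda>x. \<Sum>j<N. layer j x)"
    unfolding add[OF \<phi> neg] scale[OF sumCc(1)] ..
  ultimately have \<mu>_eq: "\<mu> \<phi> = (\<Sum>j<N. \<mu> (layer j))"
    using sumCc by simp
  have "ennreal (cmod (\<mu> \<phi>)) \<le> (\<Sum>j<N. ennreal (cmod (\<mu> (layer j))))"
    unfolding \<mu>_eq by (subst sum_ennreal) (auto intro!: ennreal_leI norm_sum)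
  \<comment> \<open>One more layer is added so that layer 0 can be split off and the others indexed
    by \<open>Suc j\<close>, with supports in \<open>E j\<close>. For layer 0 only the support
    condition in \<open>U\<close> is at hand; it costs one term with factor \<epsilon>.\<close>
  also have "\<dots> \<le> (\<Sum>j<Suc N. ennreal (cmod (\<mu> (layer j))))"
    by (rule sum_mono2) auto
  also have "\<dots> = ennreal (cmod (\<mu> (layer 0))) + (\<Sum>j<N. ennreal (cmod (\<mu> (layer (Suc j)))))"
    by (rule sum.lessThan_Suc_shift)
  also have "\<dots> \<le> ennreal \<epsilon> * open_variation X \<mu> U + (\<Sum>j<N. ennreal \<epsilon> * open_variation X \<mu> (E j))"
    by (intro add_mono sum_mono scaled_test_le_variation layer_Cc supp_E layer_le \<epsilon>)
  also have "(\<Sum>j<N. ennreal \<epsilon> * open_variation X \<mu> (E j)) = (\<integral>\<^sup>+x. (\<Sum>j<N. ennreal \<epsilon> * indicator (E j) x) \<partial>?M)"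
  proof -
    have meas: "E j \<in> sets ?M" for j
      using E_open by (simp add: sets_variation_measure sigma_sets.Basic)
    then have "(\<integral>\<^sup>+x. (\<Sum>j<N. ennreal \<epsilon> * indicator (E j) x) \<partial>?M) = (\<Sum>j<N. \<integral>\<^sup>+x. ennreal \<epsilon> * indicator (E j) x \<partial>?M)"
      by (intro nn_integral_sum) auto
    then show ?thesis using meas
      by (simp add: nn_integral_cmult_indicator emeasure_variation_open E_open)
  qed
  also have "\<dots> \<le> (\<integral>\<^sup>+x. ennreal (cmod (\<phi> x)) + ennreal \<epsilon> * indicator U x \<partial>?M)"
  proof (rule nn_integral_mono)
    fix x assume "x \<in> space ?M"
    then have x: "x \<in> topspace X" by (simp add: space_variation_measure)
    \<comment> \<open>At \<open>x\<close> the sum counts the levels below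
      \<open>cmod (\<phi> x)\<close>. If \<open>m\<close> is the largest of them there are at most
      \<open>m + 1\<close>, and \<open>m * \<epsilon>\<close> is less than
      \<open>cmod (\<phi> x)\<close>; the surplus \<epsilon> occurs only where \<phi> is nonzero,
      hence only in \<open>U\<close>.\<close>
    define J where "J = {j\<in>{..<N}. x \<in> E j}"
    have "(\<Sum>j<N. ennreal \<epsilon> * indicator (E j) x) = (\<Sum>j<N. if x \<in> E j then ennreal \<epsilon> else 0)"
      by (intro sum.cong) (auto simp: indicator_def)
    also have "\<dots> = (\<Sum>j\<in>J. ennreal \<epsilon>)"
      unfolding J_def by (rule sum.inter_filter[symmetric]) simp
    also have "\<dots> = ennreal (real (card J) * \<epsilon>)"
      using \<epsilon> by (simp add: ennreal_mult ennreal_of_nat_eq_real_of_nat)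
    finally have eq: "(\<Sum>j<N. ennreal \<epsilon> * indicator (E j) x) = ennreal (real (card J) * \<epsilon>)" .
    show "(\<Sum>j<N. ennreal \<epsilon> * indicator (E j) x) \<le> ennreal (cmod (\<phi> x)) + ennreal \<epsilon> * indicator U x"
    proof (cases "J = {}")
      case True
      then show ?thesis unfolding eq by simp
    next
      case False
      define m where "m = Max J"
      have fin: "finite J" by (simp add: J_def)
      have "m \<in> J" unfolding m_def using fin False by (rule Max_in)
      then have m: "real m * \<epsilon> < cmod (\<phi> x)" by (simp add: J_def E_def)
      have "J \<subseteq> {..m}" using fin by (auto simp: m_def)
      then have "card J \<le> Suc m" using card_mono[of "{..m}" J] by simp
      then have "real (card J) * \<epsilon> \<le> real (Suc m) * \<epsilon>" using \<epsilon> by (intro mult_right_mono) auto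
      also have "\<dots> \<le> cmod (\<phi> x) + \<epsilon>" using m by (simp add: algebra_simps)
      finally have "ennreal (real (card J) * \<epsilon>) \<le> ennreal (cmod (\<phi> x)) + ennreal \<epsilon>"
        using \<epsilon> by (simp flip: ennreal_plus)
      moreover have "x \<in> U"
      proof -
        have "0 \<le> real m * \<epsilon>" using \<epsilon> by simp
        then have "\<phi> x \<noteq> 0" using m by auto
        then show ?thesis using zero_outside_support[OF x, of \<phi>] U(2) by blast
      qed
      ultimately show ?thesis unfolding eq by simp
    qed
  qed
  also have "\<dots> = (\<integral>\<^sup>+x. ennreal (cmod (\<phi> x)) \<partial>?M) + ennreal \<epsilon> * open_variation X \<mu> U"
  proof -
    have [measurable]: "\<phi> \<in> borel_measurable ?M" "U \<in> sets ?M"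
      using continuous_measurable_variation[OF cont] U(1) by (simp_all add: sets_variation_measure sigma_sets.Basic)
    show ?thesis
      using U(1) by (subst nn_integral_add) (auto simp: nn_integral_cmult_indicator emeasure_variation_open)
  qed
  finally show ?thesis
    by (simp add: algebra_simps mult_2)
qed

text \<open>Choosing \<open>U\<close> inside a compact set makes its variation finite, so the error
  in \<open>norm_le_integral_aux\<close> vanishes with \<epsilon>. The result is continuity of the
  functional in the mean of order one.\<close>

theorem norm_le_integral:
  assumes \<phi>: "\<phi> \<in> Cc_on X"
  shows "ennreal (cmod (\<mu> \<phi>)) \<le> (\<integral>\<^sup>+x. ennreal (cmod (\<phi> x)) \<partial>variation_measure X \<mu>)"
proof (rule ennreal_le_epsilon)
  fix e :: real assume e: "e > 0"
  have K: "compactin X (support_in X \<phi>)" using \<phi> by (simp add: Cc_on_def)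
  obtain U C where U: "openin X U" "compactin X C" "support_in X \<phi> \<subseteq> U" "U \<subseteq> C"
    using compact_open_sandwich[OF lc haus K openin_topspace support_in_subset] by metis
  have "open_variation X \<mu> U \<noteq> Orderings.top"
    using open_variation_finite[OF U(2,4)] by auto
  then obtain v where v: "v \<ge> 0" "open_variation X \<mu> U = ennreal v"
    by (cases "open_variation X \<mu> U") auto
  define \<epsilon> where "\<epsilon> = e / (2 * (v + 1))"
  have \<epsilon>: "\<epsilon> > 0" using e v by (simp add: \<epsilon>_def)
  have "2 * \<epsilon> * v \<le> 2 * \<epsilon> * (v + 1)" using \<epsilon> by simp
  also have "\<dots> = \<epsilon> * (2 * (v + 1))" by simp
  also have "\<dots> = e" using nonzero_eq_divide_eq[of "2 * (v + 1)" \<epsilon> e] v by (simp add: \<epsilon>_def)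
  finally have "2 * ennreal \<epsilon> * open_variation X \<mu> U \<le> ennreal e"
    using \<epsilon> v by (auto simp: v(2) simp flip: ennreal_mult ennreal_numeral intro!: ennreal_leI)
  then show "ennreal (cmod (\<mu> \<phi>)) \<le> (\<integral>\<^sup>+x. ennreal (cmod (\<phi> x)) \<partial>variation_measure X \<mu>) + ennreal e"
    using norm_le_integral_aux[OF \<phi> U(1,3) \<epsilon>] by (meson add_left_mono order_trans)
qed

end

section \<open>Means of almost periodic functions\<close>

text \<open>Almost periodicity is total boundedness of the set of translates. It is encoded by finite
  colourings \<open>\<kappa>\<close> of the discrete group for which equally coloured elements give uniformly close
  translates; functions sharing a colouring are then treated uniformly.\<close>

definition equi_translates :: "real \<Rightarrow> ('g \<Rightarrow> nat) \<Rightarrow> ('g::ab_group_add \<Rightarrow> complex) \<Rightarrow> bool"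
  where "equi_translates \<epsilon> \<kappa> u \<longleftrightarrow> (\<forall>s t. \<kappa> s = \<kappa> t \<longrightarrow> (\<forall>r. cmod (u (r + s) - u (r + t)) \<le> \<epsilon>))"

definition almost_periodic :: "('g::ab_group_add \<Rightarrow> complex) \<Rightarrow> bool"
  where "almost_periodic u \<longleftrightarrow> (\<forall>\<epsilon>>0. \<exists>\<kappa>. finite (range \<kappa>) \<and> equi_translates \<epsilon> \<kappa> u)"

text \<open>Lists rather than sets: composing two averages gives the average over the list of all
  sums, in which repetitions must count (\<open>trans_avg_trans_avg\<close>).\<close>

definition trans_avg :: "'g list \<Rightarrow> ('g::ab_group_add \<Rightarrow> complex) \<Rightarrow> 'g \<Rightarrow> complex"
  where "trans_avg ts u x = (\<Sum>t\<leftarrow>ts. u (x + t)) / of_nat (length ts)"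

text \<open>Von Neumann's mean: the constant that is a uniform limit of finite averages of
  translates of \<open>u\<close>.\<close>

definition mean :: "('g::ab_group_add \<Rightarrow> complex) \<Rightarrow> complex"
  where "mean u = (THE c. \<forall>\<epsilon>>0. \<exists>ts. ts \<noteq> [] \<and> (\<forall>x. cmod (trans_avg ts u x - c) \<le> \<epsilon>))"

section \<open>Finite averages of translates\<close>

lemma equi_translatesD:
  "equi_translates \<epsilon> \<kappa> u \<Longrightarrow> \<kappa> s = \<kappa> t \<Longrightarrow> cmod (u (r + s) - u (r + t)) \<le> \<epsilon>"
  by (simp add: equi_translates_def)

lemma almost_periodicD:
  assumes "almost_periodic u" "\<epsilon> > 0"
  obtains \<kappa> where "finite (range \<kappa>)" "equi_translates \<epsilon> \<kappa> u"
  using assms unfolding almost_periodic_def by blast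

lemma sum_list_cmod_le:
  "(\<And>t. t \<in> set ts \<Longrightarrow> cmod (f t) \<le> \<epsilon>) \<Longrightarrow> cmod (\<Sum>t\<leftarrow>ts. f t) \<le> real (length ts) * \<epsilon>"
proof (induction ts)
  case (Cons a ts)
  have "cmod (f a + (\<Sum>t\<leftarrow>ts. f t)) \<le> cmod (f a) + cmod (\<Sum>t\<leftarrow>ts. f t)"
    by (rule norm_triangle_ineq)
  also have "\<dots> \<le> \<epsilon> + real (length ts) * \<epsilon>"
    using Cons by (intro add_mono) auto
  finally show ?case by (simp add: algebra_simps)
qed simp

lemma sum_list_swap:
  fixes f :: "'a \<Rightarrow> 'b \<Rightarrow> complex"
  shows "(\<Sum>t\<leftarrow>ts. \<Sum>s\<leftarrow>ss. f t s) = (\<Sum>s\<leftarrow>ss. \<Sum>t\<leftarrow>ts. f t s)"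
  by (induction ts) (simp_all add: sum_list_addf)

lemma sum_list_divide:
  fixes f :: "'a \<Rightarrow> complex"
  shows "(\<Sum>t\<leftarrow>ts. f t / c) = (\<Sum>t\<leftarrow>ts. f t) / c"
  by (induction ts) (simp_all add: add_divide_distrib)

lemma trans_avg_const [simp]: "ts \<noteq> [] \<Longrightarrow> trans_avg ts (\<lambda>x. c) y = c"
  by (simp add: trans_avg_def sum_list_triv)

lemma trans_avg_add: "trans_avg ts (\<lambda>x. u x + v x) y = trans_avg ts u y + trans_avg ts v y"
  by (simp add: trans_avg_def sum_list_addf add_divide_distrib)

lemma trans_avg_diff: "trans_avg ts (\<lambda>x. u x - v x) y = trans_avg ts u y - trans_avg ts v y"
  by (simp add: trans_avg_def sum_list_subtractf diff_divide_distrib)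

lemma trans_avg_cmult: "trans_avg ts (\<lambda>x. c * u x) y = c * trans_avg ts u y"
  by (simp add: trans_avg_def sum_list_const_mult)

lemma trans_avg_cnj: "trans_avg ts (\<lambda>x. cnj (u x)) y = cnj (trans_avg ts u y)"
proof -
  have "(\<Sum>t\<leftarrow>ts. cnj (u (y + t))) = cnj (\<Sum>t\<leftarrow>ts. u (y + t))"
    by (induction ts) auto
  then show ?thesis by (simp add: trans_avg_def)
qed

lemma trans_avg_shift: "trans_avg ts (\<lambda>x. u (x + s)) y = trans_avg ts u (y + s)"
  by (simp add: trans_avg_def ac_simps)

lemma trans_avg_minus: "trans_avg ts (\<lambda>x. u (- x)) y = trans_avg (map uminus ts) u (- y)"
  by (simp add: trans_avg_def o_def add.commute)

lemma trans_avg_commute: "trans_avg ts (trans_avg ss u) = trans_avg ss (trans_avg ts u)"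
proof
  fix x
  have "(\<Sum>t\<leftarrow>ts. \<Sum>s\<leftarrow>ss. u (x + t + s)) = (\<Sum>s\<leftarrow>ss. \<Sum>t\<leftarrow>ts. u (x + s + t))"
    by (subst sum_list_swap) (simp add: ac_simps)
  then show "trans_avg ts (trans_avg ss u) x = trans_avg ss (trans_avg ts u) x"
    by (simp add: trans_avg_def sum_list_divide)
qed

lemma trans_avg_le:
  assumes "ts \<noteq> []" "\<And>x. cmod (u x) \<le> \<epsilon>"
  shows "cmod (trans_avg ts u x) \<le> \<epsilon>"
proof -
  have "cmod (\<Sum>t\<leftarrow>ts. u (x + t)) \<le> real (length ts) * \<epsilon>"
    using assms by (intro sum_list_cmod_le) auto
  then show ?thesis
    using assms(1) by (simp add: trans_avg_def norm_divide divide_le_eq mult.commute)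
qed

lemma trans_avg_close:
  assumes "ts \<noteq> []" "\<And>x. cmod (u x - v x) \<le> \<epsilon>"
  shows "cmod (trans_avg ts u x - trans_avg ts v x) \<le> \<epsilon>"
  using trans_avg_le[OF assms(1), of "\<lambda>x. u x - v x"] assms(2) by (simp add: trans_avg_diff)

lemma trans_avg_close_const:
  assumes "ts \<noteq> []" "\<And>x. cmod (u x - c) \<le> \<epsilon>"
  shows "cmod (trans_avg ts u x - c) \<le> \<epsilon>"
  using trans_avg_close[OF assms(1), of u "\<lambda>_. c"] assms by simp

lemma trans_avg_trans_avg:
  "trans_avg ts (trans_avg ss u) = trans_avg (concat (map (\<lambda>t. map (\<lambda>s. t + s) ss) ts)) u"
proof
  fix x
  have "(\<Sum>p\<leftarrow>concat (map (\<lambda>t. map (\<lambda>s. t + s) ss) ts). u (x + p)) = (\<Sum>t\<leftarrow>ts. \<Sum>s\<leftarrow>ss. u (x + t + s))"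
    by (induction ts) (simp_all add: o_def add.assoc)
  moreover have "length (concat (map (\<lambda>t. map (\<lambda>s. t + s) ss) ts)) = length ts * length ss"
    by (induction ts) auto
  ultimately show "trans_avg ts (trans_avg ss u) x = trans_avg (concat (map (\<lambda>t. map (\<lambda>s. t + s) ss) ts)) u x"
    by (simp add: trans_avg_def sum_list_divide mult.commute)
qed

lemma equi_translates_trans_avg:
  assumes "ts \<noteq> []" "equi_translates \<epsilon> \<kappa> u"
  shows "equi_translates \<epsilon> \<kappa> (trans_avg ts u)"
  unfolding equi_translates_def
proof (intro allI impI)
  fix s t r assume st: "\<kappa> s = \<kappa> t"
  have "cmod (trans_avg ts (\<lambda>r. u (r + s)) r - trans_avg ts (\<lambda>r. u (r + t)) r) \<le> \<epsilon>"
    using equi_translatesD[OF assms(2) st] by (intro trans_avg_close assms)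
  then show "cmod (trans_avg ts u (r + s) - trans_avg ts u (r + t)) \<le> \<epsilon>"
    by (simp add: trans_avg_shift)
qed

text \<open>In the averages at \<open>x\<close> and \<open>y\<close> one pair of terms can be
  matched: some \<open>t1\<close> in the list has the colour of \<open>y + t0 - x\<close>, so
  \<open>u (x + t1)\<close> and \<open>u (y + t0)\<close> differ by at most \<epsilon>. The
  remaining terms are paired by an arbitrary bijection and differ by at most \<open>d\<close> each.
  Averaging thus shrinks the oscillation by a factor close to
  \<open>1 - 1 / length ts\<close>.\<close>

lemma trans_avg_contract:
  assumes ts: "distinct ts" "ts \<noteq> []"
    and net: "\<And>s. \<exists>t\<in>set ts. \<kappa> s = \<kappa> t"
    and u: "equi_translates \<epsilon> \<kappa> u" "\<And>x y. cmod (u x - u y) \<le> d"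
  shows "cmod (trans_avg ts u x - trans_avg ts u y) \<le> ((real (length ts) - 1) * d + \<epsilon>) / real (length ts)"
proof -
  define T where "T = set ts"
  define t0 where "t0 = hd ts"
  have T: "finite T" "t0 \<in> T" "card T = length ts"
    using ts by (auto simp: T_def t0_def distinct_card)
  obtain t1 where t1: "t1 \<in> T" "\<kappa> (y + t0 - x) = \<kappa> t1"
    using net unfolding T_def by blast
  have close: "cmod (u (x + t1) - u (y + t0)) \<le> \<epsilon>"
    using equi_translatesD[OF u(1) t1(2), of x] by (simp add: norm_minus_commute)
  have "card (T - {t0}) = card (T - {t1})"
    using T t1 by simp
  then obtain f where f: "bij_betw f (T - {t0}) (T - {t1})"
    using finite_same_card_bij[of "T - {t0}" "T - {t1}"] T(1) by auto
  have avg: "(\<Sum>t\<leftarrow>ts. u (z + t)) = (\<Sum>t\<in>T. u (z + t))" for z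
    using ts(1) by (simp add: T_def sum_list_distinct_conv_sum_set)
  have "(\<Sum>t\<in>T. u (x + t)) = u (x + t1) + (\<Sum>t\<in>T - {t1}. u (x + t))"
    by (rule sum.remove) (use T t1 in auto)
  also have "(\<Sum>t\<in>T - {t1}. u (x + t)) = (\<Sum>t\<in>T - {t0}. u (x + f t))"
    using sum.reindex_bij_betw[OF f, of "\<lambda>t. u (x + t)"] by simp
  finally have "(\<Sum>t\<in>T. u (x + t)) - (\<Sum>t\<in>T. u (y + t)) =
      (u (x + t1) - u (y + t0)) + (\<Sum>t\<in>T - {t0}. u (x + f t) - u (y + t))"
    using sum.remove[OF T(1,2), of "\<lambda>t. u (y + t)"] by (simp add: sum_subtractf)
  also have "cmod \<dots> \<le> \<epsilon> + (\<Sum>t\<in>T - {t0}. d)"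
    by (intro norm_triangle_le add_mono close sum_norm_le u(2))
  also have "\<dots> = (real (length ts) - 1) * d + \<epsilon>"
  proof -
    have "real (card (T - {t0})) = real (length ts) - 1"
      using T ts(2) by (cases ts) auto
    then show ?thesis by simp
  qed
  finally have le: "cmod ((\<Sum>t\<in>T. u (x + t)) - (\<Sum>t\<in>T. u (y + t))) \<le> (real (length ts) - 1) * d + \<epsilon>" .
  have eq: "trans_avg ts u x - trans_avg ts u y
      = ((\<Sum>t\<in>T. u (x + t)) - (\<Sum>t\<in>T. u (y + t))) / of_nat (length ts)"
    by (simp add: trans_avg_def avg diff_divide_distrib)
  show ?thesis
    unfolding eq norm_divide norm_of_nat by (rule divide_right_mono[OF le]) simp
qed

lemma finite_representatives:
  fixes \<kappa> :: "'g \<Rightarrow> nat"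
  assumes "finite (range \<kappa>)"
  obtains ts where "distinct ts" "ts \<noteq> []" "\<And>s. \<exists>t\<in>set ts. \<kappa> s = \<kappa> t"
proof -
  have "finite ((\<lambda>c. SOME s. \<kappa> s = c) ` range \<kappa>)"
    using assms by simp
  from finite_distinct_list[OF this] obtain ts where ts: "distinct ts" "set ts = (\<lambda>c. SOME s. \<kappa> s = c) ` range \<kappa>"
    by auto
  have "\<exists>t\<in>set ts. \<kappa> s = \<kappa> t" for s
  proof
    show "(SOME t. \<kappa> t = \<kappa> s) \<in> set ts" using ts(2) by blast
    show "\<kappa> s = \<kappa> (SOME t. \<kappa> t = \<kappa> s)" by (metis (mono_tags) someI)
  qed
  then show ?thesis
    using that[OF ts(1)] by fastforce
qed

text \<open>The averaging list depends on the colouring and on a bound for the oscillation only; this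
  uniformity is what makes iterated means commute.\<close>

lemma uniform_trans_avg:
  assumes fin: "finite (range \<kappa>)" and \<epsilon>: "\<epsilon> > 0"
  obtains ts where "ts \<noteq> []"
    "\<And>u x y. equi_translates \<epsilon> \<kappa> u \<Longrightarrow> (\<And>x y. cmod (u x - u y) \<le> d) \<Longrightarrow>
      cmod (trans_avg ts u x - trans_avg ts u y) \<le> 2 * \<epsilon>"
proof -
  obtain ts0 where ts0: "distinct ts0" "ts0 \<noteq> []" "\<And>s. \<exists>t\<in>set ts0. \<kappa> s = \<kappa> t"
    using finite_representatives[OF fin] by metis
  define n where "n = real (length ts0)"
  define q where "q = 1 - 1 / n"
  have n: "n \<ge> 1" using ts0(2) by (simp add: n_def Suc_le_eq)
  \<comment> \<open>Contraction by one round of averaging sends an oscillation bound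
    \<open>\<epsilon> + \<delta>\<close> to \<open>\<epsilon> + q * \<delta>\<close>; the excess
    over \<epsilon> therefore decays geometrically.\<close>
  have step: "\<exists>ts. ts \<noteq> [] \<and> (\<forall>u x y. equi_translates \<epsilon> \<kappa> u \<longrightarrow> (\<forall>x y. cmod (u x - u y) \<le> d) \<longrightarrow>
      cmod (trans_avg ts u x - trans_avg ts u y) \<le> \<epsilon> + q ^ N * d)" for N
  proof (induction N)
    case 0
    show ?case
      using \<epsilon> by (intro exI[of _ "[0]"]) (auto simp: trans_avg_def intro: add_increasing)
  next
    case (Suc N)
    then obtain ts where ts: "ts \<noteq> []"
      "\<And>u x y. equi_translates \<epsilon> \<kappa> u \<Longrightarrow> \<forall>x y. cmod (u x - u y) \<le> d \<Longrightarrow>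
        cmod (trans_avg ts u x - trans_avg ts u y) \<le> \<epsilon> + q ^ N * d"
      by blast
    define ts' where "ts' = concat (map (\<lambda>t. map (\<lambda>s. t + s) ts) ts0)"
    have ne: "ts' \<noteq> []"
      using ts(1) ts0(2) by (cases ts0; cases ts) (auto simp: ts'_def)
    have "cmod (trans_avg ts' u x - trans_avg ts' u y) \<le> \<epsilon> + q ^ Suc N * d"
      if u: "equi_translates \<epsilon> \<kappa> u" "\<forall>x y. cmod (u x - u y) \<le> d" for u x y
    proof -
      have "cmod (trans_avg ts0 (trans_avg ts u) x - trans_avg ts0 (trans_avg ts u) y)
          \<le> ((n - 1) * (\<epsilon> + q ^ N * d) + \<epsilon>) / n"
        unfolding n_def
        by (intro trans_avg_contract[OF ts0] equi_translates_trans_avg ts u)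
      also have "\<dots> = \<epsilon> + q ^ Suc N * d"
        using n by (simp add: q_def field_simps)
      finally show ?thesis
        by (simp add: ts'_def trans_avg_trans_avg)
    qed
    with ne show ?case by blast
  qed
  have "0 \<le> q" "q < 1" using n by (auto simp: q_def)
  then have "(\<lambda>N. q ^ N * d) \<longlonglongrightarrow> 0 * d"
    by (intro tendsto_intros LIMSEQ_realpow_zero)
  then have "\<forall>\<^sub>F N in sequentially. q ^ N * d < \<epsilon>"
    using \<epsilon> by (simp add: order_tendsto_iff)
  then obtain N where N: "q ^ N * d < \<epsilon>"
    by (auto simp: eventually_sequentially)
  obtain ts where ts: "ts \<noteq> []" "\<forall>u x y. equi_translates \<epsilon> \<kappa> u \<longrightarrow> (\<forall>x y. cmod (u x - u y) \<le> d) \<longrightarrow>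
      cmod (trans_avg ts u x - trans_avg ts u y) \<le> \<epsilon> + q ^ N * d"
    using step by blast
  show ?thesis
  proof (rule that[OF ts(1)])
    fix u x y assume "equi_translates \<epsilon> \<kappa> u" "\<And>x y. cmod (u x - u y) \<le> d"
    then have "cmod (trans_avg ts u x - trans_avg ts u y) \<le> \<epsilon> + q ^ N * d"
      using ts(2) by blast
    then show "cmod (trans_avg ts u x - trans_avg ts u y) \<le> 2 * \<epsilon>"
      using N by linarith
  qed
qed

lemma almost_periodic_bounded:
  assumes "almost_periodic u"
  obtains B where "B \<ge> 0" "\<And>x. cmod (u x) \<le> B"
proof -
  obtain \<kappa> where \<kappa>: "finite (range \<kappa>)" "equi_translates 1 \<kappa> u"
    using almost_periodicD[OF assms, of 1] by auto
  obtain ts where ts: "distinct ts" "ts \<noteq> []" "\<And>s. \<exists>t\<in>set ts. \<kappa> s = \<kappa> t"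
    using finite_representatives[OF \<kappa>(1)] by metis
  define B where "B = 1 + (\<Sum>t\<in>set ts. cmod (u t))"
  have "cmod (u x) \<le> B" for x
  proof -
    obtain t where t: "t \<in> set ts" "\<kappa> x = \<kappa> t" using ts by blast
    have "cmod (u x - u t) \<le> 1"
      using equi_translatesD[OF \<kappa>(2) t(2), of 0] by simp
    moreover have "cmod (u t) \<le> (\<Sum>t\<in>set ts. cmod (u t))"
      by (rule member_le_sum) (use t in auto)
    moreover have "cmod (u x) \<le> cmod (u t) + cmod (u x - u t)"
      by (metis add.commute diff_add_cancel norm_triangle_ineq)
    ultimately show ?thesis
      by (simp add: B_def)
  qed
  moreover have "B \<ge> 0" by (simp add: B_def sum_nonneg add_increasing)
  ultimately show ?thesis using that by blast
qed

lemma trans_avg_osc: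
  assumes "ss \<noteq> []" "\<And>x. cmod (trans_avg ts u x - trans_avg ts u y) \<le> \<epsilon>"
  shows "cmod (trans_avg ts (trans_avg ss u) x - trans_avg ts u y) \<le> \<epsilon>"
  unfolding trans_avg_commute[of ts ss] by (intro trans_avg_close_const assms)

text \<open>Averages commute, so averaging with both lists produces a single value that is close to
  both constants.\<close>

lemma mean_unique:
  assumes "\<And>\<epsilon>. \<epsilon> > 0 \<Longrightarrow> \<exists>ts. ts \<noteq> [] \<and> (\<forall>x. cmod (trans_avg ts u x - c) \<le> \<epsilon>)"
    and "\<And>\<epsilon>. \<epsilon> > 0 \<Longrightarrow> \<exists>ts. ts \<noteq> [] \<and> (\<forall>x. cmod (trans_avg ts u x - c') \<le> \<epsilon>)"
  shows "c = c'"
proof -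
  have "cmod (c - c') \<le> e" if "e > 0" for e
  proof -
    obtain ts ss where ts: "ts \<noteq> []" "\<And>x. cmod (trans_avg ts u x - c) \<le> e / 2"
      and ss: "ss \<noteq> []" "\<And>x. cmod (trans_avg ss u x - c') \<le> e / 2"
      using assms \<open>e > 0\<close> by (meson half_gt_zero)
    have "cmod (trans_avg ts (trans_avg ss u) 0 - c') \<le> e / 2"
      by (intro trans_avg_close_const ss ts)
    moreover have "cmod (trans_avg ss (trans_avg ts u) 0 - c) \<le> e / 2"
      by (intro trans_avg_close_const ss ts)
    ultimately show ?thesis
      using norm_triangle_ineq4[of "trans_avg ts (trans_avg ss u) 0 - c'" "trans_avg ts (trans_avg ss u) 0 - c"]
      unfolding trans_avg_commute[of ts ss] by simp
  qed
  then have "cmod (c - c') \<le> 0"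
    by (metis field_le_epsilon add_0)
  then show ?thesis by simp
qed

text \<open>Values at 0 of nearly constant averages form a Cauchy sequence: the \<open>m\<close>-th
  and the \<open>n\<close>-th are both compared with the average taken over both lists.\<close>

lemma mean_exists:
  assumes "almost_periodic u"
  shows "\<exists>c. \<forall>\<epsilon>>0. \<exists>ts. ts \<noteq> [] \<and> (\<forall>x. cmod (trans_avg ts u x - c) \<le> \<epsilon>)"
proof -
  obtain B where B: "\<And>x. cmod (u x) \<le> B"
    using almost_periodic_bounded[OF assms] by blast
  have osc: "cmod (u x - u y) \<le> 2 * B" for x y
    using norm_triangle_ineq4[of "u x" "u y"] B[of x] B[of y] by linarith
  have "\<exists>ts. ts \<noteq> [] \<and> (\<forall>x y. cmod (trans_avg ts u x - trans_avg ts u y) \<le> inverse (real (Suc n)))" for n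
  proof -
    obtain \<kappa> where \<kappa>: "finite (range \<kappa>)" "equi_translates (inverse (real (Suc n)) / 2) \<kappa> u"
      using almost_periodicD[OF assms, of "inverse (real (Suc n)) / 2"] by auto
    obtain ts where ts: "ts \<noteq> []" "\<And>v x y. equi_translates (inverse (real (Suc n)) / 2) \<kappa> v \<Longrightarrow>
        (\<And>x y. cmod (v x - v y) \<le> 2 * B) \<Longrightarrow>
        cmod (trans_avg ts v x - trans_avg ts v y) \<le> 2 * (inverse (real (Suc n)) / 2)"
      using uniform_trans_avg[OF \<kappa>(1), of "inverse (real (Suc n)) / 2" "2 * B"]
      by (metis half_gt_zero inverse_positive_iff_positive of_nat_0_less_iff zero_less_Suc)
    then show ?thesis using ts(2)[OF \<kappa>(2) osc] by (intro exI[of _ ts]) auto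
  qed
  then obtain ts where ts: "\<And>n. ts n \<noteq> []"
    "\<And>n x y. cmod (trans_avg (ts n) u x - trans_avg (ts n) u y) \<le> inverse (real (Suc n))"
    by metis
  define c where "c n = trans_avg (ts n) u 0" for n
  have cc: "cmod (c m - c n) \<le> inverse (real (Suc m)) + inverse (real (Suc n))" for m n
  proof -
    have "cmod (trans_avg (ts m) (trans_avg (ts n) u) 0 - c m) \<le> inverse (real (Suc m))"
      unfolding c_def by (intro trans_avg_osc ts)
    moreover have "cmod (trans_avg (ts n) (trans_avg (ts m) u) 0 - c n) \<le> inverse (real (Suc n))"
      unfolding c_def by (intro trans_avg_osc ts)
    ultimately show ?thesis
      using norm_triangle_ineq4[of "trans_avg (ts n) (trans_avg (ts m) u) 0 - c n"
          "trans_avg (ts n) (trans_avg (ts m) u) 0 - c m"]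
      unfolding trans_avg_commute[of "ts m" "ts n"] by simp
  qed
  have small: "\<exists>N. \<forall>n\<ge>N. inverse (real (Suc n)) < e" if "e > 0" for e
  proof -
    obtain N where "inverse (real (Suc N)) < e" using reals_Archimedean \<open>e > 0\<close> by blast
    moreover have "inverse (real (Suc n)) \<le> inverse (real (Suc N))" if "n \<ge> N" for n
      using that by (simp add: le_imp_inverse_le)
    ultimately show ?thesis by (meson le_less_trans)
  qed
  have "Cauchy c"
  proof (rule CauchyI)
    fix e :: real assume "e > 0"
    then obtain N where "\<forall>n\<ge>N. inverse (real (Suc n)) < e / 2" using small[of "e / 2"] by auto
    then show "\<exists>M. \<forall>m\<ge>M. \<forall>n\<ge>M. norm (c m - c n) < e"
      using cc by (intro exI[of _ N]) (smt (verit, best) field_sum_of_halves)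
  qed
  then obtain c0 where c0: "c \<longlonglongrightarrow> c0"
    by (metis Cauchy_convergent convergent_def)
  show ?thesis
  proof (intro exI[of _ c0] allI impI)
    fix \<epsilon> :: real assume "\<epsilon> > 0"
    then obtain N where N: "\<forall>n\<ge>N. inverse (real (Suc n)) < \<epsilon> / 2" using small[of "\<epsilon> / 2"] by auto
    have "\<forall>\<^sub>F n in sequentially. dist (c n) c0 < \<epsilon> / 2"
      using c0 \<open>\<epsilon> > 0\<close> by (intro tendstoD) auto
    then obtain n where n: "n \<ge> N" "dist (c n) c0 < \<epsilon> / 2"
      by (metis eventually_at_top_linorder linorder_le_cases)
    have "cmod (trans_avg (ts n) u x - c0) \<le> \<epsilon>" for x
    proof -
      have "cmod (trans_avg (ts n) u x - c n) < \<epsilon> / 2"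
        using ts(2)[of n x 0] N n(1) by (metis c_def le_less_trans)
      then show ?thesis
        using n(2) norm_triangle_ineq[of "trans_avg (ts n) u x - c n" "c n - c0"]
        by (simp add: dist_norm)
    qed
    then show "\<exists>ts. ts \<noteq> [] \<and> (\<forall>x. cmod (trans_avg ts u x - c0) \<le> \<epsilon>)"
      using ts(1) by blast
  qed
qed

lemma mean_approx:
  assumes "almost_periodic u" "\<epsilon> > 0"
  obtains ts where "ts \<noteq> []" "\<And>x. cmod (trans_avg ts u x - mean u) \<le> \<epsilon>"
proof -
  have "\<exists>!c. \<forall>\<epsilon>>0. \<exists>ts. ts \<noteq> [] \<and> (\<forall>x. cmod (trans_avg ts u x - c) \<le> \<epsilon>)"
    using mean_exists[OF assms(1)] mean_unique[of u] by blast
  from theI'[OF this] show ?thesis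
    using that assms(2) unfolding mean_def by meson
qed

lemma mean_eqI:
  assumes "\<And>\<epsilon>. \<epsilon> > 0 \<Longrightarrow> \<exists>ts. ts \<noteq> [] \<and> (\<forall>x. cmod (trans_avg ts u x - c) \<le> \<epsilon>)"
  shows "mean u = c"
  unfolding mean_def
  by (rule the_equality) (use assms mean_unique[of u] in blast)+

text \<open>A further averaging \<open>ss\<close> brings the average close to the mean, while it
  moves a function of oscillation at most \<epsilon> by no more than \<epsilon>. So small
  oscillation alone certifies closeness to the mean, with no reference to how the list was
  found.\<close>

lemma mean_osc:
  assumes "almost_periodic u" "ts \<noteq> []" "\<And>x y. cmod (trans_avg ts u x - trans_avg ts u y) \<le> \<epsilon>"
  shows "cmod (trans_avg ts u x - mean u) \<le> \<epsilon>"
proof (rule field_le_epsilon)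
  fix e :: real assume "e > 0"
  then obtain ss where ss: "ss \<noteq> []" "\<And>x. cmod (trans_avg ss u x - mean u) \<le> e"
    using mean_approx assms(1) by blast
  have "cmod (trans_avg ts (trans_avg ss u) x - mean u) \<le> e"
    by (intro trans_avg_close_const ss assms)
  moreover have "cmod (trans_avg ts (trans_avg ss u) x - trans_avg ts u x) \<le> \<epsilon>"
    by (intro trans_avg_osc ss assms)
  ultimately show "cmod (trans_avg ts u x - mean u) \<le> \<epsilon> + e"
    using norm_triangle_ineq4[of "trans_avg ts (trans_avg ss u) x - mean u" "trans_avg ts (trans_avg ss u) x - trans_avg ts u x"]
    by simp
qed


section \<open>Closure properties of almost periodicity\<close>

named_theorems ap_intros

text \<open>Colouring by pairs of colours controls \<open>u\<close> and \<open>v\<close>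
  simultaneously. The hypothesis on \<open>w\<close> is uniform continuity in the two values, which
  treats sums, products and conjugates alike.\<close>

lemma almost_periodic_combine:
  assumes u: "almost_periodic u" and v: "almost_periodic v"
    and w: "\<And>\<epsilon>. \<epsilon> > 0 \<Longrightarrow> \<exists>\<delta>>0. \<forall>x x'. cmod (u x - u x') \<le> \<delta> \<longrightarrow> cmod (v x - v x') \<le> \<delta> \<longrightarrow> cmod (w x - w x') \<le> \<epsilon>"
  shows "almost_periodic w"
  unfolding almost_periodic_def
proof (intro allI impI)
  fix \<epsilon> :: real assume "\<epsilon> > 0"
  then obtain \<delta> where \<delta>: "\<delta> > 0"
    "\<And>x x'. cmod (u x - u x') \<le> \<delta> \<Longrightarrow> cmod (v x - v x') \<le> \<delta> \<Longrightarrow> cmod (w x - w x') \<le> \<epsilon>"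
    using w by blast
  obtain \<kappa> where \<kappa>: "finite (range \<kappa>)" "equi_translates \<delta> \<kappa> u"
    using almost_periodicD[OF u \<delta>(1)] .
  obtain \<kappa>' where \<kappa>': "finite (range \<kappa>')" "equi_translates \<delta> \<kappa>' v"
    using almost_periodicD[OF v \<delta>(1)] .
  define \<kappa>'' where "\<kappa>'' x = prod_encode (\<kappa> x, \<kappa>' x)" for x
  have "range \<kappa>'' \<subseteq> prod_encode ` (range \<kappa> \<times> range \<kappa>')"
    by (auto simp: \<kappa>''_def)
  then have "finite (range \<kappa>'')"
    using \<kappa>(1) \<kappa>'(1) by (meson finite_SigmaI finite_imageI finite_subset)
  moreover have "equi_translates \<epsilon> \<kappa>'' w"
    unfolding equi_translates_def \<kappa>''_def
    using \<delta>(2) equi_translatesD[OF \<kappa>(2)] equi_translatesD[OF \<kappa>'(2)] by auto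
  ultimately show "\<exists>\<kappa>. finite (range \<kappa>) \<and> equi_translates \<epsilon> \<kappa> w" by blast
qed

lemma almost_periodic_const [ap_intros]: "almost_periodic (\<lambda>x. c)"
  unfolding almost_periodic_def equi_translates_def
  by (auto intro!: exI[of _ "\<lambda>_. 0::nat"])

lemma almost_periodic_add [ap_intros]:
  assumes "almost_periodic u" "almost_periodic v"
  shows "almost_periodic (\<lambda>x. u x + v x)"
proof (rule almost_periodic_combine[OF assms])
  fix \<epsilon> :: real assume "\<epsilon> > 0"
  have "cmod (u x + v x - (u x' + v x')) \<le> \<epsilon>"
    if "cmod (u x - u x') \<le> \<epsilon> / 2" "cmod (v x - v x') \<le> \<epsilon> / 2" for x x'
    using that norm_diff_triangle_ineq[of "u x" "v x" "u x'" "v x'"] by linarith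
  then show "\<exists>\<delta>>0. \<forall>x x'. cmod (u x - u x') \<le> \<delta> \<longrightarrow> cmod (v x - v x') \<le> \<delta> \<longrightarrow>
      cmod (u x + v x - (u x' + v x')) \<le> \<epsilon>"
    using \<open>\<epsilon> > 0\<close> half_gt_zero by blast
qed

lemma almost_periodic_mult [ap_intros]:
  assumes "almost_periodic u" "almost_periodic v"
  shows "almost_periodic (\<lambda>x. u x * v x)"
proof (rule almost_periodic_combine[OF assms])
  fix \<epsilon> :: real assume "\<epsilon> > 0"
  obtain A B where A: "A \<ge> 0" "\<And>x. cmod (u x) \<le> A" and B: "B \<ge> 0" "\<And>x. cmod (v x) \<le> B"
    using almost_periodic_bounded assms by metis
  define \<delta> where "\<delta> = \<epsilon> / (A + B + 1)"
  have \<delta>: "\<delta> > 0" using \<open>\<epsilon> > 0\<close> A B by (simp add: \<delta>_def)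
  have "cmod (u x * v x - u x' * v x') \<le> \<epsilon>"
    if "cmod (u x - u x') \<le> \<delta>" "cmod (v x - v x') \<le> \<delta>" for x x'
  proof -
    have "u x * v x - u x' * v x' = u x * (v x - v x') + (u x - u x') * v x'"
      by (simp add: algebra_simps)
    also have "cmod \<dots> \<le> A * \<delta> + \<delta> * B"
      by (intro norm_triangle_le add_mono) (use A B that \<delta> in \<open>auto simp: norm_mult intro!: mult_mono\<close>)
    also have "\<dots> \<le> (A + B + 1) * \<delta>"
      using \<delta> by (simp add: algebra_simps)
    also have "\<dots> = \<epsilon>"
      using A B by (simp add: \<delta>_def)
    finally show ?thesis .
  qed
  then show "\<exists>\<delta>>0. \<forall>x x'. cmod (u x - u x') \<le> \<delta> \<longrightarrow> cmod (v x - v x') \<le> \<delta> \<longrightarrow>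
      cmod (u x * v x - u x' * v x') \<le> \<epsilon>"
    using \<delta> by blast
qed

lemma almost_periodic_cnj [ap_intros]:
  assumes "almost_periodic u"
  shows "almost_periodic (\<lambda>x. cnj (u x))"
  by (rule almost_periodic_combine[OF assms assms])
    (metis complex_cnj_diff complex_mod_cnj)

lemma almost_periodic_diff [ap_intros]:
  assumes "almost_periodic u" "almost_periodic v"
  shows "almost_periodic (\<lambda>x. u x - v x)"
proof -
  have "almost_periodic (\<lambda>x. u x + (- 1) * v x)"
    by (intro ap_intros assms)
  then show ?thesis by simp
qed

text \<open>Colourings pull back along homomorphisms. Shifts, reflections, and sections and
  projections of product groups are all instances.\<close>

lemma almost_periodic_hom:
  assumes "almost_periodic u" and h: "\<And>x y. h (x + y) = h x + h y"
  shows "almost_periodic (\<lambda>x. u (h x + c))"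
  unfolding almost_periodic_def
proof (intro allI impI)
  fix \<epsilon> :: real assume "\<epsilon> > 0"
  then obtain \<kappa> where \<kappa>: "finite (range \<kappa>)" "equi_translates \<epsilon> \<kappa> u"
    using almost_periodicD assms(1) by blast
  have "range (\<lambda>x. \<kappa> (h x)) \<subseteq> range \<kappa>" by auto
  then have "finite (range (\<lambda>x. \<kappa> (h x)))"
    using \<kappa>(1) finite_subset by blast
  moreover have "equi_translates \<epsilon> (\<lambda>x. \<kappa> (h x)) (\<lambda>x. u (h x + c))"
    unfolding equi_translates_def
  proof (intro allI impI)
    fix s t r assume "\<kappa> (h s) = \<kappa> (h t)"
    then show "cmod (u (h (r + s) + c) - u (h (r + t) + c)) \<le> \<epsilon>"
      using equi_translatesD[OF \<kappa>(2), of "h s" "h t" "h r + c"] by (simp add: h ac_simps)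
  qed
  ultimately show "\<exists>\<kappa>. finite (range \<kappa>) \<and> equi_translates \<epsilon> \<kappa> (\<lambda>x. u (h x + c))"
    by (intro exI[of _ "\<lambda>x. \<kappa> (h x)"] conjI)
qed

lemma almost_periodic_shift [ap_intros]: "almost_periodic u \<Longrightarrow> almost_periodic (\<lambda>x. u (x + c))"
  by (rule almost_periodic_hom[of u "\<lambda>x. x" c]) auto

lemma almost_periodic_shift' [ap_intros]: "almost_periodic u \<Longrightarrow> almost_periodic (\<lambda>x. u (c + x))"
  using almost_periodic_shift[of u c] by (simp add: add.commute)

lemma almost_periodic_shift_diff [ap_intros]: "almost_periodic u \<Longrightarrow> almost_periodic (\<lambda>x. u (x - c))"
  using almost_periodic_shift[of u "- c"] by simp

lemma almost_periodic_reflect [ap_intros]: "almost_periodic u \<Longrightarrow> almost_periodic (\<lambda>x. u (c - x))"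
  using almost_periodic_hom[of u uminus c] by simp

lemma almost_periodic_minus [ap_intros]: "almost_periodic u \<Longrightarrow> almost_periodic (\<lambda>x. u (- x))"
  using almost_periodic_reflect[of u 0] by simp

lemma almost_periodic_sum [ap_intros]:
  "(\<And>i. i \<in> I \<Longrightarrow> almost_periodic (u i)) \<Longrightarrow> almost_periodic (\<lambda>x. \<Sum>i\<in>I. u i x)"
  by (induction I rule: infinite_finite_induct) (auto intro: ap_intros)

lemma almost_periodic_sum_list [ap_intros]:
  "(\<And>i. i \<in> set is \<Longrightarrow> almost_periodic (u i)) \<Longrightarrow> almost_periodic (\<lambda>x. \<Sum>i\<leftarrow>is. u i x)"
  by (induction "is") (auto intro: ap_intros)

lemma almost_periodic_limit:
  assumes "\<And>\<epsilon>. \<epsilon> > 0 \<Longrightarrow> \<exists>v. almost_periodic v \<and> (\<forall>x. cmod (u x - v x) \<le> \<epsilon>)"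
  shows "almost_periodic u"
  unfolding almost_periodic_def
proof (intro allI impI)
  fix \<epsilon> :: real assume \<epsilon>: "\<epsilon> > 0"
  then obtain v where v: "almost_periodic v" "\<And>x. cmod (u x - v x) \<le> \<epsilon> / 3"
    using assms by (meson divide_pos_pos zero_less_numeral)
  obtain \<kappa> where \<kappa>: "finite (range \<kappa>)" "equi_translates (\<epsilon> / 3) \<kappa> v"
    using almost_periodicD[OF v(1), of "\<epsilon> / 3"] \<epsilon> by auto
  have "cmod (u (r + s) - u (r + t)) \<le> \<epsilon>" if "\<kappa> s = \<kappa> t" for r s t
  proof -
    have "u (r + s) - u (r + t) = (u (r + s) - v (r + s)) - (u (r + t) - v (r + t)) + (v (r + s) - v (r + t))"
      by simp
    also have "cmod \<dots> \<le> \<epsilon> / 3 + \<epsilon> / 3 + \<epsilon> / 3"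
      by (intro norm_triangle_le norm_triangle_le_diff add_mono v equi_translatesD[OF \<kappa>(2) that])
    finally show ?thesis by simp
  qed
  then show "\<exists>\<kappa>. finite (range \<kappa>) \<and> equi_translates \<epsilon> \<kappa> u"
    using \<kappa>(1) unfolding equi_translates_def by blast
qed

section \<open>Linearity, invariance and positivity of the mean\<close>

lemma mean_const [simp]: "mean (\<lambda>x. c) = c"
  by (rule mean_eqI) (auto intro!: exI[of _ "[0]"])

lemma mean_add:
  assumes "almost_periodic u" "almost_periodic v"
  shows "mean (\<lambda>x. u x + v x) = mean u + mean v"
proof (rule mean_eqI)
  fix \<epsilon> :: real assume "\<epsilon> > 0"
  then have "\<epsilon> / 2 > 0" by simp
  obtain ts where ts: "ts \<noteq> []" "\<And>x. cmod (trans_avg ts u x - mean u) \<le> \<epsilon> / 2"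
    using mean_approx[OF assms(1) \<open>\<epsilon> / 2 > 0\<close>] by blast
  obtain ss where ss: "ss \<noteq> []" "\<And>x. cmod (trans_avg ss v x - mean v) \<le> \<epsilon> / 2"
    using mean_approx[OF assms(2) \<open>\<epsilon> / 2 > 0\<close>] by blast
  have "cmod (trans_avg ts (trans_avg ss (\<lambda>x. u x + v x)) x - (mean u + mean v)) \<le> \<epsilon>" for x
  proof -
    have "trans_avg ts (trans_avg ss (\<lambda>x. u x + v x)) x
        = trans_avg ss (trans_avg ts u) x + trans_avg ts (trans_avg ss v) x"
      by (subst trans_avg_commute[of ss]) (simp add: trans_avg_add[abs_def])
    moreover have "cmod (trans_avg ss (trans_avg ts u) x - mean u) \<le> \<epsilon> / 2"
      by (intro trans_avg_close_const ts ss)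
    moreover have "cmod (trans_avg ts (trans_avg ss v) x - mean v) \<le> \<epsilon> / 2"
      by (intro trans_avg_close_const ts ss)
    ultimately show ?thesis
      using norm_triangle_ineq[of "trans_avg ss (trans_avg ts u) x - mean u" "trans_avg ts (trans_avg ss v) x - mean v"]
      by (simp add: algebra_simps)
  qed
  moreover have "concat (map (\<lambda>t. map (\<lambda>s. t + s) ss) ts) \<noteq> []"
    using ts(1) ss(1) by (cases ts; cases ss) auto
  ultimately show "\<exists>ts. ts \<noteq> [] \<and> (\<forall>x. cmod (trans_avg ts (\<lambda>x. u x + v x) x - (mean u + mean v)) \<le> \<epsilon>)"
    unfolding trans_avg_trans_avg by blast
qed

lemma mean_cmult:
  assumes "almost_periodic u"
  shows "mean (\<lambda>x. c * u x) = c * mean u"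
proof (rule mean_eqI)
  fix \<epsilon> :: real assume "\<epsilon> > 0"
  then have "\<epsilon> / (cmod c + 1) > 0" by (simp add: add_nonneg_pos)
  then obtain ts where ts: "ts \<noteq> []" "\<And>x. cmod (trans_avg ts u x - mean u) \<le> \<epsilon> / (cmod c + 1)"
    using mean_approx[OF assms(1)] by blast
  have "cmod (trans_avg ts (\<lambda>x. c * u x) x - c * mean u) \<le> \<epsilon>" for x
  proof -
    have "cmod (trans_avg ts (\<lambda>x. c * u x) x - c * mean u) = cmod c * cmod (trans_avg ts u x - mean u)"
      by (simp add: trans_avg_cmult norm_mult flip: right_diff_distrib)
    also have "\<dots> \<le> (cmod c + 1) * (\<epsilon> / (cmod c + 1))"
      by (intro mult_mono ts) auto
    also have "\<dots> = \<epsilon>"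
      by (simp add: add_nonneg_eq_0_iff)
    finally show ?thesis .
  qed
  then show "\<exists>ts. ts \<noteq> [] \<and> (\<forall>x. cmod (trans_avg ts (\<lambda>x. c * u x) x - c * mean u) \<le> \<epsilon>)"
    using ts(1) by blast
qed

lemma mean_diff:
  assumes "almost_periodic u" "almost_periodic v"
  shows "mean (\<lambda>x. u x - v x) = mean u - mean v"
proof -
  have "mean (\<lambda>x. u x + (- 1) * v x) = mean u + (- 1) * mean v"
    by (subst mean_add, (intro ap_intros assms)+, subst mean_cmult) (auto simp: assms)
  then show ?thesis by simp
qed

lemma mean_sum:
  "(\<And>i. i \<in> I \<Longrightarrow> almost_periodic (u i)) \<Longrightarrow> mean (\<lambda>x. \<Sum>i\<in>I. u i x) = (\<Sum>i\<in>I. mean (u i))"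
  by (induction I rule: infinite_finite_induct) (auto simp: mean_add almost_periodic_sum)

lemma mean_sum_list:
  "(\<And>i. i \<in> set is \<Longrightarrow> almost_periodic (u i)) \<Longrightarrow> mean (\<lambda>x. \<Sum>i\<leftarrow>is. u i x) = (\<Sum>i\<leftarrow>is. mean (u i))"
  by (induction "is") (auto simp: mean_add almost_periodic_sum_list)

lemma mean_shift:
  assumes "almost_periodic u"
  shows "mean (\<lambda>x. u (x + s)) = mean u"
proof (rule mean_eqI)
  fix \<epsilon> :: real assume "\<epsilon> > 0"
  then obtain ts where ts: "ts \<noteq> []" "\<And>x. cmod (trans_avg ts u x - mean u) \<le> \<epsilon>"
    using mean_approx[OF assms(1)] by blast
  then show "\<exists>ts. ts \<noteq> [] \<and> (\<forall>x. cmod (trans_avg ts (\<lambda>x. u (x + s)) x - mean u) \<le> \<epsilon>)"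
    by (auto simp: trans_avg_shift)
qed

lemma mean_minus:
  assumes "almost_periodic u"
  shows "mean (\<lambda>x. u (- x)) = mean u"
proof (rule mean_eqI)
  fix \<epsilon> :: real assume "\<epsilon> > 0"
  then obtain ts where ts: "ts \<noteq> []" "\<And>x. cmod (trans_avg ts u x - mean u) \<le> \<epsilon>"
    using mean_approx[OF assms(1)] by blast
  then have "cmod (trans_avg (map uminus ts) (\<lambda>x. u (- x)) x - mean u) \<le> \<epsilon>" for x
    by (simp add: trans_avg_minus o_def)
  then show "\<exists>ts. ts \<noteq> [] \<and> (\<forall>x. cmod (trans_avg ts (\<lambda>x. u (- x)) x - mean u) \<le> \<epsilon>)"
    using ts(1) by (intro exI[of _ "map uminus ts"]) auto
qed

lemma mean_reflect:
  assumes "almost_periodic u"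
  shows "mean (\<lambda>x. u (s - x)) = mean u"
  using mean_minus[of "\<lambda>x. u (x + s)"] mean_shift[OF assms] assms
  by (simp add: ap_intros)

lemma mean_cnj:
  assumes "almost_periodic u"
  shows "mean (\<lambda>x. cnj (u x)) = cnj (mean u)"
proof (rule mean_eqI)
  fix \<epsilon> :: real assume "\<epsilon> > 0"
  then obtain ts where ts: "ts \<noteq> []" "\<And>x. cmod (trans_avg ts u x - mean u) \<le> \<epsilon>"
    using mean_approx[OF assms(1)] by blast
  have "cmod (trans_avg ts (\<lambda>x. cnj (u x)) x - cnj (mean u)) \<le> \<epsilon>" for x
    unfolding trans_avg_cnj complex_cnj_diff[symmetric] complex_mod_cnj by (rule ts)
  then show "\<exists>ts. ts \<noteq> [] \<and> (\<forall>x. cmod (trans_avg ts (\<lambda>x. cnj (u x)) x - cnj (mean u)) \<le> \<epsilon>)"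
    using ts(1) by blast
qed

lemma mean_le:
  assumes "almost_periodic u" "\<And>x. cmod (u x) \<le> B"
  shows "cmod (mean u) \<le> B"
proof (rule field_le_epsilon)
  fix e :: real assume "e > 0"
  then obtain ts where ts: "ts \<noteq> []" "\<And>x. cmod (trans_avg ts u x - mean u) \<le> e"
    using mean_approx[OF assms(1)] by blast
  have "cmod (trans_avg ts u 0) \<le> B"
    by (intro trans_avg_le ts assms)
  then show "cmod (mean u) \<le> B + e"
    using ts(2)[of 0] norm_triangle_ineq3[of "trans_avg ts u 0" "mean u"] by linarith
qed

lemma mean_close:
  assumes "almost_periodic u" "almost_periodic v" "\<And>x. cmod (u x - v x) \<le> \<epsilon>"
  shows "cmod (mean u - mean v) \<le> \<epsilon>"
  using mean_le[of "\<lambda>x. u x - v x" \<epsilon>] assms by (simp add: mean_diff ap_intros)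

lemma mean_tendsto:
  assumes u: "\<And>n. almost_periodic (u n)" and v: "almost_periodic v"
    and lim: "uniform_limit UNIV u v sequentially"
  shows "(\<lambda>n. mean (u n)) \<longlonglongrightarrow> mean v"
proof (rule tendstoI)
  fix e :: real assume "e > 0"
  then have "\<forall>\<^sub>F n in sequentially. \<forall>x\<in>UNIV. dist (u n x) (v x) < e / 2"
    using lim by (intro uniform_limitD) auto
  then show "\<forall>\<^sub>F n in sequentially. dist (mean (u n)) (mean v) < e"
  proof eventually_elim
    case (elim n)
    have "cmod (mean (u n) - mean v) \<le> e / 2"
      using elim by (intro mean_close u v) (auto simp: dist_norm less_imp_le)
    then show ?case using \<open>e > 0\<close> by (simp add: dist_norm)
  qed
qed

lemma mean_Re_nonneg:
  assumes "almost_periodic u" "\<And>x. Re (u x) \<ge> 0"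
  shows "Re (mean u) \<ge> 0"
proof (rule field_le_epsilon)
  fix e :: real assume "e > 0"
  then obtain ts where ts: "ts \<noteq> []" "\<And>x. cmod (trans_avg ts u x - mean u) \<le> e"
    using mean_approx[OF assms(1)] by blast
  have "Re (\<Sum>t\<leftarrow>ts. u (0 + t)) = (\<Sum>t\<leftarrow>ts. Re (u (0 + t)))"
    by (induction ts) auto
  then have "Re (trans_avg ts u 0) \<ge> 0"
    unfolding trans_avg_def
    by (simp add: Re_divide_of_nat) (auto intro!: divide_nonneg_nonneg sum_list_nonneg assms)
  then show "0 \<le> Re (mean u) + e"
    using ts(2)[of 0] complex_Re_le_cmod[of "trans_avg ts u 0 - mean u"] by simp
qed

section \<open>Means in two variables\<close>

lemma equi_translates_section:
  assumes "equi_translates \<epsilon> \<kappa> \<Phi>"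
  shows "equi_translates \<epsilon> (\<lambda>x. \<kappa> (x, 0)) (\<lambda>x. \<Phi> (x, y))"
    and "equi_translates \<epsilon> (\<lambda>y. \<kappa> (0, y)) (\<lambda>y. \<Phi> (x, y))"
proof -
  show "equi_translates \<epsilon> (\<lambda>x. \<kappa> (x, 0)) (\<lambda>x. \<Phi> (x, y))"
    unfolding equi_translates_def
  proof (intro allI impI)
    fix s t r assume "\<kappa> (s, 0) = \<kappa> (t, 0)"
    from equi_translatesD[OF assms this, of "(r, y)"]
    show "cmod (\<Phi> (r + s, y) - \<Phi> (r + t, y)) \<le> \<epsilon>" by simp
  qed
  show "equi_translates \<epsilon> (\<lambda>y. \<kappa> (0, y)) (\<lambda>y. \<Phi> (x, y))"
    unfolding equi_translates_def
  proof (intro allI impI)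
    fix s t r assume "\<kappa> (0, s) = \<kappa> (0, t)"
    from equi_translatesD[OF assms this, of "(x, r)"]
    show "cmod (\<Phi> (x, r + s) - \<Phi> (x, r + t)) \<le> \<epsilon>" by simp
  qed
qed

lemma finite_range_section:
  "finite (range \<kappa>) \<Longrightarrow> finite (range (\<lambda>x. \<kappa> (x, b)))"
  "finite (range \<kappa>) \<Longrightarrow> finite (range (\<lambda>y. \<kappa> (a, y)))"
  by (rule finite_subset[of _ "range \<kappa>"]; auto)+

lemma almost_periodic_section [ap_intros]:
  assumes "almost_periodic \<Phi>"
  shows "almost_periodic (\<lambda>x. \<Phi> (x, y))" "almost_periodic (\<lambda>y. \<Phi> (x, y))"
proof -
  have "almost_periodic (\<lambda>x. \<Phi> ((x, 0) + (0, y)))" "almost_periodic (\<lambda>y. \<Phi> ((0, y) + (x, 0)))"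
    using almost_periodic_hom[OF assms, of "\<lambda>x. (x, 0)" "(0, y)"]
      almost_periodic_hom[OF assms, of "\<lambda>y. (0, y)" "(x, 0)"] by simp_all
  then show "almost_periodic (\<lambda>x. \<Phi> (x, y))" "almost_periodic (\<lambda>y. \<Phi> (x, y))"
    by simp_all
qed

lemma almost_periodic_mean:
  assumes "almost_periodic \<Phi>"
  shows "almost_periodic (\<lambda>x. mean (\<lambda>y. \<Phi> (x, y)))" "almost_periodic (\<lambda>y. mean (\<lambda>x. \<Phi> (x, y)))"
proof -
  show "almost_periodic (\<lambda>x. mean (\<lambda>y. \<Phi> (x, y)))"
    unfolding almost_periodic_def
  proof (intro allI impI)
    fix \<epsilon> :: real assume "\<epsilon> > 0"
    then obtain \<kappa> where \<kappa>: "finite (range \<kappa>)" "equi_translates \<epsilon> \<kappa> \<Phi>"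
      using almost_periodicD assms by blast
    have "equi_translates \<epsilon> (\<lambda>x. \<kappa> (x, 0)) (\<lambda>x. mean (\<lambda>y. \<Phi> (x, y)))"
      unfolding equi_translates_def
      by (intro allI impI mean_close ap_intros assms equi_translatesD[OF equi_translates_section(1)[OF \<kappa>(2)]])
    with finite_range_section(1)[OF \<kappa>(1)]
    show "\<exists>\<kappa>. finite (range \<kappa>) \<and> equi_translates \<epsilon> \<kappa> (\<lambda>x. mean (\<lambda>y. \<Phi> (x, y)))"
      by (intro exI conjI)
  qed
  show "almost_periodic (\<lambda>y. mean (\<lambda>x. \<Phi> (x, y)))"
    unfolding almost_periodic_def
  proof (intro allI impI)
    fix \<epsilon> :: real assume "\<epsilon> > 0"
    then obtain \<kappa> where \<kappa>: "finite (range \<kappa>)" "equi_translates \<epsilon> \<kappa> \<Phi>"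
      using almost_periodicD assms by blast
    have "equi_translates \<epsilon> (\<lambda>y. \<kappa> (0, y)) (\<lambda>y. mean (\<lambda>x. \<Phi> (x, y)))"
      unfolding equi_translates_def
      by (intro allI impI mean_close ap_intros assms equi_translatesD[OF equi_translates_section(2)[OF \<kappa>(2)]])
    with finite_range_section(2)[OF \<kappa>(1)]
    show "\<exists>\<kappa>. finite (range \<kappa>) \<and> equi_translates \<epsilon> \<kappa> (\<lambda>y. mean (\<lambda>x. \<Phi> (x, y)))"
      by (intro exI conjI)
  qed
qed

lemma uniform_mean_approx:
  assumes fin: "finite (range \<kappa>)" and \<epsilon>: "\<epsilon> > 0"
  obtains ts where "ts \<noteq> []"
    "\<And>u x. almost_periodic u \<Longrightarrow> equi_translates \<epsilon> \<kappa> u \<Longrightarrow> (\<And>x. cmod (u x) \<le> B) \<Longrightarrow>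
      cmod (trans_avg ts u x - mean u) \<le> 2 * \<epsilon>"
proof -
  obtain ts where ts: "ts \<noteq> []"
    "\<And>u x y. equi_translates \<epsilon> \<kappa> u \<Longrightarrow> (\<And>x y. cmod (u x - u y) \<le> 2 * B) \<Longrightarrow>
      cmod (trans_avg ts u x - trans_avg ts u y) \<le> 2 * \<epsilon>"
    using uniform_trans_avg[OF assms, of "2 * B"] by metis
  show ?thesis
  proof (rule that[OF ts(1)])
    fix u :: "'a \<Rightarrow> complex" and x
    assume u: "almost_periodic u" "equi_translates \<epsilon> \<kappa> u" "\<And>x. cmod (u x) \<le> B"
    have "cmod (u x - u y) \<le> 2 * B" for x y
      using norm_triangle_ineq4[of "u x" "u y"] u(3)[of x] u(3)[of y] by linarith
    then show "cmod (trans_avg ts u x - mean u) \<le> 2 * \<epsilon>"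
      by (intro mean_osc u(1) ts u(2))
  qed
qed

lemma norm_diff_four_steps:
  fixes a b c d e :: complex
  assumes "cmod (b - a) \<le> \<epsilon>" "cmod (c - d) \<le> \<epsilon>" "cmod (e - b) \<le> \<epsilon>" "cmod (e - c) \<le> \<epsilon>"
  shows "cmod (a - d) \<le> 4 * \<epsilon>"
proof -
  have "cmod (a - d) \<le> cmod (b - a) + (cmod (e - b) + (cmod (e - c) + cmod (c - d)))"
    using dist_triangle[of a d b] dist_triangle[of b d e] dist_triangle[of e d c]
    unfolding dist_norm norm_minus_commute[of a b] norm_minus_commute[of b e] by linarith
  then show ?thesis using assms by linarith
qed

text \<open>Fubini for means: one list \<open>ts\<close> works for all sections in the first
  variable, one list \<open>ss\<close> for all sections in the second, and the finite double sum can
  be taken in either order. Four comparisons with error \<open>2 * \<epsilon>\<close> give the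
  8.\<close>

lemma mean_swap:
  assumes "almost_periodic \<Phi>"
  shows "mean (\<lambda>x. mean (\<lambda>y. \<Phi> (x, y))) = mean (\<lambda>y. mean (\<lambda>x. \<Phi> (x, y)))"
proof -
  obtain B where B: "\<And>p. cmod (\<Phi> p) \<le> B"
    using almost_periodic_bounded[OF assms] by blast
  have close: "cmod (mean (\<lambda>x. mean (\<lambda>y. \<Phi> (x, y))) - mean (\<lambda>y. mean (\<lambda>x. \<Phi> (x, y)))) \<le> 8 * \<epsilon>"
    if \<epsilon>: "\<epsilon> > 0" for \<epsilon>
  proof -
    define d where "d x = mean (\<lambda>y. \<Phi> (x, y))" for x
    define c where "c y = mean (\<lambda>x. \<Phi> (x, y))" for y
    obtain \<kappa> where \<kappa>: "finite (range \<kappa>)" "equi_translates \<epsilon> \<kappa> \<Phi>"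
      using almost_periodicD[OF assms \<epsilon>] .
    obtain ts where ts: "ts \<noteq> []"
      "\<And>u x. almost_periodic u \<Longrightarrow> equi_translates \<epsilon> (\<lambda>x. \<kappa> (x, 0)) u \<Longrightarrow> (\<And>x. cmod (u x) \<le> B) \<Longrightarrow>
        cmod (trans_avg ts u x - mean u) \<le> 2 * \<epsilon>"
      using uniform_mean_approx[OF finite_range_section(1)[OF \<kappa>(1)] \<epsilon>] by metis
    obtain ss where ss: "ss \<noteq> []"
      "\<And>u x. almost_periodic u \<Longrightarrow> equi_translates \<epsilon> (\<lambda>y. \<kappa> (0, y)) u \<Longrightarrow> (\<And>x. cmod (u x) \<le> B) \<Longrightarrow>
        cmod (trans_avg ss u x - mean u) \<le> 2 * \<epsilon>"
      using uniform_mean_approx[OF finite_range_section(2)[OF \<kappa>(1)] \<epsilon>] by metis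
    have ap: "almost_periodic c" "almost_periodic d"
      unfolding c_def d_def by (intro almost_periodic_mean assms)+
    have equi: "equi_translates \<epsilon> (\<lambda>x. \<kappa> (x, 0)) d" "equi_translates \<epsilon> (\<lambda>y. \<kappa> (0, y)) c"
      unfolding equi_translates_def c_def d_def
      by (intro allI impI mean_close ap_intros assms equi_translatesD[OF equi_translates_section(1)[OF \<kappa>(2)]]
          equi_translatesD[OF equi_translates_section(2)[OF \<kappa>(2)]]; assumption)+
    have bd: "cmod (c y) \<le> B" "cmod (d x) \<le> B" for x y
      unfolding c_def d_def by (intro mean_le ap_intros assms B)+
    have "trans_avg ts (\<lambda>x. trans_avg ss (\<lambda>y. \<Phi> (x, y)) 0) 0 = trans_avg ss (\<lambda>y. trans_avg ts (\<lambda>x. \<Phi> (x, y)) 0) 0"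
      unfolding trans_avg_def sum_list_divide by (subst sum_list_swap) simp
    moreover have "cmod (trans_avg ss (\<lambda>y. trans_avg ts (\<lambda>x. \<Phi> (x, y)) 0) 0 - trans_avg ss c 0) \<le> 2 * \<epsilon>"
      unfolding c_def
      by (intro trans_avg_close ss(1) ts(2) almost_periodic_section assms equi_translates_section \<kappa> B)
    ultimately have "cmod (mean d - mean c) \<le> 4 * (2 * \<epsilon>)"
    proof (intro norm_diff_four_steps)
      show "cmod (trans_avg ts d 0 - mean d) \<le> 2 * \<epsilon>"
        by (intro ts ap equi bd)
      show "cmod (trans_avg ss c 0 - mean c) \<le> 2 * \<epsilon>"
        by (intro ss ap equi bd)
      show "cmod (trans_avg ts (\<lambda>x. trans_avg ss (\<lambda>y. \<Phi> (x, y)) 0) 0 - trans_avg ts d 0) \<le> 2 * \<epsilon>"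
        unfolding d_def
        by (intro trans_avg_close ts(1) ss(2) almost_periodic_section assms equi_translates_section \<kappa> B)
    qed simp
    then show ?thesis unfolding c_def[abs_def] d_def[abs_def] by simp
  qed
  then have "cmod (mean (\<lambda>x. mean (\<lambda>y. \<Phi> (x, y))) - mean (\<lambda>y. mean (\<lambda>x. \<Phi> (x, y)))) \<le> 0 + e" if "e > 0" for e
    using that close[of "e / 8"] by simp
  then have "cmod (mean (\<lambda>x. mean (\<lambda>y. \<Phi> (x, y))) - mean (\<lambda>y. mean (\<lambda>x. \<Phi> (x, y)))) \<le> 0"
    by (rule field_le_epsilon)
  then show ?thesis by simp
qed

section \<open>Convolution and positive definite functions\<close>

definition character :: "('g::ab_group_add \<Rightarrow> complex) \<Rightarrow> bool"
  where "character \<xi> \<longleftrightarrow> (\<forall>x y. \<xi> (x + y) = \<xi> x * \<xi> y) \<and> (\<forall>x. cmod (\<xi> x) = 1)"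

definition ip :: "('g::ab_group_add \<Rightarrow> complex) \<Rightarrow> ('g \<Rightarrow> complex) \<Rightarrow> complex"
  where "ip u v = mean (\<lambda>x. u x * cnj (v x))"

definition msq :: "('g::ab_group_add \<Rightarrow> complex) \<Rightarrow> real"
  where "msq u = Re (ip u u)"

text \<open>Convolution over the Bohr compactification in disguise: the mean stands for integration
  against its Haar measure.\<close>

definition conv :: "('g::ab_group_add \<Rightarrow> complex) \<Rightarrow> ('g \<Rightarrow> complex) \<Rightarrow> 'g \<Rightarrow> complex"
  where "conv u v x = mean (\<lambda>y. u (x - y) * v y)"

definition hermitian :: "('g::ab_group_add \<Rightarrow> complex) \<Rightarrow> bool"
  where "hermitian u \<longleftrightarrow> (\<forall>x. cnj (u (- x)) = u x)"

text \<open>Points and coefficients form a list of pairs in which points may repeat, so test lists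
  can be appended without any disjointness condition.\<close>

definition positive_definite :: "('g::ab_group_add \<Rightarrow> complex) \<Rightarrow> bool"
  where "positive_definite p \<longleftrightarrow>
    (\<forall>xs :: ('g \<times> complex) list. (\<Sum>a\<leftarrow>xs. \<Sum>b\<leftarrow>xs. snd a * cnj (snd b) * p (fst a - fst b)) \<in> \<real>\<^sub>\<ge>\<^sub>0)"

lemma ip_add_left:
  "almost_periodic u \<Longrightarrow> almost_periodic v \<Longrightarrow> almost_periodic w \<Longrightarrow> ip (\<lambda>x. u x + v x) w = ip u w + ip v w"
  unfolding ip_def distrib_right by (intro mean_add ap_intros)

lemma ip_cmult_left:
  "almost_periodic u \<Longrightarrow> almost_periodic w \<Longrightarrow> ip (\<lambda>x. c * u x) w = c * ip u w"
  unfolding ip_def mult.assoc by (intro mean_cmult ap_intros)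

lemma ip_cnj: "almost_periodic u \<Longrightarrow> almost_periodic v \<Longrightarrow> ip v u = cnj (ip u v)"
  unfolding ip_def by (subst mean_cnj[symmetric]) (auto intro: ap_intros simp: mult.commute)

lemma ip_diff_left:
  "almost_periodic u \<Longrightarrow> almost_periodic v \<Longrightarrow> almost_periodic w \<Longrightarrow> ip (\<lambda>x. u x - v x) w = ip u w - ip v w"
  unfolding ip_def left_diff_distrib by (intro mean_diff ap_intros)

lemma ip_add_right:
  "almost_periodic u \<Longrightarrow> almost_periodic v \<Longrightarrow> almost_periodic w \<Longrightarrow> ip w (\<lambda>x. u x + v x) = ip w u + ip w v"
  unfolding ip_def complex_cnj_add distrib_left by (intro mean_add ap_intros)

lemma ip_diff_right:
  "almost_periodic u \<Longrightarrow> almost_periodic v \<Longrightarrow> almost_periodic w \<Longrightarrow> ip w (\<lambda>x. u x - v x) = ip w u - ip w v"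
  unfolding ip_def complex_cnj_diff right_diff_distrib by (intro mean_diff ap_intros)

lemma ip_cmult_right:
  "almost_periodic u \<Longrightarrow> almost_periodic w \<Longrightarrow> ip w (\<lambda>x. c * u x) = cnj c * ip w u"
  unfolding ip_def complex_cnj_mult mult.left_commute[of _ "cnj c"] by (intro mean_cmult ap_intros)

lemmas ip_simps = ip_add_left ip_cmult_left ip_diff_left ip_add_right ip_diff_right ip_cmult_right ap_intros

lemma ip_self:
  assumes "almost_periodic u"
  shows "ip u u = of_real (msq u)"
  using ip_cnj[OF assms assms] by (simp add: msq_def complex_eq_iff)

lemma msq_nonneg:
  assumes "almost_periodic u"
  shows "msq u \<ge> 0"
  unfolding msq_def ip_def by (intro mean_Re_nonneg ap_intros assms) (simp add: complex_norm_square[symmetric])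

lemma msq_cmult: "almost_periodic u \<Longrightarrow> msq (\<lambda>x. c * u x) = (cmod c)\<^sup>2 * msq u"
proof -
  assume u: "almost_periodic u"
  have "ip (\<lambda>x. c * u x) (\<lambda>x. c * u x) = c * cnj c * ip u u"
    using u by (simp add: ip_simps)
  also have "\<dots> = of_real ((cmod c)\<^sup>2 * msq u)"
    by (simp add: ip_self[OF u] complex_norm_square[symmetric])
  finally show ?thesis by (simp add: msq_def)
qed

lemma mean_trans_avg:
  assumes "almost_periodic v" "ts \<noteq> []"
  shows "mean (trans_avg ts v) = mean v"
proof -
  have "mean (\<lambda>x. \<Sum>t\<leftarrow>ts. v (x + t)) = (\<Sum>t\<leftarrow>ts. mean v)"
    using assms(1) by (simp add: mean_sum_list mean_shift ap_intros)
  moreover have "mean (\<lambda>x. 1 / of_nat (length ts) * (\<Sum>t\<leftarrow>ts. v (x + t))) =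
      1 / of_nat (length ts) * mean (\<lambda>x. \<Sum>t\<leftarrow>ts. v (x + t))"
    by (intro mean_cmult ap_intros assms)
  moreover have "trans_avg ts v = (\<lambda>x. 1 / of_nat (length ts) * (\<Sum>t\<leftarrow>ts. v (x + t)))"
    by (simp add: fun_eq_iff trans_avg_def)
  ultimately show ?thesis
    using assms(2) by (simp add: sum_list_triv)
qed

text \<open>The mean square is definite because a value cannot occur too rarely: if
  \<open>cmod (u x)\<close> is \<open>2 * \<delta>\<close>, then every \<open>y\<close> has some
  \<open>t\<close> in a fixed finite list with \<open>cmod (u (y + t))\<close> at least \<delta>.
  The averages of the squared modulus over this list are then bounded below by
  \<open>\<delta>\<^sup>2 / n\<close> everywhere.\<close>

lemma msq_eq_0D:
  assumes u: "almost_periodic u" and zero: "msq u = 0"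
  shows "u x = 0"
proof (rule ccontr)
  assume nz: "u x \<noteq> 0"
  define \<delta> where "\<delta> = cmod (u x) / 2"
  have \<delta>: "\<delta> > 0" using nz by (simp add: \<delta>_def)
  obtain \<kappa> where \<kappa>: "finite (range \<kappa>)" "equi_translates \<delta> \<kappa> u"
    using almost_periodicD[OF u \<delta>] .
  obtain ts where ts: "ts \<noteq> []" "\<And>s. \<exists>t\<in>set ts. \<kappa> s = \<kappa> t"
    using finite_representatives[OF \<kappa>(1)] by metis
  define v where "v y = u y * cnj (u y)" for y
  have v: "almost_periodic v" unfolding v_def by (intro ap_intros u)
  have Rev: "Re (v y) = (cmod (u y))\<^sup>2" for y
    by (simp add: v_def complex_norm_square[symmetric])
  define n where "n = real (length ts)"
  have n: "n > 0" using ts(1) by (simp add: n_def)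
  have "Re (trans_avg ts v y) \<ge> \<delta>\<^sup>2 / n" for y
  proof -
    obtain t where t: "t \<in> set ts" "\<kappa> (x - y) = \<kappa> t" using ts(2) by blast
    have "cmod (u x - u (y + t)) \<le> \<delta>"
      using equi_translatesD[OF \<kappa>(2) t(2), of y] by simp
    then have "cmod (u (y + t)) \<ge> \<delta>"
      using norm_triangle_ineq2[of "u x" "u (y + t)"] by (simp add: \<delta>_def)
    then have "\<delta>\<^sup>2 \<le> Re (v (y + t))"
      unfolding Rev using \<delta> by (intro power_mono) auto
    also have "\<dots> \<le> (\<Sum>t\<leftarrow>ts. Re (v (y + t)))"
      using t(1) by (intro member_le_sum_list) (auto simp: Rev)
    also have "\<dots> = Re (\<Sum>t\<leftarrow>ts. v (y + t))"
      by (induction ts) auto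
    finally show ?thesis
      using n by (simp add: trans_avg_def Re_divide_of_nat n_def divide_right_mono)
  qed
  moreover have "almost_periodic (trans_avg ts v)"
    unfolding trans_avg_def[abs_def] divide_inverse by (intro ap_intros v)
  ultimately have "Re (mean (\<lambda>y. trans_avg ts v y - of_real (\<delta>\<^sup>2 / n))) \<ge> 0"
    by (intro mean_Re_nonneg ap_intros) auto
  then have "Re (mean v) \<ge> \<delta>\<^sup>2 / n"
    using \<open>almost_periodic (trans_avg ts v)\<close> v ts(1) by (simp add: mean_diff ap_intros mean_trans_avg)
  moreover have "\<delta>\<^sup>2 / n > 0" using \<delta> n by simp
  ultimately show False
    using zero by (simp add: msq_def ip_def v_def[abs_def])
qed

lemma msq_zero [simp]: "msq (\<lambda>x. 0) = 0"
  by (simp add: msq_def ip_def)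

lemma ip_cauchy_schwarz:
  assumes u: "almost_periodic u" and v: "almost_periodic v"
  shows "(cmod (ip u v))\<^sup>2 \<le> msq u * msq v"
proof (cases "msq v = 0")
  case True
  then have "v = (\<lambda>x. 0)" using msq_eq_0D[OF v] by auto
  then show ?thesis using True by (simp add: ip_def)
next
  case False
  then have pos: "msq v > 0" using msq_nonneg[OF v] by simp
  define z where "z = ip u v"
  define m where "m = msq v"
  \<comment> \<open>The coefficient of the orthogonal projection of \<open>u\<close> to the line
    through \<open>v\<close>.\<close>
  define c where "c = z / of_real m"
  have m: "m > 0" using pos by (simp add: m_def)
  have zz: "z * cnj z = of_real ((cmod z)\<^sup>2)" "cnj z * z = of_real ((cmod z)\<^sup>2)"
    by (simp_all only: complex_norm_square mult.commute)
  have c: "cnj c * z = of_real ((cmod z)\<^sup>2 / m)" "c * cnj z = of_real ((cmod z)\<^sup>2 / m)"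
    "c * cnj c * of_real m = of_real ((cmod z)\<^sup>2 / m)"
    using m by (simp_all add: c_def zz)
  have w: "almost_periodic (\<lambda>x. u x - c * v x)"
    by (intro ap_intros u v)
  have "of_real (msq (\<lambda>x. u x - c * v x)) = ip (\<lambda>x. u x - c * v x) (\<lambda>x. u x - c * v x)"
    by (rule ip_self[OF w, symmetric])
  also have "\<dots> = ip u u - cnj c * z - c * cnj z + c * cnj c * ip v v"
    using u v by (simp add: ip_simps ip_cnj[OF u v] z_def algebra_simps)
  also have "\<dots> = of_real (msq u - (cmod z)\<^sup>2 / m)"
    by (simp only: ip_self u v c m_def[symmetric]) simp
  finally have "msq (\<lambda>x. u x - c * v x) = msq u - (cmod z)\<^sup>2 / m"
    by (simp only: of_real_eq_iff)
  then have "msq u - (cmod z)\<^sup>2 / m \<ge> 0"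
    using msq_nonneg[OF w] by simp
  then show ?thesis using m by (simp add: field_simps z_def m_def)
qed

section \<open>Convolution\<close>

lemma almost_periodic_conv_kernel:
  assumes "almost_periodic u" "almost_periodic v"
  shows "almost_periodic (\<lambda>p. u (fst p - snd p) * v (snd p))"
proof -
  have "almost_periodic (\<lambda>p. u ((fst p - snd p) + 0) * v (snd p + 0))"
    by (intro almost_periodic_mult almost_periodic_hom[of u "\<lambda>p. fst p - snd p" 0]
        almost_periodic_hom[of v snd 0] assms) simp_all
  then show ?thesis by simp
qed

lemma almost_periodic_conv [ap_intros]:
  assumes "almost_periodic u" "almost_periodic v"
  shows "almost_periodic (conv u v)"
  using almost_periodic_mean(1)[OF almost_periodic_conv_kernel[OF assms]]
  by (simp add: conv_def[abs_def])

lemma conv_commute: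
  assumes "almost_periodic u" "almost_periodic v"
  shows "conv u v = conv v u"
proof
  fix x
  have "mean (\<lambda>y. (\<lambda>z. u (x - z) * v z) (x - y)) = mean (\<lambda>z. u (x - z) * v z)"
    by (intro mean_reflect ap_intros assms)
  then show "conv u v x = conv v u x"
    by (simp add: conv_def mult.commute)
qed

text \<open>Interchange of the two means by \<open>mean_swap\<close>, followed by a shift of the
  inner variable.\<close>

lemma conv_assoc:
  assumes "almost_periodic u" "almost_periodic v" "almost_periodic w"
  shows "conv (conv u v) w = conv u (conv v w)"
proof
  fix x
  have "conv u (conv v w) x = mean (\<lambda>y. mean (\<lambda>z. u (x - y) * (v (y - z) * w z)))"
    unfolding conv_def by (subst mean_cmult) (auto intro!: ap_intros assms)
  also have "\<dots> = mean (\<lambda>z. mean (\<lambda>y. u (x - y) * (v (y - z) * w z)))"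
  proof -
    have "almost_periodic (\<lambda>p. u (- fst p + x) * (v (fst p - snd p) * w (snd p)))"
      by (intro almost_periodic_mult[of "\<lambda>p. u (- fst p + x)"] almost_periodic_conv_kernel assms
          almost_periodic_hom[of u "\<lambda>p. - fst p" x]) simp
    from mean_swap[OF this] show ?thesis by simp
  qed
  also have "\<dots> = mean (\<lambda>z. mean (\<lambda>y. u (x - z - y) * v y) * w z)"
  proof (rule arg_cong[where f = mean], rule ext)
    fix z
    have "mean (\<lambda>y. (\<lambda>y. u (x - z - y) * v y * w z) (y + (- z))) = mean (\<lambda>y. u (x - z - y) * v y * w z)"
      by (intro mean_shift ap_intros assms)
    then have "mean (\<lambda>y. u (x - y) * (v (y - z) * w z)) = mean (\<lambda>y. w z * (u (x - z - y) * v y))"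
      by (simp add: algebra_simps)
    also have "\<dots> = w z * mean (\<lambda>y. u (x - z - y) * v y)"
      by (intro mean_cmult ap_intros assms)
    finally show "mean (\<lambda>y. u (x - y) * (v (y - z) * w z)) = mean (\<lambda>y. u (x - z - y) * v y) * w z"
      by (simp add: mult.commute)
  qed
  finally show "conv (conv u v) w x = conv u (conv v w) x"
    by (simp add: conv_def)
qed

lemma conv_cmult_right:
  "almost_periodic u \<Longrightarrow> almost_periodic v \<Longrightarrow> conv u (\<lambda>x. c * v x) x = c * conv u v x"
  unfolding conv_def mult.left_commute[of _ c] by (intro mean_cmult ap_intros)

lemma conv_add_right:
  "almost_periodic u \<Longrightarrow> almost_periodic v \<Longrightarrow> almost_periodic w \<Longrightarrow>
    conv u (\<lambda>x. v x + w x) x = conv u v x + conv u w x"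
  unfolding conv_def distrib_left by (intro mean_add ap_intros)

lemma conv_shift_right:
  assumes "almost_periodic u" "almost_periodic v"
  shows "conv u (\<lambda>x. v (x + t)) x = conv u v (x + t)"
proof -
  have "mean (\<lambda>y. (\<lambda>y. u (x + t - y) * v y) (y + t)) = mean (\<lambda>y. u (x + t - y) * v y)"
    by (intro mean_shift ap_intros assms)
  then show ?thesis by (simp add: conv_def)
qed

lemma conv_hermitian:
  assumes "almost_periodic u" "almost_periodic v" "hermitian u" "hermitian v"
  shows "hermitian (conv u v)"
  unfolding hermitian_def
proof
  fix x
  have "cnj (conv u v (- x)) = mean (\<lambda>y. cnj (u (- x - y)) * cnj (v y))"
    unfolding conv_def complex_cnj_mult[symmetric] by (intro mean_cnj[symmetric] ap_intros assms)
  also have "\<dots> = mean (\<lambda>y. u (x + y) * v (- y))"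
    using assms(3,4) unfolding hermitian_def by (metis (no_types, opaque_lifting) minus_add_distrib minus_diff_eq
        diff_conv_add_uminus minus_minus)
  also have "\<dots> = mean (\<lambda>y. (\<lambda>z. u (x - z) * v z) (- y))"
    by simp
  also have "\<dots> = conv u v x"
    unfolding conv_def by (intro mean_minus ap_intros assms)
  finally show "cnj (conv u v (- x)) = conv u v x" .
qed

lemma conv_0_ip:
  assumes "almost_periodic u" "almost_periodic v" "hermitian v"
  shows "conv u v 0 = ip u v"
proof -
  have "conv u v 0 = mean (\<lambda>y. (\<lambda>z. u z * v (- z)) (- y))"
    by (simp add: conv_def)
  also have "\<dots> = mean (\<lambda>z. u z * v (- z))"
    by (intro mean_minus ap_intros assms)
  also have "(\<lambda>z. u z * v (- z)) = (\<lambda>z. u z * cnj (v z))"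
    using assms(3) unfolding hermitian_def by (metis minus_minus)
  finally show ?thesis by (simp add: ip_def)
qed

lemma msq_reflect: "almost_periodic u \<Longrightarrow> msq (\<lambda>y. u (x - y)) = msq u"
  using mean_reflect[of "\<lambda>y. u y * cnj (u y)" x] by (simp add: msq_def ip_def ap_intros)

lemma msq_cnj: "almost_periodic u \<Longrightarrow> msq (\<lambda>y. cnj (u y)) = msq u"
  by (simp add: msq_def ip_def mult.commute)

lemma conv_le:
  assumes "almost_periodic u" "almost_periodic v"
  shows "(cmod (conv u v x))\<^sup>2 \<le> msq u * msq v"
proof -
  have "conv u v x = ip (\<lambda>y. u (x - y)) (\<lambda>y. cnj (v y))"
    by (simp add: conv_def ip_def)
  also have "(cmod \<dots>)\<^sup>2 \<le> msq (\<lambda>y. u (x - y)) * msq (\<lambda>y. cnj (v y))"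
    by (intro ip_cauchy_schwarz ap_intros assms)
  finally show ?thesis by (simp add: msq_reflect msq_cnj assms)
qed

text \<open>The colouring depends on \<open>u\<close> alone, and \<open>v\<close> enters only by its
  bound. So \<open>conv u\<close> maps bounded families to families with common colourings, which is
  compactness of the convolution operator in the form used below.\<close>

lemma equi_translates_conv:
  assumes "almost_periodic u" "almost_periodic v" "equi_translates \<epsilon> \<kappa> u" "\<And>x. cmod (v x) \<le> B"
  shows "equi_translates (\<epsilon> * B) \<kappa> (conv u v)"
  unfolding equi_translates_def conv_def
proof (intro allI impI mean_close ap_intros assms(1,2))
  fix s t r y assume st: "\<kappa> s = \<kappa> t"
  have "cmod (u (r - y + s) - u (r - y + t)) \<le> \<epsilon>"
    by (rule equi_translatesD[OF assms(3) st])
  moreover have "0 \<le> \<epsilon>" using calculation norm_ge_zero order_trans by blast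
  moreover have "u (r + s - y) * v y - u (r + t - y) * v y = (u (r - y + s) - u (r - y + t)) * v y"
    by (simp add: algebra_simps)
  ultimately show "cmod (u (r + s - y) * v y - u (r + t - y) * v y) \<le> \<epsilon> * B"
    using assms(4)[of y] by (simp add: norm_mult mult_mono)
qed

section \<open>Positive definite functions\<close>

lemma positive_definiteD:
  "positive_definite p \<Longrightarrow> (\<Sum>a\<leftarrow>xs. \<Sum>b\<leftarrow>xs. snd a * cnj (snd b) * p (fst a - fst b)) \<in> \<real>\<^sub>\<ge>\<^sub>0"
  by (auto simp: positive_definite_def)

lemma sum_list_cnj: "cnj (\<Sum>a\<leftarrow>xs. f a) = (\<Sum>a\<leftarrow>xs. cnj (f a))"
  by (induction xs) auto

text \<open>As \<open>v\<close> is hermitian, \<open>conv v v (x - y)\<close> is the mean inner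
  product of the functions sending \<open>z\<close> to \<open>v (x - z)\<close> and
  \<open>v (y - z)\<close>. The quadratic form is therefore a Gram form, equal to the mean square of
  \<open>S\<close>.\<close>

lemma positive_definite_conv:
  assumes v: "almost_periodic v" and "hermitian v"
  shows "positive_definite (conv v v)"
  unfolding positive_definite_def
proof
  fix xs :: "('a \<times> complex) list"
  have h: "v (- z) = cnj (v z)" for z
    using assms(2) unfolding hermitian_def by (metis minus_minus)
  define S where "S z = (\<Sum>a\<leftarrow>xs. snd a * v (fst a - z))" for z
  have S: "almost_periodic S" unfolding S_def by (intro ap_intros v)
  have conv: "conv v v (x - y) = mean (\<lambda>z. v (x - z) * cnj (v (y - z)))" for x y
  proof -
    have "mean (\<lambda>z. (\<lambda>z. v (x - y - z) * v z) (z + (- y))) = conv v v (x - y)"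
      unfolding conv_def by (intro mean_shift ap_intros v)
    then show ?thesis
      using h[of "y - _"] by simp
  qed
  have "(\<Sum>a\<leftarrow>xs. \<Sum>b\<leftarrow>xs. snd a * cnj (snd b) * conv v v (fst a - fst b))
      = mean (\<lambda>z. \<Sum>a\<leftarrow>xs. \<Sum>b\<leftarrow>xs. snd a * cnj (snd b) * (v (fst a - z) * cnj (v (fst b - z))))"
    unfolding conv using v by (simp add: mean_sum_list mean_cmult ap_intros)
  also have "\<dots> = mean (\<lambda>z. S z * cnj (S z))"
  proof (rule arg_cong[where f = mean], rule ext)
    fix z
    show "(\<Sum>a\<leftarrow>xs. \<Sum>b\<leftarrow>xs. snd a * cnj (snd b) * (v (fst a - z) * cnj (v (fst b - z)))) = S z * cnj (S z)"
      unfolding S_def sum_list_cnj sum_list_mult_const[symmetric] sum_list_const_mult[symmetric]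
      by (subst sum_list_swap) (simp add: mult_ac)
  qed
  also have "\<dots> = of_real (msq S)"
    using ip_self[OF S] by (simp add: ip_def)
  finally show "(\<Sum>a\<leftarrow>xs. \<Sum>b\<leftarrow>xs. snd a * cnj (snd b) * conv v v (fst a - fst b)) \<in> \<real>\<^sub>\<ge>\<^sub>0"
    using msq_nonneg[OF S] by simp
qed

lemma positive_definite_add:
  assumes "positive_definite p" "positive_definite q"
  shows "positive_definite (\<lambda>x. p x + q x)"
  unfolding positive_definite_def distrib_left sum_list_addf
  using assms by (auto intro!: nonneg_Reals_add_I positive_definiteD)

lemma positive_definite_cmult:
  assumes "positive_definite p" "c \<ge> 0"
  shows "positive_definite (\<lambda>x. of_real c * p x)"
  unfolding positive_definite_def
proof
  fix xs :: "('a \<times> complex) list"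
  have "(\<Sum>a\<leftarrow>xs. \<Sum>b\<leftarrow>xs. snd a * cnj (snd b) * (of_real c * p (fst a - fst b)))
      = of_real c * (\<Sum>a\<leftarrow>xs. \<Sum>b\<leftarrow>xs. snd a * cnj (snd b) * p (fst a - fst b))"
    by (simp add: mult_ac flip: sum_list_const_mult)
  then show "(\<Sum>a\<leftarrow>xs. \<Sum>b\<leftarrow>xs. snd a * cnj (snd b) * (of_real c * p (fst a - fst b))) \<in> \<real>\<^sub>\<ge>\<^sub>0"
    using positive_definiteD[OF assms(1)] assms(2) by (simp add: nonneg_Reals_mult_I)
qed

lemma positive_definite_limit:
  assumes "\<And>n. positive_definite (p n)" "\<And>x. (\<lambda>n. p n x) \<longlonglongrightarrow> q x"
  shows "positive_definite q"
  unfolding positive_definite_def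
proof
  fix xs :: "('a \<times> complex) list"
  have tl: "(\<lambda>n. \<Sum>a\<leftarrow>ys. f n a) \<longlonglongrightarrow> (\<Sum>a\<leftarrow>ys. g a)" if "\<And>a. (\<lambda>n. f n a) \<longlonglongrightarrow> g a"
    for ys :: "('a \<times> complex) list" and f :: "nat \<Rightarrow> _ \<Rightarrow> complex" and g
    by (induction ys) (auto intro: tendsto_intros that)
  have "(\<lambda>n. \<Sum>a\<leftarrow>xs. \<Sum>b\<leftarrow>xs. snd a * cnj (snd b) * p n (fst a - fst b))
      \<longlonglongrightarrow> (\<Sum>a\<leftarrow>xs. \<Sum>b\<leftarrow>xs. snd a * cnj (snd b) * q (fst a - fst b))"
    by (intro tl tendsto_intros assms(2))
  then show "(\<Sum>a\<leftarrow>xs. \<Sum>b\<leftarrow>xs. snd a * cnj (snd b) * q (fst a - fst b)) \<in> \<real>\<^sub>\<ge>\<^sub>0"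
    by (rule closed_sequentially[OF closed_nonneg_Reals_complex, rotated])
      (auto intro: positive_definiteD assms(1))
qed

text \<open>Doubling the test points: the form of the new function at the points \<open>x\<^sub>i\<close> is the form of \<open>p\<close>
  at the points \<open>x\<^sub>i\<close> and \<open>x\<^sub>i + t\<close>.\<close>

lemma positive_definite_shift:
  assumes "positive_definite p" "cmod e = 1"
  shows "positive_definite (\<lambda>x. 2 * p x + (e * p (x + t) + cnj e * p (x - t)))"
  unfolding positive_definite_def
proof
  fix xs :: "('a \<times> complex) list"
  define ys where "ys = xs @ map (\<lambda>a. (fst a + t, e * snd a)) xs"
  have e: "e * cnj e = 1" using assms(2) by (simp add: complex_norm_square[symmetric])
  have e': "(e * c) * cnj (e * d) * z = c * cnj d * z" for c d z
  proof -
    have "(e * c) * cnj (e * d) * z = (e * cnj e) * (c * cnj d * z)" by (simp add: mult_ac)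
    then show ?thesis by (simp add: e)
  qed
  have split: "(\<Sum>a\<leftarrow>ys. \<Sum>b\<leftarrow>ys. G a b) = (\<Sum>a\<leftarrow>xs. \<Sum>b\<leftarrow>xs. (G a b + G a (fst b + t, e * snd b)) +
      (G (fst a + t, e * snd a) b + G (fst a + t, e * snd a) (fst b + t, e * snd b)))" for G :: "_ \<Rightarrow> _ \<Rightarrow> complex"
    by (simp add: ys_def o_def sum_list_addf)
  have args: "x - (y + t) = x - y - t" "x + t - y = x - y + t" "x + t - (y + t) = x - y" for x y
    by (simp_all add: algebra_simps)
  have "(\<Sum>a\<leftarrow>ys. \<Sum>b\<leftarrow>ys. snd a * cnj (snd b) * p (fst a - fst b))
      = (\<Sum>a\<leftarrow>xs. \<Sum>b\<leftarrow>xs. snd a * cnj (snd b) * (2 * p (fst a - fst b) +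
          (e * p (fst a - fst b + t) + cnj e * p (fst a - fst b - t))))"
    unfolding split fst_conv snd_conv args e' by (simp add: algebra_simps)
  then show "(\<Sum>a\<leftarrow>xs. \<Sum>b\<leftarrow>xs. snd a * cnj (snd b) * (2 * p (fst a - fst b) +
          (e * p (fst a - fst b + t) + cnj e * p (fst a - fst b - t)))) \<in> \<real>\<^sub>\<ge>\<^sub>0"
    using positive_definiteD[OF assms(1), of ys] by simp
qed

lemma positive_definite_two_points:
  assumes "positive_definite p"
  shows "p 0 + cnj b * p (- x) + (b * p x + b * cnj b * p 0) \<in> \<real>\<^sub>\<ge>\<^sub>0"
  using positive_definiteD[OF assms, of "[(0, 1), (x, b)]"] by simp

text \<open>The two-point form has to be real. The coefficient 1 gives the imaginary part of the
  claim, the coefficient \<open>\<i>\<close> the real part.\<close>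

lemma positive_definite_hermitian:
  assumes "positive_definite p"
  shows "p (- x) = cnj (p x)"
proof -
  have "p 0 \<in> \<real>\<^sub>\<ge>\<^sub>0" using positive_definiteD[OF assms, of "[(0, 1)]"] by simp
  then have "Im (p 0) = 0" by (auto simp: complex_nonneg_Reals_iff)
  then show ?thesis
    using positive_definite_two_points[OF assms, of 1 x] positive_definite_two_points[OF assms, of \<i> x]
    by (auto simp: complex_nonneg_Reals_iff complex_eq_iff)
qed

lemma positive_definite_le:
  assumes "positive_definite p"
  shows "cmod (p x) \<le> Re (p 0)"
proof (cases "p x = 0")
  case True
  then show ?thesis
    using positive_definiteD[OF assms, of "[(0, 1)]"] by (simp add: complex_nonneg_Reals_iff)
next
  case False
  define c where "c = complex_of_real (cmod (p x))"
  have c: "c \<noteq> 0" "cnj c = c" using False by (simp_all add: c_def)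
  have sq: "p x * cnj (p x) = c * c"
    unfolding c_def power2_eq_square[symmetric] by (rule complex_norm_square[symmetric, simplified of_real_power])
  \<comment> \<open>The phase with \<open>b * p x\<close> equal to \<open>- cmod (p x)\<close>: it
    makes the two-point form as small as possible, namely
    \<open>2 * p 0 - 2 * cmod (p x)\<close>.\<close>
  define b where "b = - (cnj (p x) / c)"
  have bp: "b * p x = - c"
  proof -
    have "b * p x = - (p x * cnj (p x) / c)" by (simp add: b_def)
    then show ?thesis unfolding sq using c by simp
  qed
  have bb: "b * cnj b = 1"
  proof -
    have "b * cnj b = p x * cnj (p x) / (c * c)" by (simp add: b_def c)
    then show ?thesis unfolding sq using c by simp
  qed
  have "cnj b * p (- x) = cnj (b * p x)"
    by (simp add: positive_definite_hermitian[OF assms])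
  also have "\<dots> = - c" by (simp add: bp c)
  finally have "p 0 + (- c) + (- c + 1 * p 0) \<in> \<real>\<^sub>\<ge>\<^sub>0"
    using positive_definite_two_points[OF assms, of b x] by (simp only: bp bb)
  then show ?thesis
    by (simp add: c_def complex_nonneg_Reals_iff)
qed

section \<open>Fourier approximation of almost periodic functions\<close>

lemma equi_translates_limit:
  assumes "\<And>n. equi_translates \<epsilon> \<kappa> (f n)" "\<And>x. (\<lambda>n. f n x) \<longlonglongrightarrow> g x"
  shows "equi_translates \<epsilon> \<kappa> g"
  unfolding equi_translates_def
proof (intro allI impI)
  fix s t r assume st: "\<kappa> s = \<kappa> t"
  have "(\<lambda>n. cmod (f n (r + s) - f n (r + t))) \<longlonglongrightarrow> cmod (g (r + s) - g (r + t))"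
    by (intro tendsto_intros assms(2))
  then show "cmod (g (r + s) - g (r + t)) \<le> \<epsilon>"
    by (rule LIMSEQ_le_const2) (use equi_translatesD[OF assms(1) st] in blast)
qed

text \<open>Arzela-Ascoli with colourings in place of a topology on the group. Representatives of
  the colours at all scales \<open>1 / (m + 1)\<close> form a countable set \<open>S\<close>, on
  which a diagonal subsequence converges; each point behaves, uniformly in \<open>n\<close>, like
  one of the finitely many representatives of a given scale.\<close>

lemma uniformly_convergent_subsequence:
  fixes f :: "nat \<Rightarrow> 'g::ab_group_add \<Rightarrow> complex"
  assumes equi: "\<And>\<epsilon>. \<epsilon> > 0 \<Longrightarrow> \<exists>\<kappa>. finite (range \<kappa>) \<and> (\<forall>n. equi_translates \<epsilon> \<kappa> (f n))"
    and bd: "\<And>n x. cmod (f n x) \<le> B"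
  obtains r g where "strict_mono (r :: nat \<Rightarrow> nat)" "uniform_limit UNIV (\<lambda>n. f (r n)) g sequentially"
    "almost_periodic g"
proof -
  have "\<exists>ts. \<forall>s. \<exists>t\<in>set ts. \<forall>n. cmod (f n s - f n t) \<le> inverse (real (Suc m))" for m
  proof -
    obtain \<kappa> where \<kappa>: "finite (range \<kappa>)" "\<And>n. equi_translates (inverse (real (Suc m))) \<kappa> (f n)"
      using equi[of "inverse (real (Suc m))"] by auto
    obtain ts where ts: "\<And>s. \<exists>t\<in>set ts. \<kappa> s = \<kappa> t"
      using finite_representatives[OF \<kappa>(1)] by metis
    have "\<exists>t\<in>set ts. \<forall>n. cmod (f n s - f n t) \<le> inverse (real (Suc m))" for s
    proof -
      obtain t where t: "t \<in> set ts" "\<kappa> s = \<kappa> t" using ts by blast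
      have "cmod (f n (0 + s) - f n (0 + t)) \<le> inverse (real (Suc m))" for n
        by (rule equi_translatesD[OF \<kappa>(2) t(2)])
      then show ?thesis using t(1) by auto
    qed
    then show ?thesis by blast
  qed
  then obtain ts where ts: "\<And>m s. \<exists>t\<in>set (ts m). \<forall>n. cmod (f n s - f n t) \<le> inverse (real (Suc m))"
    by metis
  define S where "S = (\<Union>m. set (ts m))"
  have "countable S" unfolding S_def by (rule countable_UN) (auto intro: countable_finite)
  then obtain r where r: "strict_mono (r :: nat \<Rightarrow> nat)" "\<And>x. x \<in> S \<Longrightarrow> \<exists>l. (\<lambda>n. f (r n) x) \<longlonglongrightarrow> l"
    using function_convergent_subsequence[of S f B] bd by metis
  have "uniformly_Cauchy_on UNIV (\<lambda>n. f (r n))"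
    unfolding uniformly_Cauchy_on_def
  proof (intro allI impI)
    fix e :: real assume "e > 0"
    then obtain m where m: "inverse (real (Suc m)) < e / 3"
      using reals_Archimedean[of "e / 3"] by auto
    have "\<exists>N. \<forall>n\<ge>N. \<forall>k\<ge>N. dist (f (r n) t) (f (r k) t) < e / 3" if "t \<in> S" for t
    proof -
      have "Cauchy (\<lambda>n. f (r n) t)"
        using r(2)[OF that] LIMSEQ_imp_Cauchy by blast
      from metric_CauchyD[OF this, of "e / 3"] show ?thesis using \<open>e > 0\<close> by simp
    qed
    then obtain N where N: "\<And>t n k. t \<in> S \<Longrightarrow> n \<ge> N t \<Longrightarrow> k \<ge> N t \<Longrightarrow> dist (f (r n) t) (f (r k) t) < e / 3"
      by metis
    define M where "M = (\<Sum>t\<in>set (ts m). N t)"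
    have "dist (f (r n) x) (f (r k) x) < e" if "n \<ge> M" "k \<ge> M" for n k x
    proof -
      obtain t where t: "t \<in> set (ts m)" "\<And>n. cmod (f n x - f n t) \<le> inverse (real (Suc m))"
        using ts by blast
      have "N t \<le> M" unfolding M_def by (rule member_le_sum) (use t in auto)
      then have "dist (f (r n) t) (f (r k) t) < e / 3"
        using that t(1) by (intro N) (auto simp: S_def)
      moreover have "dist (f (r n) x) (f (r n) t) < e / 3" "dist (f (r k) x) (f (r k) t) < e / 3"
        unfolding dist_norm by (rule le_less_trans[OF t(2) m])+
      ultimately show ?thesis
        using dist_triangle[of "f (r n) x" "f (r k) x" "f (r n) t"]
          dist_triangle[of "f (r n) t" "f (r k) x" "f (r k) t"] dist_commute[of "f (r k) x" "f (r k) t"]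
        by linarith
    qed
    then show "\<exists>M. \<forall>x\<in>UNIV. \<forall>n\<ge>M. \<forall>k\<ge>M. dist (f (r n) x) (f (r k) x) < e" by blast
  qed
  then obtain g where g: "uniform_limit UNIV (\<lambda>n. f (r n)) g sequentially"
    using Cauchy_uniformly_convergent unfolding uniformly_convergent_on_def by blast
  have "almost_periodic g"
    unfolding almost_periodic_def
  proof (intro allI impI)
    fix \<epsilon> :: real assume "\<epsilon> > 0"
    then obtain \<kappa> where \<kappa>: "finite (range \<kappa>)" "\<And>n. equi_translates \<epsilon> \<kappa> (f n)" using equi by blast
    have "equi_translates \<epsilon> \<kappa> g"
      by (rule equi_translates_limit[of \<epsilon> \<kappa> "\<lambda>n. f (r n)"])
        (auto intro: \<kappa> tendsto_uniform_limitI[OF g])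
    then show "\<exists>\<kappa>. finite (range \<kappa>) \<and> equi_translates \<epsilon> \<kappa> g" using \<kappa>(1) by blast
  qed
  then show ?thesis using that r(1) g by blast
qed

lemma almost_periodic_bounded_range: "almost_periodic u \<Longrightarrow> bounded (u ` S)"
  by (rule almost_periodic_bounded) (auto intro!: boundedI)

lemma uniform_limit_cmult:
  fixes u :: "nat \<Rightarrow> 'a \<Rightarrow> complex"
  assumes "uniform_limit UNIV u v sequentially"
  shows "uniform_limit UNIV (\<lambda>n x. c * u n x) (\<lambda>x. c * v x) sequentially"
  by (intro bounded_linear.uniform_limit[OF bounded_linear_mult_right] assms)

lemma msq_tendsto:
  assumes u: "\<And>n. almost_periodic (u n)" and v: "almost_periodic v"
    and lim: "uniform_limit UNIV u v sequentially"
  shows "(\<lambda>n. msq (u n)) \<longlonglongrightarrow> msq v"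
proof -
  have cnj: "uniform_limit UNIV (\<lambda>n x. cnj (u n x)) (\<lambda>x. cnj (v x)) sequentially"
    by (intro bounded_linear.uniform_limit[OF bounded_linear_cnj] lim)
  have "uniform_limit UNIV (\<lambda>n x. u n x * cnj (u n x)) (\<lambda>x. v x * cnj (v x)) sequentially"
    by (intro uniform_lim_mult lim cnj almost_periodic_bounded_range ap_intros v)
  then show ?thesis
    unfolding msq_def ip_def by (intro tendsto_Re mean_tendsto ap_intros u v)
qed

lemma conv_tendsto:
  assumes u: "\<And>n. almost_periodic (u n)" and v: "almost_periodic v" and k: "almost_periodic k"
    and lim: "uniform_limit UNIV u v sequentially"
  shows "uniform_limit UNIV (\<lambda>n. conv k (u n)) (conv k v) sequentially"
proof (rule uniform_limitI)
  fix e :: real assume "e > 0"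
  obtain B where B: "B \<ge> 0" "\<And>x. cmod (k x) \<le> B" using almost_periodic_bounded[OF k] by blast
  define \<delta> where "\<delta> = e / (B + 1)"
  have \<delta>: "\<delta> > 0" using \<open>e > 0\<close> B by (simp add: \<delta>_def)
  have "\<forall>\<^sub>F n in sequentially. \<forall>x\<in>UNIV. dist (u n x) (v x) < \<delta>"
    using lim \<delta> by (rule uniform_limitD)
  then show "\<forall>\<^sub>F n in sequentially. \<forall>x\<in>UNIV. dist (conv k (u n) x) (conv k v x) < e"
  proof eventually_elim
    case (elim n)
    have "cmod (conv k (u n) x - conv k v x) \<le> B * \<delta>" for x
      unfolding conv_def
    proof (intro mean_close ap_intros k u v)
      fix y
      have "cmod (k (x - y)) * cmod (u n y - v y) \<le> B * \<delta>"
        using elim B by (intro mult_mono) (auto simp: dist_norm less_imp_le)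
      then show "cmod (k (x - y) * u n y - k (x - y) * v y) \<le> B * \<delta>"
        by (simp add: norm_mult flip: right_diff_distrib)
    qed
    moreover have "B * \<delta> < (B + 1) * \<delta>" using \<delta> by simp
    moreover have "(B + 1) * \<delta> = e" using B by (simp add: \<delta>_def)
    ultimately show ?case by (auto simp: dist_norm intro: le_less_trans)
  qed
qed

text \<open>Power iteration replaces the spectral theorem for the compact operator \<open>conv w\<close>: \<open>k n\<close> is the
  \<open>(2 * n + 2)\<close>-fold convolution power of \<open>w\<close> and \<open>b n\<close> its value at \<open>0\<close>. Log-convexity of \<open>b\<close> makes
  the ratios \<open>r n\<close> increase to an eigenvalue \<open>lam\<close> of \<open>conv (k 0)\<close>, and the limit points of \<open>p n\<close> are
  positive definite eigenfunctions. The set \<open>P\<close> of these, normalised at \<open>0\<close>, is convex, and \<^const>\<open>msq\<close>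
  is strictly convex, so a maximiser of \<^const>\<open>msq\<close> is an extreme point of \<open>P\<close>; extreme points are
  characters.\<close>

locale hermitian_kernel =
  fixes w :: "'g::ab_group_add \<Rightarrow> complex"
  assumes ap: "almost_periodic w" and herm: "hermitian w" and nonzero: "\<exists>x. w x \<noteq> 0"
begin

text \<open>The \<open>(n + 1)\<close>-fold convolution power of \<open>w\<close>; hence the
  \<open>Suc\<close> in the index when powers are convolved.\<close>

definition W :: "nat \<Rightarrow> 'g \<Rightarrow> complex"
  where "W n = (conv w ^^ n) w"

definition b :: "nat \<Rightarrow> real"
  where "b n = msq (W n)"

lemma W_simps [simp]: "W 0 = w" "W (Suc n) = conv w (W n)"
  by (simp_all add: W_def)

lemma W_ap [ap_intros]: "almost_periodic (W n)"
  by (induction n) (auto intro: ap_intros ap)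

lemma W_hermitian: "hermitian (W n)"
  by (induction n) (auto intro: conv_hermitian ap herm W_ap)

lemma conv_W: "conv (W m) (W n) = W (Suc (m + n))"
  by (induction m) (simp_all add: conv_assoc ap W_ap)

lemma ip_W: "ip (W m) (W n) = W (Suc (m + n)) 0"
  using conv_0_ip[OF W_ap W_ap W_hermitian] by (simp only: conv_W)

lemma b_eq: "W (Suc (2 * n)) 0 = of_real (b n)"
  using ip_W[of n n] ip_self[OF W_ap, of n] by (simp add: b_def mult_2)

lemma ip_W_even:
  assumes "even (m + n)"
  shows "ip (W m) (W n) = of_real (b ((m + n) div 2))"
  using assms b_eq[of "(m + n) div 2"] ip_W[of m n] by simp

lemma b_nonneg: "b n \<ge> 0"
  unfolding b_def by (rule msq_nonneg[OF W_ap])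

text \<open>Cauchy-Schwarz for \<open>W n\<close> and \<open>W (n + 2)\<close>, whose inner product
  depends only on the sum of the indices and so equals \<open>b (n + 1)\<close>.\<close>

lemma b_log_convex: "(b (Suc n))\<^sup>2 \<le> b n * b (Suc (Suc n))"
proof -
  have "ip (W n) (W (Suc (Suc n))) = of_real (b (Suc n))"
    by (subst ip_W_even) auto
  then show ?thesis
    using ip_cauchy_schwarz[OF W_ap W_ap, of n "Suc (Suc n)"] unfolding b_def[symmetric]
    by (simp add: b_nonneg)
qed

lemma b_pos: "b n > 0"
proof -
  have b0: "b 0 > 0"
    using nonzero msq_eq_0D[OF ap] b_nonneg[of 0] by (force simp: b_def)
  \<comment> \<open>If \<open>b 1\<close> were 0 then \<open>conv w w\<close> would vanish, but its
    value at 0 is \<open>b 0\<close>. Log-convexity carries positivity from two consecutive indices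
    to all later ones.\<close>
  have "b 1 \<noteq> 0"
  proof
    assume "b 1 = 0"
    then have "W 1 0 = 0" unfolding b_def by (intro msq_eq_0D W_ap)
    then show False using b_eq[of 0] b0 by simp
  qed
  then have b1: "b 1 > 0" using b_nonneg[of 1] by simp
  have "b n > 0 \<and> b (Suc n) > 0"
  proof (induction n)
    case (Suc n)
    then have "0 < (b (Suc n))\<^sup>2" by simp
    also have "\<dots> \<le> b n * b (Suc (Suc n))" by (rule b_log_convex)
    finally show ?case using Suc by (simp add: zero_less_mult_iff)
  qed (use b0 b1 in simp)
  then show ?thesis by simp
qed

text \<open>Only even powers of \<open>w\<close> are used: as convolution squares of hermitian
  functions they are positive definite, and so are the limits of their normalisations.\<close>

definition k :: "nat \<Rightarrow> 'g \<Rightarrow> complex"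
  where "k n = W (Suc (2 * n))"

lemma k_conv: "k n = conv (W n) (W n)"
  unfolding k_def conv_W mult_2 ..

lemma k_ap [ap_intros]: "almost_periodic (k n)"
  by (simp add: k_def W_ap del: W_simps)

lemma k_le: "cmod (k n x) \<le> b n"
  using conv_le[OF W_ap W_ap, of n n x] b_nonneg[of n]
  by (simp add: k_conv b_def[symmetric] flip: power2_eq_square)

lemma k_0: "k n 0 = of_real (b n)"
  unfolding k_def by (rule b_eq)

lemma conv_k: "conv (k 0) (k n) = k (Suc n)"
  unfolding k_def conv_W by simp

lemma ip_k: "ip (k m) (k n) = of_real (b (m + n + 1))"
  unfolding k_def by (subst ip_W_even) (auto simp: algebra_simps simp del: W_simps)

lemma k_positive_definite: "positive_definite (k n)"
  unfolding k_conv by (intro positive_definite_conv W_ap W_hermitian)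

definition r :: "nat \<Rightarrow> real"
  where "r n = b (Suc n) / b n"

lemma b_Suc: "b (Suc n) = r n * b n"
  using b_pos[of n] by (simp add: r_def)

lemma r_pos: "r n > 0"
  using b_pos by (simp add: r_def)

lemma r_mono: "incseq r"
proof (rule incseq_SucI)
  fix n
  have "b (Suc n) * b (Suc n) \<le> b n * b (Suc (Suc n))"
    using b_log_convex[of n] by (simp add: power2_eq_square)
  then show "r n \<le> r (Suc n)"
    using b_pos[of n] b_pos[of "Suc n"] by (simp add: r_def field_simps)
qed

lemma r_bounded: "r n \<le> b 0"
proof -
  have "cmod (conv (k 0) (k n) 0) \<le> b 0 * b n"
    unfolding conv_def
    by (intro mean_le ap_intros) (auto simp: norm_mult intro!: mult_mono k_le b_nonneg)
  then have "b (Suc n) \<le> b 0 * b n"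
    using b_nonneg by (simp add: conv_k k_0)
  then show ?thesis using b_pos[of n] by (simp add: r_def divide_le_eq)
qed

definition lam :: real
  where "lam = lim r"

lemma r_tendsto: "r \<longlonglongrightarrow> lam"
proof -
  obtain l where "r \<longlonglongrightarrow> l"
    using incseq_convergent[OF r_mono] r_bounded by blast
  then show ?thesis by (simp add: lam_def limI)
qed

lemma r_le_lam: "r n \<le> lam"
  using r_mono r_tendsto by (rule incseq_le)

lemma lam_pos: "lam > 0"
  using r_pos[of 0] r_le_lam[of 0] by linarith

definition p :: "nat \<Rightarrow> 'g \<Rightarrow> complex"
  where "p n x = of_real (1 / b n) * k n x"

lemma p_ap [ap_intros]: "almost_periodic (p n)"
  unfolding p_def[abs_def] by (intro ap_intros)

lemma p_0: "p n 0 = 1"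
  using b_pos[of n] by (simp add: p_def k_0)

lemma p_le: "cmod (p n x) \<le> 1"
  using k_le[of n x] b_pos[of n] by (simp add: p_def norm_mult norm_divide divide_le_eq)

lemma conv_p: "conv (k 0) (p n) x = of_real (r n) * p (Suc n) x"
proof -
  have "conv (k 0) (p n) x = of_real (1 / b n) * k (Suc n) x"
    unfolding p_def[abs_def] by (subst conv_cmult_right) (simp_all add: k_ap conv_k)
  then show ?thesis
    using b_pos[of n] b_pos[of "Suc n"] by (simp add: p_def r_def)
qed

lemma p_positive_definite: "positive_definite (p n)"
  unfolding p_def[abs_def] using b_pos[of n]
  by (intro positive_definite_cmult k_positive_definite) simp

text \<open>From the index 1 on, \<open>p (Suc n)\<close> is \<open>conv (k 0) (p n)\<close> divided
  by \<open>r n\<close>. Since \<open>r n\<close> is at least \<open>r 0\<close> and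
  \<open>p n\<close> is bounded by 1, a colouring of \<open>k 0\<close> alone serves all of
  them.\<close>

lemma p_equi:
  assumes "\<epsilon> > 0"
  shows "\<exists>\<kappa>. finite (range \<kappa>) \<and> (\<forall>n. equi_translates \<epsilon> \<kappa> (p (Suc n)))"
proof -
  have "\<epsilon> * r 0 > 0" using assms r_pos by simp
  then obtain \<kappa> where \<kappa>: "finite (range \<kappa>)" "equi_translates (\<epsilon> * r 0) \<kappa> (k 0)"
    using almost_periodicD[OF k_ap] by blast
  have "equi_translates \<epsilon> \<kappa> (p (Suc n))" for n
    unfolding equi_translates_def
  proof (intro allI impI)
    fix s t x assume "\<kappa> s = \<kappa> t"
    then have "cmod (conv (k 0) (p n) (x + s) - conv (k 0) (p n) (x + t)) \<le> \<epsilon> * r 0 * 1"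
      by (rule equi_translatesD[OF equi_translates_conv[OF k_ap p_ap \<kappa>(2) p_le]])
    also have "\<dots> \<le> \<epsilon> * r n"
      using r_mono assms by (simp add: incseq_def)
    finally have "r n * cmod (p (Suc n) (x + s) - p (Suc n) (x + t)) \<le> \<epsilon> * r n"
      unfolding conv_p right_diff_distrib[symmetric] norm_mult using r_pos[of n] by simp
    then show "cmod (p (Suc n) (x + s) - p (Suc n) (x + t)) \<le> \<epsilon>"
      using r_pos[of n] by (simp add: mult.commute)
  qed
  then show ?thesis using \<kappa>(1) by blast
qed

text \<open>All inner products of the \<open>k n\<close> are values of \<open>b\<close>. With
  \<beta> for \<open>b (2 * n + 1)\<close> and \<open>s\<close>, \<open>s'\<close> for the next two
  ratios, the squared norm of \<open>k (Suc n) - lam * k n\<close> is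
  \<open>\<beta> * (s' * s - 2 * lam * s + lam * lam)\<close>; both ratios are at most
  \<open>lam\<close>, and \<beta> is at most \<open>(b n)\<^sup>2\<close>, the square of the
  normalising factor. The bound tends to 0 because the ratios tend to \<open>lam\<close>.\<close>

lemma residual: "msq (\<lambda>x. conv (k 0) (p n) x - of_real lam * p n x) \<le> 2 * lam * (lam - r (2 * n + 1))"
proof -
  define v where "v x = k (Suc n) x - of_real lam * k n x" for x
  have v: "almost_periodic v" unfolding v_def by (intro ap_intros)
  have "ip v v = of_real (b (2 * n + 3)) - of_real lam * of_real (b (2 * n + 2))
      - of_real lam * (of_real (b (2 * n + 2)) - of_real lam * of_real (b (2 * n + 1)))"
  proof -
    have "ip v v = ip (k (Suc n)) (k (Suc n)) - of_real lam * ip (k (Suc n)) (k n)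
        - of_real lam * (ip (k n) (k (Suc n)) - of_real lam * ip (k n) (k n))"
      unfolding v_def[abs_def] by (simp add: ip_simps k_ap algebra_simps)
    moreover have "Suc n + Suc n + 1 = 2 * n + 3" "Suc n + n + 1 = 2 * n + 2" "n + Suc n + 1 = 2 * n + 2"
      "n + n + 1 = 2 * n + 1" by simp_all
    ultimately show ?thesis unfolding ip_k by presburger
  qed
  also have "\<dots> = of_real (b (2 * n + 3) - lam * b (2 * n + 2) - lam * (b (2 * n + 2) - lam * b (2 * n + 1)))"
    by simp
  finally have eq: "msq v = b (2 * n + 3) - lam * b (2 * n + 2) - lam * (b (2 * n + 2) - lam * b (2 * n + 1))"
    unfolding msq_def by (simp only: Re_complex_of_real)
  define \<beta> where "\<beta> = b (2 * n + 1)"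
  define s where "s = r (2 * n + 1)"
  define s' where "s' = r (2 * n + 2)"
  have bs: "b (2 * n + 2) = s * \<beta>" "b (2 * n + 3) = s' * (s * \<beta>)"
    using b_Suc[of "2 * n + 1"] b_Suc[of "2 * n + 2"] by (simp_all add: s_def s'_def \<beta>_def numeral_3_eq_3 numeral_2_eq_2)
  have s: "0 < s" "s \<le> lam" "s' \<le> lam" "0 < \<beta>"
    by (simp_all add: s_def s'_def r_pos r_le_lam \<beta>_def b_pos)
  have "msq v = \<beta> * (s' * s - 2 * lam * s + lam * lam)"
    unfolding eq bs \<beta>_def[symmetric] by (simp add: algebra_simps)
  also have "\<dots> \<le> \<beta> * (2 * lam * (lam - s))"
  proof -
    have "s' * s \<le> lam * lam" using s lam_pos by (intro mult_mono) auto
    then show ?thesis using s by (intro mult_left_mono) (auto simp: algebra_simps)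
  qed
  also have "\<dots> \<le> (b n)\<^sup>2 * (2 * lam * (lam - s))"
  proof (rule mult_right_mono)
    have "cmod (ip (k n) (k n)) \<le> b n * b n"
      unfolding ip_def by (intro mean_le ap_intros) (auto simp: norm_mult intro!: mult_mono k_le b_nonneg)
    then show "\<beta> \<le> (b n)\<^sup>2"
      using s by (simp add: ip_k \<beta>_def power2_eq_square mult_2)
    show "0 \<le> 2 * lam * (lam - s)" using s lam_pos by simp
  qed
  finally have le: "msq v \<le> (b n)\<^sup>2 * (2 * lam * (lam - s))" .
  have "(\<lambda>x. conv (k 0) (p n) x - of_real lam * p n x) = (\<lambda>x. of_real (1 / b n) * v x)"
  proof
    fix x
    have "conv (k 0) (p n) x = of_real (1 / b n) * k (Suc n) x"
      unfolding p_def[abs_def] by (subst conv_cmult_right) (simp_all add: k_ap conv_k)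
    then show "conv (k 0) (p n) x - of_real lam * p n x = of_real (1 / b n) * v x"
      by (simp add: p_def v_def algebra_simps)
  qed
  then have "msq (\<lambda>x. conv (k 0) (p n) x - of_real lam * p n x) = (1 / b n)\<^sup>2 * msq v"
    using msq_cmult[OF v, of "of_real (1 / b n)"] b_pos[of n] by (simp add: norm_divide)
  also have "\<dots> \<le> 2 * lam * (lam - s)"
    using le b_pos[of n] by (simp add: power_divide divide_le_eq mult.commute)
  finally show ?thesis by (simp add: s_def)
qed

definition P :: "('g \<Rightarrow> complex) set"
  where "P = {q. almost_periodic q \<and> positive_definite q \<and> q 0 = 1 \<and> (\<forall>x. conv (k 0) q x = of_real lam * q x)}"

text \<open>A uniform limit point of the \<open>p n\<close> satisfies the eigenvalue equation
  because the mean square of its defect is the limit of the residuals, which is 0, and the mean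
  square is definite.\<close>

lemma P_nonempty: "P \<noteq> {}"
proof -
  obtain s g where s: "strict_mono (s :: nat \<Rightarrow> nat)"
    and lim: "uniform_limit UNIV (\<lambda>n. p (Suc (s n))) g sequentially" and g: "almost_periodic g"
    using uniformly_convergent_subsequence[of "\<lambda>n. p (Suc n)" 1] p_equi p_le by metis
  have pt: "(\<lambda>n. p (Suc (s n)) x) \<longlonglongrightarrow> g x" for x
    using tendsto_uniform_limitI[OF lim] by simp
  have "positive_definite g"
    using positive_definite_limit[OF p_positive_definite pt] .
  moreover have "g 0 = 1"
    using pt[of 0] by (simp add: p_0 LIMSEQ_const_iff)
  moreover have "conv (k 0) g x = of_real lam * g x" for x
  proof -
    define h where "h x = conv (k 0) g x - of_real lam * g x" for x
    have h: "almost_periodic h" unfolding h_def by (intro ap_intros g)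
    have "uniform_limit UNIV (\<lambda>n x. conv (k 0) (p (Suc (s n))) x - of_real lam * p (Suc (s n)) x) h sequentially"
      unfolding h_def[abs_def] by (intro uniform_limit_minus conv_tendsto uniform_limit_cmult lim g ap_intros)
    then have "(\<lambda>n. msq (\<lambda>x. conv (k 0) (p (Suc (s n))) x - of_real lam * p (Suc (s n)) x)) \<longlonglongrightarrow> msq h"
      by (intro msq_tendsto ap_intros h)
    moreover have "(\<lambda>n. 2 * lam * (lam - r (2 * Suc (s n) + 1))) \<longlonglongrightarrow> 2 * lam * (lam - lam)"
    proof -
      have "strict_mono (\<lambda>n. 2 * Suc (s n) + 1)"
        using s by (simp add: strict_mono_def)
      from LIMSEQ_subseq_LIMSEQ[OF r_tendsto this] show ?thesis
        by (intro tendsto_intros) (simp add: o_def)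
    qed
    ultimately have "msq h \<le> 2 * lam * (lam - lam)"
      by (rule LIMSEQ_le) (use residual in blast)
    then have "msq h = 0" using msq_nonneg[OF h] by simp
    then have "h x = 0" by (rule msq_eq_0D[OF h])
    then show ?thesis by (simp add: h_def)
  qed
  ultimately have "g \<in> P" using g by (simp add: P_def)
  then show ?thesis by blast
qed

lemma P_le: "q \<in> P \<Longrightarrow> cmod (q x) \<le> 1"
  using positive_definite_le[of q x] by (simp add: P_def)

lemma P_msq_le: "q \<in> P \<Longrightarrow> msq q \<le> 1"
proof -
  assume q: "q \<in> P"
  then have ap: "almost_periodic q" by (simp add: P_def)
  have "cmod (ip q q) \<le> 1 * 1"
    unfolding ip_def by (intro mean_le ap_intros ap) (auto simp: norm_mult intro!: mult_le_one P_le q)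
  then show ?thesis by (simp add: ip_self[OF ap])
qed

text \<open>Every \<open>q\<close> in \<open>P\<close> reproduces itself as
  \<open>conv (k 0) q\<close> divided by \<open>lam\<close>, so it inherits a colouring of
  \<open>k 0\<close>.\<close>

lemma P_equi:
  assumes "\<epsilon> > 0"
  shows "\<exists>\<kappa>. finite (range \<kappa>) \<and> (\<forall>q\<in>P. equi_translates \<epsilon> \<kappa> q)"
proof -
  have "\<epsilon> * lam > 0" using assms lam_pos by simp
  then obtain \<kappa> where \<kappa>: "finite (range \<kappa>)" "equi_translates (\<epsilon> * lam) \<kappa> (k 0)"
    using almost_periodicD[OF k_ap] by blast
  have "equi_translates \<epsilon> \<kappa> q" if q: "q \<in> P" for q
    unfolding equi_translates_def
  proof (intro allI impI)
    fix s t x assume st: "\<kappa> s = \<kappa> t"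
    have "almost_periodic q" using q by (simp add: P_def)
    from equi_translatesD[OF equi_translates_conv[OF k_ap this \<kappa>(2) P_le[OF q]] st]
    have "cmod (conv (k 0) q (x + s) - conv (k 0) q (x + t)) \<le> \<epsilon> * lam * 1" .
    then have "lam * cmod (q (x + s) - q (x + t)) \<le> lam * \<epsilon>"
      using q lam_pos by (simp add: P_def norm_mult mult.commute flip: right_diff_distrib)
    then show "cmod (q (x + s) - q (x + t)) \<le> \<epsilon>"
      using lam_pos by simp
  qed
  then show ?thesis using \<kappa>(1) by blast
qed

text \<open>\<open>P\<close> is sequentially compact under uniform convergence:
  \<open>P_equi\<close> supplies the common colourings, the defining conditions are closed, and
  \<open>msq\<close> is continuous.\<close>

lemma P_maximum: "\<exists>q\<in>P. \<forall>q'\<in>P. msq q' \<le> msq q"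
proof -
  define S where "S = Sup (msq ` P)"
  have bdd: "bdd_above (msq ` P)" by (intro bdd_aboveI2[of _ _ 1] P_msq_le)
  have "\<exists>q\<in>P. msq q > S - inverse (real (Suc n))" for n
    using less_cSup_iff[of "msq ` P" "S - inverse (real (Suc n))"] bdd P_nonempty
    by (auto simp: S_def)
  then obtain q where q: "\<And>n. q n \<in> P" "\<And>n. msq (q n) > S - inverse (real (Suc n))"
    by metis
  have q_ap: "almost_periodic (q n)" for n using q(1) by (simp add: P_def)
  obtain s g where s: "strict_mono (s :: nat \<Rightarrow> nat)"
    and lim: "uniform_limit UNIV (\<lambda>n. q (s n)) g sequentially" and g: "almost_periodic g"
  proof (rule uniformly_convergent_subsequence[of q 1])
    fix \<epsilon> :: real assume "\<epsilon> > 0"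
    then show "\<exists>\<kappa>. finite (range \<kappa>) \<and> (\<forall>n. equi_translates \<epsilon> \<kappa> (q n))"
      using P_equi q(1) by blast
  qed (use P_le q(1) in auto)
  have pt: "(\<lambda>n. q (s n) x) \<longlonglongrightarrow> g x" for x
    using tendsto_uniform_limitI[OF lim] by simp
  have "g \<in> P"
    unfolding P_def
  proof (intro CollectI conjI allI g)
    show "positive_definite g"
      by (rule positive_definite_limit[OF _ pt]) (use q(1) in \<open>simp add: P_def\<close>)
    show "g 0 = 1"
      using pt[of 0] q(1) by (simp add: P_def LIMSEQ_const_iff)
    fix x
    have "(\<lambda>n. conv (k 0) (q (s n)) x) \<longlonglongrightarrow> conv (k 0) g x"
      using tendsto_uniform_limitI[OF conv_tendsto[OF q_ap g k_ap lim]] by simp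
    moreover have "(\<lambda>n. conv (k 0) (q (s n)) x) = (\<lambda>n. of_real lam * q (s n) x)"
      using q(1) by (simp add: P_def)
    ultimately show "conv (k 0) g x = of_real lam * g x"
      using tendsto_mult_left[OF pt[of x], of "of_real lam"] by (metis LIMSEQ_unique)
  qed
  have lim1: "(\<lambda>n. msq (q (s n))) \<longlonglongrightarrow> msq g"
    by (intro msq_tendsto q_ap g lim)
  have lim2: "(\<lambda>n. S - inverse (real (Suc (s n)))) \<longlonglongrightarrow> S - 0"
    using LIMSEQ_subseq_LIMSEQ[OF LIMSEQ_inverse_real_of_nat s] by (intro tendsto_intros) (simp add: o_def)
  have "S - 0 \<le> msq g"
    by (rule LIMSEQ_le[OF lim2 lim1]) (use q(2) in \<open>blast intro: less_imp_le\<close>)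
  then have "msq q' \<le> msq g" if "q' \<in> P" for q'
    using cSup_upper[OF _ bdd, of "msq q'"] that by (simp add: S_def)
  with \<open>g \<in> P\<close> show ?thesis by blast
qed

text \<open>The mean square of a convex combination is the convex combination of the mean squares
  minus \<open>\<theta> * (1 - \<theta>) * msq (q1 - q2)\<close>, by expansion. At a maximum the
  subtracted term must vanish.\<close>

lemma P_maximum_unique:
  assumes q: "\<And>q'. q' \<in> P \<Longrightarrow> msq q' \<le> msq q"
    and "q1 \<in> P" "q2 \<in> P" "0 < \<theta>" "\<theta> < 1" "\<And>x. q x = of_real \<theta> * q1 x + of_real (1 - \<theta>) * q2 x"
  shows "q1 x = q2 x"
proof -
  have ap: "almost_periodic q1" "almost_periodic q2" using assms(2,3) by (simp_all add: P_def)
  have d: "almost_periodic (\<lambda>x. q1 x - q2 x)" by (intro ap_intros ap)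
  have q_eq: "q = (\<lambda>x. of_real \<theta> * q1 x + of_real (1 - \<theta>) * q2 x)" using assms(6) by blast
  have "ip q q = of_real \<theta> * ip q1 q1 + of_real (1 - \<theta>) * ip q2 q2
      - of_real \<theta> * of_real (1 - \<theta>) * ip (\<lambda>x. q1 x - q2 x) (\<lambda>x. q1 x - q2 x)"
    unfolding q_eq using ap by (simp add: ip_simps) (simp add: algebra_simps)
  then have "Re (ip q q) = \<theta> * msq q1 + (1 - \<theta>) * msq q2 - \<theta> * (1 - \<theta>) * msq (\<lambda>x. q1 x - q2 x)"
    unfolding ip_self[OF ap(1)] ip_self[OF ap(2)] ip_self[OF d]
    by (simp flip: of_real_mult of_real_diff of_real_add)
  then have eq: "msq q = \<theta> * msq q1 + (1 - \<theta>) * msq q2 - \<theta> * (1 - \<theta>) * msq (\<lambda>x. q1 x - q2 x)"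
    by (simp only: msq_def[of q])
  have "\<theta> * msq q1 \<le> \<theta> * msq q" "(1 - \<theta>) * msq q2 \<le> (1 - \<theta>) * msq q"
    using q assms by (auto intro!: mult_left_mono)
  then have "\<theta> * (1 - \<theta>) * msq (\<lambda>x. q1 x - q2 x) \<le> 0"
    using eq by (simp add: algebra_simps)
  then have "msq (\<lambda>x. q1 x - q2 x) \<le> 0"
    using assms(4,5) by (simp add: mult_le_0_iff)
  then have "msq (\<lambda>x. q1 x - q2 x) = 0"
    using msq_nonneg[OF d] by simp
  then show ?thesis
    using msq_eq_0D[OF d] by simp
qed

lemma P_maximum_shift:
  assumes q: "q \<in> P" and max: "\<And>q'. q' \<in> P \<Longrightarrow> msq q' \<le> msq q" and e: "cmod e = 1"
  shows "\<exists>\<sigma>. \<forall>x. e * q (x + t) + cnj e * q (x - t) = \<sigma> * q x"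
proof -
  have qP: "almost_periodic q" "positive_definite q" "q 0 = 1" "\<And>x. conv (k 0) q x = of_real lam * q x"
    using q by (auto simp: P_def)
  define s where "s x = e * q (x + t) + cnj e * q (x - t)" for x
  have s_ap: "almost_periodic s" unfolding s_def by (intro ap_intros qP)
  define \<sigma> where "\<sigma> = 2 * Re (e * q t)"
  have s0: "s 0 = of_real \<sigma>"
    using positive_definite_hermitian[OF qP(2), of t] by (simp add: s_def \<sigma>_def complex_eq_iff)
  have "cmod (e * q t) \<le> 1" using P_le[OF q, of t] e by (simp add: norm_mult)
  then have \<sigma>: "\<bar>\<sigma>\<bar> \<le> 2" using abs_Re_le_cmod[of "e * q t"] by (simp add: \<sigma>_def)
  have pd: "positive_definite (\<lambda>x. 2 * q x + s x)" "positive_definite (\<lambda>x. 2 * q x - s x)"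
    using positive_definite_shift[OF qP(2) e, of t] positive_definite_shift[OF qP(2), of "- e" t] e
    by (simp_all add: s_def algebra_simps)
  have conv_s: "conv (k 0) s x = of_real lam * s x" for x
  proof -
    have "conv (k 0) (\<lambda>x. e * q (x + t) + cnj e * q (x + (- t))) x =
        e * conv (k 0) (\<lambda>x. q (x + t)) x + cnj e * conv (k 0) (\<lambda>x. q (x + (- t))) x"
      by (subst conv_add_right, (intro ap_intros qP)+, subst conv_cmult_right, (intro ap_intros qP)+,
          subst conv_cmult_right, (intro ap_intros qP)+) simp
    also have "\<dots> = e * (of_real lam * q (x + t)) + cnj e * (of_real lam * q (x + (- t)))"
      by (simp only: conv_shift_right[OF k_ap qP(1)] qP(4))
    finally show ?thesis by (simp add: s_def[abs_def] algebra_simps)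
  qed
  \<comment> \<open>\<open>2 * q + s\<close> and \<open>2 * q - s\<close> are positive definite, but
    their values at 0 may vanish, as \<open>\<bar>\<sigma>\<bar>\<close> can be 2. Adding another
    \<open>2 * q\<close> keeps the value at 0 positive, so that the functions can be normalised into
    \<open>P\<close>.\<close>
  have mem: "(\<lambda>x. of_real (1 / (4 + \<epsilon> * \<sigma>)) * (4 * q x + of_real \<epsilon> * s x)) \<in> P"
    if \<epsilon>: "\<epsilon> = 1 \<or> \<epsilon> = - 1" for \<epsilon> :: real
    unfolding P_def
  proof (intro CollectI conjI allI)
    show "almost_periodic (\<lambda>x. of_real (1 / (4 + \<epsilon> * \<sigma>)) * (4 * q x + of_real \<epsilon> * s x))"
      by (intro ap_intros qP s_ap)
    have pos: "4 + \<epsilon> * \<sigma> > 0" using \<sigma> \<epsilon> by auto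
    have "positive_definite (\<lambda>x. 2 * q x)"
      using positive_definite_cmult[OF qP(2), of 2] by simp
    moreover have "positive_definite (\<lambda>x. 2 * q x + of_real \<epsilon> * s x)"
      using pd \<epsilon> by auto
    ultimately have "positive_definite (\<lambda>x. 2 * q x + (2 * q x + of_real \<epsilon> * s x))"
      by (rule positive_definite_add)
    then have "positive_definite (\<lambda>x. 4 * q x + of_real \<epsilon> * s x)" by (simp add: algebra_simps)
    then show "positive_definite (\<lambda>x. of_real (1 / (4 + \<epsilon> * \<sigma>)) * (4 * q x + of_real \<epsilon> * s x))"
      by (rule positive_definite_cmult) (use pos in simp)
    have "(4 + of_real \<epsilon> * of_real \<sigma> :: complex) = of_real (4 + \<epsilon> * \<sigma>)" by simp
    then show "of_real (1 / (4 + \<epsilon> * \<sigma>)) * (4 * q 0 + of_real \<epsilon> * s 0) = 1"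
      unfolding s0 qP(3) mult_1_right using pos by (metis of_real_mult of_real_1 nonzero_divide_eq_eq order_less_irrefl)
    fix x
    have "conv (k 0) (\<lambda>x. of_real (1 / (4 + \<epsilon> * \<sigma>)) * (4 * q x + of_real \<epsilon> * s x)) x =
      of_real (1 / (4 + \<epsilon> * \<sigma>)) * (4 * conv (k 0) q x + of_real \<epsilon> * conv (k 0) s x)"
      by (subst conv_cmult_right, (intro ap_intros qP s_ap)+, subst conv_add_right, (intro ap_intros qP s_ap)+,
          subst conv_cmult_right, (intro ap_intros qP)+, subst conv_cmult_right, (intro ap_intros s_ap)+) simp
    then show "conv (k 0) (\<lambda>x. of_real (1 / (4 + \<epsilon> * \<sigma>)) * (4 * q x + of_real \<epsilon> * s x)) x =
      of_real lam * (of_real (1 / (4 + \<epsilon> * \<sigma>)) * (4 * q x + of_real \<epsilon> * s x))"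
      unfolding qP(4) conv_s by (simp add: algebra_simps)
  qed
  define q1 where "q1 x = of_real (1 / (4 + \<sigma>)) * (4 * q x + s x)" for x
  define q2 where "q2 x = of_real (1 / (4 - \<sigma>)) * (4 * q x - s x)" for x
  \<comment> \<open>\<open>q\<close> is the sum of \<open>(4 * q + s) / 8\<close> and
    \<open>(4 * q - s) / 8\<close>; the weights of the normalised functions are the values of these
    two summands at 0.\<close>
  define \<theta> where "\<theta> = (4 + \<sigma>) / 8"
  have \<theta>: "0 < \<theta>" "\<theta> < 1" using \<sigma> by (auto simp: \<theta>_def)
  have nz: "4 + \<sigma> \<noteq> 0" "4 - \<sigma> \<noteq> 0" using \<sigma> by auto
  have scale: "of_real a * (of_real b * z) = of_real (a * b) * z" for a b and z :: complex by simp
  have parts: "of_real \<theta> * q1 x = (4 * q x + s x) / 8" "of_real (1 - \<theta>) * q2 x = (4 * q x - s x) / 8" for x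
  proof -
    have eqs: "\<theta> * (1 / (4 + \<sigma>)) = 1 / 8" "(1 - \<theta>) * (1 / (4 - \<sigma>)) = 1 / 8"
      using nz by (auto simp: \<theta>_def field_simps)
    show "of_real \<theta> * q1 x = (4 * q x + s x) / 8" "of_real (1 - \<theta>) * q2 x = (4 * q x - s x) / 8"
      unfolding q1_def q2_def scale eqs by simp_all
  qed
  have q12: "q x = of_real \<theta> * q1 x + of_real (1 - \<theta>) * q2 x" for x
    unfolding parts by (simp add: field_simps)
  have eq: "q1 x = q2 x" for x
    by (rule P_maximum_unique[OF max _ _ \<theta> q12]) (use mem[of 1] mem[of "- 1"] in \<open>simp_all add: q1_def[abs_def] q2_def[abs_def]\<close>)
  have "s x = of_real \<sigma> * q x" for x
  proof -
    have "q x = q1 x" using q12[of x] eq[of x] by (simp add: algebra_simps)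
    then have "of_real \<theta> * q x = (4 * q x + s x) / 8" using parts(1) by simp
    then show ?thesis by (simp add: \<theta>_def field_simps)
  qed
  then show ?thesis unfolding s_def by blast
qed

text \<open>For the maximiser \<open>q\<close>, the phases 1 and \<open>\<i>\<close> in
  \<open>P_maximum_shift\<close> together isolate \<open>q (x + t)\<close> as a multiple of
  \<open>q x\<close>, with factor \<open>q t\<close> by evaluation at 0. Modulus one follows from
  \<open>q x * q (- x) = 1\<close> and the bound by 1.\<close>

lemma character_exists: "\<exists>\<xi>. almost_periodic \<xi> \<and> character \<xi> \<and> (\<forall>x. conv (k 0) \<xi> x = of_real lam * \<xi> x)"
proof -
  obtain q where q: "q \<in> P" "\<And>q'. q' \<in> P \<Longrightarrow> msq q' \<le> msq q" using P_maximum by blast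
  have q0: "q 0 = 1" using q by (simp add: P_def)
  have mult: "q (x + t) = q x * q t" for x t
  proof -
    obtain a where a: "\<And>x. q (x + t) + q (x - t) = a * q x"
      using P_maximum_shift[OF q, of 1 t] by auto
    obtain c where c: "\<And>x. \<i> * q (x + t) - \<i> * q (x - t) = c * q x"
      using P_maximum_shift[OF q, of \<i> t] by auto
    have two: "2 * q (x + t) = (a - \<i> * c) * q x" for x
    proof -
      have "2 * q (x + t) = (q (x + t) + q (x - t)) - \<i> * (\<i> * q (x + t) - \<i> * q (x - t))"
        by (simp add: algebra_simps)
      then show ?thesis unfolding a c by (simp add: algebra_simps)
    qed
    have "a - \<i> * c = 2 * q t" using two[of 0] q0 by simp
    then have "2 * q (x + t) = 2 * (q x * q t)" using two[of x] by simp
    then show ?thesis by simp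
  qed
  have "cmod (q x) = 1" for x
  proof -
    have "q x * q (- x) = 1" using mult[of x "- x"] q0 by simp
    then have "cmod (q x) * cmod (q (- x)) = 1" by (metis norm_mult norm_one)
    moreover have "cmod (q x) * cmod (q (- x)) \<le> cmod (q x) * 1"
      by (intro mult_left_mono P_le q) simp
    ultimately show ?thesis using P_le[OF q(1), of x] by simp
  qed
  then have "character q" using mult by (simp add: character_def)
  then show ?thesis using q(1) by (auto simp: P_def)
qed

end

section \<open>Characters and Fourier coefficients\<close>

lemma character_add: "character \<xi> \<Longrightarrow> \<xi> (x + y) = \<xi> x * \<xi> y"
  by (simp add: character_def)

lemma character_norm: "character \<xi> \<Longrightarrow> cmod (\<xi> x) = 1"
  by (simp add: character_def)

lemma character_0: "character \<xi> \<Longrightarrow> \<xi> 0 = 1"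
  using character_add[of \<xi> 0 0] character_norm[of \<xi> 0] by auto

lemma character_mult_cnj: "character \<xi> \<Longrightarrow> \<xi> x * cnj (\<xi> x) = 1"
  using character_norm[of \<xi> x] by (metis complex_norm_square of_real_1 one_power2)

lemma character_minus: "character \<xi> \<Longrightarrow> \<xi> (- x) = cnj (\<xi> x)"
proof -
  assume \<xi>: "character \<xi>"
  have "\<xi> x * \<xi> (- x) = 1" using character_add[OF \<xi>, of x "- x"] character_0[OF \<xi>] by simp
  then show ?thesis using character_mult_cnj[OF \<xi>, of x]
    by (metis mult_cancel_left mult_zero_left zero_neq_one)
qed

lemma character_hermitian: "character \<xi> \<Longrightarrow> hermitian \<xi>"
  by (simp add: hermitian_def character_minus)

lemma conv_character:
  assumes u: "almost_periodic u" and "almost_periodic \<xi>" "character \<xi>"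
  shows "conv u \<xi> x = ip u \<xi> * \<xi> x"
proof -
  have "conv u \<xi> x = conv \<xi> u x" using conv_commute[OF u assms(2)] by simp
  also have "\<dots> = mean (\<lambda>y. \<xi> x * (u y * cnj (\<xi> y)))"
    unfolding conv_def using character_add[OF assms(3), of x "- _"]
    by (simp add: character_minus[OF assms(3)] mult_ac)
  also have "\<dots> = \<xi> x * ip u \<xi>"
    unfolding ip_def by (intro mean_cmult ap_intros assms)
  finally show ?thesis by (simp add: mult.commute)
qed

text \<open>The autocorrelation turns an arbitrary \<open>u\<close> into a hermitian kernel, and its
  value at 0 shows that it is nonzero when \<open>u\<close> is.\<close>

lemma correlation:
  assumes u: "almost_periodic u"
  defines "v \<equiv> (\<lambda>x. cnj (u (- x)))"
  shows "hermitian (conv u v)" "conv u v 0 = of_real (msq u)"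
proof -
  have corr: "conv u v x = mean (\<lambda>z. u (x + z) * cnj (u z))" for x
    using mean_minus[of "\<lambda>z. u (x + z) * cnj (u z)"] u
    by (simp add: conv_def v_def ap_intros)
  show "hermitian (conv u v)"
    unfolding hermitian_def
  proof
    fix x
    have "cnj (conv u v (- x)) = mean (\<lambda>z. cnj (u (- x + z) * cnj (u z)))"
      unfolding corr by (intro mean_cnj[symmetric] ap_intros u)
    also have "\<dots> = mean (\<lambda>z. (\<lambda>z. u (x + z) * cnj (u z)) (z + (- x)))"
      by (simp add: mult.commute)
    also have "\<dots> = conv u v x"
      unfolding corr by (intro mean_shift ap_intros u)
    finally show "cnj (conv u v (- x)) = conv u v x" .
  qed
  show "conv u v 0 = of_real (msq u)"
    unfolding corr using ip_self[OF u] by (simp add: ip_def)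
qed

text \<open>The character found for the autocorrelation is an eigenfunction with the positive
  eigenvalue \<open>lam\<close>. A vanishing coefficient \<open>ip u \<xi>\<close> would give
  \<open>conv u \<xi> = 0\<close>, and associativity would then annihilate
  \<open>conv (k 0) \<xi>\<close>.\<close>

theorem nonzero_fourier_coefficient:
  assumes u: "almost_periodic u" and nz: "u x0 \<noteq> 0"
  obtains \<xi> where "almost_periodic \<xi>" "character \<xi>" "ip u \<xi> \<noteq> 0"
proof -
  define v where "v = (\<lambda>x. cnj (u (- x)))"
  have v: "almost_periodic v" unfolding v_def by (intro ap_intros u)
  have "msq u \<noteq> 0" using msq_eq_0D[OF u] nz by blast
  then have "conv u v 0 \<noteq> 0" using correlation(2)[OF u] by (simp add: v_def)
  then interpret hermitian_kernel "conv u v"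
    by unfold_locales (use correlation(1)[OF u] u v in \<open>auto simp: v_def[symmetric] intro: ap_intros\<close>)
  obtain \<xi> where \<xi>: "almost_periodic \<xi>" "character \<xi>" "\<And>x. conv (k 0) \<xi> x = of_real lam * \<xi> x"
    using character_exists by blast
  have "ip u \<xi> \<noteq> 0"
  proof
    assume "ip u \<xi> = 0"
    then have "conv u \<xi> = (\<lambda>x. 0)" using conv_character[OF u \<xi>(1,2)] by auto
    moreover have "conv (conv u v) \<xi> = conv v (conv u \<xi>)"
      using conv_commute[OF u v] conv_assoc[OF v u \<xi>(1)] by simp
    ultimately have "conv (conv u v) \<xi> = (\<lambda>x. 0)" by (simp add: conv_def[abs_def])
    then have "conv (k 0) \<xi> 0 = 0"
      unfolding k_conv W_simps using conv_assoc[OF ap ap \<xi>(1)] by (simp add: conv_def[abs_def])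
    then show False using \<xi>(3)[of 0] lam_pos character_0[OF \<xi>(2)] by simp
  qed
  then show ?thesis using that \<xi> by blast
qed

text \<open>Shifting by a \<open>t\<close> at which the characters differ multiplies the mean by
  \<open>\<xi> t * cnj (\<eta> t)\<close>, which is not 1.\<close>

lemma ip_character:
  assumes \<xi>: "almost_periodic \<xi>" "character \<xi>" and \<eta>: "almost_periodic \<eta>" "character \<eta>"
  shows "ip \<xi> \<eta> = (if \<xi> = \<eta> then 1 else 0)"
proof (cases "\<xi> = \<eta>")
  case True
  then show ?thesis by (simp add: ip_def character_mult_cnj \<eta>)
next
  case False
  then obtain t where t: "\<xi> t \<noteq> \<eta> t" by blast
  have "ip \<xi> \<eta> = mean (\<lambda>x. (\<lambda>x. \<xi> x * cnj (\<eta> x)) (x + t))"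
    unfolding ip_def by (intro mean_shift[symmetric] ap_intros \<xi> \<eta>)
  also have "\<dots> = mean (\<lambda>x. (\<xi> t * cnj (\<eta> t)) * (\<xi> x * cnj (\<eta> x)))"
    by (simp add: character_add \<xi> \<eta> mult_ac)
  also have "\<dots> = (\<xi> t * cnj (\<eta> t)) * ip \<xi> \<eta>"
    unfolding ip_def by (intro mean_cmult ap_intros \<xi> \<eta>)
  finally have "ip \<xi> \<eta> = 0 \<or> \<xi> t * cnj (\<eta> t) = 1" by simp
  moreover have "\<xi> t * cnj (\<eta> t) \<noteq> 1"
  proof
    assume "\<xi> t * cnj (\<eta> t) = 1"
    then have "\<xi> t * cnj (\<eta> t) = \<eta> t * cnj (\<eta> t)" by (simp add: character_mult_cnj \<eta>)
    moreover have "cnj (\<eta> t) \<noteq> 0" using character_norm[OF \<eta>(2), of t] by auto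
    ultimately show False using t by simp
  qed
  ultimately show ?thesis using False by simp
qed

lemma ip_sum_left:
  "(\<And>i. i \<in> I \<Longrightarrow> almost_periodic (u i)) \<Longrightarrow> almost_periodic w \<Longrightarrow> ip (\<lambda>x. \<Sum>i\<in>I. u i x) w = (\<Sum>i\<in>I. ip (u i) w)"
  unfolding ip_def sum_distrib_right by (intro mean_sum ap_intros)

lemma ip_sum_right:
  "(\<And>i. i \<in> I \<Longrightarrow> almost_periodic (u i)) \<Longrightarrow> almost_periodic w \<Longrightarrow> ip w (\<lambda>x. \<Sum>i\<in>I. u i x) = (\<Sum>i\<in>I. ip w (u i))"
  unfolding ip_def cnj_sum sum_distrib_left by (intro mean_sum ap_intros)


text \<open>Parseval: the series of \<open>(cmod (ip u \<xi>))\<^sup>2 * \<xi> x\<close> converges uniformly and has the Fourier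
  coefficients of the autocorrelation of \<open>u\<close>, hence equals it; evaluate at \<open>0\<close>.\<close>

theorem fourier_approximation:
  assumes u: "almost_periodic u" and "\<epsilon> > 0"
  obtains E where "finite E" "\<And>\<xi>. \<xi> \<in> E \<Longrightarrow> almost_periodic \<xi> \<and> character \<xi> \<and> ip u \<xi> \<noteq> 0"
    "msq (\<lambda>x. u x - (\<Sum>\<xi>\<in>E. ip u \<xi> * \<xi> x)) < \<epsilon>"
proof -
  define Ch where "Ch = {\<xi>. almost_periodic \<xi> \<and> character \<xi> \<and> ip u \<xi> \<noteq> 0}"
  define a where "a \<xi> = (cmod (ip u \<xi>))\<^sup>2" for \<xi>
  have a_nonneg: "a \<xi> \<ge> 0" for \<xi> by (simp add: a_def)
  have Ch: "almost_periodic \<xi>" "character \<xi>" if "\<xi> \<in> Ch" for \<xi>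
    using that by (auto simp: Ch_def)
  have bessel: "msq (\<lambda>x. u x - (\<Sum>\<xi>\<in>E. ip u \<xi> * \<xi> x)) = msq u - sum a E" if E: "finite E" "E \<subseteq> Ch" for E
  proof -
    define s where "s x = (\<Sum>\<xi>\<in>E. ip u \<xi> * \<xi> x)" for x
    have s: "almost_periodic s" unfolding s_def using E Ch by (intro ap_intros) auto
    have aa: "ip u \<xi> * cnj (ip u \<xi>) = of_real (a \<xi>)" for \<xi>
      unfolding a_def by (rule complex_norm_square[symmetric])
    have us: "ip u s = of_real (sum a E)"
    proof -
      have "ip u s = (\<Sum>\<xi>\<in>E. cnj (ip u \<xi>) * ip u \<xi>)"
        unfolding s_def[abs_def] using E Ch u
        by (subst ip_sum_right) (auto intro!: ap_intros sum.cong ip_cmult_right)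
      then show ?thesis by (simp add: aa mult.commute[of "cnj _" "ip _ _"])
    qed
    have ss: "ip s s = of_real (sum a E)"
    proof -
      have "ip \<xi> s = cnj (ip u \<xi>)" if "\<xi> \<in> E" for \<xi>
      proof -
        have "ip \<xi> s = (\<Sum>\<eta>\<in>E. cnj (ip u \<eta>) * ip \<xi> \<eta>)"
          unfolding s_def[abs_def] using E Ch that
          by (subst ip_sum_right) (auto intro!: ap_intros sum.cong ip_cmult_right)
        also have "\<dots> = (\<Sum>\<eta>\<in>E. if \<xi> = \<eta> then cnj (ip u \<eta>) else 0)"
        proof (rule sum.cong[OF refl])
          fix \<eta> assume "\<eta> \<in> E"
          then show "cnj (ip u \<eta>) * ip \<xi> \<eta> = (if \<xi> = \<eta> then cnj (ip u \<eta>) else 0)"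
            using E that by (simp add: ip_character Ch subsetD)
        qed
        finally show ?thesis using E that by simp
      qed
      moreover have "ip s s = (\<Sum>\<xi>\<in>E. ip u \<xi> * ip \<xi> s)"
        using E Ch s by (subst (1) s_def[abs_def], subst ip_sum_left) (auto intro!: ap_intros sum.cong ip_cmult_left)
      ultimately show ?thesis by (simp add: aa)
    qed
    have "ip (\<lambda>x. u x - s x) (\<lambda>x. u x - s x) = ip u u - ip u s - cnj (ip u s) + ip s s"
      using u s by (simp add: ip_simps ip_cnj[OF u s] algebra_simps)
    also have "\<dots> = of_real (msq u - sum a E)"
      by (simp add: us ss ip_self[OF u])
    finally show ?thesis
      unfolding msq_def s_def by (simp only: Re_complex_of_real)
  qed
  have bd: "sum a E \<le> msq u" if "finite E" "E \<subseteq> Ch" for E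
  proof -
    have "almost_periodic (\<lambda>x. u x - (\<Sum>\<xi>\<in>E. ip u \<xi> * \<xi> x))"
      using that Ch by (intro ap_intros u) auto
    from msq_nonneg[OF this] show ?thesis using bessel[OF that] by simp
  qed
  define \<F> where "\<F> = {E. finite E \<and> E \<subseteq> Ch}"
  define S where "S = Sup (sum a ` \<F>)"
  have ne: "sum a ` \<F> \<noteq> {}" and bdd: "bdd_above (sum a ` \<F>)"
    unfolding \<F>_def using bd by (auto intro!: bdd_aboveI2[of _ _ "msq u"])
  have le_S: "sum a E \<le> S" if "E \<in> \<F>" for E
    unfolding S_def by (intro cSup_upper bdd imageI that)
  have "\<exists>E\<in>\<F>. sum a E > S - inverse (real (Suc n))" for n
    using less_cSup_iff[OF ne bdd, of "S - inverse (real (Suc n))"] by (auto simp: S_def)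
  then obtain E where E: "\<And>n. E n \<in> \<F>" "\<And>n. sum a (E n) > S - inverse (real (Suc n))"
    by metis
  have En: "finite (E n)" "E n \<subseteq> Ch" for n using E(1)[of n] by (auto simp: \<F>_def)
  define q where "q n x = (\<Sum>\<xi>\<in>E n. of_real (a \<xi>) * \<xi> x)" for n x
  have q_ap: "almost_periodic (q n)" for n
    unfolding q_def using En(2)[of n] Ch by (intro ap_intros) auto
  \<comment> \<open>\<open>E m\<close> comes within \<open>1 / (m + 1)\<close> of the supremum, so
    no other finite set can contribute more than that outside of it. Hence the \<open>q n\<close>
    form a uniform Cauchy sequence although the sets \<open>E n\<close> need not be nested.\<close>
  have diff: "sum a (E n - E m) \<le> inverse (real (Suc m))" for n m
  proof -
    have "sum a (E n \<union> E m) \<le> S" using E(1) by (intro le_S) (auto simp: \<F>_def)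
    moreover have "sum a (E n \<union> E m) = sum a (E n - E m) + sum a (E m)"
      using En by (metis Un_Diff_cancel2 sum.union_disjoint finite_Diff Diff_disjoint inf_commute)
    ultimately show ?thesis using E(2)[of m] by simp
  qed
  have q_diff: "cmod (q n x - q m x) \<le> inverse (real (Suc m)) + inverse (real (Suc n))" for n m x
  proof -
    have "q n x - q m x = (\<Sum>\<xi>\<in>E n - E m. of_real (a \<xi>) * \<xi> x) - (\<Sum>\<xi>\<in>E m - E n. of_real (a \<xi>) * \<xi> x)"
      unfolding q_def
      using sum.Int_Diff[OF En(1)[of n], of "\<lambda>\<xi>. of_real (a \<xi>) * \<xi> x" "E m"]
        sum.Int_Diff[OF En(1)[of m], of "\<lambda>\<xi>. of_real (a \<xi>) * \<xi> x" "E n"] by (simp add: Int_commute)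
    moreover have "cmod (\<Sum>\<xi>\<in>E n - E m. of_real (a \<xi>) * \<xi> x) \<le> sum a (E n - E m)" for n m
    proof (rule sum_norm_le)
      fix \<xi> assume "\<xi> \<in> E n - E m"
      then have "cmod (\<xi> x) = 1" using En(2) Ch character_norm by blast
      then show "cmod (of_real (a \<xi>) * \<xi> x) \<le> a \<xi>" by (simp add: norm_mult a_nonneg)
    qed
    ultimately show ?thesis
      using diff[of n m] diff[of m n] by (smt (verit) norm_triangle_ineq4)
  qed
  have small: "\<exists>N. \<forall>n\<ge>N. inverse (real (Suc n)) < e" if "e > 0" for e
    using order_tendstoD(2)[OF LIMSEQ_inverse_real_of_nat that] by (simp add: eventually_sequentially)
  have "uniformly_Cauchy_on UNIV q"
    unfolding uniformly_Cauchy_on_def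
  proof (intro allI impI)
    fix e :: real assume "e > 0"
    then obtain N where N: "\<forall>n\<ge>N. inverse (real (Suc n)) < e / 2" using small[of "e / 2"] by auto
    have "dist (q n x) (q m x) < e" if "n \<ge> N" "m \<ge> N" for n m x
      using q_diff[of n x m] N that unfolding dist_norm by (smt (verit) field_sum_of_halves)
    then show "\<exists>M. \<forall>x\<in>UNIV. \<forall>m\<ge>M. \<forall>n\<ge>M. dist (q m x) (q n x) < e" by blast
  qed
  then obtain g where g: "uniform_limit UNIV q g sequentially"
    using Cauchy_uniformly_convergent unfolding uniformly_convergent_on_def by blast
  have g_ap: "almost_periodic g"
  proof (rule almost_periodic_limit)
    fix \<epsilon> :: real assume "\<epsilon> > 0"
    then have "\<forall>\<^sub>F n in sequentially. \<forall>x\<in>UNIV. dist (q n x) (g x) < \<epsilon>" using g by (intro uniform_limitD)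
    then obtain n where "\<forall>x. dist (q n x) (g x) < \<epsilon>" by (auto simp: eventually_sequentially)
    then show "\<exists>v. almost_periodic v \<and> (\<forall>x. cmod (g x - v x) \<le> \<epsilon>)"
      using q_ap[of n] by (intro exI[of _ "q n"]) (auto simp: dist_norm norm_minus_commute less_imp_le)
  qed
  define v where "v = (\<lambda>x. cnj (u (- x)))"
  have v: "almost_periodic v" unfolding v_def by (intro ap_intros u)
  have c_ap: "almost_periodic (conv u v)" by (intro ap_intros u v)
  have ip_c: "ip (conv u v) \<xi> = of_real (a \<xi>)" if \<xi>: "almost_periodic \<xi>" "character \<xi>" for \<xi>
  proof -
    have "ip v \<xi> = mean (\<lambda>x. (\<lambda>x. cnj (u x * cnj (\<xi> x))) (- x))"
      unfolding ip_def v_def by (simp add: character_minus \<xi>)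
    also have "\<dots> = mean (\<lambda>x. cnj (u x * cnj (\<xi> x)))" by (intro mean_minus ap_intros u \<xi>)
    also have "\<dots> = cnj (ip u \<xi>)" unfolding ip_def by (intro mean_cnj ap_intros u \<xi>)
    finally have v\<xi>: "ip v \<xi> = cnj (ip u \<xi>)" .
    \<comment> \<open>Characters are hermitian, so inner products with them are convolutions at 0;
      associativity then factors the coefficient into those of \<open>v\<close> and
      \<open>u\<close>.\<close>
    have "ip (conv u v) \<xi> = conv (conv u v) \<xi> 0"
      by (intro conv_0_ip[symmetric] c_ap \<xi> character_hermitian)
    also have "\<dots> = conv u (conv v \<xi>) 0" by (simp add: conv_assoc u v \<xi>)
    also have "conv v \<xi> = (\<lambda>x. cnj (ip u \<xi>) * \<xi> x)" using conv_character[OF v \<xi>] v\<xi> by auto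
    also have "conv u (\<lambda>x. cnj (ip u \<xi>) * \<xi> x) 0 = cnj (ip u \<xi>) * ip u \<xi>"
      by (simp add: conv_cmult_right u \<xi> conv_character character_0)
    also have "\<dots> = of_real (a \<xi>)"
      unfolding a_def mult.commute[of "cnj (ip u \<xi>)"] by (rule complex_norm_square[symmetric])
    finally show ?thesis .
  qed
  have ip_g: "ip g \<xi> = of_real (a \<xi>)" if \<xi>: "almost_periodic \<xi>" "character \<xi>" for \<xi>
  proof -
    have ip_q: "ip (q n) \<xi> = (if \<xi> \<in> E n then of_real (a \<xi>) else 0)" for n
    proof -
      have "ip (q n) \<xi> = (\<Sum>\<eta>\<in>E n. of_real (a \<eta>) * ip \<eta> \<xi>)"
        unfolding q_def[abs_def] using En(2)[of n] Ch \<xi>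
        by (subst ip_sum_left) (auto intro!: ap_intros sum.cong ip_cmult_left)
      also have "\<dots> = (\<Sum>\<eta>\<in>E n. if \<eta> = \<xi> then of_real (a \<eta>) else 0)"
        using En(2)[of n] Ch \<xi> by (intro sum.cong) (auto simp: ip_character)
      finally show ?thesis using En(1) by simp
    qed
    have "uniform_limit UNIV (\<lambda>n x. q n x * cnj (\<xi> x)) (\<lambda>x. g x * cnj (\<xi> x)) sequentially"
      by (intro uniform_lim_mult g uniform_limit_const almost_periodic_bounded_range ap_intros g_ap \<xi>)
    then have "(\<lambda>n. ip (q n) \<xi>) \<longlonglongrightarrow> ip g \<xi>"
      unfolding ip_def by (intro mean_tendsto ap_intros q_ap g_ap \<xi>)
    moreover have "(\<lambda>n. ip (q n) \<xi>) \<longlonglongrightarrow> of_real (a \<xi>)"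
    proof (rule tendstoI)
      fix e :: real assume "e > 0"
      then obtain N where N: "\<forall>n\<ge>N. inverse (real (Suc n)) < e" using small by blast
      have "dist (ip (q n) \<xi>) (of_real (a \<xi>)) < e" if "n \<ge> N" for n
      proof (cases "\<xi> \<in> E n \<or> a \<xi> = 0")
        case True
        then show ?thesis using \<open>e > 0\<close> by (auto simp: ip_q)
      next
        case False
        \<comment> \<open>A character missing from \<open>E n\<close> could be added to it without
          exceeding \<open>S\<close>, so its weight is below the gap
          \<open>1 / (n + 1)\<close>.\<close>
        then have "insert \<xi> (E n) \<in> \<F>" using En \<xi> by (auto simp: \<F>_def Ch_def a_def)
        then have "a \<xi> + sum a (E n) \<le> S" using le_S[of "insert \<xi> (E n)"] False En(1) by simp
        then have "a \<xi> < inverse (real (Suc n))" using E(2)[of n] by linarith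
        then show ?thesis using False N that a_nonneg[of \<xi>] by (auto simp: ip_q dist_norm)
      qed
      then show "\<forall>\<^sub>F n in sequentially. dist (ip (q n) \<xi>) (of_real (a \<xi>)) < e"
        unfolding eventually_sequentially by blast
    qed
    ultimately show ?thesis by (rule LIMSEQ_unique)
  qed
  have "conv u v 0 - g 0 = 0"
  proof (rule ccontr)
    assume "conv u v 0 - g 0 \<noteq> 0"
    then obtain \<xi> where \<xi>: "almost_periodic \<xi>" "character \<xi>" "ip (\<lambda>x. conv u v x - g x) \<xi> \<noteq> 0"
      using nonzero_fourier_coefficient[of "\<lambda>x. conv u v x - g x" 0] c_ap g_ap
      by (metis almost_periodic_diff)
    then show False using c_ap g_ap by (simp add: ip_diff_left ip_c ip_g)
  qed
  then have g0: "g 0 = of_real (msq u)" using correlation(2)[OF u] by (simp add: v_def)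
  have "(\<lambda>n. q n 0) \<longlonglongrightarrow> g 0" using tendsto_uniform_limitI[OF g] by simp
  then have "\<forall>\<^sub>F n in sequentially. dist (q n 0) (g 0) < \<epsilon>" using \<open>\<epsilon> > 0\<close> by (rule tendstoD)
  then obtain n where n: "dist (q n 0) (g 0) < \<epsilon>" by (auto simp: eventually_sequentially)
  have "q n 0 = (\<Sum>\<xi>\<in>E n. of_real (a \<xi>))"
    unfolding q_def using En(2)[of n] Ch by (intro sum.cong) (auto simp: character_0)
  then have "q n 0 = of_real (sum a (E n))" by simp
  then have "msq u - sum a (E n) < \<epsilon>"
    using n bd[OF En] unfolding g0 \<open>q n 0 = of_real (sum a (E n))\<close> dist_of_real by (simp add: dist_real_def)
  then have "msq (\<lambda>x. u x - (\<Sum>\<xi>\<in>E n. ip u \<xi> * \<xi> x)) < \<epsilon>"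
    using bessel[OF En] by simp
  then show ?thesis
    using that[OF En(1)] En(2)[of n] by (auto simp: Ch_def)
qed

section \<open>Equicontinuous minimal systems\<close>

lemma continuous_map_epsI:
  fixes f :: "'x \<Rightarrow> 'b::metric_space"
  assumes "\<And>x \<epsilon>. x \<in> topspace X \<Longrightarrow> \<epsilon> > 0 \<Longrightarrow> \<exists>U. openin X U \<and> x \<in> U \<and> (\<forall>y\<in>U. dist (f y) (f x) < \<epsilon>)"
  shows "continuous_map X euclidean f"
  unfolding continuous_map_def
proof (intro conjI allI impI)
  fix V :: "'b set" assume "openin euclidean V"
  then have V: "open V" by simp
  show "openin X {x \<in> topspace X. f x \<in> V}"
  proof (subst openin_subopen, intro ballI)
    fix x assume x: "x \<in> {x \<in> topspace X. f x \<in> V}"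
    then obtain e where e: "e > 0" "ball (f x) e \<subseteq> V" using V openE by blast
    obtain U where U: "openin X U" "x \<in> U" "\<forall>y\<in>U. dist (f y) (f x) < e"
      using assms[of x e] x e(1) by auto
    have "U \<subseteq> {x \<in> topspace X. f x \<in> V}"
    proof
      fix y assume y: "y \<in> U"
      then have "f y \<in> ball (f x) e" using U(3) dist_commute[of "f x" "f y"] by simp
      then show "y \<in> {x \<in> topspace X. f x \<in> V}" using e(2) openin_subset[OF U(1)] y by blast
    qed
    then show "\<exists>T. openin X T \<and> x \<in> T \<and> T \<subseteq> {x \<in> topspace X. f x \<in> V}" using U by blast
  qed
qed simp

lemma continuous_map_epsD:
  fixes f :: "'x \<Rightarrow> 'b::metric_space"
  assumes "continuous_map X euclidean f" "x \<in> topspace X" "\<epsilon> > 0"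
  obtains U where "openin X U" "x \<in> U" "\<And>y. y \<in> U \<Longrightarrow> dist (f y) (f x) < \<epsilon>"
proof -
  have "openin X {y \<in> topspace X. f y \<in> ball (f x) \<epsilon>}"
    by (rule openin_continuous_map_preimage[OF assms(1)]) simp
  moreover have "dist (f y) (f x) < \<epsilon>" if "y \<in> {y \<in> topspace X. f y \<in> ball (f x) \<epsilon>}" for y
    using that dist_commute[of "f x" "f y"] by simp
  moreover have "x \<in> {y \<in> topspace X. f y \<in> ball (f x) \<epsilon>}" using assms(2,3) by simp
  ultimately show ?thesis using that by meson
qed

lemma continuous_map_uniform_approx:
  fixes f :: "'x \<Rightarrow> 'b::metric_space"
  assumes "\<And>\<epsilon>. \<epsilon> > 0 \<Longrightarrow> \<exists>g. continuous_map X euclidean g \<and> (\<forall>x\<in>topspace X. dist (f x) (g x) \<le> \<epsilon>)"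
  shows "continuous_map X euclidean f"
proof (rule continuous_map_epsI)
  fix x and \<epsilon> :: real assume x: "x \<in> topspace X" and \<epsilon>: "\<epsilon> > 0"
  then obtain g where g: "continuous_map X euclidean g" "\<And>x. x \<in> topspace X \<Longrightarrow> dist (f x) (g x) \<le> \<epsilon> / 4"
    using assms[of "\<epsilon> / 4"] by auto
  obtain U where U: "openin X U" "x \<in> U" "\<And>y. y \<in> U \<Longrightarrow> dist (g y) (g x) < \<epsilon> / 4"
    using continuous_map_epsD[OF g(1) x, of "\<epsilon> / 4"] \<epsilon> by auto
  have "dist (f y) (f x) < \<epsilon>" if y: "y \<in> U" for y
  proof -
    have "dist (f y) (g y) \<le> \<epsilon> / 4" using g(2) openin_subset[OF U(1)] y by blast
    then show ?thesis
      using g(2)[OF x] U(3)[OF y] dist_triangle[of "f y" "f x" "g y"] dist_triangle[of "g y" "f x" "g x"]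
        dist_commute[of "g x" "f x"] \<epsilon> by linarith
  qed
  then show "\<exists>U. openin X U \<and> x \<in> U \<and> (\<forall>y\<in>U. dist (f y) (f x) < \<epsilon>)" using U by blast
qed

lemma space_borel_of [simp]: "space (borel_of X) = topspace X"
  unfolding borel_of_def by (rule space_measure_of) (auto dest: openin_subset)

lemma sets_borel_of: "sets (borel_of X) = sigma_sets (topspace X) {U. openin X U}"
  unfolding borel_of_def by (rule sets_measure_of) (auto dest: openin_subset)

lemma openin_sets_borel_of: "openin X U \<Longrightarrow> U \<in> sets (borel_of X)"
  by (simp add: sets_borel_of sigma_sets.Basic)

lemma closedin_sets_borel_of: "closedin X C \<Longrightarrow> C \<in> sets (borel_of X)"
proof -
  assume C: "closedin X C"
  then have "topspace X - C \<in> sets (borel_of X)" by (intro openin_sets_borel_of) blast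
  then have "space (borel_of X) - (topspace X - C) \<in> sets (borel_of X)" by (rule sets.compl_sets)
  moreover have "space (borel_of X) - (topspace X - C) = C" using closedin_subset[OF C] by auto
  ultimately show ?thesis by simp
qed

lemma continuous_map_borel_measurable:
  assumes "continuous_map X euclidean (g :: 'x \<Rightarrow> 'b::topological_space)" "sets m = sets (borel_of X)"
  shows "g \<in> borel_measurable m"
proof (rule borel_measurableI)
  fix S :: "'b set" assume "open S"
  then have "openin X {x \<in> topspace X. g x \<in> S}"
    using assms by (auto simp: continuous_map_def)
  moreover have "g -` S \<inter> space m = {x \<in> topspace X. g x \<in> S}"
    using sets_eq_imp_space_eq[OF assms(2)] by auto
  ultimately show "g -` S \<inter> space m \<in> sets m"
    by (simp add: assms(2) openin_sets_borel_of)
qed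

lemma continuous_map_measurable_borel_of:
  assumes "continuous_map X X f" "sets m = sets (borel_of X)"
  shows "f \<in> measurable m m"
proof -
  have "f \<in> measurable m (sigma (topspace X) {U. openin X U})"
  proof (rule measurable_sigma_sets[OF sets_borel_of[unfolded borel_of_def]])
    show "{U. openin X U} \<subseteq> Pow (topspace X)" by (auto dest: openin_subset)
    have sp: "space m = topspace X" using sets_eq_imp_space_eq[OF assms(2)] by simp
    show "f \<in> space m \<rightarrow> topspace X" using assms(1) by (auto simp: sp continuous_map_def)
    fix U assume "U \<in> {U. openin X U}"
    then have "openin X {x \<in> topspace X. f x \<in> U}" using assms(1) by (auto simp: continuous_map_def)
    moreover have "f -` U \<inter> space m = {x \<in> topspace X. f x \<in> U}" by (auto simp: sp)
    ultimately show "f -` U \<inter> space m \<in> sets m" by (simp add: assms(2) openin_sets_borel_of)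
  qed
  then show ?thesis
    unfolding measurable_cong_sets[OF refl assms(2)] borel_of_def .
qed

text \<open>The assumption \<open>equi\<close> is equicontinuity of the action, stated through finite colourings of the
  group so that no uniform structure on \<open>X\<close> is needed.\<close>

locale ap_system =
  fixes X :: "'x topology" and a :: "'g::topological_ab_group_add \<Rightarrow> 'x \<Rightarrow> 'x"
  assumes compact: "compact_space X" and haus: "Hausdorff_space X" and nonempty: "topspace X \<noteq> {}"
    and act_map: "\<And>t. continuous_map X X (a t)"
    and act_zero: "\<And>x. x \<in> topspace X \<Longrightarrow> a 0 x = x"
    and act_add: "\<And>s t x. x \<in> topspace X \<Longrightarrow> a (s + t) x = a s (a t x)"
    and act_cont: "\<And>x. x \<in> topspace X \<Longrightarrow> continuous_map euclidean X (\<lambda>t. a t x)"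
    and minimal: "\<And>x. x \<in> topspace X \<Longrightarrow> X closure_of (range (\<lambda>t. a t x)) = topspace X"
    and equi: "\<And>(g :: 'x \<Rightarrow> complex) \<epsilon>. continuous_map X euclidean g \<Longrightarrow> \<epsilon> > 0 \<Longrightarrow>
      \<exists>\<kappa> :: 'g \<Rightarrow> nat. finite (range \<kappa>) \<and>
        (\<forall>s t. \<kappa> s = \<kappa> t \<longrightarrow> (\<forall>x\<in>topspace X. cmod (g (a s x) - g (a t x)) \<le> \<epsilon>))"
begin

section \<open>Orbit functions and their means\<close>

lemma act_closed: "x \<in> topspace X \<Longrightarrow> a t x \<in> topspace X"
  using act_map[of t] by (auto simp: continuous_map_def)

lemma act_inverse: "x \<in> topspace X \<Longrightarrow> a (- t) (a t x) = x" "x \<in> topspace X \<Longrightarrow> a t (a (- t) x) = x"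
  using act_add[of x "- t" t] act_add[of x t "- t"] by (simp_all add: act_zero)

text \<open>Every orbit is dense, so a closed condition on a continuous function spreads from a
  single orbit to the whole space.\<close>

lemma dense_orbit:
  assumes "continuous_map X euclidean g" "closed C" "x \<in> topspace X" "\<And>t. g (a t x) \<in> C" "y \<in> topspace X"
  shows "g y \<in> C"
proof -
  have "closedin X {y \<in> topspace X. g y \<in> C}"
    using assms(1,2) by (intro closedin_continuous_map_preimage) auto
  moreover have "range (\<lambda>t. a t x) \<subseteq> {y \<in> topspace X. g y \<in> C}"
    using assms(3,4) act_closed by auto
  ultimately have "X closure_of (range (\<lambda>t. a t x)) \<subseteq> {y \<in> topspace X. g y \<in> C}"
    by (rule closure_of_minimal[rotated])
  then show ?thesis using minimal[OF assms(3)] assms(5) by auto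
qed

definition base :: 'x
  where "base = (SOME x. x \<in> topspace X)"

lemma base: "base \<in> topspace X"
  unfolding base_def using nonempty by (meson ex_in_conv someI_ex)

lemma continuous_map_act: "continuous_map X Y g \<Longrightarrow> continuous_map X Y (\<lambda>x. g (a t x))"
  using continuous_map_compose[OF act_map[of t], of Y g] by (simp add: o_def)

lemma orbit_equi_translates:
  assumes "\<And>s t x. \<kappa> s = \<kappa> t \<Longrightarrow> x \<in> topspace X \<Longrightarrow> cmod (g (a s x) - g (a t x)) \<le> \<epsilon>" "x \<in> topspace X"
  shows "equi_translates \<epsilon> \<kappa> (\<lambda>s. g (a s x))"
  unfolding equi_translates_def
proof (intro allI impI)
  fix s t r assume "\<kappa> s = \<kappa> t"
  then show "cmod (g (a (r + s) x) - g (a (r + t) x)) \<le> \<epsilon>"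
    using assms(1)[of s t "a r x"] act_add[OF assms(2), of s r] act_add[OF assms(2), of t r]
      act_closed[OF assms(2), of r] by (simp add: add.commute)
qed

lemma orbit_almost_periodic:
  assumes "continuous_map X euclidean g" "x \<in> topspace X"
  shows "almost_periodic (\<lambda>s. g (a s x))"
  unfolding almost_periodic_def
proof (intro allI impI)
  fix \<epsilon> :: real assume "\<epsilon> > 0"
  from equi[OF assms(1) this] obtain \<kappa> :: "'g \<Rightarrow> nat" where \<kappa>: "finite (range \<kappa>)"
    "\<And>s t x. \<kappa> s = \<kappa> t \<Longrightarrow> x \<in> topspace X \<Longrightarrow> cmod (g (a s x) - g (a t x)) \<le> \<epsilon>" by blast
  have "equi_translates \<epsilon> \<kappa> (\<lambda>s. g (a s x))"
    by (rule orbit_equi_translates[where g = g, OF _ assms(2)]) (rule \<kappa>(2))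
  then show "\<exists>\<kappa>. finite (range \<kappa>) \<and> equi_translates \<epsilon> \<kappa> (\<lambda>s. g (a s x))" using \<kappa>(1) by blast
qed

text \<open>The mean along one orbit. The choice of \<open>base\<close> is immaterial in the end,
  since this is the integral against the invariant measure.\<close>

definition Lam :: "('x \<Rightarrow> complex) \<Rightarrow> complex"
  where "Lam g = mean (\<lambda>s. g (a s base))"

lemma sum_list_continuous:
  assumes "\<And>t. continuous_map X euclidean (\<lambda>x. f t x :: complex)"
  shows "continuous_map X euclidean (\<lambda>x. \<Sum>t\<leftarrow>ts. f t x)"
proof (induction ts)
  case (Cons t ts)
  have "continuous_map X euclidean (\<lambda>x. (\<lambda>x. f t x) x + (\<lambda>x. \<Sum>t\<leftarrow>ts. f t x) x)"
    by (intro continuous_map_compose2_UNIV[where g = "(+)"] assms Cons continuous_intros)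
  then show ?case by simp
qed simp

text \<open>On the orbit of \<open>base\<close> the estimate is the definition of the mean; it is a
  closed condition on a continuous function and extends by \<open>dense_orbit\<close>.\<close>

lemma uniform_average:
  assumes g: "continuous_map X euclidean g" and "\<epsilon> > 0"
  obtains ts where "ts \<noteq> []"
    "\<And>x. x \<in> topspace X \<Longrightarrow> cmod ((\<Sum>t\<leftarrow>ts. g (a t x)) / of_nat (length ts) - Lam g) \<le> \<epsilon>"
proof -
  obtain ts where ts: "ts \<noteq> []" "\<And>s. cmod (trans_avg ts (\<lambda>s. g (a s base)) s - Lam g) \<le> \<epsilon>"
    using mean_approx[OF orbit_almost_periodic[OF g base] \<open>\<epsilon> > 0\<close>] unfolding Lam_def by blast
  define h where "h x = (\<Sum>t\<leftarrow>ts. g (a t x)) / of_nat (length ts) - Lam g" for x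
  have cont: "continuous_map X euclidean h"
    unfolding h_def
    by (intro continuous_map_compose_UNIV[OF sum_list_continuous[of "\<lambda>t x. g (a t x)", OF continuous_map_act[OF g]],
          where g = "\<lambda>z. z / of_nat (length ts) - Lam g"] continuous_intros) (use ts(1) in simp)
  have "h (a s base) \<in> cball 0 \<epsilon>" for s
  proof -
    have "a (s + t) base = a t (a s base)" for t
      using act_add[OF base, of t s] by (simp add: add.commute)
    then show ?thesis using ts(2)[of s] by (simp add: h_def trans_avg_def)
  qed
  then have "h x \<in> cball 0 \<epsilon>" if "x \<in> topspace X" for x
    using dense_orbit[OF cont closed_cball base _ that] by blast
  then show ?thesis using that[OF ts(1)] by (simp add: h_def)
qed

lemma continuous_bounded:
  assumes "continuous_map X euclidean (g :: 'x \<Rightarrow> complex)"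
  obtains B where "B > 0" "\<And>x. x \<in> topspace X \<Longrightarrow> cmod (g x) \<le> B"
proof -
  have "compactin euclidean (g ` topspace X)"
    using image_compactin[OF _ assms] compact by (simp add: compact_space_def)
  then have "bounded (g ` topspace X)" by (simp add: compact_imp_bounded)
  then show ?thesis using that by (auto simp: bounded_pos)
qed

section \<open>Uniqueness of the invariant probability measure\<close>

context
  fixes m :: "'x measure"
  assumes m: "invariant_probability X a m"
begin

lemma sets_m: "sets m = sets (borel_of X)"
  using m by (simp add: invariant_probability_def)

lemma space_m: "space m = topspace X"
  using sets_eq_imp_space_eq[OF sets_m] by simp

lemma prob: "prob_space m"
  using m by (intro prob_spaceI) (simp add: invariant_probability_def)

lemma meas: "continuous_map X euclidean (g :: 'x \<Rightarrow> 'b::topological_space) \<Longrightarrow> g \<in> borel_measurable m"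
  by (rule continuous_map_borel_measurable[OF _ sets_m])

lemma continuous_integrable:
  assumes "continuous_map X euclidean (g :: 'x \<Rightarrow> complex)"
  shows "integrable m g"
proof -
  interpret prob_space m by (rule prob)
  obtain B where "\<And>x. x \<in> topspace X \<Longrightarrow> cmod (g x) \<le> B" using continuous_bounded[OF assms] by blast
  then show ?thesis
    by (intro integrable_const_bound[of _ B] meas assms) (auto simp: space_m)
qed

lemma act_measurable: "a t \<in> measurable m m"
  using m by (simp add: invariant_probability_def)

lemma integral_act:
  assumes "(f :: 'x \<Rightarrow> complex) \<in> borel_measurable m"
  shows "(\<integral>x. f (a t x) \<partial>m) = (\<integral>x. f x \<partial>m)"
proof -
  have "(\<integral>x. f x \<partial>distr m m (a t)) = (\<integral>x. f (a t x) \<partial>m)"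
    by (rule integral_distr[OF act_measurable assms])
  then show ?thesis using m by (simp add: invariant_probability_def)
qed

text \<open>Averaging over translates leaves the integral unchanged, and the averaged function is
  uniformly close to the constant \<open>Lam g\<close>.\<close>

lemma integral_eq_Lam:
  assumes g: "continuous_map X euclidean g"
  shows "(\<integral>x. g x \<partial>m) = Lam g"
proof -
  interpret prob_space m by (rule prob)
  have "cmod ((\<integral>x. g x \<partial>m) - Lam g) \<le> 0 + \<epsilon>" if \<epsilon>: "\<epsilon> > 0" for \<epsilon>
  proof -
    obtain ts where ts: "ts \<noteq> []"
      "\<And>x. x \<in> topspace X \<Longrightarrow> cmod ((\<Sum>t\<leftarrow>ts. g (a t x)) / of_nat (length ts) - Lam g) \<le> \<epsilon>"
      using uniform_average[OF g \<epsilon>] by blast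
    have int: "integrable m (\<lambda>x. g (a t x))" for t
      by (intro continuous_integrable continuous_map_act g)
    have "integrable m (\<lambda>x. \<Sum>t\<leftarrow>us. g (a t x)) \<and> (\<integral>x. (\<Sum>t\<leftarrow>us. g (a t x)) \<partial>m) = of_nat (length us) * (\<integral>x. g x \<partial>m)" for us
    proof (induction us)
      case (Cons t us)
      have "(\<integral>x. g (a t x) + (\<Sum>t\<leftarrow>us. g (a t x)) \<partial>m) = (\<integral>x. g (a t x) \<partial>m) + (\<integral>x. (\<Sum>t\<leftarrow>us. g (a t x)) \<partial>m)"
        using Cons int by (intro Bochner_Integration.integral_add) auto
      then show ?case
        using Cons int[of t] integral_act[OF meas[OF g], of t] by (simp add: distrib_right)
    qed simp
    then have sum: "integrable m (\<lambda>x. \<Sum>t\<leftarrow>ts. g (a t x))"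
      "(\<integral>x. (\<Sum>t\<leftarrow>ts. g (a t x)) \<partial>m) = of_nat (length ts) * (\<integral>x. g x \<partial>m)" by auto
    have int1: "integrable m (\<lambda>x. (\<Sum>t\<leftarrow>ts. g (a t x)) / of_nat (length ts))"
      by (intro integrable_divide sum(1))
    have e1: "(\<integral>x. (\<Sum>t\<leftarrow>ts. g (a t x)) / of_nat (length ts) - Lam g \<partial>m) =
        (\<integral>x. (\<Sum>t\<leftarrow>ts. g (a t x)) / of_nat (length ts) \<partial>m) - (\<integral>x. Lam g \<partial>m)"
      by (intro Bochner_Integration.integral_diff int1 integrable_const)
    have e2: "(\<integral>x. (\<Sum>t\<leftarrow>ts. g (a t x)) / of_nat (length ts) \<partial>m) = (\<integral>x. (\<Sum>t\<leftarrow>ts. g (a t x)) \<partial>m) / of_nat (length ts)"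
      by (rule integral_divide_zero)
    have e3: "of_nat (length ts) * (\<integral>x. g x \<partial>m) / of_nat (length ts) = (\<integral>x. g x \<partial>m)"
      using ts(1) by simp
    have e4: "(\<integral>x. Lam g \<partial>m) = Lam g" by (simp add: prob_space)
    have eq: "(\<integral>x. (\<Sum>t\<leftarrow>ts. g (a t x)) / of_nat (length ts) - Lam g \<partial>m) = (\<integral>x. g x \<partial>m) - Lam g"
      by (simp only: e1 e2 sum(2) e3 e4)
    have "cmod (\<integral>x. (\<Sum>t\<leftarrow>ts. g (a t x)) / of_nat (length ts) - Lam g \<partial>m) \<le>
        (\<integral>x. cmod ((\<Sum>t\<leftarrow>ts. g (a t x)) / of_nat (length ts) - Lam g) \<partial>m)"
      by (rule integral_norm_bound)
    also have "\<dots> \<le> (\<integral>x. \<epsilon> \<partial>m)"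
      by (intro integral_mono integrable_norm Bochner_Integration.integrable_diff int1 integrable_const ts(2))
        (simp add: space_m)
    also have "(\<integral>x. \<epsilon> \<partial>m) = \<epsilon>" by (simp add: prob_space)
    finally show ?thesis unfolding eq by simp
  qed
  then have "cmod ((\<integral>x. g x \<partial>m) - Lam g) \<le> 0" by (rule field_le_epsilon)
  then show ?thesis by simp
qed

lemma regular_outer: "A \<in> sets m \<Longrightarrow> emeasure m A = (INF U\<in>{U. openin X U \<and> A \<subseteq> U}. emeasure m U)"
  using m unfolding invariant_probability_def regular_measure_def by blast

lemma regular_inner: "A \<in> sets m \<Longrightarrow>
    emeasure m A = (SUP K\<in>{K. K \<in> sets m \<and> compactin X K \<and> K \<subseteq> A}. emeasure m K)"
  using m unfolding invariant_probability_def regular_measure_def by blast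

end

lemma locally_compact: "locally_compact_space X"
  by (rule compact_imp_locally_compact_space[OF compact])

text \<open>Between a compact \<open>K\<close> and the open set \<open>U\<close> a continuous
  function can be inserted, and all invariant measures integrate it to the same number. Inner
  regularity then compares the measures of \<open>U\<close>; outer regularity extends equality to
  all Borel sets in \<open>invariant_probability_unique\<close>.\<close>

lemma invariant_probability_le:
  assumes m: "invariant_probability X a m" and m': "invariant_probability X a m'" and U: "openin X U"
  shows "emeasure m U \<le> emeasure m' U"
proof -
  have "U \<in> sets m" using U by (simp add: sets_m[OF m] openin_sets_borel_of)
  then have "emeasure m U = (SUP K\<in>{K. K \<in> sets m \<and> compactin X K \<and> K \<subseteq> U}. emeasure m K)"
    by (rule regular_inner[OF m])
  also have "\<dots> \<le> emeasure m' U"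
  proof (rule SUP_least)
    fix K assume "K \<in> {K. K \<in> sets m \<and> compactin X K \<and> K \<subseteq> U}"
    then have K: "K \<in> sets m" "compactin X K" "K \<subseteq> U" by auto
    obtain h C where h: "continuous_map X euclideanreal h" "C \<subseteq> U"
      "\<And>x. x \<in> topspace X \<Longrightarrow> 0 \<le> h x \<and> h x \<le> 1" "\<And>x. x \<in> K \<Longrightarrow> h x = 1"
      "\<And>x. x \<in> topspace X \<Longrightarrow> x \<notin> C \<Longrightarrow> h x = 0"
      using Urysohn_compact_support[OF locally_compact haus K(2) U K(3)] by metis
    have hc: "continuous_map X euclidean (\<lambda>x. complex_of_real (h x))"
      by (intro continuous_map_compose_UNIV[OF h(1)] continuous_intros)
    have int: "(\<integral>\<^sup>+x. ennreal (h x) \<partial>n) = ennreal (Re (Lam (\<lambda>x. complex_of_real (h x))))"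
      if n: "invariant_probability X a n" for n
    proof -
      have "integrable n h"
        using integrable_Re[OF continuous_integrable[OF n hc]] by simp
      then have "(\<integral>\<^sup>+x. ennreal (h x) \<partial>n) = ennreal (\<integral>x. h x \<partial>n)"
        by (intro nn_integral_eq_integral) (auto simp: space_m[OF n] h(3))
      moreover have "(\<integral>x. h x \<partial>n) = Re (Lam (\<lambda>x. complex_of_real (h x)))"
        using integral_eq_Lam[OF n hc] by (metis integral_complex_of_real Re_complex_of_real)
      ultimately show ?thesis by simp
    qed
    have "emeasure m K = (\<integral>\<^sup>+x. indicator K x \<partial>m)" using K(1) by simp
    also have "\<dots> \<le> (\<integral>\<^sup>+x. ennreal (h x) \<partial>m)"
      using h(4) by (intro nn_integral_mono) (auto simp: indicator_def)
    also have "\<dots> = (\<integral>\<^sup>+x. ennreal (h x) \<partial>m')" using int[OF m] int[OF m'] by simp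
    also have "\<dots> \<le> (\<integral>\<^sup>+x. indicator U x \<partial>m')"
      using h(2,3,5) by (intro nn_integral_mono) (auto simp: space_m[OF m'] indicator_def)
    also have "\<dots> = emeasure m' U"
      using U by (simp add: sets_m[OF m'] openin_sets_borel_of)
    finally show "emeasure m K \<le> emeasure m' U" .
  qed
  finally show ?thesis .
qed

lemma invariant_probability_unique:
  assumes m: "invariant_probability X a m" and m': "invariant_probability X a m'"
  shows "m = m'"
proof (rule measure_eqI)
  show sets: "sets m = sets m'" using sets_m[OF m] sets_m[OF m'] by simp
  have op: "emeasure m U = emeasure m' U" if "openin X U" for U
    using invariant_probability_le[OF m m' that] invariant_probability_le[OF m' m that] by (rule antisym)
  fix A assume "A \<in> sets m"
  then show "emeasure m A = emeasure m' A"
    using regular_outer[OF m, of A] regular_outer[OF m', of A] sets op by simp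
qed

section \<open>Existence of the invariant probability measure\<close>

lemma Cc_on_eq: "\<psi> \<in> Cc_on X \<longleftrightarrow> continuous_map X euclidean \<psi>"
  using closed_compactin[of X "topspace X" "support_in X \<psi>"] compact
  by (auto simp: Cc_on_def compact_space_def support_in_def closure_of_subset_topspace)

lemma Lam_le:
  assumes "continuous_map X euclidean g" "\<And>x. x \<in> topspace X \<Longrightarrow> cmod (g x) \<le> B"
  shows "cmod (Lam g) \<le> B"
  unfolding Lam_def by (intro mean_le orbit_almost_periodic assms base act_closed)

text \<open>On a compact space every continuous function is a test function, and the mean has norm
  at most 1, so one constant serves all compact sets.\<close>

sublocale radon_functional X Lam
proof
  show "locally_compact_space X" by (rule locally_compact)
  show "Hausdorff_space X" by (rule haus)
  show "Lam (\<lambda>x. \<phi> x + \<psi> x) = Lam \<phi> + Lam \<psi>" if "\<phi> \<in> Cc_on X" "\<psi> \<in> Cc_on X" for \<phi> \<psi>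
    unfolding Lam_def using that by (intro mean_add orbit_almost_periodic base) (auto simp: Cc_on_eq)
  show "Lam (\<lambda>x. c * \<phi> x) = c * Lam \<phi>" if "\<phi> \<in> Cc_on X" for \<phi> c
    unfolding Lam_def using that by (intro mean_cmult orbit_almost_periodic base) (auto simp: Cc_on_eq)
  show "\<exists>C. \<forall>\<phi>\<in>Cc_on X. support_in X \<phi> \<subseteq> K \<longrightarrow>
      (\<forall>B. (\<forall>x\<in>topspace X. cmod (\<phi> x) \<le> B) \<longrightarrow> cmod (Lam \<phi>) \<le> C * B)" for K
    by (intro exI[of _ 1]) (auto intro!: Lam_le simp: Cc_on_eq)
qed

lemma Lam_act: "continuous_map X euclidean g \<Longrightarrow> Lam (\<lambda>x. g (a t x)) = Lam g"
proof -
  assume g: "continuous_map X euclidean g"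
  have "mean (\<lambda>s. (\<lambda>s. g (a s base)) (s + t)) = mean (\<lambda>s. g (a s base))"
    by (intro mean_shift orbit_almost_periodic g base)
  moreover have "a (s + t) base = a t (a s base)" for s
    using act_add[OF base, of t s] by (simp add: add.commute)
  ultimately show ?thesis by (simp add: Lam_def)
qed

definition pre :: "'g \<Rightarrow> 'x set \<Rightarrow> 'x set"
  where "pre t A = {x \<in> topspace X. a t x \<in> A}"

lemma pre_pre: "A \<subseteq> topspace X \<Longrightarrow> pre (- t) (pre t A) = A" "A \<subseteq> topspace X \<Longrightarrow> pre t (pre (- t) A) = A"
  unfolding pre_def using act_inverse act_closed by auto

lemma openin_pre: "openin X U \<Longrightarrow> openin X (pre t U)"
  using act_map[of t] by (auto simp: pre_def continuous_map_def)

text \<open>Composition with the action carries test functions for \<open>U\<close> to test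
  functions for its preimage and preserves \<open>Lam\<close>. The reverse inequality is the same
  statement for \<open>- t\<close>.\<close>

lemma open_variation_pre_le:
  assumes "openin X U"
  shows "open_variation X Lam U \<le> open_variation X Lam (pre t U)"
  unfolding open_variation_def[of X Lam U]
proof (rule SUP_least)
  fix \<psi> assume \<psi>: "\<psi> \<in> unit_tests X U"
  then have c: "continuous_map X euclidean \<psi>" "support_in X \<psi> \<subseteq> U" by (auto simp: unit_tests_def Cc_on_eq)
  have "closedin X (pre t (support_in X \<psi>))"
    unfolding pre_def by (rule closedin_continuous_map_preimage[OF act_map]) (simp add: support_in_def)
  moreover have "{x \<in> topspace X. \<psi> (a t x) \<noteq> 0} \<subseteq> pre t (support_in X \<psi>)"
    using zero_outside_support act_closed by (fastforce simp: pre_def)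
  ultimately have "support_in X (\<lambda>x. \<psi> (a t x)) \<subseteq> pre t (support_in X \<psi>)"
    unfolding support_in_def[of X "\<lambda>x. \<psi> (a t x)"] by (intro closure_of_minimal)
  also have "\<dots> \<subseteq> pre t U" using c(2) by (auto simp: pre_def)
  finally have "(\<lambda>x. \<psi> (a t x)) \<in> unit_tests X (pre t U)"
    using \<psi> act_closed continuous_map_act[OF c(1)] by (auto simp: unit_tests_def Cc_on_eq)
  from test_le_variation[OF this] show "ennreal (cmod (Lam \<psi>)) \<le> open_variation X Lam (pre t U)"
    by (simp add: Lam_act[OF c(1)])
qed

lemma open_variation_pre: "openin X U \<Longrightarrow> open_variation X Lam (pre t U) = open_variation X Lam U"
  using open_variation_pre_le[of U t] open_variation_pre_le[OF openin_pre[of U t], of "- t"]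
  by (simp add: pre_pre openin_subset)

lemma outer_variation_pre_le:
  assumes "A \<subseteq> topspace X"
  shows "outer_variation X Lam A \<le> outer_variation X Lam (pre t A)"
  unfolding outer_variation_def[of X Lam "pre t A"]
proof (rule INF_greatest)
  fix W assume "W \<in> {U. openin X U \<and> pre t A \<subseteq> U}"
  then have W: "openin X W" "pre t A \<subseteq> W" by auto
  have "pre (- t) (pre t A) \<subseteq> pre (- t) W" using W(2) by (auto simp: pre_def)
  then have "A \<subseteq> pre (- t) W" by (simp add: pre_pre assms)
  then have "outer_variation X Lam A \<le> outer_variation X Lam (pre (- t) W)"
    by (rule outer_variation_mono)
  also have "\<dots> = open_variation X Lam W"
    by (simp add: outer_variation_open openin_pre W open_variation_pre)
  finally show "outer_variation X Lam A \<le> open_variation X Lam W" .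
qed

lemma outer_variation_pre:
  assumes "A \<subseteq> topspace X"
  shows "outer_variation X Lam (pre t A) = outer_variation X Lam A"
proof (rule antisym)
  have "pre t A \<subseteq> topspace X" by (auto simp: pre_def)
  from outer_variation_pre_le[OF this, of "- t"]
  show "outer_variation X Lam (pre t A) \<le> outer_variation X Lam A"
    by (simp add: pre_pre assms)
qed (rule outer_variation_pre_le[OF assms])

lemma variation_topspace: "open_variation X Lam (topspace X) = 1"
proof (rule antisym)
  show "open_variation X Lam (topspace X) \<le> 1"
    unfolding open_variation_def
  proof (rule SUP_least)
    fix \<psi> assume "\<psi> \<in> unit_tests X (topspace X)"
    then have "cmod (Lam \<psi>) \<le> 1" by (intro Lam_le) (auto simp: unit_tests_def Cc_on_eq)
    then show "ennreal (cmod (Lam \<psi>)) \<le> 1" by simp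
  qed
  have "(\<lambda>x. 1) \<in> unit_tests X (topspace X)"
    by (simp add: unit_tests_def Cc_on_eq support_in_subset)
  from test_le_variation[OF this] show "1 \<le> open_variation X Lam (topspace X)"
    by (simp add: Lam_def)
qed

lemma invariant_probability_exists: "invariant_probability X a (variation_measure X Lam)"
proof -
  let ?m = "variation_measure X Lam"
  have sets: "sets ?m = sets (borel_of X)" by (simp add: sets_variation_measure sets_borel_of)
  have sp: "space ?m = topspace X" by (rule space_variation_measure)
  have em: "emeasure ?m A = outer_variation X Lam A" if "A \<in> sets ?m" for A
    using that by (intro emeasure_variation_measure) (simp add: sets_variation_measure)
  have one: "emeasure ?m (space ?m) = 1"
    by (simp add: sp emeasure_variation_open variation_topspace)
  interpret prob_space ?m by (rule prob_spaceI[OF one])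
  have outer: "emeasure ?m A = (INF U\<in>{U. openin X U \<and> A \<subseteq> U}. emeasure ?m U)" if "A \<in> sets ?m" for A
    using em[OF that] by (simp add: outer_variation_def emeasure_variation_open cong: INF_cong_simp)
  \<comment> \<open>Inner regularity by complements: an open set barely larger than the complement
    of \<open>A\<close> leaves a closed, hence compact, subset of \<open>A\<close> of nearly full
    measure. This uses that the measure is finite.\<close>
  have inner: "emeasure ?m A = (SUP K\<in>{K. K \<in> sets ?m \<and> compactin X K \<and> K \<subseteq> A}. emeasure ?m K)"
    if A: "A \<in> sets ?m" for A
  proof (rule antisym)
    show "(SUP K\<in>{K. K \<in> sets ?m \<and> compactin X K \<and> K \<subseteq> A}. emeasure ?m K) \<le> emeasure ?m A"
      using A by (auto intro!: SUP_least emeasure_mono)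
    show "emeasure ?m A \<le> (SUP K\<in>{K. K \<in> sets ?m \<and> compactin X K \<and> K \<subseteq> A}. emeasure ?m K)"
    proof (rule ennreal_le_epsilon)
      fix e :: real assume "e > 0"
      have A': "topspace X - A \<in> sets ?m" using sets.compl_sets[OF A] by (simp add: sp)
      obtain U where U: "openin X U" "topspace X - A \<subseteq> U" "emeasure ?m U < emeasure ?m (topspace X - A) + e"
        using INF_approx_ennreal[OF \<open>e > 0\<close> outer[OF A']] by auto
      define K where "K = topspace X - U"
      have K: "compactin X K" "K \<subseteq> A" "K \<in> sets ?m" "U \<in> sets ?m"
        using U compact closed_compactin[of X "topspace X" K] closedin_sets_borel_of[of X K]
        by (auto simp: K_def compact_space_def sets openin_sets_borel_of)
      have "emeasure ?m A \<le> emeasure ?m K + e"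
      proof -
        have "prob K = 1 - prob U" unfolding K_def sp[symmetric] by (rule prob_compl[OF K(4)])
        moreover have "prob (topspace X - A) = 1 - prob A" unfolding sp[symmetric] by (rule prob_compl[OF A])
        moreover have "prob U < prob (topspace X - A) + e"
          using U(3) \<open>e > 0\<close> by (simp add: emeasure_eq_measure ennreal_less_iff flip: ennreal_plus)
        ultimately have "prob A \<le> prob K + e" by simp
        then show ?thesis using \<open>e > 0\<close> by (simp add: emeasure_eq_measure flip: ennreal_plus)
      qed
      also have "\<dots> \<le> (SUP K\<in>{K. K \<in> sets ?m \<and> compactin X K \<and> K \<subseteq> A}. emeasure ?m K) + e"
        using K by (intro add_right_mono SUP_upper) auto
      finally show "emeasure ?m A \<le> (SUP K\<in>{K. K \<in> sets ?m \<and> compactin X K \<and> K \<subseteq> A}. emeasure ?m K) + e" .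
    qed
  qed
  have meas: "a t \<in> measurable ?m ?m" for t
    by (rule continuous_map_measurable_borel_of[OF act_map sets])
  have "distr ?m ?m (a t) = ?m" for t
  proof (rule measure_eqI)
    fix A assume "A \<in> sets (distr ?m ?m (a t))"
    then have A: "A \<in> sets ?m" by simp
    then have sub: "A \<subseteq> topspace X" using sets.sets_into_space[OF A] by (simp add: sp)
    have pre: "a t -` A \<inter> space ?m = pre t A" by (auto simp: pre_def sp)
    have "pre t A \<in> sets ?m" using measurable_sets[OF meas A, of t] by (simp add: pre)
    then show "emeasure (distr ?m ?m (a t)) A = emeasure ?m A"
      using A sub by (simp add: emeasure_distr[OF meas A] pre em outer_variation_pre)
  qed simp
  then show ?thesis
    unfolding invariant_probability_def regular_measure_def using sets one outer inner meas by blast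
qed

theorem uniquely_ergodic: "uniquely_ergodic X a"
  unfolding uniquely_ergodic_def using invariant_probability_exists invariant_probability_unique by blast

end

section \<open>Eigenfunctions of equicontinuous minimal systems\<close>

lemma borel_measurable_cnj [measurable (raw)]:
  "f \<in> borel_measurable M \<Longrightarrow> (\<lambda>x. cnj (f x)) \<in> borel_measurable M"
  by (rule borel_measurable_continuous_on[where f = cnj]) (auto intro: continuous_intros)

context ap_system
begin

text \<open>Nonzero continuous eigenfunctions of a minimal system have constant modulus, so
  normalisation to modulus 1 loses nothing.\<close>

definition is_eigen :: "('g \<Rightarrow> complex) \<Rightarrow> ('x \<Rightarrow> complex) \<Rightarrow> bool"
  where "is_eigen \<xi> e \<longleftrightarrow> continuous_map X euclidean e \<and>
    (\<forall>t. \<forall>x\<in>topspace X. e (a (- t) x) = \<xi> t * e x) \<and> (\<forall>x\<in>topspace X. cmod (e x) = 1)"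

lemma is_eigenD:
  assumes "is_eigen \<xi> e"
  shows "continuous_map X euclidean e" "x \<in> topspace X \<Longrightarrow> e (a (- t) x) = \<xi> t * e x"
    "x \<in> topspace X \<Longrightarrow> cmod (e x) = 1"
  using assms by (auto simp: is_eigen_def)

lemma is_eigen_value: "is_eigen \<xi> e \<Longrightarrow> x \<in> topspace X \<Longrightarrow> \<xi> t = e (a (- t) x) * cnj (e x)"
  using is_eigenD(2)[of \<xi> e x t] is_eigenD(3)[of \<xi> e x] complex_norm_square[of "e x"] by simp

text \<open>Evaluated along the orbit of \<open>base\<close>, the eigenfunction returns
  \<open>\<xi>\<close> up to a constant factor. Continuity of \<open>\<xi>\<close> on the
  topological group is thereby inherited from the orbit map.\<close>

lemma is_eigen_dual:
  assumes "is_eigen \<xi> e"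
  shows "\<xi> \<in> dual"
proof -
  have \<xi>: "\<xi> t = e (a (- t) base) * cnj (e base)" for t
    by (rule is_eigen_value[OF assms base])
  have cont: "continuous_map euclidean euclidean \<xi>"
  proof -
    have "continuous_map euclidean euclidean (\<lambda>t. e (a t base))"
      using continuous_map_compose[OF act_cont[OF base] is_eigenD(1)[OF assms]] by (simp add: o_def)
    then have "continuous_on UNIV (\<lambda>t. e (a t base))" by simp
    then have "continuous_on UNIV (\<lambda>t. e (a (- t) base) * cnj (e base))"
      by (intro continuous_intros continuous_on_compose2[of UNIV "\<lambda>t. e (a t base)" UNIV uminus]) auto
    then show ?thesis using \<xi> by (simp add: continuous_on_cong[OF refl \<xi>])
  qed
  have norm: "cmod (\<xi> t) = 1" for t
    unfolding \<xi> using is_eigenD(3)[OF assms] base act_closed[OF base] by (simp add: norm_mult)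
  have add: "\<xi> (s + t) = \<xi> s * \<xi> t" for s t
  proof -
    have "\<xi> (s + t) * e base = e (a (- s) (a (- t) base))"
      using is_eigenD(2)[OF assms base, of "s + t"] act_add[OF base, of "- s" "- t"] by simp
    also have "\<dots> = \<xi> s * \<xi> t * e base"
      using is_eigenD(2)[OF assms act_closed[OF base, of "- t"], of s] is_eigenD(2)[OF assms base, of t] by simp
    finally show ?thesis using is_eigenD(3)[OF assms base] by auto
  qed
  show ?thesis
    unfolding characters_def using cont norm add by (simp add: additive_group_def)
qed

text \<open>The product of one eigenfunction with the conjugate of the other is invariant along an
  orbit and continuous, hence constant.\<close>

lemma is_eigen_unique:
  assumes e: "is_eigen \<xi> e" and e': "is_eigen \<xi> e'"
  obtains c where "\<And>x. x \<in> topspace X \<Longrightarrow> e' x = c * e x"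
proof -
  have "continuous_map X euclidean (\<lambda>x. e' x * cnj (e x))"
    by (intro continuous_map_compose2_UNIV[OF is_eigenD(1)[OF e'] is_eigenD(1)[OF e], where g = "\<lambda>z w. z * cnj w"]
        continuous_intros)
  moreover have "e' (a t base) * cnj (e (a t base)) \<in> {e' base * cnj (e base)}" for t
  proof -
    have "\<xi> (- t) * cnj (\<xi> (- t)) = 1"
      using is_eigen_dual[OF e] complex_norm_square[of "\<xi> (- t)"] by (simp add: characters_def additive_group_def)
    then have "(\<xi> (- t) * e' base) * cnj (\<xi> (- t) * e base) = e' base * cnj (e base)"
      by (simp add: mult_ac)
    then show ?thesis
      using is_eigenD(2)[OF e base, of "- t"] is_eigenD(2)[OF e' base, of "- t"] by simp
  qed
  ultimately have const: "e' x * cnj (e x) \<in> {e' base * cnj (e base)}" if "x \<in> topspace X" for x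
    using dense_orbit[OF _ closed_singleton base _ that, of "\<lambda>x. e' x * cnj (e x)"] by blast
  have "e' x = (e' base * cnj (e base)) * e x" if x: "x \<in> topspace X" for x
  proof -
    have "cnj (e x) * e x = 1"
      using is_eigenD(3)[OF e x] complex_norm_square[of "e x"] by (simp add: mult.commute)
    then have "e' x = (e' x * cnj (e x)) * e x" by (simp add: mult.assoc)
    also have "e' x * cnj (e x) = e' base * cnj (e base)" using const[OF x] by blast
    finally show ?thesis .
  qed
  then show ?thesis using that by blast
qed

text \<open>If \<open>\<xi>\<close> occurs in the orbit function of \<open>g\<close>, then the normalised mean of
  \<open>s \<mapsto> g (a s x) * cnj (\<xi> s)\<close> depends continuously on \<open>x\<close> and is the eigenfunction.\<close>

lemma character_extends:
  assumes g: "continuous_map X euclidean g" and \<xi>: "almost_periodic \<xi>" "character \<xi>"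
    and nz: "ip (\<lambda>s. g (a s base)) \<xi> \<noteq> 0"
  obtains e where "is_eigen (\<lambda>t. cnj (\<xi> t)) e" "\<And>s. e (a s base) = \<xi> s"
proof -
  define c where "c = ip (\<lambda>s. g (a s base)) \<xi>"
  define F where "F x s = g (a s x) * cnj (\<xi> s)" for x s
  define e where "e x = mean (F x) / c" for x
  have F_ap: "almost_periodic (F x)" if "x \<in> topspace X" for x
    unfolding F_def by (intro ap_intros orbit_almost_periodic g that \<xi>)
  obtain B where B: "B > 0" "\<And>x. x \<in> topspace X \<Longrightarrow> cmod (g x) \<le> B"
    using continuous_bounded[OF g] by blast
  have F_le: "cmod (F x s) \<le> B" if "x \<in> topspace X" for x s
    using B(2)[OF act_closed[OF that]] character_norm[OF \<xi>(2)] by (simp add: F_def norm_mult)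
  have c: "c \<noteq> 0" using nz by (simp add: c_def)
  have cont: "continuous_map X euclidean e"
  proof (rule continuous_map_uniform_approx)
    fix \<epsilon> :: real assume "\<epsilon> > 0"
    \<comment> \<open>The approximation of means has error \<open>2 * \<delta>\<close>, and division
      by \<open>c\<close> turns it into \<epsilon>.\<close>
    define \<delta> where "\<delta> = \<epsilon> * cmod c / 2"
    have \<delta>: "\<delta> > 0" using \<open>\<epsilon> > 0\<close> c by (simp add: \<delta>_def)
    define \<eta> where "\<eta> = \<delta> / (1 + B)"
    have \<eta>: "\<eta> > 0" using \<delta> B by (simp add: \<eta>_def)
    from equi[OF g \<eta>] obtain \<kappa>1 :: "'g \<Rightarrow> nat" where \<kappa>1: "finite (range \<kappa>1)"
      "\<And>s t x. \<kappa>1 s = \<kappa>1 t \<Longrightarrow> x \<in> topspace X \<Longrightarrow> cmod (g (a s x) - g (a t x)) \<le> \<eta>" by blast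
    obtain \<kappa>2 where \<kappa>2: "finite (range \<kappa>2)" "equi_translates \<eta> \<kappa>2 \<xi>"
      using almost_periodicD[OF \<xi>(1) \<eta>] .
    define \<kappa> where "\<kappa> s = prod_encode (\<kappa>1 s, \<kappa>2 s)" for s
    have "range \<kappa> \<subseteq> prod_encode ` (range \<kappa>1 \<times> range \<kappa>2)" by (auto simp: \<kappa>_def)
    then have fin: "finite (range \<kappa>)"
      using \<kappa>1(1) \<kappa>2(1) by (meson finite_SigmaI finite_imageI finite_subset)
    have F_equi: "equi_translates \<delta> \<kappa> (F x)" if x: "x \<in> topspace X" for x
      unfolding equi_translates_def
    proof (intro allI impI)
      fix s t r assume "\<kappa> s = \<kappa> t"
      then have st: "\<kappa>1 s = \<kappa>1 t" "\<kappa>2 s = \<kappa>2 t" by (simp_all add: \<kappa>_def)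
      have "equi_translates \<eta> \<kappa>1 (\<lambda>s. g (a s x))"
        by (rule orbit_equi_translates[where g = g, OF _ x]) (rule \<kappa>1(2))
      from equi_translatesD[OF this st(1), of r]
      have 1: "cmod (g (a (r + s) x) - g (a (r + t) x)) \<le> \<eta>" .
      have 2: "cmod (\<xi> (r + s) - \<xi> (r + t)) \<le> \<eta>" by (rule equi_translatesD[OF \<kappa>2(2) st(2)])
      have "F x (r + s) - F x (r + t) = (g (a (r + s) x) - g (a (r + t) x)) * cnj (\<xi> (r + s)) +
          g (a (r + t) x) * cnj (\<xi> (r + s) - \<xi> (r + t))"
        by (simp add: F_def algebra_simps)
      also have "cmod \<dots> \<le> \<eta> * 1 + B * \<eta>"
      proof (intro norm_triangle_le add_mono)
        show "cmod ((g (a (r + s) x) - g (a (r + t) x)) * cnj (\<xi> (r + s))) \<le> \<eta> * 1"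
          unfolding norm_mult complex_mod_cnj using 1 character_norm[OF \<xi>(2)] by simp
        show "cmod (g (a (r + t) x) * cnj (\<xi> (r + s) - \<xi> (r + t))) \<le> B * \<eta>"
          unfolding norm_mult complex_mod_cnj using 2 B act_closed[OF x] by (intro mult_mono) auto
      qed
      also have "\<dots> = (1 + B) * \<eta>" by (simp add: algebra_simps)
      also have "\<dots> = \<delta>" using B by (simp add: \<eta>_def)
      finally show "cmod (F x (r + s) - F x (r + t)) \<le> \<delta>" .
    qed
    \<comment> \<open>The colouring and the bound do not depend on \<open>x\<close>, so one list
      serves all \<open>x\<close>. The finite sums \<open>h\<close> are continuous in
      \<open>x\<close>, and \<open>e\<close> is their uniform limit.\<close>
    obtain ts where ts: "ts \<noteq> []" "\<And>u x. almost_periodic u \<Longrightarrow> equi_translates \<delta> \<kappa> u \<Longrightarrow>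
        (\<And>x. cmod (u x) \<le> B) \<Longrightarrow> cmod (trans_avg ts u x - mean u) \<le> 2 * \<delta>"
      using uniform_mean_approx[OF fin \<delta>, of B] by metis
    define h where "h x = (\<Sum>t\<leftarrow>ts. g (a t x) * cnj (\<xi> t)) / (of_nat (length ts) * c)" for x
    have "continuous_map X euclidean (\<lambda>x. \<Sum>t\<leftarrow>ts. g (a t x) * cnj (\<xi> t))"
      by (intro sum_list_continuous continuous_map_compose_UNIV[OF continuous_map_act[OF g],
            where g = "\<lambda>z. z * cnj (\<xi> _)"] continuous_intros)
    then have "continuous_map X euclidean h"
      unfolding h_def[abs_def]
      by (rule continuous_map_compose_UNIV[where g = "\<lambda>z. z / (of_nat (length ts) * c)"])
        (intro continuous_intros, use ts(1) c in simp)
    moreover have "dist (e x) (h x) \<le> \<epsilon>" if x: "x \<in> topspace X" for x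
    proof -
      have "cmod (trans_avg ts (F x) 0 - mean (F x)) \<le> 2 * \<delta>"
        by (intro ts(2) F_ap F_equi F_le x)
      moreover have "h x = trans_avg ts (F x) 0 / c"
        by (simp add: h_def trans_avg_def F_def)
      ultimately have "cmod (h x - e x) \<le> 2 * \<delta> / cmod c"
        using c by (simp add: e_def norm_divide divide_right_mono flip: diff_divide_distrib)
      then show ?thesis using c by (simp add: dist_norm norm_minus_commute \<delta>_def)
    qed
    ultimately show "\<exists>g. continuous_map X euclidean g \<and> (\<forall>x\<in>topspace X. dist (e x) (g x) \<le> \<epsilon>)" by blast
  qed
  have act: "e (a t x) = \<xi> t * e x" if x: "x \<in> topspace X" for t x
  proof -
    have "F (a t x) s = \<xi> t * F x (s + t)" for s
    proof -
      have "F x (s + t) = g (a s (a t x)) * (cnj (\<xi> s) * cnj (\<xi> t))"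
        by (simp add: F_def act_add[OF x] character_add[OF \<xi>(2)])
      then have "\<xi> t * F x (s + t) = g (a s (a t x)) * cnj (\<xi> s) * (\<xi> t * cnj (\<xi> t))" by simp
      then show ?thesis by (simp add: F_def character_mult_cnj[OF \<xi>(2)])
    qed
    then have "mean (F (a t x)) = mean (\<lambda>s. \<xi> t * F x (s + t))" by (metis ext)
    also have "\<dots> = \<xi> t * mean (\<lambda>s. F x (s + t))" by (intro mean_cmult ap_intros F_ap x)
    also have "mean (\<lambda>s. F x (s + t)) = mean (F x)" by (intro mean_shift F_ap x)
    finally show ?thesis by (simp add: e_def)
  qed
  have e_base: "e base = 1"
    using c by (simp add: e_def F_def[abs_def] c_def ip_def)
  have orbit: "e (a s base) = \<xi> s" for s by (simp add: act base e_base)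
  have norm: "cmod (e x) = 1" if "x \<in> topspace X" for x
  proof -
    have "continuous_map X euclidean (\<lambda>x. cmod (e x))"
      by (intro continuous_map_compose_UNIV[OF cont] continuous_intros)
    moreover have "cmod (e (a t base)) \<in> {1}" for t by (simp add: orbit character_norm[OF \<xi>(2)])
    ultimately have "cmod (e x) \<in> {1}"
      using dense_orbit[OF _ closed_singleton base _ that, of "\<lambda>x. cmod (e x)"] by blast
    then show ?thesis by simp
  qed
  \<comment> \<open>The conjugate appears because eigenvalues are read off from
    \<open>a (- t)\<close>, whereas \<open>e\<close> follows \<open>\<xi>\<close> along
    \<open>a t\<close>.\<close>
  have "is_eigen (\<lambda>t. cnj (\<xi> t)) e"
    unfolding is_eigen_def using cont norm act by (auto simp: character_minus[OF \<xi>(2)])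
  then show ?thesis using that orbit by blast
qed

lemma continuous_map_sum_eigen:
  assumes "\<And>e. e \<in> E \<Longrightarrow> continuous_map X euclidean (e :: 'x \<Rightarrow> complex)"
  shows "continuous_map X euclidean (\<lambda>x. \<Sum>e\<in>E. c e * e x)"
  using assms
proof (induction E rule: infinite_finite_induct)
  case (insert e E)
  have "continuous_map X euclidean (\<lambda>x. c e * e x + (\<Sum>e\<in>E. c e * e x))"
  proof (rule continuous_map_compose2_UNIV[of X e "\<lambda>x. \<Sum>e\<in>E. c e * e x" "\<lambda>z w. c e * z + w"])
    show "continuous_on UNIV (\<lambda>p. c e * fst p + snd p)" by (intro continuous_intros)
  qed (use insert in auto)
  then show ?case using insert by simp
qed auto

context
  fixes m :: "'x measure"
  assumes m: "invariant_probability X a m"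
begin

interpretation prob_space m by (rule prob[OF m])

section \<open>Approximation in the square mean\<close>

lemma nn_integral_square:
  assumes "continuous_map X euclidean (g :: 'x \<Rightarrow> complex)"
  shows "(\<integral>\<^sup>+x. ennreal ((cmod (g x))\<^sup>2) \<partial>m) = ennreal (msq (\<lambda>s. g (a s base)))"
proof -
  have cont: "continuous_map X euclidean (\<lambda>x. g x * cnj (g x))"
    by (intro continuous_map_compose_UNIV[OF assms, where g = "\<lambda>z. z * cnj z"] continuous_intros)
  have eq: "(cmod (g x))\<^sup>2 = Re (g x * cnj (g x))" for x
    by (simp add: complex_norm_square[symmetric])
  have int: "integrable m (\<lambda>x. g x * cnj (g x))" by (rule continuous_integrable[OF m cont])
  have "(\<integral>\<^sup>+x. ennreal ((cmod (g x))\<^sup>2) \<partial>m) = ennreal (\<integral>x. (cmod (g x))\<^sup>2 \<partial>m)"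
    by (intro nn_integral_eq_integral) (use integrable_Re[OF int] in \<open>simp_all add: eq\<close>)
  also have "(\<integral>x. (cmod (g x))\<^sup>2 \<partial>m) = Re (Lam (\<lambda>x. g x * cnj (g x)))"
    unfolding eq integral_eq_Lam[OF m cont, symmetric] by (rule integral_Re[OF int])
  finally show ?thesis by (simp add: Lam_def msq_def ip_def)
qed

lemma square_add_le: "(cmod (z + w))\<^sup>2 \<le> 2 * (cmod z)\<^sup>2 + 2 * (cmod w)\<^sup>2"
proof -
  have "(cmod (z + w))\<^sup>2 \<le> (cmod z + cmod w)\<^sup>2"
    by (intro power_mono norm_triangle_ineq) simp
  also have "\<dots> \<le> 2 * (cmod z)\<^sup>2 + 2 * (cmod w)\<^sup>2"
    using sum_squares_ge_zero[of "cmod z - cmod w" 0] by (simp add: power2_eq_square algebra_simps)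
  finally show ?thesis .
qed

lemma nn_integral_square_add:
  assumes "u \<in> borel_measurable m" "v \<in> borel_measurable m"
    and "(\<integral>\<^sup>+x. ennreal ((cmod (u x))\<^sup>2) \<partial>m) < ennreal (\<epsilon> / 4)" "(\<integral>\<^sup>+x. ennreal ((cmod (v x))\<^sup>2) \<partial>m) < ennreal (\<epsilon> / 4)"
  shows "(\<integral>\<^sup>+x. ennreal ((cmod (u x + v x))\<^sup>2) \<partial>m) < ennreal \<epsilon>"
proof -
  have \<epsilon>: "\<epsilon> > 0" using assms(3) by (cases "\<epsilon> > 0") (auto simp: ennreal_neg)
  have "(\<integral>\<^sup>+x. ennreal ((cmod (u x + v x))\<^sup>2) \<partial>m) \<le>
      (\<integral>\<^sup>+x. 2 * ennreal ((cmod (u x))\<^sup>2) + 2 * ennreal ((cmod (v x))\<^sup>2) \<partial>m)"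
  proof (rule nn_integral_mono)
    fix x
    have "ennreal ((cmod (u x + v x))\<^sup>2) \<le> ennreal (2 * (cmod (u x))\<^sup>2 + 2 * (cmod (v x))\<^sup>2)"
      by (intro ennreal_leI square_add_le)
    then show "ennreal ((cmod (u x + v x))\<^sup>2) \<le> 2 * ennreal ((cmod (u x))\<^sup>2) + 2 * ennreal ((cmod (v x))\<^sup>2)"
      by (simp add: ennreal_plus ennreal_mult)
  qed
  also have "\<dots> = 2 * (\<integral>\<^sup>+x. ennreal ((cmod (u x))\<^sup>2) \<partial>m) + 2 * (\<integral>\<^sup>+x. ennreal ((cmod (v x))\<^sup>2) \<partial>m)"
    using assms(1,2) by (simp add: nn_integral_add nn_integral_cmult)
  also have "\<dots> < ennreal \<epsilon>"
  proof -
    obtain p where p: "p \<ge> 0" "(\<integral>\<^sup>+x. ennreal ((cmod (u x))\<^sup>2) \<partial>m) = ennreal p"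
      using assms(3) by (cases "\<integral>\<^sup>+x. ennreal ((cmod (u x))\<^sup>2) \<partial>m") auto
    obtain q where q: "q \<ge> 0" "(\<integral>\<^sup>+x. ennreal ((cmod (v x))\<^sup>2) \<partial>m) = ennreal q"
      using assms(4) by (cases "\<integral>\<^sup>+x. ennreal ((cmod (v x))\<^sup>2) \<partial>m") auto
    have "p < \<epsilon> / 4" "q < \<epsilon> / 4"
      using assms(3,4) p q by (simp_all add: ennreal_less_iff)
    then have "ennreal (2 * p + 2 * q) < ennreal \<epsilon>" using \<epsilon> by (intro ennreal_lessI) auto
    then show ?thesis using p q by (simp add: ennreal_plus ennreal_mult)
  qed
  finally show ?thesis .
qed

definition approximable :: "('x \<Rightarrow> complex) \<Rightarrow> bool"
  where "approximable g \<longleftrightarrow> g \<in> borel_measurable m \<and> (\<forall>\<epsilon>>0. \<exists>h. continuous_map X euclidean h \<and>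
    (\<integral>\<^sup>+x. ennreal ((cmod (g x - h x))\<^sup>2) \<partial>m) < ennreal \<epsilon>)"

lemma approximable_cong:
  assumes "\<And>x. x \<in> space m \<Longrightarrow> u x = v x" "approximable u"
  shows "approximable v"
  unfolding approximable_def
proof (intro conjI allI impI)
  show "v \<in> borel_measurable m"
    using assms(2) measurable_cong[of m u v borel] assms(1) by (simp add: approximable_def)
  fix \<epsilon> :: real assume "\<epsilon> > 0"
  then obtain h where h: "continuous_map X euclidean h" "(\<integral>\<^sup>+x. ennreal ((cmod (u x - h x))\<^sup>2) \<partial>m) < ennreal \<epsilon>"
    using assms(2) unfolding approximable_def by blast
  moreover have "(\<integral>\<^sup>+x. ennreal ((cmod (u x - h x))\<^sup>2) \<partial>m) = (\<integral>\<^sup>+x. ennreal ((cmod (v x - h x))\<^sup>2) \<partial>m)"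
    by (rule nn_integral_cong) (simp add: assms(1))
  ultimately show "\<exists>h. continuous_map X euclidean h \<and> (\<integral>\<^sup>+x. ennreal ((cmod (v x - h x))\<^sup>2) \<partial>m) < ennreal \<epsilon>"
    by auto
qed

lemma approximable_add:
  assumes "approximable u" "approximable v"
  shows "approximable (\<lambda>x. u x + v x)"
  unfolding approximable_def
proof (intro conjI allI impI)
  show "(\<lambda>x. u x + v x) \<in> borel_measurable m"
    using assms unfolding approximable_def by (intro borel_measurable_add) auto
  fix \<epsilon> :: real assume "\<epsilon> > 0"
  then have "\<epsilon> / 4 > 0" by simp
  obtain h where h: "continuous_map X euclidean h" "(\<integral>\<^sup>+x. ennreal ((cmod (u x - h x))\<^sup>2) \<partial>m) < ennreal (\<epsilon> / 4)"
    using assms(1) \<open>\<epsilon> / 4 > 0\<close> unfolding approximable_def by blast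
  obtain h' where h': "continuous_map X euclidean h'" "(\<integral>\<^sup>+x. ennreal ((cmod (v x - h' x))\<^sup>2) \<partial>m) < ennreal (\<epsilon> / 4)"
    using assms(2) \<open>\<epsilon> / 4 > 0\<close> unfolding approximable_def by blast
  have "continuous_map X euclidean (\<lambda>x. h x + h' x)"
    by (intro continuous_map_compose2_UNIV[OF h(1) h'(1)] continuous_intros)
  moreover have "(\<integral>\<^sup>+x. ennreal ((cmod (u x + v x - (h x + h' x)))\<^sup>2) \<partial>m) < ennreal \<epsilon>"
    unfolding add_diff_add using assms meas[OF m h(1)] meas[OF m h'(1)]
    by (intro nn_integral_square_add h h' borel_measurable_diff) (simp_all add: approximable_def)
  ultimately show "\<exists>h. continuous_map X euclidean h \<and>
      (\<integral>\<^sup>+x. ennreal ((cmod (u x + v x - h x))\<^sup>2) \<partial>m) < ennreal \<epsilon>"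
    by (intro exI[of _ "\<lambda>x. h x + h' x"] conjI)
qed

text \<open>Regularity encloses \<open>A\<close> between a compact \<open>K\<close> and an open
  \<open>U\<close> whose difference has measure below \<open>2 * \<delta>\<close>. A Urysohn
  function for this pair differs from the indicator only on \<open>U - K\<close>, and there by at
  most 1. The factor \<open>(cmod c)\<^sup>2 + 1\<close> in \<delta> absorbs the scalar and avoids a
  division by 0.\<close>

lemma approximable_cmult_indicator:
  assumes A: "A \<in> sets m"
  shows "approximable (\<lambda>x. c * indicator A x)"
  unfolding approximable_def
proof (intro conjI allI impI)
  show "(\<lambda>x. c * indicator A x) \<in> borel_measurable m" using A by simp
  fix \<epsilon> :: real assume \<epsilon>: "\<epsilon> > 0"
  define \<delta> where "\<delta> = \<epsilon> / (2 * ((cmod c)\<^sup>2 + 1))"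
  have pos: "2 * ((cmod c)\<^sup>2 + 1) > 0" by (simp add: add_nonneg_pos)
  have \<delta>: "\<delta> > 0" using \<epsilon> pos by (simp add: \<delta>_def)
  obtain U where U: "openin X U" "A \<subseteq> U" "emeasure m U < emeasure m A + \<delta>"
    using INF_approx_ennreal[OF \<delta> regular_outer[OF m A]] by auto
  obtain K where K: "K \<in> sets m" "compactin X K" "K \<subseteq> A" "emeasure m A < emeasure m K + \<delta>"
  proof -
    have "{K. K \<in> sets m \<and> compactin X K \<and> K \<subseteq> A} \<noteq> {}" by (auto intro!: exI[of _ "{}"])
    from SUP_approx_ennreal[OF \<delta> this regular_inner[OF m A]] show ?thesis using that by auto
  qed
  have Us: "U \<in> sets m" using U(1) by (simp add: sets_m[OF m] openin_sets_borel_of)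
  have "prob U < prob A + \<delta>" "prob A < prob K + \<delta>"
    using U(3) K(4) \<delta> by (simp_all add: emeasure_eq_measure ennreal_less_iff flip: ennreal_plus)
  then have UK: "prob (U - K) < 2 * \<delta>"
    using finite_measure_Diff[OF Us K(1)] U(2) K(3) by simp
  obtain h C where h: "continuous_map X euclideanreal h" "C \<subseteq> U"
    "\<And>x. x \<in> topspace X \<Longrightarrow> 0 \<le> h x \<and> h x \<le> 1" "\<And>x. x \<in> K \<Longrightarrow> h x = 1"
    "\<And>x. x \<in> topspace X \<Longrightarrow> x \<notin> C \<Longrightarrow> h x = 0"
    using Urysohn_compact_support[OF locally_compact haus K(2) U(1) order_trans[OF K(3) U(2)]] by metis
  have hc: "continuous_map X euclidean (\<lambda>x. c * complex_of_real (h x))"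
    by (intro continuous_map_compose_UNIV[OF h(1), where g = "\<lambda>r. c * complex_of_real r"] continuous_intros)
  have le: "ennreal ((cmod (c * indicator A x - c * complex_of_real (h x)))\<^sup>2) \<le> ennreal ((cmod c)\<^sup>2) * indicator (U - K) x"
    if x: "x \<in> space m" for x
  proof -
    have xX: "x \<in> topspace X" using x by (simp add: space_m[OF m])
    have eq: "(cmod (c * indicator A x - c * complex_of_real (h x)))\<^sup>2 = (cmod c)\<^sup>2 * (indicator A x - h x)\<^sup>2"
    proof -
      have "c * indicator A x - c * complex_of_real (h x) = c * complex_of_real (indicator A x - h x)"
        by (simp add: indicator_def algebra_simps)
      then show ?thesis by (simp add: norm_mult power_mult_distrib del: of_real_diff)
    qed
    consider "x \<in> K" | "x \<notin> U" | "x \<in> U - K" by blast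
    then show ?thesis
    proof cases
      case 1
      then show ?thesis using h(4) K(3) by (auto simp: eq indicator_def)
    next
      case 2
      then show ?thesis using h(2,5) xX U(2) by (auto simp: eq indicator_def)
    next
      case 3
      have "\<bar>indicator A x - h x\<bar> \<le> 1" using h(3)[OF xX] by (auto simp: indicator_def)
      then have "(indicator A x - h x)\<^sup>2 \<le> 1" by (simp add: abs_square_le_1)
      then have "(cmod c)\<^sup>2 * (indicator A x - h x)\<^sup>2 \<le> (cmod c)\<^sup>2 * 1" by (intro mult_left_mono) auto
      then show ?thesis using 3 by (simp add: eq ennreal_leI)
    qed
  qed
  have "(\<integral>\<^sup>+x. ennreal ((cmod (c * indicator A x - c * complex_of_real (h x)))\<^sup>2) \<partial>m) \<le>
      (\<integral>\<^sup>+x. ennreal ((cmod c)\<^sup>2) * indicator (U - K) x \<partial>m)"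
    by (intro nn_integral_mono le)
  also have "\<dots> = ennreal ((cmod c)\<^sup>2 * prob (U - K))"
    using Us K(1) by (subst nn_integral_cmult_indicator) (auto simp: emeasure_eq_measure ennreal_mult)
  also have "\<dots> < ennreal \<epsilon>"
  proof (rule ennreal_lessI[OF \<epsilon>])
    have "(cmod c)\<^sup>2 * prob (U - K) \<le> (cmod c)\<^sup>2 * (2 * \<delta>)"
      using UK by (intro mult_left_mono) auto
    also have "\<dots> < 2 * ((cmod c)\<^sup>2 + 1) * \<delta>" using \<delta> by (simp add: algebra_simps)
    also have "\<dots> = \<epsilon>" using nonzero_eq_divide_eq[of "2 * ((cmod c)\<^sup>2 + 1)" \<delta> \<epsilon>] pos by (simp add: \<delta>_def mult.commute)
    finally show "(cmod c)\<^sup>2 * prob (U - K) < \<epsilon>" .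
  qed
  finally show "\<exists>h. continuous_map X euclidean h \<and>
      (\<integral>\<^sup>+x. ennreal ((cmod (c * indicator A x - h x))\<^sup>2) \<partial>m) < ennreal \<epsilon>"
    using hc by blast
qed

lemma approximable_sum:
  "finite I \<Longrightarrow> (\<And>i. i \<in> I \<Longrightarrow> approximable (u i)) \<Longrightarrow> approximable (\<lambda>x. \<Sum>i\<in>I. u i x)"
proof (induction I rule: finite_induct)
  case empty
  show ?case using approximable_cmult_indicator[of "{}" 0] by simp
next
  case (insert i I)
  then show ?case using approximable_add[of "u i" "\<lambda>x. \<Sum>i\<in>I. u i x"] by simp
qed

text \<open>Simple functions with modulus at most twice that of \<open>g\<close> converge to
  \<open>g\<close> pointwise, so the squared errors are dominated by
  \<open>9 * (cmod (g x))\<^sup>2\<close>. Simple functions are finite combinations of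
  indicators.\<close>

lemma approximable_L2:
  assumes g: "g \<in> L2 m" and "\<epsilon> > 0"
  obtains h where "continuous_map X euclidean h" "(\<integral>\<^sup>+x. ennreal ((cmod (g x - h x))\<^sup>2) \<partial>m) < ennreal \<epsilon>"
proof -
  have gm [measurable]: "g \<in> borel_measurable m" and gi: "integrable m (\<lambda>x. (cmod (g x))\<^sup>2)"
    using g by (auto simp: L2_def)
  from borel_measurable_implies_sequence_metric[OF gm, of 0]
  obtain F where F': "\<forall>i. simple_function m (F i)" "\<forall>x\<in>space m. (\<lambda>i. F i x) \<longlonglongrightarrow> g x"
    "\<forall>i. \<forall>x\<in>space m. dist (F i x) 0 \<le> 2 * dist (g x) 0"
    by (elim exE conjE)
  have F: "simple_function m (F i)" "x \<in> space m \<Longrightarrow> (\<lambda>i. F i x) \<longlonglongrightarrow> g x"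
    "x \<in> space m \<Longrightarrow> dist (F i x) 0 \<le> 2 * dist (g x) 0" for i x
    using F' by simp_all
  have Fm [measurable]: "F i \<in> borel_measurable m" for i
    by (rule borel_measurable_simple_function[OF F(1)])
  have app: "approximable (F i)" for i
  proof -
    have sum: "approximable (\<lambda>x. \<Sum>y\<in>F i ` space m. y * indicator (F i -` {y} \<inter> space m) x)"
      using F(1)[of i] by (intro approximable_sum approximable_cmult_indicator)
        (auto simp: simple_function_def)
    have eq: "F i x = (\<Sum>y\<in>F i ` space m. y * indicator (F i -` {y} \<inter> space m) x)" if "x \<in> space m" for x
    proof -
      have "F i x = (\<Sum>y\<in>F i ` space m. indicator (F i -` {y} \<inter> space m) x *\<^sub>R y)"
        by (rule simple_function_indicator_representation_banach[OF F(1) that])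
      also have "\<dots> = (\<Sum>y\<in>F i ` space m. y * indicator (F i -` {y} \<inter> space m) x)"
        by (intro sum.cong) (auto simp: indicator_def)
      finally show ?thesis .
    qed
    show ?thesis by (rule approximable_cong[OF eq[symmetric] sum])
  qed
  have bound: "ennreal ((cmod (g x - F i x))\<^sup>2) \<le> ennreal (9 * (cmod (g x))\<^sup>2)" if "x \<in> space m" for i x
  proof (rule ennreal_leI)
    have "cmod (g x - F i x) \<le> 3 * cmod (g x)"
      using F(3)[OF that, of i] norm_triangle_ineq4[of "g x" "F i x"] by simp
    then have "(cmod (g x - F i x))\<^sup>2 \<le> (3 * cmod (g x))\<^sup>2" by (intro power_mono) auto
    then show "(cmod (g x - F i x))\<^sup>2 \<le> 9 * (cmod (g x))\<^sup>2" by (simp add: power_mult_distrib)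
  qed
  have "(\<lambda>i. \<integral>\<^sup>+x. ennreal ((cmod (g x - F i x))\<^sup>2) \<partial>m) \<longlonglongrightarrow> (\<integral>\<^sup>+x. 0 \<partial>m)"
  proof (rule nn_integral_dominated_convergence[where w = "\<lambda>x. ennreal (9 * (cmod (g x))\<^sup>2)"])
    show "(\<integral>\<^sup>+x. ennreal (9 * (cmod (g x))\<^sup>2) \<partial>m) < \<infinity>"
      using gi by (subst nn_integral_eq_integral) auto
    show "AE x in m. (\<lambda>i. ennreal ((cmod (g x - F i x))\<^sup>2)) \<longlonglongrightarrow> 0"
    proof (rule AE_I2)
      fix x assume "x \<in> space m"
      from F(2)[OF this] have "(\<lambda>i. (cmod (g x - F i x))\<^sup>2) \<longlonglongrightarrow> (cmod (g x - g x))\<^sup>2"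
        by (intro tendsto_intros)
      then have "(\<lambda>i. ennreal ((cmod (g x - F i x))\<^sup>2)) \<longlonglongrightarrow> ennreal ((cmod (g x - g x))\<^sup>2)"
        by (rule tendsto_ennrealI)
      then show "(\<lambda>i. ennreal ((cmod (g x - F i x))\<^sup>2)) \<longlonglongrightarrow> 0" by simp
    qed
  qed (use bound in auto)
  then have "\<forall>\<^sub>F i in sequentially. (\<integral>\<^sup>+x. ennreal ((cmod (g x - F i x))\<^sup>2) \<partial>m) < ennreal (\<epsilon> / 4)"
    using \<open>\<epsilon> > 0\<close> by (intro order_tendstoD(2)[where y = 0]) auto
  then obtain i where i: "(\<integral>\<^sup>+x. ennreal ((cmod (g x - F i x))\<^sup>2) \<partial>m) < ennreal (\<epsilon> / 4)"
    by (auto simp: eventually_sequentially)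
  have "\<epsilon> / 4 > 0" using \<open>\<epsilon> > 0\<close> by simp
  then obtain h where h: "continuous_map X euclidean h" "(\<integral>\<^sup>+x. ennreal ((cmod (F i x - h x))\<^sup>2) \<partial>m) < ennreal (\<epsilon> / 4)"
    using app[of i] unfolding approximable_def by blast
  have "(\<integral>\<^sup>+x. ennreal ((cmod ((g x - F i x) + (F i x - h x)))\<^sup>2) \<partial>m) < ennreal \<epsilon>"
    using meas[OF m h(1)] by (intro nn_integral_square_add i h borel_measurable_diff) auto
  then show ?thesis using that h(1) by simp
qed

text \<open>After replacing \<open>g\<close> by a continuous \<open>h\<close>, the norm of a
  continuous function is the mean square of its orbit function, so Fourier approximation on the
  group carries over. Only characters with nonzero coefficient occur, and precisely these extend to
  eigenfunctions.\<close>

lemma eigen_approximation: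
  assumes g: "g \<in> L2 m" and "\<epsilon> > 0"
  obtains E c where "finite E" "\<And>e. e \<in> E \<Longrightarrow> \<exists>\<xi>. is_eigen \<xi> e"
    "(\<integral>\<^sup>+x. ennreal ((cmod (g x - (\<Sum>e\<in>E. c e * e x)))\<^sup>2) \<partial>m) < ennreal \<epsilon>"
proof -
  have e4: "\<epsilon> / 4 > 0" using \<open>\<epsilon> > 0\<close> by simp
  obtain h where h: "continuous_map X euclidean h" "(\<integral>\<^sup>+x. ennreal ((cmod (g x - h x))\<^sup>2) \<partial>m) < ennreal (\<epsilon> / 4)"
    by (rule approximable_L2[OF g e4])
  define u where "u s = h (a s base)" for s
  have u: "almost_periodic u" unfolding u_def by (rule orbit_almost_periodic[OF h(1) base])
  obtain Ch where Ch: "finite Ch" "\<And>\<xi>. \<xi> \<in> Ch \<Longrightarrow> almost_periodic \<xi> \<and> character \<xi> \<and> ip u \<xi> \<noteq> 0"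
    "msq (\<lambda>x. u x - (\<Sum>\<xi>\<in>Ch. ip u \<xi> * \<xi> x)) < \<epsilon> / 4"
    by (rule fourier_approximation[OF u e4]) blast
  have "\<exists>e. is_eigen (\<lambda>t. cnj (\<xi> t)) e \<and> (\<forall>s. e (a s base) = \<xi> s)" if "\<xi> \<in> Ch" for \<xi>
  proof -
    have \<xi>: "almost_periodic \<xi>" "character \<xi>" "ip (\<lambda>s. h (a s base)) \<xi> \<noteq> 0"
      using Ch(2)[OF that] by (simp_all add: u_def[abs_def])
    show ?thesis by (rule character_extends[OF h(1) \<xi>]) blast
  qed
  then obtain ext where ext: "\<And>\<xi>. \<xi> \<in> Ch \<Longrightarrow> is_eigen (\<lambda>t. cnj (\<xi> t)) (ext \<xi>)"
    "\<And>\<xi> s. \<xi> \<in> Ch \<Longrightarrow> ext \<xi> (a s base) = \<xi> s" by metis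
  define E where "E = ext ` Ch"
  \<comment> \<open>The coefficient is recovered from \<open>e\<close> through its orbit function,
    as the sum has to be indexed by eigenfunctions instead of characters.\<close>
  define c where "c e = ip u (\<lambda>s. e (a s base))" for e
  have inj: "inj_on ext Ch"
  proof (rule inj_onI)
    fix \<xi> \<eta> assume *: "\<xi> \<in> Ch" "\<eta> \<in> Ch" "ext \<xi> = ext \<eta>"
    show "\<xi> = \<eta>"
    proof
      fix s show "\<xi> s = \<eta> s" using ext(2)[OF *(1), of s] ext(2)[OF *(2), of s] *(3) by simp
    qed
  qed
  have ext_orbit: "(\<lambda>s. ext \<xi> (a s base)) = \<xi>" if "\<xi> \<in> Ch" for \<xi>
    using ext(2)[OF that] by auto
  have E: "finite E" "\<And>e. e \<in> E \<Longrightarrow> \<exists>\<xi>. is_eigen \<xi> e"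
    using Ch(1) ext(1) by (auto simp: E_def)
  have sum_cont: "continuous_map X euclidean (\<lambda>x. \<Sum>e\<in>E. c e * e x)"
    using E(2) is_eigenD(1) by (intro continuous_map_sum_eigen) blast
  have cont: "continuous_map X euclidean (\<lambda>x. h x - (\<Sum>e\<in>E. c e * e x))"
    by (intro continuous_map_compose2_UNIV[OF h(1) sum_cont, where g = "(-)"] continuous_intros)
  have "(\<Sum>e\<in>E. c e * e (a s base)) = (\<Sum>\<xi>\<in>Ch. ip u \<xi> * \<xi> s)" for s
    unfolding E_def by (subst sum.reindex[OF inj]) (auto simp: c_def ext_orbit ext(2) intro!: sum.cong)
  then have "(\<integral>\<^sup>+x. ennreal ((cmod (h x - (\<Sum>e\<in>E. c e * e x)))\<^sup>2) \<partial>m) < ennreal (\<epsilon> / 4)"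
    using Ch(3) e4 by (simp add: nn_integral_square[OF cont] u_def ennreal_lessI)
  moreover have "g \<in> borel_measurable m" using g by (simp add: L2_def)
  ultimately have "(\<integral>\<^sup>+x. ennreal ((cmod ((g x - h x) + (h x - (\<Sum>e\<in>E. c e * e x))))\<^sup>2) \<partial>m) < ennreal \<epsilon>"
    using meas[OF m h(1)] meas[OF m sum_cont] by (intro nn_integral_square_add h(2) borel_measurable_diff)
  then show ?thesis using that[OF E, of c] by simp
qed

lemma continuous_L2:
  assumes "continuous_map X euclidean (g :: 'x \<Rightarrow> complex)"
  shows "g \<in> L2 m"
proof -
  have "continuous_map X euclidean (\<lambda>x. complex_of_real ((cmod (g x))\<^sup>2))"
    by (intro continuous_map_compose_UNIV[OF assms] continuous_intros)
  from integrable_Re[OF continuous_integrable[OF m this]] show ?thesis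
    using meas[OF m assms] by (simp add: L2_def)
qed

lemma is_eigen_eigenfunction:
  assumes "is_eigen \<xi> e"
  shows "eigenfunction a m \<xi> e"
  unfolding eigenfunction_def
proof (intro conjI allI)
  show "\<not> (AE x in m. e x = 0)"
  proof
    assume "AE x in m. e x = 0"
    moreover have "e x \<noteq> 0" if "x \<in> topspace X" for x using is_eigenD(3)[OF assms that] by auto
    ultimately have "AE x in m. False"
      by (elim AE_mp) (auto intro!: AE_I2 simp: space_m[OF m])
    then show False by simp
  qed
qed (use is_eigen_dual[OF assms] is_eigenD[OF assms] continuous_L2 in \<open>auto simp: space_m[OF m] intro!: AE_I2\<close>)

theorem pure_point: "pure_point_spectrum a m"
  unfolding pure_point_spectrum_def
proof (intro ballI allI impI)
  fix g and \<epsilon> :: real assume "g \<in> L2 m" "\<epsilon> > 0"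
  then obtain E c where E: "finite E" "\<And>e. e \<in> E \<Longrightarrow> \<exists>\<xi>. is_eigen \<xi> e"
    "(\<integral>\<^sup>+x. ennreal ((cmod (g x - (\<Sum>e\<in>E. c e * e x)))\<^sup>2) \<partial>m) < ennreal \<epsilon>"
    by (rule eigen_approximation) blast
  show "\<exists>E c. finite E \<and> (\<forall>e\<in>E. \<exists>\<xi>. eigenfunction a m \<xi> e) \<and>
      (\<integral>\<^sup>+x. ennreal ((cmod (g x - (\<Sum>e\<in>E. c e * e x)))\<^sup>2) \<partial>m) < ennreal \<epsilon>"
  proof (intro exI[of _ E] exI[of _ c] conjI ballI)
    show "\<exists>\<xi>. eigenfunction a m \<xi> e" if "e \<in> E" for e
      using E(2)[OF that] is_eigen_eigenfunction by blast
  qed (rule E)+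
qed

section \<open>Orthogonality and continuous representatives\<close>

lemma L2_mult_integrable:
  assumes "u \<in> L2 m" "v \<in> L2 m"
  shows "integrable m (\<lambda>x. u x * cnj (v x))"
proof (rule Bochner_Integration.integrable_bound)
  show "integrable m (\<lambda>x. (cmod (u x))\<^sup>2 + (cmod (v x))\<^sup>2)"
    using assms by (intro Bochner_Integration.integrable_add) (simp_all add: L2_def)
  have [measurable]: "u \<in> borel_measurable m" "v \<in> borel_measurable m"
    using assms by (simp_all add: L2_def)
  show "(\<lambda>x. u x * cnj (v x)) \<in> borel_measurable m"
    by measurable
  have "cmod z * cmod w \<le> (cmod z)\<^sup>2 + (cmod w)\<^sup>2" for z w
    using sum_squares_bound[of "cmod z" "cmod w"] mult_nonneg_nonneg[OF norm_ge_zero[of z] norm_ge_zero[of w]]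
    unfolding mult.assoc by linarith
  then show "AE x in m. norm (u x * cnj (v x)) \<le> norm ((cmod (u x))\<^sup>2 + (cmod (v x))\<^sup>2)"
    by (intro AE_I2) (simp add: norm_mult)
qed

lemma L2_diff:
  assumes "u \<in> L2 m" "v \<in> L2 m"
  shows "(\<lambda>x. u x - v x) \<in> L2 m"
proof -
  have [measurable]: "u \<in> borel_measurable m" "v \<in> borel_measurable m"
    using assms by (simp_all add: L2_def)
  have meas': "(\<lambda>x. u x - v x) \<in> borel_measurable m" by measurable
  have "integrable m (\<lambda>x. (cmod (u x - v x))\<^sup>2)"
  proof (rule Bochner_Integration.integrable_bound)
    show "integrable m (\<lambda>x. 2 * (cmod (u x))\<^sup>2 + 2 * (cmod (v x))\<^sup>2)"
      using assms by (intro Bochner_Integration.integrable_add integrable_mult_right) (simp_all add: L2_def)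
    show "(\<lambda>x. (cmod (u x - v x))\<^sup>2) \<in> borel_measurable m" using meas' by simp
    show "AE x in m. norm ((cmod (u x - v x))\<^sup>2) \<le> norm (2 * (cmod (u x))\<^sup>2 + 2 * (cmod (v x))\<^sup>2)"
      using square_add_le[of "u _" "- v _"] by (intro AE_I2) simp
  qed
  then show ?thesis using meas' by (simp add: L2_def)
qed

text \<open>Pythagoras: \<open>h\<close> is orthogonal to every combination \<open>s\<close> of
  eigenfunctions, so the squared distance from \<open>h\<close> to \<open>s\<close> is at least the
  squared norm of \<open>h\<close>, yet it can be made arbitrarily small.\<close>

lemma orthogonal_eigen_zero:
  assumes h: "h \<in> L2 m" and orth: "\<And>\<xi> e. is_eigen \<xi> e \<Longrightarrow> (\<integral>x. h x * cnj (e x) \<partial>m) = 0"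
  shows "AE x in m. h x = 0"
proof -
  have hi: "integrable m (\<lambda>x. (cmod (h x))\<^sup>2)" "h \<in> borel_measurable m" using h by (simp_all add: L2_def)
  have "(\<integral>x. (cmod (h x))\<^sup>2 \<partial>m) \<le> 0 + \<epsilon>" if \<epsilon>: "\<epsilon> > 0" for \<epsilon>
  proof -
    obtain E c where E: "finite E" "\<And>e. e \<in> E \<Longrightarrow> \<exists>\<xi>. is_eigen \<xi> e"
      "(\<integral>\<^sup>+x. ennreal ((cmod (h x - (\<Sum>e\<in>E. c e * e x)))\<^sup>2) \<partial>m) < ennreal \<epsilon>"
      by (rule eigen_approximation[OF h \<epsilon>]) blast
    define s where "s x = (\<Sum>e\<in>E. c e * e x)" for x
    have E': "continuous_map X euclidean e" "(\<integral>x. h x * cnj (e x) \<partial>m) = 0" if "e \<in> E" for e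
      using E(2)[OF that] is_eigenD(1) orth by blast+
    have "continuous_map X euclidean s"
      unfolding s_def by (intro continuous_map_sum_eigen E')
    then have s: "s \<in> L2 m" by (rule continuous_L2)
    have d: "(\<lambda>x. h x - s x) \<in> L2 m" by (rule L2_diff[OF h s])
    have hs: "integrable m (\<lambda>x. h x * cnj (s x))" by (rule L2_mult_integrable[OF h s])
    have int0: "(\<integral>x. h x * cnj (s x) \<partial>m) = 0"
    proof -
      have "h x * cnj (s x) = (\<Sum>e\<in>E. cnj (c e) * (h x * cnj (e x)))" for x
        by (simp add: s_def sum_distrib_left mult_ac)
      then have "(\<integral>x. h x * cnj (s x) \<partial>m) = (\<integral>x. (\<Sum>e\<in>E. cnj (c e) * (h x * cnj (e x))) \<partial>m)"
        by simp
      also have "\<dots> = (\<Sum>e\<in>E. \<integral>x. cnj (c e) * (h x * cnj (e x)) \<partial>m)"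
        by (intro Bochner_Integration.integral_sum integrable_mult_right L2_mult_integrable h continuous_L2 E')
      also have "\<dots> = 0" using E'(2) by (intro sum.neutral) simp
      finally show ?thesis .
    qed
    have eq: "(cmod (h x - s x))\<^sup>2 = (cmod (h x))\<^sup>2 + (cmod (s x))\<^sup>2 - 2 * Re (h x * cnj (s x))" for x
      by (simp add: cmod_power2) (simp add: power2_eq_square algebra_simps)
    have "(\<integral>x. (cmod (h x - s x))\<^sup>2 \<partial>m) = (\<integral>x. (cmod (h x))\<^sup>2 + (cmod (s x))\<^sup>2 \<partial>m) - (\<integral>x. 2 * Re (h x * cnj (s x)) \<partial>m)"
      unfolding eq using hi(1) s integrable_Re[OF hs]
      by (intro Bochner_Integration.integral_diff Bochner_Integration.integrable_add integrable_mult_right) (simp_all add: L2_def)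
    moreover have "(\<integral>x. (cmod (h x))\<^sup>2 + (cmod (s x))\<^sup>2 \<partial>m) = (\<integral>x. (cmod (h x))\<^sup>2 \<partial>m) + (\<integral>x. (cmod (s x))\<^sup>2 \<partial>m)"
      using hi(1) s by (intro Bochner_Integration.integral_add) (simp_all add: L2_def)
    moreover have "(\<integral>x. 2 * Re (h x * cnj (s x)) \<partial>m) = 0"
    proof -
      have "(\<integral>x. 2 * Re (h x * cnj (s x)) \<partial>m) = 2 * (\<integral>x. Re (h x * cnj (s x)) \<partial>m)"
        by (rule integral_mult_right_zero)
      also have "\<dots> = 0" unfolding integral_Re[OF hs] int0 by simp
      finally show ?thesis .
    qed
    moreover have "(\<integral>x. (cmod (s x))\<^sup>2 \<partial>m) \<ge> 0" by simp
    moreover have "(\<integral>x. (cmod (h x - s x))\<^sup>2 \<partial>m) < \<epsilon>"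
    proof -
      have "(\<integral>\<^sup>+x. ennreal ((cmod (h x - s x))\<^sup>2) \<partial>m) = ennreal (\<integral>x. (cmod (h x - s x))\<^sup>2 \<partial>m)"
        using d by (intro nn_integral_eq_integral) (simp_all add: L2_def)
      then show ?thesis using E(3) by (simp add: s_def ennreal_less_iff)
    qed
    ultimately show ?thesis by linarith
  qed
  then have "(\<integral>x. (cmod (h x))\<^sup>2 \<partial>m) \<le> 0" by (rule field_le_epsilon)
  then have "(\<integral>x. (cmod (h x))\<^sup>2 \<partial>m) = 0" by (simp add: antisym)
  then have "AE x in m. (cmod (h x))\<^sup>2 = 0"
    using integral_nonneg_eq_0_iff_AE[OF hi(1)] by simp
  then show ?thesis by simp
qed

text \<open>Invariance of the measure multiplies the inner product by
  \<open>\<xi> t * cnj (\<eta> t)\<close>, which differs from 1 for a suitable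
  \<open>t\<close>.\<close>

lemma eigenfunction_orthogonal:
  assumes g: "eigenfunction a m \<xi> g" and e: "is_eigen \<eta> e" and "\<xi> \<noteq> \<eta>"
  shows "(\<integral>x. g x * cnj (e x) \<partial>m) = 0"
proof -
  obtain t where t: "\<xi> t \<noteq> \<eta> t" using \<open>\<xi> \<noteq> \<eta>\<close> by blast
  define I where "I = (\<integral>x. g x * cnj (e x) \<partial>m)"
  have gL: "g \<in> L2 m" "AE x in m. g (a (- t) x) = \<xi> t * g x" using g by (simp_all add: eigenfunction_def)
  have em: "e \<in> borel_measurable m" by (rule meas[OF m is_eigenD(1)[OF e]])
  have gm: "g \<in> borel_measurable m" using gL(1) by (simp add: L2_def)
  have "I = (\<integral>x. g (a (- t) x) * cnj (e (a (- t) x)) \<partial>m)"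
    unfolding I_def
    by (rule integral_act[OF m, symmetric]) (intro borel_measurable_times gm borel_measurable_cnj em)
  also have "\<dots> = (\<integral>x. \<xi> t * cnj (\<eta> t) * (g x * cnj (e x)) \<partial>m)"
  proof (rule integral_cong_AE)
    have [measurable]: "a (- t) \<in> measurable m m" "g \<in> borel_measurable m" "e \<in> borel_measurable m"
      by (rule act_measurable[OF m]) (fact gm em)+
    show "(\<lambda>x. g (a (- t) x) * cnj (e (a (- t) x))) \<in> borel_measurable m" by measurable
    show "(\<lambda>x. \<xi> t * cnj (\<eta> t) * (g x * cnj (e x))) \<in> borel_measurable m" by measurable
    show "AE x in m. g (a (- t) x) * cnj (e (a (- t) x)) = \<xi> t * cnj (\<eta> t) * (g x * cnj (e x))"
      using gL(2) AE_space
    proof eventually_elim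
      case (elim x)
      then show ?case using is_eigenD(2)[OF e, of x t] by (simp add: space_m[OF m])
    qed
  qed
  also have "\<dots> = \<xi> t * cnj (\<eta> t) * I" unfolding I_def by simp
  finally have "I = 0 \<or> \<xi> t * cnj (\<eta> t) = 1" by simp
  moreover have "\<xi> t * cnj (\<eta> t) \<noteq> 1"
  proof
    assume 1: "\<xi> t * cnj (\<eta> t) = 1"
    have n: "cmod (\<eta> t) = 1" using is_eigen_dual[OF e] by (simp add: characters_def additive_group_def)
    then have "\<eta> t * cnj (\<eta> t) = 1" using complex_norm_square[of "\<eta> t"] by simp
    moreover have "cnj (\<eta> t) \<noteq> 0" using n by auto
    ultimately show False using 1 t by (metis mult_cancel_right)
  qed
  ultimately show ?thesis by (simp add: I_def)
qed

text \<open>Without a continuous eigenfunction for \<open>\<xi>\<close>, \<open>g\<close> would be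
  orthogonal to all continuous eigenfunctions and vanish. Given one, \<open>g\<close> minus its
  projection is orthogonal to it and to its multiples, which are all those with eigenvalue
  \<open>\<xi>\<close>, and also to those with other eigenvalues; so the difference
  vanishes.\<close>

lemma eigenfunction_continuous_representative:
  assumes g: "eigenfunction a m \<xi> g"
  obtains e c where "is_eigen \<xi> e" "AE x in m. g x = c * e x"
proof -
  have gL: "g \<in> L2 m" and nz: "\<not> (AE x in m. g x = 0)" using g by (simp_all add: eigenfunction_def)
  obtain e where e: "is_eigen \<xi> e"
  proof (rule ccontr)
    assume "\<not> thesis"
    then have none: "\<not> is_eigen \<xi> e" for e using that by blast
    have "(\<integral>x. g x * cnj (e x) \<partial>m) = 0" if "is_eigen \<eta> e" for \<eta> e
      using eigenfunction_orthogonal[OF g that] none that by blast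
    then have "AE x in m. g x = 0" by (rule orthogonal_eigen_zero[OF gL])
    then show False using nz by blast
  qed
  have eL: "e \<in> L2 m" by (rule continuous_L2[OF is_eigenD(1)[OF e]])
  define c where "c = (\<integral>x. g x * cnj (e x) \<partial>m)"
  define h where "h x = g x - c * e x" for x
  have ceL: "(\<lambda>x. c * e x) \<in> L2 m"
    by (intro continuous_L2 continuous_map_compose_UNIV[OF is_eigenD(1)[OF e]] continuous_intros)
  have hL: "h \<in> L2 m" unfolding h_def by (rule L2_diff[OF gL ceL])
  have ee: "(\<integral>x. e x * cnj (e x) \<partial>m) = 1"
  proof -
    have "(\<integral>x. e x * cnj (e x) \<partial>m) = (\<integral>x. 1 \<partial>m)"
    proof (rule Bochner_Integration.integral_cong[OF refl])
      fix x assume "x \<in> space m"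
      then have "cmod (e x) = 1" using is_eigenD(3)[OF e] by (simp add: space_m[OF m])
      then show "e x * cnj (e x) = 1" using complex_norm_square[of "e x"] by simp
    qed
    then show ?thesis by (simp add: prob_space)
  qed
  have split: "(\<integral>x. h x * cnj (e' x) \<partial>m) = (\<integral>x. g x * cnj (e' x) \<partial>m) - c * (\<integral>x. e x * cnj (e' x) \<partial>m)"
    if "e' \<in> L2 m" for e'
  proof -
    have "(\<integral>x. h x * cnj (e' x) \<partial>m) = (\<integral>x. g x * cnj (e' x) - c * (e x * cnj (e' x)) \<partial>m)"
      by (simp add: h_def algebra_simps)
    also have "\<dots> = (\<integral>x. g x * cnj (e' x) \<partial>m) - (\<integral>x. c * (e x * cnj (e' x)) \<partial>m)"
      by (intro Bochner_Integration.integral_diff integrable_mult_right L2_mult_integrable gL eL that)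
    finally show ?thesis by simp
  qed
  have orth: "(\<integral>x. h x * cnj (e' x) \<partial>m) = 0" if e': "is_eigen \<eta> e'" for \<eta> e'
  proof (cases "\<eta> = \<xi>")
    case True
    obtain d where d: "\<And>x. x \<in> topspace X \<Longrightarrow> e' x = d * e x"
      using is_eigen_unique[OF e] e' True by metis
    have "(\<integral>x. h x * cnj (e' x) \<partial>m) = (\<integral>x. cnj d * (h x * cnj (e x)) \<partial>m)"
      by (rule Bochner_Integration.integral_cong[OF refl]) (simp add: d space_m[OF m])
    also have "\<dots> = cnj d * (\<integral>x. h x * cnj (e x) \<partial>m)" by simp
    also have "(\<integral>x. h x * cnj (e x) \<partial>m) = 0"
      using split[OF eL] ee by (simp add: c_def)
    finally show ?thesis by simp
  next
    case False
    have e'L: "e' \<in> L2 m" by (rule continuous_L2[OF is_eigenD(1)[OF e']])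
    show ?thesis
      using split[OF e'L] eigenfunction_orthogonal[OF g e'] False
        eigenfunction_orthogonal[OF is_eigen_eigenfunction[OF e] e'] by simp
  qed
  have "AE x in m. h x = 0" by (rule orthogonal_eigen_zero[OF hL orth])
  then have "AE x in m. g x = c * e x" by (simp add: h_def)
  then show ?thesis using that e by blast
qed

theorem eigenfunctions_continuous: "all_eigenfunctions_continuous X a m"
  unfolding all_eigenfunctions_continuous_def
proof (intro allI impI)
  fix \<xi> g assume g: "eigenfunction a m \<xi> g"
  obtain e c where e: "is_eigen \<xi> e" "AE x in m. g x = c * e x"
    by (rule eigenfunction_continuous_representative[OF g])
  have "continuous_map X euclidean (\<lambda>x. c * e x)"
    by (intro continuous_map_compose_UNIV[OF is_eigenD(1)[OF e(1)]] continuous_intros)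
  moreover have "\<forall>t. \<forall>x\<in>topspace X. c * e (a (- t) x) = \<xi> t * (c * e x)"
    using is_eigenD(2)[OF e(1)] by simp
  ultimately show "continuous_eigenfunction X a m \<xi> g"
    unfolding continuous_eigenfunction_def using g e(2) by blast
qed

theorem eigenvalues_is_eigen: "\<xi> \<in> eigenvalues a m \<Longrightarrow> \<exists>e. is_eigen \<xi> e"
  unfolding eigenvalues_def using eigenfunction_continuous_representative by blast

end

end

section \<open>Radon measures on topological groups\<close>

instance prod :: (topological_monoid_add, topological_monoid_add) topological_monoid_add
proof
  fix a b :: "'a \<times> 'b"
  show "((\<lambda>x. fst x + snd x) \<longlongrightarrow> a + b) (nhds a \<times>\<^sub>F nhds b)"
    unfolding plus_prod_def
    by (intro tendsto_intros filterlim_compose[OF tendsto_fst] filterlim_compose[OF tendsto_snd] filterlim_fst filterlim_snd)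
qed

instance prod :: (topological_group_add, topological_group_add) topological_group_add
proof
  fix a :: "'a \<times> 'b"
  show "(uminus \<longlongrightarrow> - a) (nhds a)"
    unfolding uminus_prod_def
    by (intro tendsto_intros filterlim_ident)
qed

instance prod :: (topological_ab_group_add, topological_ab_group_add) topological_ab_group_add ..

section \<open>Test functions on a topological group\<close>

lemma support_in_euclidean: "support_in euclidean \<phi> = supp \<phi>"
  by (simp add: support_in_def supp_def)

lemma Cc_on_euclidean: "Cc_on euclidean = Cc"
  by (simp add: Cc_on_def Cc_def support_in_euclidean)

text \<open>The bridge by which \<open>norm_le_integral\<close> speaks about the measure occurring
  in admissibility and in \<open>radon_integral\<close>.\<close>

lemma variation_measure_euclidean: "variation_measure euclidean \<mu> = total_variation \<mu>"
proof -
  have "open_variation euclidean \<mu> = variation_open \<mu>"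
    by (simp add: fun_eq_iff open_variation_def variation_open_def unit_tests_def Cc_on_euclidean support_in_euclidean)
  then show ?thesis
    unfolding variation_measure_def total_variation_def outer_variation_def[abs_def]
    by (simp add: borel_def)
qed

lemma Hausdorff_euclidean: "Hausdorff_space (euclidean :: 'a::t2_space topology)"
  unfolding Hausdorff_space_def disjnt_def using hausdorff by fastforce

lemma CcI:
  fixes \<phi> :: "'a::t2_space \<Rightarrow> complex"
  assumes "continuous_on UNIV \<phi>" "compact K" "\<And>x. x \<notin> K \<Longrightarrow> \<phi> x = 0"
  shows "\<phi> \<in> Cc" "supp \<phi> \<subseteq> K"
  using Cc_onI[OF Hausdorff_euclidean, of \<phi> K] assms by (simp_all add: Cc_on_euclidean support_in_euclidean)

lemma CcD: "\<phi> \<in> Cc \<Longrightarrow> continuous_on UNIV \<phi>" "\<phi> \<in> Cc \<Longrightarrow> compact (supp \<phi>)"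
  by (simp_all add: Cc_def)

lemma not_in_supp: "x \<notin> supp \<phi> \<Longrightarrow> \<phi> x = 0"
  using zero_outside_support[of x euclidean \<phi>] by (simp add: support_in_euclidean)

lemma Cc_bounded:
  assumes "\<phi> \<in> Cc"
  obtains B where "B > 0" "\<And>x. cmod (\<phi> x) \<le> B"
  using Cc_on_bounded[of \<phi> euclidean] assms by (auto simp: Cc_on_euclidean)

lemma Cc_cmult: "\<phi> \<in> Cc \<Longrightarrow> (\<lambda>x. c * \<phi> x) \<in> Cc" "\<phi> \<in> Cc \<Longrightarrow> supp (\<lambda>x. c * \<phi> x) \<subseteq> supp \<phi>"
  for \<phi> :: "'a::t2_space \<Rightarrow> complex"
  using Cc_on_cmult[OF Hausdorff_euclidean, of \<phi> c] by (simp_all add: Cc_on_euclidean support_in_euclidean)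

lemma Cc_add: "\<phi> \<in> Cc \<Longrightarrow> \<psi> \<in> Cc \<Longrightarrow> (\<lambda>x. \<phi> x + \<psi> x) \<in> Cc"
  for \<phi> :: "'a::t2_space \<Rightarrow> complex"
  using Cc_on_add(1)[OF Hausdorff_euclidean, of \<phi> \<psi>] by (simp add: Cc_on_euclidean)

lemma Cc_cutoff:
  fixes K :: "'a::t2_space set"
  assumes "locally_compact_space (euclidean :: 'a topology)" "compact K"
  obtains h :: "'a \<Rightarrow> real" where "(\<lambda>x. complex_of_real (h x)) \<in> Cc" "\<And>x. 0 \<le> h x \<and> h x \<le> 1" "\<And>x. x \<in> K \<Longrightarrow> h x = 1"
proof -
  have K: "compactin euclidean K" using assms(2) by simp
  obtain h :: "'a \<Rightarrow> real" and C where h: "continuous_map euclidean euclideanreal h" "compactin euclidean C" "C \<subseteq> UNIV"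
    "\<And>x. x \<in> topspace euclidean \<Longrightarrow> 0 \<le> h x \<and> h x \<le> 1" "\<And>x. x \<in> K \<Longrightarrow> h x = 1"
    "\<And>x. x \<in> topspace euclidean \<Longrightarrow> x \<notin> C \<Longrightarrow> h x = 0"
    using Urysohn_compact_support[OF assms(1) Hausdorff_euclidean K, of UNIV] by auto
  have "(\<lambda>x. complex_of_real (h x)) \<in> Cc"
    by (rule CcI(1)[of _ C]) (use h in \<open>auto intro!: continuous_intros\<close>)
  then show ?thesis using that h(4,5) by simp
qed

lemma compact_diff_image:
  fixes A B :: "'a::topological_group_add set"
  assumes "compact A" "compact B"
  shows "compact ((\<lambda>p. fst p - snd p) ` (A \<times> B))"
  using assms by (intro compact_continuous_image compact_Times continuous_intros)

lemma Cc_translate: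
  fixes \<phi> :: "'a::{topological_group_add, t2_space} \<Rightarrow> complex"
  assumes "\<phi> \<in> Cc"
  shows "(\<lambda>x. \<phi> (x + c)) \<in> Cc" "supp (\<lambda>x. \<phi> (x + c)) \<subseteq> (\<lambda>x. x - c) ` supp \<phi>"
proof -
  have cont: "continuous_on UNIV (\<lambda>x. \<phi> (x + c))"
    by (rule continuous_on_compose2[OF CcD(1)[OF assms]]) (auto intro!: continuous_intros)
  have K: "compact ((\<lambda>x. x - c) ` supp \<phi>)"
    using CcD(2)[OF assms] by (intro compact_continuous_image continuous_intros)
  have z: "\<phi> (x + c) = 0" if x: "x \<notin> (\<lambda>x. x - c) ` supp \<phi>" for x
  proof -
    have "x + c \<notin> supp \<phi>"
    proof
      assume "x + c \<in> supp \<phi>"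
      then have "(x + c) - c \<in> (\<lambda>x. x - c) ` supp \<phi>" by (rule imageI)
      then show False using x by simp
    qed
    then show ?thesis by (rule not_in_supp)
  qed
  show "(\<lambda>x. \<phi> (x + c)) \<in> Cc" "supp (\<lambda>x. \<phi> (x + c)) \<subseteq> (\<lambda>x. x - c) ` supp \<phi>"
    using CcI[OF cont K z] by auto
qed

lemma Cc_reflect:
  fixes \<phi> :: "'a::{topological_group_add, t2_space} \<Rightarrow> complex"
  assumes "\<phi> \<in> Cc"
  shows "(\<lambda>x. \<phi> (- x)) \<in> Cc"
proof (rule CcI(1)[of _ "uminus ` supp \<phi>"])
  show "continuous_on UNIV (\<lambda>x. \<phi> (- x))"
    by (rule continuous_on_compose2[OF CcD(1)[OF assms]]) (auto intro!: continuous_intros)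
  show "compact (uminus ` supp \<phi>)"
    using CcD(2)[OF assms] by (intro compact_continuous_image continuous_intros)
  show "\<phi> (- x) = 0" if x: "x \<notin> uminus ` supp \<phi>" for x
  proof -
    have "- x \<notin> supp \<phi>"
    proof
      assume "- x \<in> supp \<phi>"
      then have "- (- x) \<in> uminus ` supp \<phi>" by (rule imageI)
      then show False using x by simp
    qed
    then show ?thesis by (rule not_in_supp)
  qed
qed

text \<open>Continuity of \<open>u (x + w)\<close> at the points \<open>(d, 0)\<close> yields
  product neighbourhoods; finitely many of their first factors cover \<open>D\<close>, and the
  second factors are intersected.\<close>

lemma compact_uniformly_continuous_translates:
  fixes u :: "'a::topological_group_add \<Rightarrow> complex"
  assumes D: "compact D" and u: "continuous_on UNIV u" and \<epsilon>: "\<epsilon> > 0"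
  obtains W where "open W" "0 \<in> W" "\<And>d w. d \<in> D \<Longrightarrow> w \<in> W \<Longrightarrow> cmod (u (d + w) - u d) \<le> \<epsilon>"
proof -
  have cont: "continuous_on UNIV (\<lambda>p. u (fst p + snd p))"
    by (rule continuous_on_compose2[OF u]) (auto intro!: continuous_intros)
  have "\<exists>A B. open A \<and> open B \<and> d \<in> A \<and> 0 \<in> B \<and> (\<forall>a\<in>A. \<forall>b\<in>B. cmod (u (a + b) - u d) < \<epsilon> / 2)" for d
  proof -
    have "open ((\<lambda>p. u (fst p + snd p)) -` ball (u d) (\<epsilon> / 2))"
      using cont by (intro open_vimage) auto
    moreover have "(d, 0) \<in> (\<lambda>p. u (fst p + snd p)) -` ball (u d) (\<epsilon> / 2)" using \<epsilon> by simp
    ultimately obtain A B where AB: "open A" "open B" "(d, 0) \<in> A \<times> B"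
      "A \<times> B \<subseteq> (\<lambda>p. u (fst p + snd p)) -` ball (u d) (\<epsilon> / 2)" by (rule open_prod_elim)
    have "cmod (u (a + b) - u d) < \<epsilon> / 2" if "a \<in> A" "b \<in> B" for a b
    proof -
      have "(a, b) \<in> (\<lambda>p. u (fst p + snd p)) -` ball (u d) (\<epsilon> / 2)" using AB(4) that by blast
      then show ?thesis by (simp add: dist_norm norm_minus_commute)
    qed
    then show ?thesis using AB by auto
  qed
  then obtain A B where AB: "\<And>d. open (A d)" "\<And>d. open (B d)" "\<And>d. d \<in> A d" "\<And>d. 0 \<in> B d"
    "\<And>d a b. a \<in> A d \<Longrightarrow> b \<in> B d \<Longrightarrow> cmod (u (a + b) - u d) < \<epsilon> / 2" by metis
  have cov: "D \<subseteq> (\<Union>d\<in>D. A d)" using AB(3) by auto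
  obtain T where T: "T \<subseteq> D" "finite T" "D \<subseteq> (\<Union>d\<in>T. A d)"
    using compactE_image[OF D _ cov] AB(1) by blast
  show ?thesis
  proof
    show "open (\<Inter>d\<in>T. B d)" using T AB by auto
    show "0 \<in> (\<Inter>d\<in>T. B d)" using AB by auto
    fix d w assume d: "d \<in> D" and w: "w \<in> (\<Inter>d\<in>T. B d)"
    obtain t where t: "t \<in> T" "d \<in> A t" using T(3) d by auto
    have "cmod (u (d + w) - u t) < \<epsilon> / 2" using AB(5)[OF t(2)] w t(1) by auto
    moreover have "cmod (u (d + 0) - u t) < \<epsilon> / 2" using AB(5)[OF t(2) AB(4)] .
    ultimately show "cmod (u (d + w) - u d) \<le> \<epsilon>"
      using norm_triangle_ineq4[of "u (d + w) - u t" "u d - u t"] by simp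
  qed
qed

lemma locally_compact_zero:
  assumes "locally_compact_space (euclidean :: 'a::topological_group_add topology)"
  obtains N C :: "'a::topological_group_add set" where "open N" "compact C" "0 \<in> N" "N \<subseteq> C"
proof -
  have "\<exists>U K. openin euclidean U \<and> compactin euclidean K \<and> (0::'a) \<in> U \<and> U \<subseteq> K"
    by (rule assms[unfolded locally_compact_space_def, rule_format]) simp
  then show ?thesis using that by auto
qed

text \<open>\<open>N\<close> and \<open>K\<close> are fixed before \<epsilon>: all differences of
  \<phi> and its small translates live on one compact set, so one constant bounds a Radon measure on
  all of them.\<close>

lemma Cc_uniformly_continuous:
  fixes \<phi> :: "'a::{topological_group_add, t2_space} \<Rightarrow> complex"
  assumes lc: "locally_compact_space (euclidean :: 'a topology)" and \<phi>: "\<phi> \<in> Cc"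
  obtains N K where "open N" "0 \<in> N" "compact K" "\<And>w x. w \<in> N \<Longrightarrow> x \<notin> K \<Longrightarrow> \<phi> (x + w) - \<phi> x = 0"
    "\<And>\<epsilon>. \<epsilon> > 0 \<Longrightarrow> \<exists>W. open W \<and> 0 \<in> W \<and> W \<subseteq> N \<and> (\<forall>w\<in>W. \<forall>x. cmod (\<phi> (x + w) - \<phi> x) \<le> \<epsilon>)"
proof -
  obtain N C :: "'a set" where NC: "open N" "compact C" "0 \<in> N" "N \<subseteq> C"
    using locally_compact_zero[OF lc] .
  define K where "K = (\<lambda>p. fst p - snd p) ` (supp \<phi> \<times> C)"
  have K: "compact K" unfolding K_def by (intro compact_diff_image CcD(2)[OF \<phi>] NC)
  have zero: "\<phi> (x + w) - \<phi> x = 0" if w: "w \<in> N" and x: "x \<notin> K" for w x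
  proof -
    have "x + c \<notin> supp \<phi>" if "c \<in> C" for c
    proof
      assume "x + c \<in> supp \<phi>"
      then have "(x + c) - c \<in> K" unfolding K_def using that by (intro image_eqI[of _ _ "(x + c, c)"]) auto
      then show False using x by simp
    qed
    from this[of w] this[of 0] have "x + w \<notin> supp \<phi>" "x \<notin> supp \<phi>" using NC w by auto
    then show ?thesis using not_in_supp[of _ \<phi>] by simp
  qed
  have small: "\<exists>W. open W \<and> 0 \<in> W \<and> W \<subseteq> N \<and> (\<forall>w\<in>W. \<forall>x. cmod (\<phi> (x + w) - \<phi> x) \<le> \<epsilon>)" if \<epsilon>: "\<epsilon> > 0" for \<epsilon>
  proof -
    obtain W where W: "open W" "0 \<in> W" "\<And>d w. d \<in> K \<Longrightarrow> w \<in> W \<Longrightarrow> cmod (\<phi> (d + w) - \<phi> d) \<le> \<epsilon>"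
      using compact_uniformly_continuous_translates[OF K CcD(1)[OF \<phi>] \<epsilon>] by blast
    have "cmod (\<phi> (x + w) - \<phi> x) \<le> \<epsilon>" if "w \<in> W \<inter> N" for w x
      using W(3)[of x w] zero[of w x] that \<epsilon> by (cases "x \<in> K") auto
    then show ?thesis using W NC by (intro exI[of _ "W \<inter> N"]) auto
  qed
  show ?thesis by (rule that[OF NC(1,3) K zero small])
qed

lemma radon_functional_euclidean:
  fixes \<rho> :: "'a::t2_space functional"
  assumes lc: "locally_compact_space (euclidean :: 'a topology)" and \<rho>: "\<rho> \<in> radon_measures"
  shows "radon_functional euclidean \<rho>"
proof
  show "locally_compact_space (euclidean :: 'a topology)" by (rule lc)
  show "Hausdorff_space (euclidean :: 'a topology)" by (rule Hausdorff_euclidean)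
  show "\<rho> (\<lambda>x. \<phi> x + \<psi> x) = \<rho> \<phi> + \<rho> \<psi>" if "\<phi> \<in> Cc_on euclidean" "\<psi> \<in> Cc_on euclidean" for \<phi> \<psi>
    using \<rho> that by (simp add: radon_measures_def Cc_on_euclidean)
  show "\<rho> (\<lambda>x. c * \<phi> x) = c * \<rho> \<phi>" if "\<phi> \<in> Cc_on euclidean" for \<phi> c
    using \<rho> that by (simp add: radon_measures_def Cc_on_euclidean)
  fix K :: "'a set" assume "compactin euclidean K"
  then have "\<exists>C. \<forall>\<phi>\<in>Cc. supp \<phi> \<subseteq> K \<longrightarrow> cmod (\<rho> \<phi>) \<le> C * (SUP x. cmod (\<phi> x))"
    using \<rho> by (simp add: radon_measures_def)
  then obtain C where C: "\<And>\<phi>. \<phi> \<in> Cc \<Longrightarrow> supp \<phi> \<subseteq> K \<Longrightarrow> cmod (\<rho> \<phi>) \<le> C * (SUP x. cmod (\<phi> x))"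
    by blast
  \<comment> \<open>The constant is made nonnegative so that the estimate is monotone when the
    supremum is replaced by an upper bound.\<close>
  have "cmod (\<rho> \<phi>) \<le> max C 0 * B" if \<phi>: "\<phi> \<in> Cc" "supp \<phi> \<subseteq> K" and B: "\<And>x. cmod (\<phi> x) \<le> B" for \<phi> B
  proof -
    have S: "(SUP x. cmod (\<phi> x)) \<le> B" by (rule cSUP_least) (auto intro: B)
    have bdd: "bdd_above (range (\<lambda>x. cmod (\<phi> x)))" by (intro bdd_aboveI2[of _ _ B] B)
    have "0 \<le> (SUP x. cmod (\<phi> x))"
      by (rule order_trans[OF norm_ge_zero cSUP_upper[OF UNIV_I[of undefined] bdd]])
    then have "C * (SUP x. cmod (\<phi> x)) \<le> max C 0 * (SUP x. cmod (\<phi> x))" by (intro mult_right_mono) auto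
    also have "\<dots> \<le> max C 0 * B" using S by (intro mult_left_mono) auto
    finally show ?thesis using C[OF \<phi>] by linarith
  qed
  then show "\<exists>C. \<forall>\<phi>\<in>Cc_on euclidean. support_in euclidean \<phi> \<subseteq> K \<longrightarrow>
      (\<forall>B. (\<forall>x\<in>topspace euclidean. cmod (\<phi> x) \<le> B) \<longrightarrow> cmod (\<rho> \<phi>) \<le> C * B)"
    by (intro exI[of _ "max C 0"]) (simp add: Cc_on_euclidean support_in_euclidean)
qed

section \<open>Integration of continuous functions against a Radon measure\<close>

locale radon_measure =
  fixes \<rho> :: "'a::t2_space functional"
  assumes lc_space: "locally_compact_space (euclidean :: 'a topology)" and radon: "\<rho> \<in> radon_measures"
begin

sublocale R: radon_functional euclidean \<rho>
  by (rule radon_functional_euclidean[OF lc_space radon])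

abbreviation "TV \<equiv> total_variation \<rho>"

lemma add: "\<phi> \<in> Cc \<Longrightarrow> \<psi> \<in> Cc \<Longrightarrow> \<rho> (\<lambda>x. \<phi> x + \<psi> x) = \<rho> \<phi> + \<rho> \<psi>"
  using radon by (simp add: radon_measures_def)

lemma scale: "\<phi> \<in> Cc \<Longrightarrow> \<rho> (\<lambda>x. c * \<phi> x) = c * \<rho> \<phi>"
  using radon by (simp add: radon_measures_def)

lemma diff: "\<phi> \<in> Cc \<Longrightarrow> \<psi> \<in> Cc \<Longrightarrow> (\<lambda>x. \<phi> x - \<psi> x) \<in> Cc \<and> \<rho> (\<lambda>x. \<phi> x - \<psi> x) = \<rho> \<phi> - \<rho> \<psi>"
  using add[of \<phi> "\<lambda>x. (- 1) * \<psi> x"] scale[of \<psi> "- 1"] Cc_cmult(1)[of \<psi> "- 1"] Cc_add[of \<phi> "\<lambda>x. (- 1) * \<psi> x"] by simp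

lemma norm_le: "\<phi> \<in> Cc \<Longrightarrow> ennreal (cmod (\<rho> \<phi>)) \<le> (\<integral>\<^sup>+x. ennreal (cmod (\<phi> x)) \<partial>TV)"
  using R.norm_le_integral[of \<phi>] by (simp add: Cc_on_euclidean variation_measure_euclidean)

lemma continuous_measurable: "continuous_on UNIV (g :: 'a \<Rightarrow> 'b::topological_space) \<Longrightarrow> g \<in> borel_measurable TV"
  using R.continuous_measurable_variation[of g] by (simp add: variation_measure_euclidean)

lemma nn_integral_triangle:
  assumes "continuous_on UNIV u" "continuous_on UNIV v" "continuous_on UNIV w"
  shows "(\<integral>\<^sup>+x. ennreal (cmod (u x - w x)) \<partial>TV) \<le>
    (\<integral>\<^sup>+x. ennreal (cmod (v x - u x)) \<partial>TV) + (\<integral>\<^sup>+x. ennreal (cmod (v x - w x)) \<partial>TV)"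
proof -
  have [measurable]: "u \<in> borel_measurable TV" "v \<in> borel_measurable TV" "w \<in> borel_measurable TV"
    by (intro continuous_measurable assms)+
  have "(\<integral>\<^sup>+x. ennreal (cmod (u x - w x)) \<partial>TV) \<le>
      (\<integral>\<^sup>+x. ennreal (cmod (v x - u x)) + ennreal (cmod (v x - w x)) \<partial>TV)"
  proof (rule nn_integral_mono)
    fix x
    have "cmod (u x - w x) \<le> cmod (v x - u x) + cmod (v x - w x)"
      using norm_triangle_ineq4[of "v x - w x" "v x - u x"] by simp
    then show "ennreal (cmod (u x - w x)) \<le> ennreal (cmod (v x - u x)) + ennreal (cmod (v x - w x))"
      by (simp flip: ennreal_plus)
  qed
  also have "\<dots> = (\<integral>\<^sup>+x. ennreal (cmod (v x - u x)) \<partial>TV) + (\<integral>\<^sup>+x. ennreal (cmod (v x - w x)) \<partial>TV)"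
    by (rule nn_integral_add) auto
  finally show ?thesis .
qed

text \<open>The continuous functions in the closure of \<open>Cc\<close> for the first mean, on
  which the limit defining \<open>radon_integral\<close> exists.\<close>

definition admits :: "('a \<Rightarrow> complex) \<Rightarrow> bool"
  where "admits g \<longleftrightarrow> continuous_on UNIV g \<and>
    (\<forall>\<epsilon>>0. \<exists>\<phi>\<in>Cc. (\<integral>\<^sup>+x. ennreal (cmod (g x - \<phi> x)) \<partial>TV) \<le> ennreal \<epsilon>)"

lemma close_values:
  assumes "continuous_on UNIV g" "\<phi> \<in> Cc" "\<psi> \<in> Cc" "\<epsilon> \<ge> 0" "\<delta> \<ge> 0"
    and "(\<integral>\<^sup>+x. ennreal (cmod (g x - \<phi> x)) \<partial>TV) \<le> ennreal \<epsilon>" "(\<integral>\<^sup>+x. ennreal (cmod (g x - \<psi> x)) \<partial>TV) \<le> ennreal \<delta>"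
  shows "cmod (\<rho> \<phi> - \<rho> \<psi>) \<le> \<epsilon> + \<delta>"
proof -
  have "ennreal (cmod (\<rho> \<phi> - \<rho> \<psi>)) = ennreal (cmod (\<rho> (\<lambda>x. \<phi> x - \<psi> x)))"
    using diff[OF assms(2,3)] by simp
  also have "\<dots> \<le> (\<integral>\<^sup>+x. ennreal (cmod (\<phi> x - \<psi> x)) \<partial>TV)"
    using diff[OF assms(2,3)] by (intro norm_le) simp
  also have "\<dots> \<le> ennreal \<epsilon> + ennreal \<delta>"
    using nn_integral_triangle[OF CcD(1)[OF assms(2)] assms(1) CcD(1)[OF assms(3)]] add_mono[OF assms(6,7)]
    by (rule order_trans)
  finally show ?thesis using assms(4,5) by (simp flip: ennreal_plus)
qed

text \<open>By \<open>norm_le\<close>, approximating sequences have Cauchy values with a common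
  limit, so the definite description denotes that limit. Later arguments know the integral only
  through this estimate.\<close>

lemma radon_integral_close:
  assumes g: "admits g" and \<phi>: "\<phi> \<in> Cc" "(\<integral>\<^sup>+x. ennreal (cmod (g x - \<phi> x)) \<partial>TV) \<le> ennreal \<epsilon>" "\<epsilon> \<ge> 0"
  shows "cmod (radon_integral \<rho> g - \<rho> \<phi>) \<le> \<epsilon>"
proof -
  have cont: "continuous_on UNIV g" using g by (simp add: admits_def)
  have "\<exists>\<psi>\<in>Cc. (\<integral>\<^sup>+x. ennreal (cmod (g x - \<psi> x)) \<partial>TV) \<le> ennreal (inverse (real (Suc n)))" for n
    using g by (simp add: admits_def)
  then obtain \<psi> where \<psi>: "\<And>n. \<psi> n \<in> Cc"
    "\<And>n. (\<integral>\<^sup>+x. ennreal (cmod (g x - \<psi> n x)) \<partial>TV) \<le> ennreal (inverse (real (Suc n)))" by metis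
  have lim0: "(\<lambda>n. \<integral>\<^sup>+x. ennreal (cmod (g x - \<psi> n x)) \<partial>TV) \<longlonglongrightarrow> 0"
  proof (rule tendsto_sandwich[OF _ _ tendsto_const])
    have "(\<lambda>n. ennreal (inverse (real (Suc n)))) \<longlonglongrightarrow> ennreal 0"
      by (intro tendsto_ennrealI LIMSEQ_inverse_real_of_nat)
    then show "(\<lambda>n. ennreal (inverse (real (Suc n)))) \<longlonglongrightarrow> 0" by simp
  qed (use \<psi>(2) in auto)
  have cc: "cmod (\<rho> (\<psi> m) - \<rho> (\<psi> n)) \<le> inverse (real (Suc m)) + inverse (real (Suc n))" for m n
    by (intro close_values[OF cont] \<psi>) auto
  have "Cauchy (\<lambda>n. \<rho> (\<psi> n))"
  proof (rule CauchyI)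
    fix e :: real assume "e > 0"
    then obtain N where N: "\<forall>n\<ge>N. inverse (real (Suc n)) < e / 2"
      using order_tendstoD(2)[OF LIMSEQ_inverse_real_of_nat, of "e / 2"] by (auto simp: eventually_sequentially)
    have "cmod (\<rho> (\<psi> m) - \<rho> (\<psi> n)) < e" if "m \<ge> N" "n \<ge> N" for m n
      using cc[of m n] N[rule_format, OF that(1)] N[rule_format, OF that(2)] by linarith
    then show "\<exists>M. \<forall>m\<ge>M. \<forall>n\<ge>M. norm (\<rho> (\<psi> m) - \<rho> (\<psi> n)) < e" by blast
  qed
  then obtain z where z: "(\<lambda>n. \<rho> (\<psi> n)) \<longlonglongrightarrow> z"
    using Cauchy_convergent unfolding convergent_def by blast
  have unique: "z' = z" if \<phi>': "\<And>n. \<phi>' n \<in> Cc" "(\<lambda>n. \<integral>\<^sup>+x. ennreal (cmod (g x - \<phi>' n x)) \<partial>TV) \<longlonglongrightarrow> 0"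
    "(\<lambda>n. \<rho> (\<phi>' n)) \<longlonglongrightarrow> z'" for z' \<phi>'
  proof -
    have "(\<lambda>n. \<rho> (\<phi>' n) - \<rho> (\<psi> n)) \<longlonglongrightarrow> 0"
    proof (rule tendstoI)
      fix e :: real assume "e > 0"
      then have e: "0 < ennreal (e / 3)" by simp
      have "\<forall>\<^sub>F n in sequentially. (\<integral>\<^sup>+x. ennreal (cmod (g x - \<phi>' n x)) \<partial>TV) < ennreal (e / 3)"
        by (rule order_tendstoD(2)[OF \<phi>'(2) e])
      moreover have "\<forall>\<^sub>F n in sequentially. (\<integral>\<^sup>+x. ennreal (cmod (g x - \<psi> n x)) \<partial>TV) < ennreal (e / 3)"
        by (rule order_tendstoD(2)[OF lim0 e])
      ultimately show "\<forall>\<^sub>F n in sequentially. dist (\<rho> (\<phi>' n) - \<rho> (\<psi> n)) 0 < e"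
      proof eventually_elim
        case (elim n)
        have "cmod (\<rho> (\<phi>' n) - \<rho> (\<psi> n)) \<le> e / 3 + e / 3"
          using elim \<open>e > 0\<close> by (intro close_values[OF cont] \<psi> \<phi>') auto
        then show ?case using \<open>e > 0\<close> by simp
      qed
    qed
    moreover have "(\<lambda>n. \<rho> (\<phi>' n) - \<rho> (\<psi> n)) \<longlonglongrightarrow> z' - z" by (intro tendsto_diff \<phi>' z)
    ultimately have "z' - z = 0" using LIMSEQ_unique by blast
    then show ?thesis by simp
  qed
  have "radon_integral \<rho> g = z"
    unfolding radon_integral_def
  proof (rule the_equality)
    show "\<exists>\<phi>. (\<forall>n. \<phi> n \<in> Cc) \<and> (\<lambda>n. \<integral>\<^sup>+x. ennreal (cmod (g x - \<phi> n x)) \<partial>TV) \<longlonglongrightarrow> 0 \<and> (\<lambda>n. \<rho> (\<phi> n)) \<longlonglongrightarrow> z"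
      using \<psi>(1) lim0 z by blast
  qed (use unique in blast)
  moreover have "cmod (z - \<rho> \<phi>) \<le> 0 + \<epsilon>"
  proof (rule LIMSEQ_le)
    show "(\<lambda>n. cmod (\<rho> (\<psi> n) - \<rho> \<phi>)) \<longlonglongrightarrow> cmod (z - \<rho> \<phi>)" by (intro tendsto_intros z)
    show "(\<lambda>n. inverse (real (Suc n)) + \<epsilon>) \<longlonglongrightarrow> 0 + \<epsilon>" by (intro tendsto_intros LIMSEQ_inverse_real_of_nat)
    show "\<exists>N. \<forall>n\<ge>N. cmod (\<rho> (\<psi> n) - \<rho> \<phi>) \<le> inverse (real (Suc n)) + \<epsilon>"
      by (intro exI allI impI close_values[OF cont] \<psi> \<phi>) auto
  qed
  ultimately show ?thesis by simp
qed

lemma radon_integral_add: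
  assumes g: "admits g" and h: "admits h" and gh: "admits (\<lambda>x. g x + h x)"
  shows "radon_integral \<rho> (\<lambda>x. g x + h x) = radon_integral \<rho> g + radon_integral \<rho> h"
proof -
  have "cmod (radon_integral \<rho> (\<lambda>x. g x + h x) - (radon_integral \<rho> g + radon_integral \<rho> h)) \<le> 0 + e" if e: "e > 0" for e
  proof -
    have e4: "e / 4 > 0" using e by simp
    obtain \<phi> where \<phi>: "\<phi> \<in> Cc" "(\<integral>\<^sup>+x. ennreal (cmod (g x - \<phi> x)) \<partial>TV) \<le> ennreal (e / 4)"
      using g e4 unfolding admits_def by blast
    obtain \<psi> where \<psi>: "\<psi> \<in> Cc" "(\<integral>\<^sup>+x. ennreal (cmod (h x - \<psi> x)) \<partial>TV) \<le> ennreal (e / 4)"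
      using h e4 unfolding admits_def by blast
    have [measurable]: "g \<in> borel_measurable TV" "h \<in> borel_measurable TV" "\<phi> \<in> borel_measurable TV" "\<psi> \<in> borel_measurable TV"
      using g h CcD(1)[OF \<phi>(1)] CcD(1)[OF \<psi>(1)] by (auto simp: admits_def intro: continuous_measurable)
    have "(\<integral>\<^sup>+x. ennreal (cmod (g x + h x - (\<phi> x + \<psi> x))) \<partial>TV) \<le>
        (\<integral>\<^sup>+x. ennreal (cmod (g x - \<phi> x)) + ennreal (cmod (h x - \<psi> x)) \<partial>TV)"
      by (intro nn_integral_mono) (simp add: add_diff_add norm_triangle_ineq flip: ennreal_plus)
    also have "\<dots> = (\<integral>\<^sup>+x. ennreal (cmod (g x - \<phi> x)) \<partial>TV) + (\<integral>\<^sup>+x. ennreal (cmod (h x - \<psi> x)) \<partial>TV)"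
      by (rule nn_integral_add) auto
    also have "\<dots> \<le> ennreal (e / 4) + ennreal (e / 4)" by (intro add_mono \<phi> \<psi>)
    also have "\<dots> = ennreal (e / 2)" using e by (simp flip: ennreal_plus)
    finally have "cmod (radon_integral \<rho> (\<lambda>x. g x + h x) - \<rho> (\<lambda>x. \<phi> x + \<psi> x)) \<le> e / 2"
      using e by (intro radon_integral_close[OF gh] Cc_add \<phi> \<psi>) auto
    moreover have "cmod (radon_integral \<rho> g - \<rho> \<phi>) \<le> e / 4" "cmod (radon_integral \<rho> h - \<rho> \<psi>) \<le> e / 4"
      using e by (intro radon_integral_close g h \<phi> \<psi>; simp)+
    moreover have eq: "radon_integral \<rho> (\<lambda>x. g x + h x) - (radon_integral \<rho> g + radon_integral \<rho> h) =
        (radon_integral \<rho> (\<lambda>x. g x + h x) - \<rho> (\<lambda>x. \<phi> x + \<psi> x)) -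
        ((radon_integral \<rho> g - \<rho> \<phi>) + (radon_integral \<rho> h - \<rho> \<psi>))"
      by (simp add: add[OF \<phi>(1) \<psi>(1)])
    ultimately show ?thesis
      unfolding eq using norm_triangle_ineq4[of "radon_integral \<rho> (\<lambda>x. g x + h x) - \<rho> (\<lambda>x. \<phi> x + \<psi> x)"
          "(radon_integral \<rho> g - \<rho> \<phi>) + (radon_integral \<rho> h - \<rho> \<psi>)"]
        norm_triangle_ineq[of "radon_integral \<rho> g - \<rho> \<phi>" "radon_integral \<rho> h - \<rho> \<psi>"] by linarith
  qed
  then have "cmod (radon_integral \<rho> (\<lambda>x. g x + h x) - (radon_integral \<rho> g + radon_integral \<rho> h)) \<le> 0"
    by (rule field_le_epsilon)
  then show ?thesis by simp
qed

lemma radon_integral_cmult: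
  assumes g: "admits g" and cg: "admits (\<lambda>x. c * g x)"
  shows "radon_integral \<rho> (\<lambda>x. c * g x) = c * radon_integral \<rho> g"
proof -
  have "cmod (radon_integral \<rho> (\<lambda>x. c * g x) - c * radon_integral \<rho> g) \<le> 0 + e" if e: "e > 0" for e
  proof -
    define \<delta> where "\<delta> = e / (2 * (cmod c + 1))"
    have pos: "2 * (cmod c + 1) > 0" by (simp add: add_nonneg_pos)
    have \<delta>: "\<delta> > 0" using e pos by (simp add: \<delta>_def)
    have sc: "2 * (cmod c + 1) * \<delta> = e" using pos by (simp add: \<delta>_def)
    obtain \<phi> where \<phi>: "\<phi> \<in> Cc" "(\<integral>\<^sup>+x. ennreal (cmod (g x - \<phi> x)) \<partial>TV) \<le> ennreal \<delta>"
      using g \<delta> unfolding admits_def by blast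
    have [measurable]: "g \<in> borel_measurable TV" "\<phi> \<in> borel_measurable TV"
      using g CcD(1)[OF \<phi>(1)] by (auto simp: admits_def intro: continuous_measurable)
    have "(\<integral>\<^sup>+x. ennreal (cmod (c * g x - c * \<phi> x)) \<partial>TV) = (\<integral>\<^sup>+x. ennreal (cmod c) * ennreal (cmod (g x - \<phi> x)) \<partial>TV)"
      by (simp add: norm_mult flip: right_diff_distrib ennreal_mult)
    also have "\<dots> = ennreal (cmod c) * (\<integral>\<^sup>+x. ennreal (cmod (g x - \<phi> x)) \<partial>TV)"
      by (rule nn_integral_cmult) auto
    also have "\<dots> \<le> ennreal (cmod c) * ennreal \<delta>" by (intro mult_left_mono \<phi>) simp
    also have "\<dots> = ennreal (cmod c * \<delta>)" using \<delta> by (simp add: ennreal_mult)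
    finally have 1: "cmod (radon_integral \<rho> (\<lambda>x. c * g x) - \<rho> (\<lambda>x. c * \<phi> x)) \<le> cmod c * \<delta>"
      using \<delta> by (intro radon_integral_close[OF cg] Cc_cmult \<phi>) auto
    have "cmod (radon_integral \<rho> g - \<rho> \<phi>) \<le> \<delta>"
      using \<delta> by (intro radon_integral_close g \<phi>) simp
    then have 2: "cmod (c * (radon_integral \<rho> g - \<rho> \<phi>)) \<le> cmod c * \<delta>"
      unfolding norm_mult by (rule mult_left_mono) simp
    have "radon_integral \<rho> (\<lambda>x. c * g x) - c * radon_integral \<rho> g =
        (radon_integral \<rho> (\<lambda>x. c * g x) - \<rho> (\<lambda>x. c * \<phi> x)) - c * (radon_integral \<rho> g - \<rho> \<phi>)"
      by (simp add: scale[OF \<phi>(1)] algebra_simps)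
    then have "cmod (radon_integral \<rho> (\<lambda>x. c * g x) - c * radon_integral \<rho> g) \<le> cmod c * \<delta> + cmod c * \<delta>"
      using 1 2 by (simp only:) (rule order_trans[OF norm_triangle_ineq4], linarith)
    also have "\<dots> \<le> 2 * (cmod c + 1) * \<delta>" using \<delta> by (simp add: algebra_simps)
    finally show ?thesis unfolding sc by simp
  qed
  then have "cmod (radon_integral \<rho> (\<lambda>x. c * g x) - c * radon_integral \<rho> g) \<le> 0"
    by (rule field_le_epsilon)
  then show ?thesis by simp
qed

end

section \<open>Periodic functions on the embedding space\<close>

lemma comm_group_additive_group: "comm_group (additive_group :: 'a::ab_group_add monoid)"
proof (rule comm_groupI)
  fix x :: 'a assume "x \<in> carrier additive_group"
  show "\<exists>y\<in>carrier additive_group. y \<otimes>\<^bsub>additive_group\<^esub> x = \<one>\<^bsub>additive_group\<^esub>"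
    by (rule bexI[of _ "- x"]) (simp_all add: additive_group_def)
qed (simp_all add: additive_group_def ac_simps)

lemma inv_additive_group: "inv\<^bsub>additive_group\<^esub> x = - (x :: 'a::ab_group_add)"
  by (rule group.inv_equality[OF comm_group.axioms(2)[OF comm_group_additive_group]])
    (simp_all add: additive_group_def)

locale cut_project =
  fixes L :: "('g::{topological_ab_group_add, t2_space} \<times> 'h::{topological_ab_group_add, t2_space}) set"
    and \<rho> :: "('g \<times> 'h) functional" and f :: "'h \<Rightarrow> complex"
  assumes scheme: "measure_cut_and_project_scheme L \<rho>"
    and f_cont: "continuous_on UNIV f" and f_adm: "admissible \<rho> f"
begin

lemma lcG: "locally_compact_space (euclidean :: 'g topology)"
  and lcH: "locally_compact_space (euclidean :: 'h topology)"
  and L_subgroup: "subgroup L additive_group"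
  and quotient_compact: "compact_space (quotient_topology L)"
  and star_dense: "closure (snd ` L) = UNIV"
  using scheme by (auto simp: measure_cut_and_project_scheme_def cut_and_project_scheme_def)

lemma lcE: "locally_compact_space (euclidean :: ('g \<times> 'h) topology)"
  using lcG lcH locally_compact_space_prod_topology[of "euclidean :: 'g topology" "euclidean :: 'h topology"]
  by simp

sublocale radon_measure \<rho>
  by unfold_locales (use lcE scheme in \<open>auto simp: measure_cut_and_project_scheme_def\<close>)

lemma \<rho>_invariant: "l \<in> L \<Longrightarrow> \<phi> \<in> Cc \<Longrightarrow> \<rho> (\<lambda>x. \<phi> (x + l)) = \<rho> \<phi>"
  using scheme by (simp add: measure_cut_and_project_scheme_def)

lemma L_closed: "0 \<in> L" "x \<in> L \<Longrightarrow> y \<in> L \<Longrightarrow> x + y \<in> L" "x \<in> L \<Longrightarrow> - x \<in> L"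
proof -
  interpret subgroup L additive_group by (rule L_subgroup)
  show "0 \<in> L" "x \<in> L \<Longrightarrow> y \<in> L \<Longrightarrow> x + y \<in> L"
    using one_closed m_closed by (simp_all add: additive_group_def)
  show "- x \<in> L" if "x \<in> L"
    using m_inv_closed[OF that] by (simp add: inv_additive_group)
qed

abbreviation coset :: "'g \<times> 'h \<Rightarrow> ('g \<times> 'h) set"
  where "coset x \<equiv> L #>\<^bsub>additive_group\<^esub> x"

lemma coset_eq: "coset x = (\<lambda>l. l + x) ` L"
  by (auto simp: r_coset_def additive_group_def)

lemma coset_eq_iff: "coset x = coset y \<longleftrightarrow> (\<exists>l\<in>L. x = y + l)"
proof
  assume "coset x = coset y"
  moreover have "x \<in> coset x" unfolding coset_eq using L_closed(1) by force
  ultimately show "\<exists>l\<in>L. x = y + l" by (auto simp: coset_eq add.commute)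
next
  assume "\<exists>l\<in>L. x = y + l"
  then obtain l where l: "l \<in> L" "x = y + l" by blast
  show "coset x = coset y"
  proof (intro equalityI subsetI)
    fix z assume "z \<in> coset x"
    then obtain k where "k \<in> L" "z = k + x" by (auto simp: coset_eq)
    then show "z \<in> coset y"
      unfolding coset_eq using l L_closed(2)[of k l] by (intro image_eqI[of _ _ "k + l"]) (auto simp: ac_simps)
  next
    fix z assume "z \<in> coset y"
    then obtain k where "k \<in> L" "z = k + y" by (auto simp: coset_eq)
    then show "z \<in> coset x"
      unfolding coset_eq using l L_closed(2)[of k "- l"] L_closed(3)[of l]
      by (intro image_eqI[of _ _ "k + - l"]) (auto simp: ac_simps)
  qed
qed

lemma carrier_torus: "carrier (torus L) = range coset"
  by (auto simp: carrier_FactGroup additive_group_def)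

lemma coset_mult: "coset x \<otimes>\<^bsub>torus L\<^esub> coset y = coset (x + y)"
proof -
  have "L \<lhd> additive_group"
    by (rule comm_group.normal_iff_subgroup[OF comm_group_additive_group, THEN iffD2]) (rule L_subgroup)
  from normal.rcos_sum[OF this, of x y] show ?thesis
    by (simp add: FactGroup_def additive_group_def)
qed

text \<open>Translates of an open neighbourhood of 0 with compact hull have open images covering the
  quotient. Finitely many suffice, and their compact hulls make up \<open>D\<close>.\<close>

lemma compact_fundamental_domain:
  obtains D where "compact D" "\<And>x. \<exists>l\<in>L. \<exists>d\<in>D. x = l + d"
proof -
  obtain N C :: "('g \<times> 'h) set" where NC: "open N" "compact C" "0 \<in> N" "N \<subseteq> C"
    using locally_compact_zero[OF lcE] .
  define U where "U x = coset ` ((\<lambda>n. x + n) ` N)" for x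
  have U_open: "openin (quotient_topology L) (U x)" for x
    unfolding openin_quotient_topology
  proof
    show "U x \<subseteq> carrier (torus L)" by (auto simp: U_def carrier_torus)
    have "{y. coset y \<in> U x} = (\<Union>l\<in>L. (\<lambda>y. y - l - x) -` N)"
    proof (intro equalityI subsetI)
      fix y assume "y \<in> {y. coset y \<in> U x}"
      then obtain n where n: "n \<in> N" "coset y = coset (x + n)" by (auto simp: U_def)
      then obtain l where l: "l \<in> L" "y = x + n + l" by (auto simp: coset_eq_iff)
      have "y - l - x = n" unfolding l(2) by (simp add: algebra_simps)
      then have "y \<in> (\<lambda>y. y - l - x) -` N" using n(1) by simp
      then show "y \<in> (\<Union>l\<in>L. (\<lambda>y. y - l - x) -` N)" by (rule UN_I[OF l(1)])
    next
      fix y assume "y \<in> (\<Union>l\<in>L. (\<lambda>y. y - l - x) -` N)"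
      then obtain l where l: "l \<in> L" "y - l - x \<in> N" by auto
      have "coset y = coset (x + (y - l - x))"
        unfolding coset_eq_iff using l(1) by (intro bexI[of _ l]) (auto simp: algebra_simps)
      moreover have "coset (x + (y - l - x)) \<in> U x" unfolding U_def by (intro imageI l(2))
      ultimately show "y \<in> {y. coset y \<in> U x}" by (metis mem_Collect_eq)
    qed
    then show "open {y. coset y \<in> U x}"
      using NC(1) by (auto intro!: open_UN open_vimage continuous_intros)
  qed
  have cov: "topspace (quotient_topology L) \<subseteq> \<Union>(range U)"
  proof
    fix c assume "c \<in> topspace (quotient_topology L)"
    then obtain x where "c = coset x" by (auto simp: carrier_torus)
    moreover have "coset x \<in> U x" unfolding U_def using NC(3) by (intro imageI image_eqI[of _ _ 0]) auto
    ultimately show "c \<in> \<Union>(range U)" by blast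
  qed
  have "\<exists>\<F>. finite \<F> \<and> \<F> \<subseteq> range U \<and> topspace (quotient_topology L) \<subseteq> \<Union>\<F>"
    by (rule compactinD[OF quotient_compact[unfolded compact_space_def] _ cov]) (use U_open in auto)
  then obtain \<F> where \<F>: "finite \<F>" "\<F> \<subseteq> range U" "topspace (quotient_topology L) \<subseteq> \<Union>\<F>" by blast
  obtain T where T: "finite T" "\<F> = U ` T" using finite_subset_image[OF \<F>(1,2)] by auto
  define D where "D = (\<Union>x\<in>T. (\<lambda>c. x + c) ` C)"
  have "compact D"
    unfolding D_def by (intro compact_UN T compact_continuous_image continuous_intros NC)
  moreover have "\<exists>l\<in>L. \<exists>d\<in>D. x = l + d" for x
  proof -
    have "coset x \<in> topspace (quotient_topology L)" by (simp add: carrier_torus)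
    then obtain t where t: "t \<in> T" "coset x \<in> U t" using \<F>(3) T(2) by auto
    then obtain n where n: "n \<in> N" "coset x = coset (t + n)" by (auto simp: U_def)
    then obtain l where l: "l \<in> L" "x = t + n + l" by (auto simp: coset_eq_iff)
    have "t + n \<in> D" unfolding D_def using t(1) n(1) NC(4) by blast
    then show ?thesis using l by (intro bexI[of _ l] bexI[of _ "t + n"]) (auto simp: add.commute)
  qed
  ultimately show ?thesis using that by blast
qed

text \<open>In an open box the second coordinate is hit by some \<open>snd l\<close> by density of
  the projected lattice, and the first is then adjusted freely by \<open>t\<close>. Modulo the
  lattice these are exactly the points reached by translations in \<open>G\<close>.\<close>

lemma dense_induct:
  assumes "closed {x. P x}" "\<And>t l. l \<in> L \<Longrightarrow> P ((t, 0) + l)"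
  shows "P x"
proof (rule ccontr)
  assume "\<not> P x"
  moreover have "open (- {x. P x})" using assms(1) by (rule open_Compl)
  ultimately obtain A B where AB: "open A" "open B" "x \<in> A \<times> B" "A \<times> B \<subseteq> - {x. P x}"
    using open_prod_elim[of "- {x. P x}" x] by blast
  have "snd x \<in> closure (snd ` L)" by (simp add: star_dense)
  then have "snd ` L \<inter> B \<noteq> {}"
    using AB(2,3) closure_iff_nhds_not_empty[of "snd x" "snd ` L"] by (auto simp: mem_Times_iff)
  then obtain l where l: "l \<in> L" "snd l \<in> B" by auto
  have "(fst x - fst l, 0) + l = (fst x, snd l)" by (simp add: prod_eq_iff)
  moreover have "(fst x, snd l) \<in> A \<times> B" using AB(3) l(2) by (auto simp: mem_Times_iff)
  ultimately show False using assms(2)[OF l(1), of "fst x - fst l"] AB(4) by auto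
qed

text \<open>The sets of points that are \<open>W\<close>-close to some \<open>(t, 0) + l\<close>
  form an open cover indexed by \<open>t\<close>. Finitely many cover the compact fundamental
  domain, and they are lattice-periodic.\<close>

lemma finite_net:
  assumes W: "open W" "0 \<in> W"
  obtains T where "finite T" "\<And>x. \<exists>t\<in>T. \<exists>l\<in>L. x - ((t, 0) + l) \<in> W"
proof -
  obtain D where D: "compact D" "\<And>x. \<exists>l\<in>L. \<exists>d\<in>D. x = l + d" by (rule compact_fundamental_domain) blast
  define V where "V t = (\<Union>l\<in>L. (\<lambda>y. y - ((t, 0) + l)) -` W)" for t
  have V: "open (V t)" for t
    unfolding V_def using W(1) by (auto intro!: open_UN open_vimage continuous_intros)
  have VI: "d \<in> V t" if "l \<in> L" "d - ((t, 0) + l) \<in> W" for d t l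
    unfolding V_def by (rule UN_I[OF that(1)]) (use that(2) in simp)
  \<comment> \<open>Otherwise no \<open>(t, 0) + l\<close> would lie in the open set of
    \<open>y\<close> with \<open>d - y\<close> in \<open>W\<close>; by density that set would be
    empty, but it contains \<open>d\<close>.\<close>
  have "d \<in> (\<Union>t. V t)" for d
  proof (rule ccontr)
    assume d: "d \<notin> (\<Union>t. V t)"
    have op: "open ((\<lambda>y. d - y) -` W)"
      using W(1) by (auto intro!: open_vimage continuous_intros)
    have "{y. d - y \<notin> W} = - ((\<lambda>y. d - y) -` W)" by auto
    then have cl: "closed {y. d - y \<notin> W}" using closed_Compl[OF op] by simp
    have "d - d \<notin> W"
    proof (rule dense_induct[where P = "\<lambda>y. d - y \<notin> W", OF cl])
      fix t l assume "l \<in> L"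
      then show "d - ((t, 0) + l) \<notin> W" using d VI[of l d t] by (meson UNIV_I UN_I)
    qed
    then show False using W(2) by simp
  qed
  then have cov: "D \<subseteq> (\<Union>t\<in>UNIV. V t)" by (rule subsetI)
  obtain T where T: "finite T" "D \<subseteq> (\<Union>t\<in>T. V t)"
    by (rule compactE_image[OF D(1) V cov])
  have "\<exists>t\<in>T. \<exists>l\<in>L. x - ((t, 0) + l) \<in> W" for x
  proof -
    obtain l d where ld: "l \<in> L" "d \<in> D" "x = l + d" using D(2)[of x] by (elim bexE)
    have "d \<in> (\<Union>t\<in>T. V t)" using T(2) ld(2) by (rule subsetD)
    then obtain t where t: "t \<in> T" "d \<in> V t" by (rule UN_E)
    from t(2) obtain l' where l': "l' \<in> L" "d \<in> (\<lambda>y. y - ((t, 0) + l')) -` W"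
      unfolding V_def by (rule UN_E)
    have eq: "x - ((t, 0) + (l + l')) = d - ((t, 0) + l')" unfolding ld(3) by (simp add: algebra_simps)
    have "x - ((t, 0) + (l + l')) \<in> W" unfolding eq using l'(2) by simp
    then show ?thesis using t(1) L_closed(2)[OF ld(1) l'(1)] by (intro bexI)
  qed
  then show ?thesis by (rule that[OF T(1)])
qed

lemma invariant_uniformly_continuous:
  fixes u :: "'g \<times> 'h \<Rightarrow> complex"
  assumes u: "continuous_on UNIV u" "\<And>x l. l \<in> L \<Longrightarrow> u (x + l) = u x" and \<epsilon>: "\<epsilon> > 0"
  obtains W where "open W" "0 \<in> W" "\<And>x w. w \<in> W \<Longrightarrow> cmod (u (x + w) - u x) \<le> \<epsilon>"
proof -
  obtain D where D: "compact D" "\<And>x. \<exists>l\<in>L. \<exists>d\<in>D. x = l + d" by (rule compact_fundamental_domain) blast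
  obtain W where W: "open W" "0 \<in> W" "\<And>d w. d \<in> D \<Longrightarrow> w \<in> W \<Longrightarrow> cmod (u (d + w) - u d) \<le> \<epsilon>"
    using compact_uniformly_continuous_translates[OF D(1) u(1) \<epsilon>] by blast
  have "cmod (u (x + w) - u x) \<le> \<epsilon>" if "w \<in> W" for x w
  proof -
    obtain l d where ld: "l \<in> L" "d \<in> D" "x = l + d" using D(2) by blast
    have "u (x + w) = u (d + w)" "u x = u d"
      using u(2)[OF ld(1), of "d + w"] u(2)[OF ld(1), of d] by (simp_all add: ld(3) ac_simps)
    then show ?thesis using W(3)[OF ld(2) that] by simp
  qed
  then show ?thesis using that W(1,2) by blast
qed

text \<open>By invariance of \<open>\<rho>\<close> the translation \<open>x\<close> may be reduced
  to the compact fundamental domain \<open>D\<close>. All translates then have support in the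
  compact set of differences of \<open>K\<close> and \<open>D\<close>, where one bound for
  \<open>\<rho>\<close> applies.\<close>

lemma uniform_translate_bound:
  assumes K: "compact K"
  obtains C where "C \<ge> 0" "\<And>\<Psi> B x. \<Psi> \<in> Cc \<Longrightarrow> (\<And>y. y \<notin> K \<Longrightarrow> \<Psi> y = 0) \<Longrightarrow> (\<And>y. cmod (\<Psi> y) \<le> B) \<Longrightarrow>
    cmod (\<rho> (\<lambda>y. \<Psi> (y + x))) \<le> C * B"
proof -
  obtain D where D: "compact D" "\<And>x. \<exists>l\<in>L. \<exists>d\<in>D. x = l + d" by (rule compact_fundamental_domain) blast
  define K' where "K' = (\<lambda>p. fst p - snd p) ` (K \<times> D)"
  have K': "compact K'" unfolding K'_def by (rule compact_diff_image[OF K D(1)])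
  have "\<exists>C. \<forall>\<phi>\<in>Cc. supp \<phi> \<subseteq> K' \<longrightarrow> (\<forall>B. (\<forall>x. cmod (\<phi> x) \<le> B) \<longrightarrow> cmod (\<rho> \<phi>) \<le> C * B)"
    using R.bounded[of K'] K' by (simp add: Cc_on_euclidean support_in_euclidean)
  then obtain C where C: "\<And>\<phi> B. \<phi> \<in> Cc \<Longrightarrow> supp \<phi> \<subseteq> K' \<Longrightarrow> (\<And>x. cmod (\<phi> x) \<le> B) \<Longrightarrow> cmod (\<rho> \<phi>) \<le> C * B"
    by blast
  have "cmod (\<rho> (\<lambda>y. \<Psi> (y + x))) \<le> max C 0 * B"
    if \<Psi>: "\<Psi> \<in> Cc" "\<And>y. y \<notin> K \<Longrightarrow> \<Psi> y = 0" "\<And>y. cmod (\<Psi> y) \<le> B" for \<Psi> B x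
  proof -
    obtain l d where ld: "l \<in> L" "d \<in> D" "x = l + d" using D(2) by blast
    define \<Psi>' where "\<Psi>' y = \<Psi> (y + d)" for y
    have \<Psi>': "\<Psi>' \<in> Cc" unfolding \<Psi>'_def by (rule Cc_translate(1)[OF \<Psi>(1)])
    have "(\<lambda>y. \<Psi> (y + x)) = (\<lambda>y. \<Psi>' (y + l))" by (simp add: \<Psi>'_def ld(3) ac_simps)
    then have eq: "\<rho> (\<lambda>y. \<Psi> (y + x)) = \<rho> \<Psi>'" using \<rho>_invariant[OF ld(1) \<Psi>'] by simp
    have z: "\<Psi>' y = 0" if "y \<notin> K'" for y
    proof -
      have "y + d \<notin> K"
      proof
        assume "y + d \<in> K"
        then have "(y + d) - d \<in> K'" unfolding K'_def using ld(2) by (intro image_eqI[of _ _ "(y + d, d)"]) auto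
        then show False using that by simp
      qed
      then show ?thesis by (simp add: \<Psi>'_def \<Psi>(2))
    qed
    have supp: "supp \<Psi>' \<subseteq> K'" using CcI(2)[OF CcD(1)[OF \<Psi>'] K' z] .
    have "cmod (\<rho> \<Psi>') \<le> C * B" by (rule C[OF \<Psi>' supp]) (simp only: \<Psi>'_def \<Psi>(3))
    moreover have "B \<ge> 0" using order_trans[OF norm_ge_zero \<Psi>(3)] .
    ultimately show ?thesis unfolding eq by (metis max.cobounded1 mult_right_mono order_trans)
  qed
  then show ?thesis using that[of "max C 0"] by auto
qed

text \<open>The differences by small translations are uniformly small and supported in a fixed
  compact set, so \<open>uniform_translate_bound\<close> gives an estimate that does not depend on
  \<open>x\<close>.\<close>

lemma translate_uniformly_continuous:
  assumes \<Psi>: "\<Psi> \<in> Cc" and \<epsilon>: "\<epsilon> > 0"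
  obtains W where "open W" "0 \<in> W"
    "\<And>x w. w \<in> W \<Longrightarrow> cmod (\<rho> (\<lambda>y. \<Psi> (y + (x + w))) - \<rho> (\<lambda>y. \<Psi> (y + x))) \<le> \<epsilon>"
proof -
  obtain N K where NK: "compact K" "\<And>w x. w \<in> N \<Longrightarrow> x \<notin> K \<Longrightarrow> \<Psi> (x + w) - \<Psi> x = 0"
    "\<And>\<epsilon>. \<epsilon> > 0 \<Longrightarrow> \<exists>W. open W \<and> 0 \<in> W \<and> W \<subseteq> N \<and> (\<forall>w\<in>W. \<forall>x. cmod (\<Psi> (x + w) - \<Psi> x) \<le> \<epsilon>)"
    by (rule Cc_uniformly_continuous[OF lcE \<Psi>]) blast
  obtain C where C: "C \<ge> 0" "\<And>\<Psi> B x. \<Psi> \<in> Cc \<Longrightarrow> (\<And>y. y \<notin> K \<Longrightarrow> \<Psi> y = 0) \<Longrightarrow> (\<And>y. cmod (\<Psi> y) \<le> B) \<Longrightarrow>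
      cmod (\<rho> (\<lambda>y. \<Psi> (y + x))) \<le> C * B"
    using uniform_translate_bound[OF NK(1)] by metis
  define \<delta> where "\<delta> = \<epsilon> / (C + 1)"
  have \<delta>: "\<delta> > 0" "(C + 1) * \<delta> = \<epsilon>" using C(1) \<epsilon> by (auto simp: \<delta>_def)
  obtain W where W: "open W" "0 \<in> W" "W \<subseteq> N" "\<And>w x. w \<in> W \<Longrightarrow> cmod (\<Psi> (x + w) - \<Psi> x) \<le> \<delta>"
    using NK(3)[OF \<delta>(1)] by blast
  have "cmod (\<rho> (\<lambda>y. \<Psi> (y + (x + w))) - \<rho> (\<lambda>y. \<Psi> (y + x))) \<le> \<epsilon>" if w: "w \<in> W" for x w
  proof -
    define \<Delta> where "\<Delta> y = \<Psi> (y + w) - \<Psi> y" for y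
    have \<Delta>: "\<Delta> \<in> Cc" unfolding \<Delta>_def using diff[OF Cc_translate(1)[OF \<Psi>] \<Psi>] by blast
    have "cmod (\<rho> (\<lambda>y. \<Delta> (y + x))) \<le> C * \<delta>"
      by (rule C(2)[OF \<Delta>]) (use NK(2)[of w] W w in \<open>auto simp: \<Delta>_def\<close>)
    also have "\<dots> \<le> (C + 1) * \<delta>" using \<delta>(1) by (simp add: algebra_simps)
    finally have le: "cmod (\<rho> (\<lambda>y. \<Delta> (y + x))) \<le> \<epsilon>" unfolding \<delta>(2) .
    have eq: "(\<lambda>y. \<Delta> (y + x)) = (\<lambda>y. \<Psi> (y + (x + w)) - \<Psi> (y + x))"
      by (simp add: \<Delta>_def add.assoc)
    have "\<rho> (\<lambda>y. \<Delta> (y + x)) = \<rho> (\<lambda>y. \<Psi> (y + (x + w))) - \<rho> (\<lambda>y. \<Psi> (y + x))"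
      unfolding eq using diff[OF Cc_translate(1)[OF \<Psi>] Cc_translate(1)[OF \<Psi>]] by blast
    then show ?thesis using le by simp
  qed
  then show ?thesis using that W(1,2) by blast
qed

section \<open>The periodic functions attached to test functions\<close>

definition G :: "('g \<Rightarrow> complex) \<Rightarrow> 'g \<times> 'h \<Rightarrow> 'g \<times> 'h \<Rightarrow> complex"
  where "G \<phi> x = (\<lambda>(t, h). f (h + snd x) * \<phi> (fst x + t))"

definition F :: "('g \<Rightarrow> complex) \<Rightarrow> 'g \<times> 'h \<Rightarrow> complex"
  where "F \<phi> x = radon_integral \<rho> (G \<phi> x)"

text \<open>With a cut-off \<open>c\<close>, the value at \<open>y + x\<close> replaces
  \<open>G \<phi> x y\<close>: the truncated integrand depends on \<open>x\<close> through
  translation alone, so invariance and uniform continuity for compactly supported functions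
  apply.\<close>

definition cut :: "('g \<Rightarrow> complex) \<Rightarrow> ('h \<Rightarrow> complex) \<Rightarrow> 'g \<times> 'h \<Rightarrow> complex"
  where "cut \<phi> c y = \<phi> (fst y) * (f (snd y) * c (snd y))"

lemma G_cont: "\<phi> \<in> Cc \<Longrightarrow> continuous_on UNIV (G \<phi> x)"
  unfolding G_def case_prod_beta
  by (intro continuous_on_mult continuous_on_compose2[OF f_cont] continuous_on_compose2[OF CcD(1)[of \<phi>]] continuous_intros) auto

lemma cut_Cc:
  assumes "\<phi> \<in> Cc" "c \<in> Cc"
  shows "cut \<phi> c \<in> Cc" "y \<notin> supp \<phi> \<times> supp c \<Longrightarrow> cut \<phi> c y = 0"
proof -
  have z: "cut \<phi> c y = 0" if "y \<notin> supp \<phi> \<times> supp c" for y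
    using that not_in_supp[of "fst y" \<phi>] not_in_supp[of "snd y" c] by (auto simp: cut_def mem_Times_iff)
  have "continuous_on UNIV (cut \<phi> c)"
    unfolding cut_def[abs_def]
    by (intro continuous_on_mult continuous_on_compose2[OF f_cont] continuous_on_compose2[OF CcD(1)[OF assms(1)]]
        continuous_on_compose2[OF CcD(1)[OF assms(2)]] continuous_intros) auto
  then show "cut \<phi> c \<in> Cc"
    by (rule CcI(1)[of _ "supp \<phi> \<times> supp c"]) (use z assms in \<open>auto intro: compact_Times CcD\<close>)
  show "y \<notin> supp \<phi> \<times> supp c \<Longrightarrow> cut \<phi> c y = 0" by (rule z)
qed

text \<open>Admissibility bounds the error of cutting \<open>f\<close> off outside a compact set uniformly over all
  translates.\<close>

lemma cutoff:
  assumes \<phi>0: "\<phi>0 \<in> Cc" and \<epsilon>: "\<epsilon> > 0"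
  obtains c where "c \<in> Cc" "\<And>\<phi> x. (\<And>t. cmod (\<phi> t) \<le> cmod (\<phi>0 t)) \<Longrightarrow>
    (\<integral>\<^sup>+y. ennreal (cmod (G \<phi> x y - cut \<phi> c (y + x))) \<partial>TV) \<le> ennreal \<epsilon>"
proof -
  obtain Q where Q: "compact Q" "\<And>s k. (\<integral>\<^sup>+(t, h). ennreal (cmod (\<phi>0 (t + s) * f (h + k)) * (1 - indicator Q (h + k)))
        \<partial>TV) \<le> ennreal \<epsilon>"
    using f_adm \<phi>0 \<epsilon> unfolding admissible_def by meson
  obtain c :: "'h \<Rightarrow> real" where c: "(\<lambda>x. complex_of_real (c x)) \<in> Cc" "\<And>x. 0 \<le> c x \<and> c x \<le> 1" "\<And>x. x \<in> Q \<Longrightarrow> c x = 1"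
    by (rule Cc_cutoff[OF lcH Q(1)]) blast
  have "(\<integral>\<^sup>+y. ennreal (cmod (G \<phi> x y - cut \<phi> (\<lambda>x. complex_of_real (c x)) (y + x))) \<partial>TV) \<le> ennreal \<epsilon>"
    if \<phi>: "\<And>t. cmod (\<phi> t) \<le> cmod (\<phi>0 t)" for \<phi> x
  proof -
    have "(\<integral>\<^sup>+y. ennreal (cmod (G \<phi> x y - cut \<phi> (\<lambda>x. complex_of_real (c x)) (y + x))) \<partial>TV) \<le>
        (\<integral>\<^sup>+(t, h). ennreal (cmod (\<phi>0 (t + fst x) * f (h + snd x)) * (1 - indicator Q (h + snd x))) \<partial>TV)"
    proof (rule nn_integral_mono, clarify)
      fix t h
      have "G \<phi> x (t, h) - cut \<phi> (\<lambda>x. complex_of_real (c x)) ((t, h) + x) =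
          \<phi> (t + fst x) * f (h + snd x) * complex_of_real (1 - c (h + snd x))"
        by (simp add: G_def cut_def algebra_simps)
      also have "cmod \<dots> = cmod (\<phi> (t + fst x)) * cmod (f (h + snd x)) * (1 - c (h + snd x))"
        using c(2)[of "h + snd x"] by (simp add: norm_mult del: of_real_diff)
      also have "\<dots> \<le> cmod (\<phi>0 (t + fst x)) * cmod (f (h + snd x)) * (1 - indicator Q (h + snd x))"
        using c(2,3)[of "h + snd x"] \<phi> by (intro mult_mono) (auto simp: indicator_def)
      finally show "ennreal (cmod (G \<phi> x (t, h) - cut \<phi> (\<lambda>x. complex_of_real (c x)) ((t, h) + x)))
          \<le> ennreal (cmod (\<phi>0 (t + fst x) * f (h + snd x)) * (1 - indicator Q (h + snd x)))"
        by (simp add: norm_mult ennreal_leI)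
    qed
    also have "\<dots> \<le> ennreal \<epsilon>" by (rule Q(2))
    finally show ?thesis .
  qed
  then show ?thesis using that[OF c(1)] by blast
qed

lemma G_admits:
  assumes "\<phi> \<in> Cc"
  shows "admits (G \<phi> x)"
  unfolding admits_def
proof (intro conjI allI impI)
  fix \<epsilon> :: real assume \<epsilon>: "\<epsilon> > 0"
  obtain c where c: "c \<in> Cc" "\<And>\<psi> x. (\<And>t. cmod (\<psi> t) \<le> cmod (\<phi> t)) \<Longrightarrow>
      (\<integral>\<^sup>+y. ennreal (cmod (G \<psi> x y - cut \<psi> c (y + x))) \<partial>TV) \<le> ennreal \<epsilon>"
    by (rule cutoff[OF assms \<epsilon>]) blast
  show "\<exists>\<psi>\<in>Cc. (\<integral>\<^sup>+y. ennreal (cmod (G \<phi> x y - \<psi> y)) \<partial>TV) \<le> ennreal \<epsilon>"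
    using c(2)[of \<phi> x] Cc_translate(1)[OF cut_Cc(1)[OF assms c(1)], of x] by auto
qed (rule G_cont[OF assms])

text \<open>One cut-off works for all \<open>x\<close> and for all test functions dominated by
  \<open>\<phi>0\<close>. Uniformity in \<open>x\<close> gives continuity and periodicity of
  \<open>F\<close>, uniformity in \<phi> gives its local boundedness.\<close>

lemma F_cut:
  assumes \<phi>0: "\<phi>0 \<in> Cc" and \<epsilon>: "\<epsilon> > 0"
  obtains c where "c \<in> Cc" "\<And>\<phi> x. \<phi> \<in> Cc \<Longrightarrow> (\<And>t. cmod (\<phi> t) \<le> cmod (\<phi>0 t)) \<Longrightarrow>
    cmod (F \<phi> x - \<rho> (\<lambda>y. cut \<phi> c (y + x))) \<le> \<epsilon>"
proof -
  obtain c where c: "c \<in> Cc" "\<And>\<phi> x. (\<And>t. cmod (\<phi> t) \<le> cmod (\<phi>0 t)) \<Longrightarrow>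
      (\<integral>\<^sup>+y. ennreal (cmod (G \<phi> x y - cut \<phi> c (y + x))) \<partial>TV) \<le> ennreal \<epsilon>"
    by (rule cutoff[OF \<phi>0 \<epsilon>]) blast
  have "cmod (F \<phi> x - \<rho> (\<lambda>y. cut \<phi> c (y + x))) \<le> \<epsilon>" if "\<phi> \<in> Cc" "\<And>t. cmod (\<phi> t) \<le> cmod (\<phi>0 t)" for \<phi> x
    unfolding F_def using \<epsilon>
    by (intro radon_integral_close G_admits Cc_translate cut_Cc that c) auto
  then show ?thesis using that c(1) by blast
qed

lemma F_uniformly_continuous:
  assumes \<phi>: "\<phi> \<in> Cc" and \<epsilon>: "\<epsilon> > 0"
  obtains W where "open W" "0 \<in> W" "\<And>x w. w \<in> W \<Longrightarrow> cmod (F \<phi> (x + w) - F \<phi> x) \<le> \<epsilon>"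
proof -
  have e3: "\<epsilon> / 3 > 0" using \<epsilon> by simp
  obtain c where c: "c \<in> Cc" "\<And>\<psi> x. \<psi> \<in> Cc \<Longrightarrow> (\<And>t. cmod (\<psi> t) \<le> cmod (\<phi> t)) \<Longrightarrow>
      cmod (F \<psi> x - \<rho> (\<lambda>y. cut \<psi> c (y + x))) \<le> \<epsilon> / 3"
    by (rule F_cut[OF \<phi> e3]) blast
  obtain W where W: "open W" "0 \<in> W"
    "\<And>x w. w \<in> W \<Longrightarrow> cmod (\<rho> (\<lambda>y. cut \<phi> c (y + (x + w))) - \<rho> (\<lambda>y. cut \<phi> c (y + x))) \<le> \<epsilon> / 3"
    by (rule translate_uniformly_continuous[OF cut_Cc(1)[OF \<phi> c(1)] e3]) blast
  have "cmod (F \<phi> (x + w) - F \<phi> x) \<le> \<epsilon>" if "w \<in> W" for x w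
  proof -
    have "cmod (F \<phi> (x + w) - \<rho> (\<lambda>y. cut \<phi> c (y + (x + w)))) \<le> \<epsilon> / 3"
      "cmod (F \<phi> x - \<rho> (\<lambda>y. cut \<phi> c (y + x))) \<le> \<epsilon> / 3"
      by (intro c(2)[OF \<phi>]; simp)+
    then show ?thesis
      using W(3)[OF that, of x]
        norm_triangle_ineq[of "F \<phi> (x + w) - \<rho> (\<lambda>y. cut \<phi> c (y + (x + w)))" "\<rho> (\<lambda>y. cut \<phi> c (y + (x + w))) - \<rho> (\<lambda>y. cut \<phi> c (y + x))"]
        norm_triangle_ineq4[of "F \<phi> (x + w) - \<rho> (\<lambda>y. cut \<phi> c (y + x))" "F \<phi> x - \<rho> (\<lambda>y. cut \<phi> c (y + x))"]
      by simp
  qed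
  then show ?thesis using that W(1,2) by blast
qed

text \<open>Invariance of \<open>\<rho>\<close> is given for compactly supported functions only, so
  it is applied to the truncated integrand, at an arbitrarily small error.\<close>

lemma F_invariant:
  assumes \<phi>: "\<phi> \<in> Cc" and l: "l \<in> L"
  shows "F \<phi> (x + l) = F \<phi> x"
proof -
  have "cmod (F \<phi> (x + l) - F \<phi> x) \<le> 0 + e" if e: "e > 0" for e
  proof -
    have e2: "e / 2 > 0" using e by simp
    obtain c where c: "c \<in> Cc" "\<And>\<psi> x. \<psi> \<in> Cc \<Longrightarrow> (\<And>t. cmod (\<psi> t) \<le> cmod (\<phi> t)) \<Longrightarrow>
        cmod (F \<psi> x - \<rho> (\<lambda>y. cut \<psi> c (y + x))) \<le> e / 2"
      by (rule F_cut[OF \<phi> e2]) blast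
    have "\<rho> (\<lambda>y. cut \<phi> c (y + l + x)) = \<rho> (\<lambda>y. cut \<phi> c (y + x))"
      using \<rho>_invariant[OF l Cc_translate(1)[OF cut_Cc(1)[OF \<phi> c(1)], of x]] .
    then have "\<rho> (\<lambda>y. cut \<phi> c (y + (x + l))) = \<rho> (\<lambda>y. cut \<phi> c (y + x))" by (simp add: ac_simps)
    moreover have "cmod (F \<phi> (x + l) - \<rho> (\<lambda>y. cut \<phi> c (y + (x + l)))) \<le> e / 2"
      "cmod (F \<phi> x - \<rho> (\<lambda>y. cut \<phi> c (y + x))) \<le> e / 2"
      by (intro c(2)[OF \<phi>]; simp)+
    ultimately show ?thesis
      using norm_triangle_ineq4[of "F \<phi> (x + l) - \<rho> (\<lambda>y. cut \<phi> c (y + x))" "F \<phi> x - \<rho> (\<lambda>y. cut \<phi> c (y + x))"] by simp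
  qed
  then have "cmod (F \<phi> (x + l) - F \<phi> x) \<le> 0" by (rule field_le_epsilon)
  then show ?thesis by simp
qed

lemma F_continuous:
  assumes "\<phi> \<in> Cc"
  shows "continuous_on UNIV (F \<phi>)"
proof -
  have "continuous_map euclidean euclidean (F \<phi>)"
  proof (rule continuous_map_epsI)
    fix x and \<epsilon> :: real assume "\<epsilon> > 0"
    then have e2: "\<epsilon> / 2 > 0" by simp
    obtain W where W: "open W" "0 \<in> W" "\<And>x w. w \<in> W \<Longrightarrow> cmod (F \<phi> (x + w) - F \<phi> x) \<le> \<epsilon> / 2"
      by (rule F_uniformly_continuous[OF assms e2]) blast
    have "open ((\<lambda>y. y - x) -` W)" using W(1) by (auto intro!: open_vimage continuous_intros)
    moreover have "dist (F \<phi> y) (F \<phi> x) < \<epsilon>" if "y \<in> (\<lambda>y. y - x) -` W" for y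
      using W(3)[of "y - x" x] that \<open>\<epsilon> > 0\<close> by (simp add: dist_norm)
    ultimately show "\<exists>U. openin euclidean U \<and> x \<in> U \<and> (\<forall>y\<in>U. dist (F \<phi> y) (F \<phi> x) < \<epsilon>)"
      using W(2) by (intro exI[of _ "(\<lambda>y. y - x) -` W"]) auto
  qed
  then show ?thesis by simp
qed

lemma F_add: "\<phi> \<in> Cc \<Longrightarrow> \<psi> \<in> Cc \<Longrightarrow> F (\<lambda>t. \<phi> t + \<psi> t) x = F \<phi> x + F \<psi> x"
proof -
  assume \<phi>: "\<phi> \<in> Cc" and \<psi>: "\<psi> \<in> Cc"
  have eq: "G (\<lambda>t. \<phi> t + \<psi> t) x = (\<lambda>y. G \<phi> x y + G \<psi> x y)"
    by (auto simp: G_def fun_eq_iff distrib_left)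
  show ?thesis
    unfolding F_def eq using G_admits[OF Cc_add[OF \<phi> \<psi>], of x]
    by (intro radon_integral_add G_admits \<phi> \<psi>) (simp add: eq)
qed

lemma F_scale: "\<phi> \<in> Cc \<Longrightarrow> F (\<lambda>t. c * \<phi> t) x = c * F \<phi> x"
proof -
  assume \<phi>: "\<phi> \<in> Cc"
  have eq: "G (\<lambda>t. c * \<phi> t) x = (\<lambda>y. c * G \<phi> x y)"
    by (auto simp: G_def fun_eq_iff)
  show ?thesis
    unfolding F_def eq using G_admits[OF Cc_cmult(1)[OF \<phi>], of c x]
    by (intro radon_integral_cmult G_admits \<phi>) (simp add: eq)
qed

text \<open>A cut-off \<open>h0\<close> that is 1 on \<open>K\<close> dominates every test function
  supported in \<open>K\<close> and bounded by 1, so a single truncation, with error at most 1,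
  handles them all. Scaling does the rest; the bound is uniform in \<open>x\<close>.\<close>

lemma F_bound:
  assumes K: "compact K"
  obtains C where "C \<ge> 0" "\<And>\<phi> B x. \<phi> \<in> Cc \<Longrightarrow> supp \<phi> \<subseteq> K \<Longrightarrow> (\<And>t. cmod (\<phi> t) \<le> B) \<Longrightarrow> cmod (F \<phi> x) \<le> C * B"
proof -
  obtain h0 :: "'g \<Rightarrow> real" where h0: "(\<lambda>x. complex_of_real (h0 x)) \<in> Cc" "\<And>x. 0 \<le> h0 x \<and> h0 x \<le> 1" "\<And>x. x \<in> K \<Longrightarrow> h0 x = 1"
    by (rule Cc_cutoff[OF lcG K]) blast
  obtain c where c: "c \<in> Cc" "\<And>\<psi> x. \<psi> \<in> Cc \<Longrightarrow> (\<And>t. cmod (\<psi> t) \<le> cmod (complex_of_real (h0 t))) \<Longrightarrow>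
      cmod (F \<psi> x - \<rho> (\<lambda>y. cut \<psi> c (y + x))) \<le> 1"
    by (rule F_cut[OF h0(1) zero_less_one]) blast
  have "(\<lambda>h. f h * c h) \<in> Cc"
  proof (rule CcI(1)[OF continuous_on_mult[OF f_cont CcD(1)[OF c(1)]] CcD(2)[OF c(1)]])
    show "f h * c h = 0" if "h \<notin> supp c" for h using not_in_supp[OF that] by simp
  qed
  then obtain M where M: "M > 0" "\<And>h. cmod (f h * c h) \<le> M" by (rule Cc_bounded) blast
  have KK: "compact (K \<times> supp c)" by (intro compact_Times K CcD c)
  obtain C where C: "C \<ge> 0" "\<And>\<Psi> B x. \<Psi> \<in> Cc \<Longrightarrow> (\<And>y. y \<notin> K \<times> supp c \<Longrightarrow> \<Psi> y = 0) \<Longrightarrow> (\<And>y. cmod (\<Psi> y) \<le> B) \<Longrightarrow>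
      cmod (\<rho> (\<lambda>y. \<Psi> (y + x))) \<le> C * B"
    by (rule uniform_translate_bound[OF KK]) blast
  have unit: "cmod (F \<phi> x) \<le> C * M + 1" if \<phi>: "\<phi> \<in> Cc" "supp \<phi> \<subseteq> K" "\<And>t. cmod (\<phi> t) \<le> 1" for \<phi> x
  proof -
    have "cmod (\<phi> t) \<le> cmod (complex_of_real (h0 t))" for t
    proof (cases "t \<in> K")
      case True
      then show ?thesis using h0(3)[OF True] \<phi>(3)[of t] by simp
    next
      case False
      then have "t \<notin> supp \<phi>" using \<phi>(2) by blast
      then show ?thesis using not_in_supp[of t \<phi>] by simp
    qed
    then have "cmod (F \<phi> x - \<rho> (\<lambda>y. cut \<phi> c (y + x))) \<le> 1" by (intro c(2) \<phi>(1))
    moreover have "cmod (\<rho> (\<lambda>y. cut \<phi> c (y + x))) \<le> C * M"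
    proof (rule C(2)[OF cut_Cc(1)[OF \<phi>(1) c(1)]])
      show "cut \<phi> c y = 0" if "y \<notin> K \<times> supp c" for y
        using that \<phi>(2) by (intro cut_Cc(2)[OF \<phi>(1) c(1)]) auto
      show "cmod (cut \<phi> c y) \<le> M" for y
      proof -
        have "cmod (cut \<phi> c y) \<le> 1 * M"
          unfolding cut_def norm_mult[of "\<phi> _"] by (intro mult_mono \<phi> M) auto
        then show ?thesis by simp
      qed
    qed
    ultimately show ?thesis
      using norm_triangle_ineq[of "F \<phi> x - \<rho> (\<lambda>y. cut \<phi> c (y + x))" "\<rho> (\<lambda>y. cut \<phi> c (y + x))"] by simp
  qed
  have "cmod (F \<phi> x) \<le> (C * M + 1) * B" if \<phi>: "\<phi> \<in> Cc" "supp \<phi> \<subseteq> K" "\<And>t. cmod (\<phi> t) \<le> B" for \<phi> B x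
  proof (cases "B = 0")
    case True
    then have "\<phi> = (\<lambda>t. 0 * \<phi> t)" using \<phi>(3) by auto
    then have "F \<phi> x = 0 * F \<phi> x" using F_scale[OF \<phi>(1), of 0 x] by metis
    then show ?thesis using True by simp
  next
    case False
    then have B: "B > 0" using order_trans[OF norm_ge_zero \<phi>(3)] by (simp add: order_less_le)
    have "cmod (F (\<lambda>t. of_real (1 / B) * \<phi> t) x) \<le> C * M + 1"
      using Cc_cmult[OF \<phi>(1), of "of_real (1 / B)"] \<phi>(2,3) B
      by (intro unit) (auto simp: norm_mult norm_divide divide_le_eq)
    then have "cmod (F \<phi> x) / B \<le> C * M + 1"
      unfolding F_scale[OF \<phi>(1)] using B by (simp add: norm_mult norm_divide)
    then show ?thesis using B by (simp add: divide_le_eq)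
  qed
  moreover have "C * M + 1 \<ge> 0" using C(1) M(1) by simp
  ultimately show ?thesis using that[of "C * M + 1"] by blast
qed

end

section \<open>The hull as an image of the torus\<close>

lemma characters_iff:
  "\<xi> \<in> characters A T \<longleftrightarrow> continuous_map T euclidean \<xi> \<and> (\<forall>x\<in>carrier A. cmod (\<xi> x) = 1) \<and>
    (\<forall>x\<in>carrier A. \<forall>y\<in>carrier A. \<xi> (x \<otimes>\<^bsub>A\<^esub> y) = \<xi> x * \<xi> y)"
  by (simp add: characters_def)

text \<open>A continuous surjection from a compact to a Hausdorff space is closed, hence a quotient
  map.\<close>

lemma compact_Hausdorff_quotient:
  assumes "compact_space X" "Hausdorff_space Y" "continuous_map X Y q" "q ` topspace X = topspace Y"
    and "continuous_map X Z (\<lambda>x. g (q x))"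
  shows "continuous_map Y Z g"
proof -
  have "quotient_map X Y q"
    by (rule continuous_closed_imp_quotient_map[OF assms(3) continuous_imp_closed_map[OF assms(3,1,2)] assms(4)])
  then have "continuous_map X Z (g \<circ> q) \<longleftrightarrow> continuous_map Y Z g"
    by (rule continuous_compose_quotient_map_eq)
  then show ?thesis using assms(5) by (simp add: comp_def)
qed

lemma closed_equalizer:
  assumes "Hausdorff_space Y" "continuous_map euclidean Y a" "continuous_map euclidean Y b"
  shows "closed {x. a x = b x}"
  using closedin_continuous_maps_eq[OF assms] by simp

lemma topspace_vague [simp]: "topspace vague_topology = radon_measures"
  by (auto simp: vague_topology_def PiE_UNIV_domain radon_measures_def PiE_def)

lemma Hausdorff_vague: "Hausdorff_space vague_topology"
  unfolding vague_topology_def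
  by (intro Hausdorff_space_subtopology) (simp add: Hausdorff_space_product_topology)

context cut_project
begin

text \<open>\<open>M\<close> is the paper's map \<open>\<mu>\<close>, lifted from the torus to an \<open>L\<close>-periodic function on \<open>G \<times> H\<close>.\<close>

definition M :: "'g \<times> 'h \<Rightarrow> 'g functional"
  where "M x = (\<lambda>\<phi>\<in>Cc. F \<phi> x)"

lemma M_apply: "\<phi> \<in> Cc \<Longrightarrow> M x \<phi> = F \<phi> x"
  by (simp add: M_def)

lemma M_invariant: "l \<in> L \<Longrightarrow> M (x + l) = M x"
  unfolding M_def by (rule restrict_ext) (rule F_invariant)

lemma M_radon: "M x \<in> radon_measures"
  unfolding radon_measures_def
proof (intro CollectI conjI ballI allI impI)
  show "M x \<in> extensional Cc" by (simp add: M_def)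
  show "M x (\<lambda>t. \<phi> t + \<psi> t) = M x \<phi> + M x \<psi>" if "\<phi> \<in> Cc" "\<psi> \<in> Cc" for \<phi> \<psi>
    using that by (simp add: M_apply Cc_add F_add)
  show "M x (\<lambda>t. c * \<phi> t) = c * M x \<phi>" if "\<phi> \<in> Cc" for \<phi> c
    using that by (simp add: M_apply Cc_cmult F_scale)
  fix K :: "'g set" assume K: "compact K"
  obtain C where C: "C \<ge> 0" "\<And>\<phi> B x. \<phi> \<in> Cc \<Longrightarrow> supp \<phi> \<subseteq> K \<Longrightarrow> (\<And>t. cmod (\<phi> t) \<le> B) \<Longrightarrow> cmod (F \<phi> x) \<le> C * B"
    by (rule F_bound[OF K]) blast
  have "cmod (M x \<phi>) \<le> C * (SUP t. cmod (\<phi> t))" if \<phi>: "\<phi> \<in> Cc" "supp \<phi> \<subseteq> K" for \<phi>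
  proof -
    obtain B where B: "\<And>t. cmod (\<phi> t) \<le> B" by (rule Cc_bounded[OF \<phi>(1)]) blast
    have "cmod (F \<phi> x) \<le> C * (SUP t. cmod (\<phi> t))"
    proof (rule C(2)[OF \<phi>])
      show "cmod (\<phi> t) \<le> (SUP t. cmod (\<phi> t))" for t
        by (rule cSUP_upper[OF UNIV_I]) (use B in \<open>auto intro: bdd_aboveI2[of _ _ B]\<close>)
    qed
    then show ?thesis by (simp add: M_apply \<phi>(1))
  qed
  then show "\<exists>C. \<forall>\<phi>\<in>Cc. supp \<phi> \<subseteq> K \<longrightarrow> cmod (M x \<phi>) \<le> C * (SUP t. cmod (\<phi> t))" by blast
qed

lemma weighted_comb_eq: "weighted_comb \<rho> f = M 0"
  unfolding weighted_comb_def M_def F_def G_def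
  by (simp add: mult.commute)

lemma F_translate: "F (\<lambda>s. \<phi> (s + t)) x = F \<phi> (x + (t, 0))"
  unfolding F_def G_def by (simp add: ac_simps)

lemma translate_M: "translate t (M x) = M (x + (t, 0))"
  unfolding translate_def M_def[of "x + (t, 0)"]
  by (rule restrict_ext) (simp add: M_apply Cc_translate F_translate)

lemma M_continuous: "continuous_map euclidean vague_topology M"
  unfolding vague_topology_def continuous_map_in_subtopology continuous_map_componentwise
proof (intro conjI ballI)
  show "M ` topspace euclidean \<subseteq> extensional Cc" by (auto simp: M_def)
  show "continuous_map euclidean euclidean (\<lambda>x. M x \<phi>)" if "\<phi> \<in> Cc" for \<phi>
    using F_continuous[OF that] by (simp add: M_apply[OF that])
  show "M \<in> topspace euclidean \<rightarrow> radon_measures" by (simp add: M_radon)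
qed

section \<open>Identification of the hull\<close>

lemma compact_range_M:
  obtains D where "compact D" "M ` D = range M"
proof -
  obtain D where D: "compact D" "\<And>x. \<exists>l\<in>L. \<exists>d\<in>D. x = l + d" by (rule compact_fundamental_domain) blast
  have "M x \<in> M ` D" for x
  proof -
    obtain l d where "l \<in> L" "d \<in> D" "x = l + d" using D(2)[of x] by (elim bexE)
    then show ?thesis using M_invariant[of l d] by (simp add: add.commute)
  qed
  then have "M ` D = range M" by auto
  with D(1) show ?thesis by (rule that)
qed

lemma compactin_range_M: "compactin vague_topology (range M)"
proof -
  obtain D where D: "compact D" "M ` D = range M" by (rule compact_range_M)
  have "compactin vague_topology (M ` D)"
    by (rule image_compactin[OF _ M_continuous]) (use D(1) in simp)
  then show ?thesis by (simp add: D(2))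
qed

text \<open>The range is compact, hence closed, and contains the orbit. Conversely, an open set
  missing the orbit misses \<open>M\<close> at all points \<open>(t, 0) + l\<close>, hence
  everywhere by density.\<close>

lemma measure_hull_eq: "measure_hull (M 0) = range M"
proof
  have "closedin vague_topology (range M)"
    by (rule compactin_imp_closedin[OF Hausdorff_vague compactin_range_M])
  then show "measure_hull (M 0) \<subseteq> range M"
    unfolding measure_hull_def by (intro closure_of_minimal) (auto simp: translate_M)
  show "range M \<subseteq> measure_hull (M 0)"
    unfolding measure_hull_def
  proof
    fix \<omega> assume "\<omega> \<in> range M"
    then obtain x where x: "\<omega> = M x" by blast
    have "\<exists>y. y \<in> range (\<lambda>t. translate t (M 0)) \<and> y \<in> U" if U: "\<omega> \<in> U" "openin vague_topology U" for U
    proof (rule ccontr)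
      assume no: "\<nexists>y. y \<in> range (\<lambda>t. translate t (M 0)) \<and> y \<in> U"
      have "openin euclidean {x \<in> topspace euclidean. M x \<in> U}"
        using M_continuous U(2) by (rule openin_continuous_map_preimage)
      then have "closed (- {x. M x \<in> U})" by (intro closed_Compl) simp
      then have cl: "closed {x. M x \<notin> U}" by (simp add: Collect_neg_eq)
      have "M x \<notin> U"
      proof (rule dense_induct[where P = "\<lambda>x. M x \<notin> U", OF cl])
        fix t l assume "l \<in> L"
        then have "M ((t, 0) + l) = translate t (M 0)" by (simp add: M_invariant translate_M)
        then show "M ((t, 0) + l) \<notin> U" using no by auto
      qed
      then show False using U(1) x by simp
    qed
    then show "\<omega> \<in> vague_topology closure_of range (\<lambda>t. translate t (M 0))"
      unfolding in_closure_of using M_radon[of x] x by auto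
  qed
qed

abbreviation "\<Omega> \<equiv> hull_topology (M 0)"

lemma topspace_hull [simp]: "topspace \<Omega> = range M"
  using M_radon by (auto simp: hull_topology_def measure_hull_eq)

lemma hull_compact: "compact_space \<Omega>"
  unfolding hull_topology_def measure_hull_eq by (rule compact_space_subtopology[OF compactin_range_M])

lemma hull_Hausdorff: "Hausdorff_space \<Omega>"
  unfolding hull_topology_def by (rule Hausdorff_space_subtopology[OF Hausdorff_vague])

lemma M_continuous_hull: "continuous_map euclidean \<Omega> M"
  unfolding hull_topology_def measure_hull_eq continuous_map_in_subtopology
  using M_continuous by simp

lemma M_compose: "continuous_map X euclidean p \<Longrightarrow> continuous_map X \<Omega> (\<lambda>x. M (p x))"
  using continuous_map_compose[OF _ M_continuous_hull, of X p] by (simp add: comp_def)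

text \<open>\<open>M\<close> restricted to a compact set with full image is a quotient map, so
  continuity on the hull may be checked on \<open>G \<times> H\<close>.\<close>

lemma hull_lift:
  assumes "continuous_map euclidean Z (\<lambda>x. g (M x))"
  shows "continuous_map \<Omega> Z g"
proof -
  obtain D where D: "compact D" "M ` D = range M" by (rule compact_range_M)
  show ?thesis
  proof (rule compact_Hausdorff_quotient[OF _ hull_Hausdorff])
    show "compact_space (subtopology euclidean D)" using D(1) by (simp add: compact_space_subtopology)
    show "continuous_map (subtopology euclidean D) \<Omega> M"
      by (rule continuous_map_from_subtopology[OF M_continuous_hull])
    show "M ` topspace (subtopology euclidean D) = topspace \<Omega>" using D(2) by simp
    show "continuous_map (subtopology euclidean D) Z (\<lambda>x. g (M x))"
      by (rule continuous_map_from_subtopology[OF assms])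
  qed
qed

lemma hull_lift2:
  assumes "continuous_map euclidean Z (\<lambda>(x, y). g (M x, M y))"
  shows "continuous_map (prod_topology \<Omega> \<Omega>) Z g"
proof -
  obtain D where D: "compact D" "M ` D = range M" by (rule compact_range_M)
  let ?D = "subtopology euclidean D"
  show ?thesis
  proof (rule compact_Hausdorff_quotient[where q = "\<lambda>p. (M (fst p), M (snd p))"])
    show "compact_space (prod_topology ?D ?D)"
      unfolding compact_space_prod_topology using D(1) by (simp add: compact_space_subtopology)
    show "Hausdorff_space (prod_topology \<Omega> \<Omega>)"
      by (simp add: Hausdorff_space_prod_topology hull_Hausdorff)
    show "continuous_map (prod_topology ?D ?D) (prod_topology \<Omega> \<Omega>) (\<lambda>p. (M (fst p), M (snd p)))"
      unfolding continuous_map_pairwise comp_def fst_conv snd_conv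
      by (intro conjI M_compose continuous_map_into_fulltopology[OF continuous_map_fst]
          continuous_map_into_fulltopology[OF continuous_map_snd])
    have "(\<lambda>p. (M (fst p), M (snd p))) ` (D \<times> D) = (M ` D) \<times> (M ` D)" by force
    then show "(\<lambda>p. (M (fst p), M (snd p))) ` topspace (prod_topology ?D ?D) = topspace (prod_topology \<Omega> \<Omega>)"
      using D(2) by simp
    have "continuous_map (subtopology euclidean (D \<times> D)) Z (\<lambda>(x, y). g (M x, M y))"
      by (rule continuous_map_from_subtopology[OF assms])
    then show "continuous_map (prod_topology ?D ?D) Z (\<lambda>p. g (M (fst p), M (snd p)))"
      unfolding subtopology_Times euclidean_product_topology by (simp add: case_prod_beta')
  qed
qed

text \<open>For \<open>y\<close> of the form \<open>(t, 0) + l\<close> both sides are the translate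
  by \<open>t\<close> of the same measure; density does the rest. This is why addition descends to
  the hull.\<close>

lemma M_shift:
  assumes "M x = M x'"
  shows "M (x + y) = M (x' + y)"
proof (rule dense_induct[where P = "\<lambda>y. M (x + y) = M (x' + y)"])
  show "closed {y. M (x + y) = M (x' + y)}"
    by (intro closed_equalizer[OF hull_Hausdorff] M_compose) (auto intro!: continuous_intros)
  fix t l assume l: "l \<in> L"
  have "M (x + ((t, 0) + l)) = translate t (M x)" "M (x' + ((t, 0) + l)) = translate t (M x')"
    using M_invariant[OF l, of "x + (t, 0)"] M_invariant[OF l, of "x' + (t, 0)"]
    by (simp_all only: translate_M add.assoc)
  then show "M (x + ((t, 0) + l)) = M (x' + ((t, 0) + l))" by (simp only: assms)
qed

text \<open>Modulo the lattice, each translation by \<open>(s, 0)\<close> is close to one from a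
  finite net. Both almost periods and equicontinuity are extracted from the map
  \<open>\<tau>\<close>.\<close>

lemma translation_net:
  fixes u :: "'g \<times> 'h \<Rightarrow> complex"
  assumes u: "continuous_on UNIV u" "\<And>x l. l \<in> L \<Longrightarrow> u (x + l) = u x" and \<epsilon>: "\<epsilon> > 0"
  obtains T \<tau> where "finite T" "\<And>s. \<tau> s \<in> T" "\<And>s y. cmod (u (y + (s, 0)) - u (y + (\<tau> s, 0))) \<le> \<epsilon>"
proof -
  obtain W where W: "open W" "0 \<in> W" "\<And>x w. w \<in> W \<Longrightarrow> cmod (u (x + w) - u x) \<le> \<epsilon>"
    by (rule invariant_uniformly_continuous[OF u \<epsilon>]) blast+
  obtain T where T: "finite T" "\<And>x. \<exists>t\<in>T. \<exists>l\<in>L. x - ((t, 0) + l) \<in> W"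
    by (rule finite_net[OF W(1,2)]) blast
  have "\<forall>s. \<exists>t. t \<in> T \<and> (\<exists>l\<in>L. (s, 0) - ((t, 0) + l) \<in> W)"
    using T(2) by metis
  then obtain \<tau> where \<tau>: "\<And>s. \<tau> s \<in> T" "\<And>s. \<exists>l\<in>L. (s, 0) - ((\<tau> s, 0) + l) \<in> W"
    by metis
  have "cmod (u (y + (s, 0)) - u (y + (\<tau> s, 0))) \<le> \<epsilon>" for s y
  proof -
    obtain l where l: "l \<in> L" "(s, 0) - ((\<tau> s, 0) + l) \<in> W" using \<tau>(2)[of s] by (elim bexE)
    have "y + (\<tau> s, 0) + l + ((s, 0) - ((\<tau> s, 0) + l)) = y + (s, 0)" by (simp add: algebra_simps)
    then show ?thesis
      using W(3)[OF l(2), of "y + (\<tau> s, 0) + l"] u(2)[OF l(1), of "y + (\<tau> s, 0)"] by simp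
  qed
  then show ?thesis by (rule that[OF T(1) \<tau>(1)])
qed

lemma hull_ap_system: "ap_system \<Omega> translate"
proof
  show "compact_space \<Omega>" by (rule hull_compact)
  show "Hausdorff_space \<Omega>" by (rule hull_Hausdorff)
  show "topspace \<Omega> \<noteq> {}" by simp
  show "continuous_map \<Omega> \<Omega> (translate t)" for t
    by (rule hull_lift) (auto simp: translate_M intro!: M_compose continuous_intros)
  show "translate 0 x = x" if "x \<in> topspace \<Omega>" for x
    using that by (auto simp: translate_M zero_prod_def[symmetric])
  show "translate (s + t) x = translate s (translate t x)" if "x \<in> topspace \<Omega>" for s t x
  proof -
    obtain p where p: "x = M p" using \<open>x \<in> topspace \<Omega>\<close> by auto
    have "p + (s + t, 0) = p + (t, 0) + (s, 0)" by (simp add: prod_eq_iff ac_simps)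
    then show ?thesis by (simp only: p translate_M)
  qed
  show "continuous_map euclidean \<Omega> (\<lambda>t. translate t x)" if "x \<in> topspace \<Omega>" for x
    using that by (auto simp: translate_M intro!: M_compose continuous_intros)
  show "\<Omega> closure_of range (\<lambda>t. translate t x) = topspace \<Omega>" if "x \<in> topspace \<Omega>" for x
  proof (intro equalityI closure_of_subset_topspace subsetI)
    obtain p where p: "x = M p" using \<open>x \<in> topspace \<Omega>\<close> by auto
    fix \<omega> assume "\<omega> \<in> topspace \<Omega>"
    then obtain q where q: "\<omega> = M q" by auto
    have "\<exists>y. y \<in> range (\<lambda>t. translate t x) \<and> y \<in> U" if U: "\<omega> \<in> U" "openin \<Omega> U" for U
    proof (rule ccontr)
      assume no: "\<nexists>y. y \<in> range (\<lambda>t. translate t x) \<and> y \<in> U"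
      have "continuous_map euclidean \<Omega> (\<lambda>y. M (p + y))"
        by (rule M_compose) (auto intro!: continuous_intros)
      then have "openin euclidean {y \<in> topspace euclidean. M (p + y) \<in> U}"
        using U(2) by (rule openin_continuous_map_preimage)
      then have "closed (- {y. M (p + y) \<in> U})" by (intro closed_Compl) simp
      then have cl: "closed {y. M (p + y) \<notin> U}" by (simp add: Collect_neg_eq)
      \<comment> \<open>The orbit of \<open>M p\<close> is the image of the dense points shifted by
        \<open>p\<close>, so the density argument is applied to the shifted variable, at
        \<open>q - p\<close>.\<close>
      have "M (p + (q - p)) \<notin> U"
      proof (rule dense_induct[where P = "\<lambda>y. M (p + y) \<notin> U", OF cl])
        fix t l assume "l \<in> L"
        then have "M (p + ((t, 0) + l)) = translate t x"
          using M_invariant[of l "p + (t, 0)"] by (simp only: translate_M add.assoc p)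
        then show "M (p + ((t, 0) + l)) \<notin> U" using no by auto
      qed
      then show False using U(1) q by simp
    qed
    then show "\<omega> \<in> \<Omega> closure_of range (\<lambda>t. translate t x)"
      unfolding in_closure_of using q by auto
  qed
  fix g :: "'g functional \<Rightarrow> complex" and \<epsilon> :: real
  assume g: "continuous_map \<Omega> euclidean g" and \<epsilon>: "\<epsilon> > 0"
  have u: "continuous_on UNIV (\<lambda>x. g (M x))"
    using continuous_map_compose[OF M_continuous_hull g] by (simp add: comp_def)
  have e2: "\<epsilon> / 2 > 0" using \<epsilon> by simp
  obtain T \<tau> where T: "finite T" "\<And>s. \<tau> s \<in> T"
    "\<And>s y. cmod (g (M (y + (s, 0))) - g (M (y + (\<tau> s, 0)))) \<le> \<epsilon> / 2"
    by (rule translation_net[OF u _ e2]) (simp add: M_invariant, blast)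
  \<comment> \<open>The colour of \<open>s\<close> is the number of the net point
    \<open>\<tau> s\<close>; equally coloured translations are both within
    \<open>\<epsilon> / 2\<close> of the same one.\<close>
  obtain i :: "'g \<Rightarrow> nat" where i: "inj_on i T"
    using finite_imp_inj_to_nat_seg[OF T(1)] by auto
  have "finite ((\<lambda>s. i (\<tau> s)) ` UNIV)"
    by (rule finite_subset[of _ "i ` T"]) (use T in auto)
  moreover have "cmod (g (translate s x) - g (translate t x)) \<le> \<epsilon>"
    if st: "i (\<tau> s) = i (\<tau> t)" and x: "x \<in> topspace \<Omega>" for s t x
  proof -
    obtain p where p: "x = M p" using x by auto
    have "\<tau> s = \<tau> t" using inj_onD[OF i st] T(2) by blast
    then show ?thesis
      using T(3)[of p s] T(3)[of p t]
        norm_triangle_ineq4[of "g (M (p + (s, 0))) - g (M (p + (\<tau> s, 0)))" "g (M (p + (t, 0))) - g (M (p + (\<tau> s, 0)))"]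
      by (simp add: p translate_M)
  qed
  ultimately show "\<exists>\<kappa> :: 'g \<Rightarrow> nat. finite (range \<kappa>) \<and>
      (\<forall>s t. \<kappa> s = \<kappa> t \<longrightarrow> (\<forall>x\<in>topspace \<Omega>. cmod (g (translate s x) - g (translate t x)) \<le> \<epsilon>))"
    by (intro exI[of _ "\<lambda>s. i (\<tau> s)"]) simp
qed

lemma translation_bounded_M: "translation_bounded (M 0)"
proof -
  interpret N: radon_functional euclidean "M 0" by (rule radon_functional_euclidean[OF lcG M_radon])
  obtain V K :: "'g set" where V: "open V" "compact K" "0 \<in> V" "V \<subseteq> K"
    using locally_compact_zero[OF lcG] .
  obtain C where C: "C \<ge> 0" "\<And>\<phi> B x. \<phi> \<in> Cc \<Longrightarrow> supp \<phi> \<subseteq> K \<Longrightarrow> (\<And>t. cmod (\<phi> t) \<le> B) \<Longrightarrow> cmod (F \<phi> x) \<le> C * B"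
    by (rule F_bound[OF V(2)]) blast
  have "emeasure (total_variation (M 0)) ((\<lambda>v. t + v) ` V) \<le> ennreal (C + 1)" for t
  proof -
    have op: "openin euclidean ((\<lambda>v. t + v) ` V)"
    proof -
      have eq: "(\<lambda>v. t + v) ` V = (\<lambda>v. v - t) -` V"
        by (auto intro: image_eqI[of _ _ "_ - t"])
      have "open ((\<lambda>v. v - t) -` V)" using V(1) by (auto intro!: open_vimage continuous_intros)
      then show ?thesis unfolding eq by simp
    qed
    have "open_variation euclidean (M 0) ((\<lambda>v. t + v) ` V) \<le> ennreal (C + 1)"
      unfolding open_variation_def
    proof (rule SUP_least)
      fix \<psi> assume "\<psi> \<in> unit_tests euclidean ((\<lambda>v. t + v) ` V)"
      then have \<psi>: "\<psi> \<in> Cc" "supp \<psi> \<subseteq> (\<lambda>v. t + v) ` V" "\<And>s. cmod (\<psi> s) \<le> 1"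
        by (auto simp: unit_tests_def Cc_on_euclidean support_in_euclidean)
      \<comment> \<open>The test function is moved back into the fixed compact set \<open>K\<close>,
        and \<open>t\<close> is absorbed into the argument of \<open>F\<close>, in which the bound
        is uniform.\<close>
      have eq: "F \<psi> 0 = F (\<lambda>s. \<psi> (s + t)) (- t, 0)"
        unfolding F_translate by (simp add: zero_prod_def)
      have "supp (\<lambda>s. \<psi> (s + t)) \<subseteq> K"
        using Cc_translate(2)[OF \<psi>(1), of t] \<psi>(2) V(4) by fastforce
      then have "cmod (F (\<lambda>s. \<psi> (s + t)) (- t, 0)) \<le> C * 1"
        by (intro C(2) Cc_translate \<psi>)
      then show "ennreal (cmod (M 0 \<psi>)) \<le> ennreal (C + 1)"
        unfolding M_apply[OF \<psi>(1)] eq by (intro ennreal_leI) simp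
    qed
    then show ?thesis
      using N.emeasure_variation_open[OF op] by (simp add: variation_measure_euclidean)
  qed
  moreover have "compact (closure V)"
    using compact_Int_closed[OF V(2) closed_closure, of V] closure_minimal[OF V(4) compact_imp_closed[OF V(2)]]
    by (simp add: Int_absorb1)
  ultimately show ?thesis
    unfolding translation_bounded_def using C(1) V(1,3)
    by (intro exI[of _ "C + 1"] conjI exI[of _ V]) auto
qed

lemma strongly_almost_periodic_M: "strongly_almost_periodic (M 0)"
  unfolding strongly_almost_periodic_def bohr_almost_periodic_def
proof (intro ballI conjI allI impI)
  fix \<phi> :: "'g \<Rightarrow> complex" assume \<phi>: "\<phi> \<in> Cc"
  \<comment> \<open>The reflected test function turns the convolution into a section of the periodic
    function \<open>F \<psi>\<close>.\<close>
  define \<psi> where "\<psi> u = \<phi> (- u)" for u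
  have \<psi>: "\<psi> \<in> Cc" unfolding \<psi>_def by (rule Cc_reflect[OF \<phi>])
  have conv: "convolution (M 0) \<phi> s = F \<psi> (- s, 0)" for s
  proof -
    have e: "(\<lambda>u. \<phi> (s - u)) = (\<lambda>u. \<psi> (u + - s))" by (simp add: \<psi>_def)
    have "convolution (M 0) \<phi> s = F (\<lambda>u. \<psi> (u + - s)) 0"
      unfolding convolution_def e by (intro M_apply Cc_translate \<psi>)
    also have "\<dots> = F \<psi> (- s, 0)" unfolding F_translate by simp
    finally show ?thesis .
  qed
  show "continuous_on UNIV (convolution (M 0) \<phi>)"
    unfolding conv[abs_def]
    by (rule continuous_on_compose2[OF F_continuous[OF \<psi>]]) (auto intro!: continuous_intros)
  fix \<epsilon> :: real assume \<epsilon>: "\<epsilon> > 0"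
  obtain T \<tau> where T: "finite T" "\<And>s. \<tau> s \<in> T"
    "\<And>s y. cmod (F \<psi> (y + (s, 0)) - F \<psi> (y + (\<tau> s, 0))) \<le> \<epsilon>"
    by (rule translation_net[OF F_continuous[OF \<psi>] F_invariant[OF \<psi>] \<epsilon>]) blast+
  show "relatively_dense {t. \<forall>s. cmod (convolution (M 0) \<phi> (s + t) - convolution (M 0) \<phi> s) \<le> \<epsilon>}"
    unfolding relatively_dense_def
  proof (intro exI[of _ "uminus ` T"] conjI allI)
    show "compact (uminus ` T)" using T(1) by (intro finite_imp_compact finite_imageI)
    fix x
    \<comment> \<open>Replacing the translation by \<open>- x\<close> with its net point
      \<open>\<tau> (- x)\<close> shows that \<open>x + \<tau> (- x)\<close> is an \<epsilon>-almost
      period; it differs from \<open>x\<close> by an element of a finite set.\<close>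
    have "cmod (convolution (M 0) \<phi> (s + (x + \<tau> (- x))) - convolution (M 0) \<phi> s) \<le> \<epsilon>" for s
      using T(3)[of "(- s - \<tau> (- x), 0)" "- x"] by (simp add: conv algebra_simps)
    then show "\<exists>p\<in>{t. \<forall>s. cmod (convolution (M 0) \<phi> (s + t) - convolution (M 0) \<phi> s) \<le> \<epsilon>}.
        \<exists>k\<in>uminus ` T. x = p + k"
      using T(2)[of "- x"] by (intro bexI[of _ "x + \<tau> (- x)"] bexI[of _ "- \<tau> (- x)"]) auto
  qed
qed

section \<open>The group structure of the hull\<close>

definition hull_group :: "'g functional monoid"
  where "hull_group = \<lparr>carrier = range M, mult = (\<lambda>\<omega> \<omega>'. M (inv_into UNIV M \<omega> + inv_into UNIV M \<omega>')), one = M 0\<rparr>"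

lemma hull_group_simps: "carrier hull_group = range M" "\<one>\<^bsub>hull_group\<^esub> = M 0"
  by (simp_all add: hull_group_def)

text \<open>The operation is defined through chosen preimages; \<open>M_shift\<close>, once in each
  argument, shows that the choice does not matter.\<close>

lemma hull_group_mult: "M x \<otimes>\<^bsub>hull_group\<^esub> M y = M (x + y)"
proof -
  have i: "M (inv_into UNIV M (M z)) = M z" for z by (rule f_inv_into_f) simp
  have "M (inv_into UNIV M (M x) + inv_into UNIV M (M y)) = M (x + inv_into UNIV M (M y))" by (rule M_shift[OF i])
  also have "\<dots> = M (inv_into UNIV M (M y) + x)" by (simp only: add.commute)
  also have "\<dots> = M (y + x)" by (rule M_shift[OF i])
  finally show ?thesis by (simp add: hull_group_def add.commute)
qed

lemma hull_comm_group: "comm_group hull_group"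
proof (rule comm_groupI)
  fix x assume "x \<in> carrier hull_group"
  then obtain p where p: "x = M p" by (auto simp: hull_group_simps)
  show "\<exists>y\<in>carrier hull_group. y \<otimes>\<^bsub>hull_group\<^esub> x = \<one>\<^bsub>hull_group\<^esub>"
    by (rule bexI[of _ "M (- p)"]) (simp_all add: p hull_group_mult hull_group_simps)
qed (auto simp: hull_group_simps hull_group_mult ac_simps)

lemma hull_group_inv: "inv\<^bsub>hull_group\<^esub> (M x) = M (- x)"
  by (rule group.inv_equality[OF comm_group.axioms(2)[OF hull_comm_group]])
    (simp_all add: hull_group_simps hull_group_mult)

lemma hull_group_structure: "hull_group_structure (M 0) hull_group"
  unfolding hull_group_structure_def topological_abelian_group_def
proof (intro conjI)
  show "comm_group hull_group" by (rule hull_comm_group)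
  show "topspace \<Omega> = carrier hull_group" by (simp add: hull_group_simps)
  have "continuous_map euclidean \<Omega> (\<lambda>p. M (fst p + snd p))"
    by (intro M_compose) (auto intro!: continuous_intros)
  then show "continuous_map (prod_topology \<Omega> \<Omega>) \<Omega> (\<lambda>(x, y). x \<otimes>\<^bsub>hull_group\<^esub> y)"
    by (intro hull_lift2) (simp add: hull_group_mult case_prod_beta')
  show "continuous_map \<Omega> \<Omega> (\<lambda>x. inv\<^bsub>hull_group\<^esub> x)"
    by (rule hull_lift) (auto simp: hull_group_inv intro!: M_compose continuous_intros)
  show "continuous_map euclidean \<Omega> (\<lambda>t. translate t (M 0))"
    by (auto simp: translate_M intro!: M_compose continuous_intros)
  show "(\<lambda>t. translate t (M 0)) \<in> hom additive_group hull_group"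
    by (rule homI) (auto simp: additive_group_def hull_group_simps translate_M hull_group_mult)
qed

text \<open>A continuous group operation on the hull extends that of the dense orbit of \<open>M 0\<close>.\<close>

lemma hull_group_structure_mult:
  assumes B: "hull_group_structure (M 0) B"
  shows "M p \<otimes>\<^bsub>B\<^esub> M q = M (p + q)"
proof -
  have cB: "carrier B = range M"
    and mult: "continuous_map (prod_topology \<Omega> \<Omega>) \<Omega> (\<lambda>(x, y). x \<otimes>\<^bsub>B\<^esub> y)"
    and hom: "(\<lambda>t. translate t (M 0)) \<in> hom additive_group B"
    using B by (auto simp: hull_group_structure_def topological_abelian_group_def)
  have cont: "continuous_map euclidean \<Omega> (\<lambda>x. a x \<otimes>\<^bsub>B\<^esub> b x)"
    if "continuous_map euclidean \<Omega> a" "continuous_map euclidean \<Omega> b" for a b :: "'g \<times> 'h \<Rightarrow> 'g functional"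
  proof -
    have "continuous_map euclidean (prod_topology \<Omega> \<Omega>) (\<lambda>x. (a x, b x))"
      using that by (simp add: continuous_map_paired)
    from continuous_map_compose[OF this mult] show ?thesis by (simp add: comp_def)
  qed
  have const: "continuous_map euclidean \<Omega> (\<lambda>x. M y)" for y by simp
  have orbit: "M ((s, 0) + l) = translate s (M 0)" if "l \<in> L" for s l
    using that by (simp add: M_invariant translate_M)
  have step: "M ((s, 0) + l) \<otimes>\<^bsub>B\<^esub> M q = M ((s, 0) + l + q)" if l: "l \<in> L" for s l
  proof (rule dense_induct[where P = "\<lambda>q. M ((s, 0) + l) \<otimes>\<^bsub>B\<^esub> M q = M ((s, 0) + l + q)"])
    show "closed {q. M ((s, 0) + l) \<otimes>\<^bsub>B\<^esub> M q = M ((s, 0) + l + q)}"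
      by (intro closed_equalizer[OF hull_Hausdorff] cont const M_compose M_continuous_hull)
        (auto intro!: continuous_intros)
    fix t k assume k: "k \<in> L"
    have "(s, 0) + l + ((t, 0) + k) = (s + t, 0) + (l + k)" by (simp add: prod_eq_iff ac_simps)
    then have "M ((s, 0) + l + ((t, 0) + k)) = translate (s + t) (M 0)"
      using orbit[OF L_closed(2)[OF l k], of "s + t"] by (simp only:)
    also have "\<dots> = translate s (M 0) \<otimes>\<^bsub>B\<^esub> translate t (M 0)"
      using hom_mult[OF hom, of s t] by (simp add: additive_group_def)
    finally show "M ((s, 0) + l) \<otimes>\<^bsub>B\<^esub> M ((t, 0) + k) = M ((s, 0) + l + ((t, 0) + k))"
      by (simp only: orbit[OF l] orbit[OF k])
  qed
  show ?thesis
  proof (rule dense_induct[where P = "\<lambda>p. M p \<otimes>\<^bsub>B\<^esub> M q = M (p + q)"])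
    show "closed {p. M p \<otimes>\<^bsub>B\<^esub> M q = M (p + q)}"
      by (intro closed_equalizer[OF hull_Hausdorff] cont const M_compose M_continuous_hull)
        (auto intro!: continuous_intros)
  qed (rule step)
qed

section \<open>The factor map and characters of the torus\<close>

definition torus_map :: "('g \<times> 'h) set \<Rightarrow> 'g functional"
  where "torus_map c = M (SOME x. coset x = c)"

lemma torus_map_coset: "torus_map (coset x) = M x"
proof -
  have "coset (SOME y. coset y = coset x) = coset x" by (rule someI[of _ x]) simp
  then obtain l where l: "l \<in> L" "(SOME y. coset y = coset x) = x + l" unfolding coset_eq_iff by (elim bexE)
  show ?thesis unfolding torus_map_def l(2) by (rule M_invariant[OF l(1)])
qed

lemma quotient_lift:
  assumes "continuous_map euclidean Z (\<lambda>x. g (coset x))"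
  shows "continuous_map (quotient_topology L) Z g"
  unfolding continuous_map_def
proof (intro conjI allI impI)
  have "g (coset x) \<in> topspace Z" for x
    using assms by (auto simp: continuous_map_def)
  then show "g \<in> topspace (quotient_topology L) \<rightarrow> topspace Z" by (auto simp: carrier_torus)
  fix U assume "openin Z U"
  then have "openin euclidean {x \<in> topspace euclidean. g (coset x) \<in> U}"
    by (rule openin_continuous_map_preimage[OF assms])
  moreover have "{x. coset x \<in> {c \<in> topspace (quotient_topology L). g c \<in> U}} = {x. g (coset x) \<in> U}"
    by (auto simp: carrier_torus)
  ultimately show "openin (quotient_topology L) {c \<in> topspace (quotient_topology L). g c \<in> U}"
    unfolding openin_quotient_topology by auto
qed

lemma torus_embed_eq: "torus_embed L t = coset (t, 0)"
  by (simp add: torus_embed_def torus_class_def)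

lemma torus_map_factor: "factor_map (quotient_topology L) (torus_action L) \<Omega> translate torus_map"
  unfolding factor_map_def
proof (intro conjI allI ballI)
  show "continuous_map (quotient_topology L) \<Omega> torus_map"
    by (rule quotient_lift) (simp add: torus_map_coset M_continuous_hull)
  show "torus_map ` topspace (quotient_topology L) = topspace \<Omega>"
    by (simp add: carrier_torus image_image torus_map_coset)
  fix t c assume "c \<in> topspace (quotient_topology L)"
  then obtain x where x: "c = coset x" by (auto simp: carrier_torus)
  have "torus_action L t c = coset ((t, 0) + x)"
    unfolding torus_action_def torus_embed_eq x by (rule coset_mult)
  then show "torus_map (torus_action L t c) = translate t (torus_map c)"
    unfolding x by (simp only: torus_map_coset translate_M add.commute)
qed

lemma torus_map_hom:
  assumes "hull_group_structure (M 0) A"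
  shows "torus_map \<in> hom (torus L) A"
proof (rule homI)
  have cA: "carrier A = range M"
    using assms by (auto simp: hull_group_structure_def topological_abelian_group_def)
  fix c assume "c \<in> carrier (torus L)"
  then obtain x where x: "c = coset x" by (auto simp: carrier_torus)
  show "torus_map c \<in> carrier A" unfolding x torus_map_coset cA by simp
  fix d assume "d \<in> carrier (torus L)"
  then obtain y where y: "d = coset y" by (auto simp: carrier_torus)
  show "torus_map (c \<otimes>\<^bsub>torus L\<^esub> d) = torus_map c \<otimes>\<^bsub>A\<^esub> torus_map d"
    unfolding x y coset_mult torus_map_coset hull_group_structure_mult[OF assms] ..
qed

lemma torus_character_dual:
  assumes "\<xi> \<in> characters (torus L) (quotient_topology L)"
  shows "\<xi> \<circ> torus_embed L \<in> dual"
proof -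
  have \<xi>: "continuous_map (quotient_topology L) euclidean \<xi>" "\<And>x. cmod (\<xi> (coset x)) = 1"
    "\<And>x y. \<xi> (coset x \<otimes>\<^bsub>torus L\<^esub> coset y) = \<xi> (coset x) * \<xi> (coset y)"
    using assms unfolding characters_iff by (auto simp: carrier_torus)
  have "continuous_map euclidean (quotient_topology L) coset"
    unfolding continuous_map_def by (auto simp: openin_quotient_topology carrier_torus)
  from continuous_map_compose[OF this \<xi>(1)]
  have "continuous_on UNIV (\<lambda>x. \<xi> (coset x))" by (simp add: comp_def)
  then have "continuous_on UNIV (\<lambda>t. \<xi> (coset (t, 0)))"
    by (rule continuous_on_compose2) (auto intro!: continuous_intros)
  moreover have "\<xi> (coset (s + t, 0)) = \<xi> (coset (s, 0)) * \<xi> (coset (t, 0))" for s t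
    using \<xi>(3)[of "(s, 0)" "(t, 0)"] unfolding coset_mult by simp
  ultimately show ?thesis
    unfolding characters_iff using \<xi>(2) by (simp add: comp_def torus_embed_eq additive_group_def)
qed

sublocale hull: ap_system \<Omega> translate by (rule hull_ap_system)

text \<open>The reflection in \<open>M (- x)\<close> cancels the sign in the eigenvalue equation, so
  the lifted function \<open>g\<close>, normalised to 1 at 0, satisfies
  \<open>g ((t, 0) + y) = \<xi> t * g y\<close>. Being periodic, it is multiplicative when one
  argument is a point \<open>(t, 0) + l\<close>, hence by density everywhere, and descends to a
  character of the torus.\<close>

lemma eigen_torus_character:
  assumes e: "hull.is_eigen \<xi> e"
  shows "\<exists>\<eta>\<in>characters (torus L) (quotient_topology L). \<xi> = \<eta> \<circ> torus_embed L"
proof -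
  define g where "g x = e (M (- x)) * cnj (e (M 0))" for x
  have e_cont: "continuous_map \<Omega> euclidean e" and e_tr: "\<And>t x. e (translate (- t) (M x)) = \<xi> t * e (M x)"
    and e_norm: "\<And>x. cmod (e (M x)) = 1"
    using hull.is_eigenD[OF e] by auto
  have g_cont: "continuous_on UNIV g"
  proof -
    have "continuous_map euclidean \<Omega> (\<lambda>x. M (- x))"
      by (rule M_compose) (auto intro!: continuous_intros)
    from continuous_map_compose[OF this e_cont] have "continuous_on UNIV (\<lambda>x. e (M (- x)))"
      by (simp add: comp_def)
    then show ?thesis unfolding g_def by (intro continuous_intros)
  qed
  have g_inv: "g (x + l) = g x" if "l \<in> L" for x l
    using M_invariant[OF L_closed(3)[OF that], of "- x"] by (simp add: g_def)
  have g_tr: "g ((t, 0) + y) = \<xi> t * g y" for t y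
  proof -
    have "translate (- t) (M (- y)) = M (- ((t, 0) + y))" by (simp add: translate_M)
    then show ?thesis using e_tr[of t "- y"] by (simp add: g_def)
  qed
  have g0: "g 0 = 1"
    using e_norm[of 0] by (simp add: g_def complex_norm_square[symmetric])
  have g_mult: "g (x + y) = g x * g y" for x y
  proof (rule dense_induct[where P = "\<lambda>x. g (x + y) = g x * g y"])
    have "continuous_on UNIV (\<lambda>x. g (x + y))"
      by (rule continuous_on_compose2[OF g_cont]) (auto intro!: continuous_intros)
    then show "closed {x. g (x + y) = g x * g y}"
      by (intro closed_Collect_eq continuous_intros g_cont)
    fix t l assume l: "l \<in> L"
    have "g ((t, 0) + l + y) = g ((t, 0) + y)"
      using g_inv[OF l, of "(t, 0) + y"] by (simp only: ac_simps)
    moreover have "g ((t, 0) + l) = \<xi> t" using g_inv[OF l, of "(t, 0)"] g_tr[of t 0] g0 by simp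
    ultimately show "g ((t, 0) + l + y) = g ((t, 0) + l) * g y" by (simp only: g_tr)
  qed
  define \<eta> where "\<eta> c = g (SOME x. coset x = c)" for c
  have \<eta>: "\<eta> (coset x) = g x" for x
  proof -
    have "coset (SOME y. coset y = coset x) = coset x" by (rule someI[of _ x]) simp
    then obtain l where l: "l \<in> L" "(SOME y. coset y = coset x) = x + l" unfolding coset_eq_iff by (elim bexE)
    show ?thesis unfolding \<eta>_def l(2) by (rule g_inv[OF l(1)])
  qed
  have "\<eta> \<in> characters (torus L) (quotient_topology L)"
    unfolding characters_iff
  proof (intro conjI ballI)
    show "continuous_map (quotient_topology L) euclidean \<eta>"
      by (rule quotient_lift) (simp add: \<eta> g_cont)
    fix c assume "c \<in> carrier (torus L)"
    then obtain x where x: "c = coset x" by (auto simp: carrier_torus)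
    show "cmod (\<eta> c) = 1" unfolding x \<eta> g_def by (simp add: norm_mult e_norm)
    fix d assume "d \<in> carrier (torus L)"
    then obtain y where y: "d = coset y" by (auto simp: carrier_torus)
    show "\<eta> (c \<otimes>\<^bsub>torus L\<^esub> d) = \<eta> c * \<eta> d" unfolding x y coset_mult \<eta> by (rule g_mult)
  qed
  moreover have "\<xi> = \<eta> \<circ> torus_embed L"
    using g_tr[of _ 0] g0 by (simp add: fun_eq_iff torus_embed_eq \<eta>)
  ultimately show ?thesis by blast
qed

end

theorem theorem3p1:
  fixes L :: "('g::{topological_ab_group_add, t2_space} \<times> 'h::{topological_ab_group_add, t2_space}) set"
    and \<rho> :: "('g \<times> 'h) functional"
    and f :: "'h \<Rightarrow> complex"
    and \<nu> :: "'g functional"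
  assumes "measure_cut_and_project_scheme L \<rho>"
    and "continuous_on UNIV f"
    and "admissible \<rho> f"
    and "\<nu> = weighted_comb \<rho> f"
  shows "(\<nu> \<in> radon_measures \<and> translation_bounded \<nu>) \<and>
    (strongly_almost_periodic \<nu> \<and>
      (\<exists>A. hull_group_structure \<nu> A \<and>
        (\<forall>B. hull_group_structure \<nu> B \<longrightarrow>
          (\<forall>x\<in>measure_hull \<nu>. \<forall>y\<in>measure_hull \<nu>. x \<otimes>\<^bsub>B\<^esub> y = x \<otimes>\<^bsub>A\<^esub> y)))) \<and>
    (\<exists>\<mu>. (\<forall>s k. \<mu> (torus_class L s k) =
          (\<lambda>\<phi>\<in>Cc. radon_integral \<rho> (\<lambda>(t, h). f (h + k) * \<phi> (s + t)))) \<and>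
        factor_map (quotient_topology L) (torus_action L) (hull_topology \<nu>) translate \<mu> \<and>
        (\<forall>A. hull_group_structure \<nu> A \<longrightarrow> \<mu> \<in> hom (torus L) A)) \<and>
    (minimal_system (hull_topology \<nu>) translate \<and>
      uniquely_ergodic (hull_topology \<nu>) translate \<and>
      (\<forall>m. invariant_probability (hull_topology \<nu>) translate m \<longrightarrow>
        pure_point_spectrum translate m \<and>
        all_eigenfunctions_continuous (hull_topology \<nu>) translate m \<and>
        eigenvalues translate m \<subseteq>
          {\<xi> \<circ> torus_embed L |\<xi>. \<xi> \<in> characters (torus L) (quotient_topology L)}) \<and>
      {\<xi> \<circ> torus_embed L |\<xi>. \<xi> \<in> characters (torus L) (quotient_topology L)} \<subseteq> dual)"
proof -
  interpret cut_project L \<rho> f by unfold_locales (rule assms(1-3))+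
  have \<nu>: "\<nu> = M 0" by (simp only: assms(4) weighted_comb_eq)
  show ?thesis
    unfolding \<nu>
  proof (intro conjI)
    show "M 0 \<in> radon_measures" by (rule M_radon)
    show "translation_bounded (M 0)" by (rule translation_bounded_M)
    show "strongly_almost_periodic (M 0)" by (rule strongly_almost_periodic_M)
    show "\<exists>A. hull_group_structure (M 0) A \<and> (\<forall>B. hull_group_structure (M 0) B \<longrightarrow>
        (\<forall>x\<in>measure_hull (M 0). \<forall>y\<in>measure_hull (M 0). x \<otimes>\<^bsub>B\<^esub> y = x \<otimes>\<^bsub>A\<^esub> y))"
    proof (intro exI[of _ hull_group] conjI allI impI ballI)
      fix B x y assume B: "hull_group_structure (M 0) B" and "x \<in> measure_hull (M 0)" "y \<in> measure_hull (M 0)"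
      then obtain p q where "x = M p" "y = M q" by (auto simp: measure_hull_eq)
      then show "x \<otimes>\<^bsub>B\<^esub> y = x \<otimes>\<^bsub>hull_group\<^esub> y"
        by (simp only: hull_group_mult hull_group_structure_mult[OF B])
    qed (rule hull_group_structure)
    show "\<exists>\<mu>. (\<forall>s k. \<mu> (torus_class L s k) =
          (\<lambda>\<phi>\<in>Cc. radon_integral \<rho> (\<lambda>(t, h). f (h + k) * \<phi> (s + t)))) \<and>
        factor_map (quotient_topology L) (torus_action L) \<Omega> translate \<mu> \<and>
        (\<forall>A. hull_group_structure (M 0) A \<longrightarrow> \<mu> \<in> hom (torus L) A)"
    proof (intro exI[of _ torus_map] conjI allI impI torus_map_factor torus_map_hom)
      show "torus_map (torus_class L s k) = (\<lambda>\<phi>\<in>Cc. radon_integral \<rho> (\<lambda>(t, h). f (h + k) * \<phi> (s + t)))" for s k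
        unfolding torus_class_def torus_map_coset M_def F_def G_def by simp
    qed
    show "minimal_system \<Omega> translate"
      unfolding minimal_system_def using hull.minimal by blast
    show "uniquely_ergodic \<Omega> translate" by (rule hull.uniquely_ergodic)
    show "\<forall>m. invariant_probability \<Omega> translate m \<longrightarrow>
        pure_point_spectrum translate m \<and> all_eigenfunctions_continuous \<Omega> translate m \<and>
        eigenvalues translate m \<subseteq> {\<xi> \<circ> torus_embed L |\<xi>. \<xi> \<in> characters (torus L) (quotient_topology L)}"
    proof (intro allI impI conjI subsetI)
      fix m assume m: "invariant_probability \<Omega> translate m"
      show "pure_point_spectrum translate m" by (rule hull.pure_point[OF m])
      show "all_eigenfunctions_continuous \<Omega> translate m" by (rule hull.eigenfunctions_continuous[OF m])
      fix \<xi> assume "\<xi> \<in> eigenvalues translate m"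
      then obtain e where "hull.is_eigen \<xi> e" using hull.eigenvalues_is_eigen[OF m] by blast
      from eigen_torus_character[OF this]
      show "\<xi> \<in> {\<xi> \<circ> torus_embed L |\<xi>. \<xi> \<in> characters (torus L) (quotient_topology L)}" by blast
    qed
    show "{\<xi> \<circ> torus_embed L |\<xi>. \<xi> \<in> characters (torus L) (quotient_topology L)} \<subseteq> dual"
      using torus_character_dual by auto
  qed
qed

end
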